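(* Let $(M,\mathcal{O})$ be a formal manifold, let $\mathcal{F}$ be a sheaf of $\mathcal{O}$-modules, let $E$ be a quasi-complete LCS, and let $\{U_\gamma\}_{\gamma\in\Gamma}$ be an open cover of $M$. If $\mathcal{F}(M)$ (with the smooth topology) is Hausdorff, then the canonical linear map $$\mathrm{D}^{-\infty}(M;\mathcal{F};E)\to\prod_{\gamma\in\Gamma}\mathrm{D}^{-\infty}(U_\gamma;\mathcal{F};E),\qquad\eta\mapsto\{\eta|_{U_\gamma}\}_{\gamma\in\Gamma}$$ is a closed topological embedding (i.e. a homeomorphism onto a closed subspace).
   Context: Formal manifolds. For a smooth manifold $N$ and $k\in\mathbb{N}$, $N^{(k)}$ is the locally ringed space $(N,\mathcal{O}_N^{(k)})$ over $\mathrm{Spec}(\mathbb{C})$ with $\mathcal{O}_N^{(k)}(U)=\mathrm{C}^\infty(U)[[y_1,\dots,y_k]]$ (complex-valued smooth functions). A formal manifold is a locally ringed space $(M,\mathcal{O})$ over $\mathrm{Spec}(\mathbb{C})$ with $M$ paracompact Hausdorff such that every point has an open neighborhood $U$ with $(U,\mathcal{O}|_U)\cong(\mathbb{R}^n)^{(k)}$ for some $n,k\in\mathbb{N}$. For $f\in\mathcal{O}(U)$, $f(a)\in\mathbb{C}$ is the residue of the germ of $f$ at $a$; $\underline{\mathcal{O}}$ is the quotient of $\mathcal{O}$ by the ideal sheaf of sections $f$ with $f(a)=0$ for all $a$, and $(M,\underline{\mathcal{O}})$ is a smooth manifold with its sheaf of complex-valued smooth functions. LCS. An LCS is a locally convex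 topological vector space over $\mathbb{C}$, possibly non-Hausdorff; (quasi-)complete LCS are by convention Hausdorff. $\mathcal{L}_b(X,Y)$ is the space of continuous linear maps with the strong topology (uniform convergence on bounded sets). Inductive limits are in the category of LCS. Smooth topology. A $\mathbb{C}$-linear sheaf homomorphism $D:\mathcal{F}|_U\to\underline{\mathcal{O}}|_U$ has order $\le r$ if for every open $W\subset U$ and $f_0,\dots,f_r\in\mathcal{O}(W)$, $[\cdots[[D|_W,f_0],f_1],\dots,f_r]=0$, where $[D,f]=D\circ f-f\circ D$; it is a differential operator if it is locally of finite order. $\mathrm{Diff}_c(\mathcal{F}|_U,\underline{\mathcal{O}}|_U)$ is the space of differential operators with compact support (complement of the largest open set on which $D$ is zero). The smooth topology on $\mathcal{F}(U)$ is defined by the seminorms $|u|_D=\sup_{a\in U}|(D(u))(a)|$, $D\in\mathrm{Diff}_c(\mathcal{F}|_U,\underline{\mathcal{O}}|_U)$. Distributions. For $K\subset U$ compact, $\mathcal{F}_K(U)\subset\mathcal{F}(U)$ is the subspace of sections supported in $K$ (subspace topology); $\mathcal{F}_c(U)=\varinjlim_K\mathcal{F}_K(U)$ with the inductive limit topology. For open $V\subset U$, extension by zero $\mathrm{ext}_{U,V}:\mathcal{F}_c(V)\to\mathcal{F}_c(U)$ is continuous. $\mathrm{D}^{-\infty}(U;\mathcal{F};E)=\mathcal{L}_b(\mathcal{F}_c(U),E)$, with restriction maps $\eta|_V=\eta\circ\mathrm{ext}_{U,V}$. *)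

theory Defs
  imports "HOL-Analysis.Analysis" "HOL-Algebra.QuotRing" "HOL-Algebra.Module"
begin

section \<open>Locally convex spaces over the complex numbers\<close>

definition complex_ring :: "complex ring" (\<open>\<complex>\<^sub>R\<close>)
  where "complex_ring = \<lparr>carrier = UNIV, monoid.mult = (*), one = 1, zero = 0, add = (+)\<rparr>"

text \<open>A complex vector space together with a topology. The ring operations \<open>mult\<close> and \<open>one\<close> that every
  HOL-Algebra module record carries are irrelevant.\<close>

record 'v cspace = "(complex, 'v) module" +
  topo :: "'v topology"

definition convex_in :: "'v cspace \<Rightarrow> 'v set \<Rightarrow> bool"
  where "convex_in X C \<longleftrightarrow>
    (\<forall>x\<in>C. \<forall>y\<in>C. \<forall>t::real. 0 \<le> t \<and> t \<le> 1 \<longrightarrow>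
      (complex_of_real t \<odot>\<^bsub>X\<^esub> x) \<oplus>\<^bsub>X\<^esub> (complex_of_real (1 - t) \<odot>\<^bsub>X\<^esub> y) \<in> C)"

text \<open>Hausdorffness is not part of the definition.\<close>

definition lcs :: "'v cspace \<Rightarrow> bool"
  where "lcs X \<longleftrightarrow>
    Module.module \<complex>\<^sub>R X \<and>
    topspace (topo X) = carrier X \<and>
    continuous_map (prod_topology (topo X) (topo X)) (topo X) (\<lambda>(x, y). x \<oplus>\<^bsub>X\<^esub> y) \<and>
    continuous_map (prod_topology euclidean (topo X)) (topo X) (\<lambda>(c, x). c \<odot>\<^bsub>X\<^esub> x) \<and>
    (\<forall>N. openin (topo X) N \<and> \<zero>\<^bsub>X\<^esub> \<in> N \<longrightarrow>
      (\<exists>W C. openin (topo X) W \<and> \<zero>\<^bsub>X\<^esub> \<in> W \<and> W \<subseteq> C \<and> C \<subseteq> N \<and> convex_in X C))"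

definition bounded_in :: "'v cspace \<Rightarrow> 'v set \<Rightarrow> bool"
  where "bounded_in X B \<longleftrightarrow>
    B \<subseteq> carrier X \<and>
    (\<forall>N. openin (topo X) N \<and> \<zero>\<^bsub>X\<^esub> \<in> N \<longrightarrow>
      (\<exists>r>0. \<forall>c. cmod c \<ge> r \<longrightarrow> B \<subseteq> (\<lambda>x. c \<odot>\<^bsub>X\<^esub> x) ` N))"

definition cauchy_in :: "'v cspace \<Rightarrow> 'v filter \<Rightarrow> bool"
  where "cauchy_in X G \<longleftrightarrow>
    (\<forall>N. openin (topo X) N \<and> \<zero>\<^bsub>X\<^esub> \<in> N \<longrightarrow>
      eventually (\<lambda>(x, y). x \<ominus>\<^bsub>X\<^esub> y \<in> N) (G \<times>\<^sub>F G))"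

definition complete_in :: "'v cspace \<Rightarrow> 'v set \<Rightarrow> bool"
  where "complete_in X B \<longleftrightarrow>
    (\<forall>G. G \<noteq> bot \<and> eventually (\<lambda>x. x \<in> B) G \<and> cauchy_in X G \<longrightarrow>
      (\<exists>l\<in>B. limitin (topo X) (\<lambda>x. x) l G))"

definition quasi_complete_lcs :: "'v cspace \<Rightarrow> bool"
  where "quasi_complete_lcs X \<longleftrightarrow>
    lcs X \<and> Hausdorff_space (topo X) \<and>
    (\<forall>B. bounded_in X B \<and> closedin (topo X) B \<longrightarrow> complete_in X B)"

definition linear_in :: "'v cspace \<Rightarrow> 'w cspace \<Rightarrow> ('v \<Rightarrow> 'w) \<Rightarrow> bool"
  where "linear_in X Y f \<longleftrightarrow>
    f \<in> carrier X \<rightarrow> carrier Y \<and>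
    (\<forall>x\<in>carrier X. \<forall>y\<in>carrier X. f (x \<oplus>\<^bsub>X\<^esub> y) = f x \<oplus>\<^bsub>Y\<^esub> f y) \<and>
    (\<forall>c. \<forall>x\<in>carrier X. f (c \<odot>\<^bsub>X\<^esub> x) = c \<odot>\<^bsub>Y\<^esub> f x)"

definition closed_linear_embedding :: "'v cspace \<Rightarrow> 'w cspace \<Rightarrow> ('v \<Rightarrow> 'w) \<Rightarrow> bool"
  where "closed_linear_embedding X Y f \<longleftrightarrow>
    linear_in X Y f \<and> embedding_map (topo X) (topo Y) f \<and>
    closedin (topo Y) (f ` topspace (topo X))"

definition product_space :: "'i set \<Rightarrow> ('i \<Rightarrow> 'v cspace) \<Rightarrow> ('i \<Rightarrow> 'v) cspace"
  where "product_space I X =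
    \<lparr>carrier = (\<Pi>\<^sub>E i\<in>I. carrier (X i)),
     monoid.mult = undefined, one = undefined,
     zero = (\<lambda>i\<in>I. \<zero>\<^bsub>X i\<^esub>),
     add = (\<lambda>x y. \<lambda>i\<in>I. x i \<oplus>\<^bsub>X i\<^esub> y i),
     module.smult = (\<lambda>c x. \<lambda>i\<in>I. c \<odot>\<^bsub>X i\<^esub> x i),
     topo = product_topology (\<lambda>i. topo (X i)) I\<rparr>"

definition linear_subspace :: "'v cspace \<Rightarrow> 'v set \<Rightarrow> 'v cspace"
  where "linear_subspace X S = X\<lparr>carrier := S, topo := subtopology (topo X) S\<rparr>"

definition seminorm_topology :: "('v, 'm) ring_scheme \<Rightarrow> ('v \<Rightarrow> real) set \<Rightarrow> 'v topology"
  where "seminorm_topology R P = topology (\<lambda>S. S \<subseteq> carrier R \<and>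
    (\<forall>x\<in>S. \<exists>Q e. finite Q \<and> Q \<subseteq> P \<and> e > 0 \<and>
      {y \<in> carrier R. \<forall>p\<in>Q. p (y \<ominus>\<^bsub>R\<^esub> x) < e} \<subseteq> S))"

lemma openin_seminorm_topology:
  "openin (seminorm_topology R P) S \<longleftrightarrow> S \<subseteq> carrier R \<and>
    (\<forall>x\<in>S. \<exists>Q e. finite Q \<and> Q \<subseteq> P \<and> e > 0 \<and>
      {y \<in> carrier R. \<forall>p\<in>Q. p (y \<ominus>\<^bsub>R\<^esub> x) < e} \<subseteq> S)"
proof -
  let ?op = "\<lambda>S. S \<subseteq> carrier R \<and> (\<forall>x\<in>S. \<exists>Q e. finite Q \<and> Q \<subseteq> P \<and> (e::real) > 0 \<and>
      {y \<in> carrier R. \<forall>p\<in>Q. p (y \<ominus>\<^bsub>R\<^esub> x) < e} \<subseteq> S)"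
  have "?op (S \<inter> S')" if "?op S" "?op S'" for S S'
  proof (intro conjI ballI)
    show "S \<inter> S' \<subseteq> carrier R" using that by blast
    fix x assume x: "x \<in> S \<inter> S'"
    obtain Q e where Q: "finite Q" "Q \<subseteq> P" "e > 0" "{y \<in> carrier R. \<forall>p\<in>Q. p (y \<ominus>\<^bsub>R\<^esub> x) < e} \<subseteq> S"
      using \<open>?op S\<close> x by (meson IntD1)
    obtain Q' e' where Q': "finite Q'" "Q' \<subseteq> P" "e' > 0" "{y \<in> carrier R. \<forall>p\<in>Q'. p (y \<ominus>\<^bsub>R\<^esub> x) < e'} \<subseteq> S'"
      using \<open>?op S'\<close> x by (meson IntD2)
    have "{y \<in> carrier R. \<forall>p\<in>Q \<union> Q'. p (y \<ominus>\<^bsub>R\<^esub> x) < min e e'} \<subseteq> S \<inter> S'"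
      using Q(4) Q'(4) by auto
    then show "\<exists>Q e. finite Q \<and> Q \<subseteq> P \<and> e > 0 \<and>
        {y \<in> carrier R. \<forall>p\<in>Q. p (y \<ominus>\<^bsub>R\<^esub> x) < e} \<subseteq> S \<inter> S'"
      using Q Q' by (intro exI[of _ "Q \<union> Q'"] exI[of _ "min e e'"]) auto
  qed
  moreover have "?op (\<Union>K)" if K: "\<forall>S\<in>K. ?op S" for K
  proof (intro conjI ballI)
    show "\<Union>K \<subseteq> carrier R" using K by blast
    fix x assume "x \<in> \<Union>K"
    then obtain S where "S \<in> K" "x \<in> S" by blast
    with K show "\<exists>Q e. finite Q \<and> Q \<subseteq> P \<and> e > 0 \<and>
        {y \<in> carrier R. \<forall>p\<in>Q. p (y \<ominus>\<^bsub>R\<^esub> x) < e} \<subseteq> \<Union>K"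
      by (meson Sup_upper order_trans)
  qed
  ultimately have "istopology ?op"
    unfolding istopology_def by blast
  then show ?thesis
    unfolding seminorm_topology_def by (simp add: topology_inverse')
qed

text \<open>The space of continuous linear maps, with the topology of uniform convergence on bounded
  sets. Maps are normalised to be \<open>undefined\<close> off the carrier of the source.\<close>

definition continuous_linear_maps :: "'v cspace \<Rightarrow> 'w cspace \<Rightarrow> ('v \<Rightarrow> 'w) set"
  where "continuous_linear_maps X Y =
    {f \<in> extensional (carrier X). linear_in X Y f \<and> continuous_map (topo X) (topo Y) f}"

definition strong_topology :: "'v cspace \<Rightarrow> 'w cspace \<Rightarrow> ('v \<Rightarrow> 'w) topology"
  where "strong_topology X Y = topology (\<lambda>S. S \<subseteq> continuous_linear_maps X Y \<and>
    (\<forall>f\<in>S. \<exists>B N. bounded_in X B \<and> openin (topo Y) N \<and> \<zero>\<^bsub>Y\<^esub> \<in> N \<and>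
      {g \<in> continuous_linear_maps X Y. \<forall>x\<in>B. g x \<ominus>\<^bsub>Y\<^esub> f x \<in> N} \<subseteq> S))"

lemma bounded_in_Un:
  assumes "bounded_in X B" "bounded_in X B'"
  shows "bounded_in X (B \<union> B')"
  unfolding bounded_in_def
proof (intro conjI allI impI)
  show "B \<union> B' \<subseteq> carrier X" using assms by (simp add: bounded_in_def)
  fix N assume "openin (topo X) N \<and> \<zero>\<^bsub>X\<^esub> \<in> N"
  then obtain r r' where "r > 0" "r' > 0"
    "\<forall>c. cmod c \<ge> r \<longrightarrow> B \<subseteq> (\<lambda>x. c \<odot>\<^bsub>X\<^esub> x) ` N" "\<forall>c. cmod c \<ge> r' \<longrightarrow> B' \<subseteq> (\<lambda>x. c \<odot>\<^bsub>X\<^esub> x) ` N"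
    using assms unfolding bounded_in_def by meson
  then show "\<exists>r>0. \<forall>c. cmod c \<ge> r \<longrightarrow> B \<union> B' \<subseteq> (\<lambda>x. c \<odot>\<^bsub>X\<^esub> x) ` N"
    by (intro exI[of _ "max r r'"]) auto
qed

lemma openin_strong_topology:
  "openin (strong_topology X Y) S \<longleftrightarrow> S \<subseteq> continuous_linear_maps X Y \<and>
    (\<forall>f\<in>S. \<exists>B N. bounded_in X B \<and> openin (topo Y) N \<and> \<zero>\<^bsub>Y\<^esub> \<in> N \<and>
      {g \<in> continuous_linear_maps X Y. \<forall>x\<in>B. g x \<ominus>\<^bsub>Y\<^esub> f x \<in> N} \<subseteq> S)"
proof -
  let ?op = "\<lambda>S. S \<subseteq> continuous_linear_maps X Y \<and>
    (\<forall>f\<in>S. \<exists>B N. bounded_in X B \<and> openin (topo Y) N \<and> \<zero>\<^bsub>Y\<^esub> \<in> N \<and>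
      {g \<in> continuous_linear_maps X Y. \<forall>x\<in>B. g x \<ominus>\<^bsub>Y\<^esub> f x \<in> N} \<subseteq> S)"
  have "?op (S \<inter> S')" if "?op S" "?op S'" for S S'
  proof (intro conjI ballI)
    show "S \<inter> S' \<subseteq> continuous_linear_maps X Y" using that by blast
    fix f assume f: "f \<in> S \<inter> S'"
    obtain B N where B: "bounded_in X B" "openin (topo Y) N" "\<zero>\<^bsub>Y\<^esub> \<in> N"
        "{g \<in> continuous_linear_maps X Y. \<forall>x\<in>B. g x \<ominus>\<^bsub>Y\<^esub> f x \<in> N} \<subseteq> S"
      using \<open>?op S\<close> f by (meson IntD1)
    obtain B' N' where B': "bounded_in X B'" "openin (topo Y) N'" "\<zero>\<^bsub>Y\<^esub> \<in> N'"
        "{g \<in> continuous_linear_maps X Y. \<forall>x\<in>B'. g x \<ominus>\<^bsub>Y\<^esub> f x \<in> N'} \<subseteq> S'"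
      using \<open>?op S'\<close> f by (meson IntD2)
    have "{g \<in> continuous_linear_maps X Y. \<forall>x\<in>B \<union> B'. g x \<ominus>\<^bsub>Y\<^esub> f x \<in> N \<inter> N'} \<subseteq> S \<inter> S'"
      using B(4) B'(4) by auto
    then show "\<exists>B N. bounded_in X B \<and> openin (topo Y) N \<and> \<zero>\<^bsub>Y\<^esub> \<in> N \<and>
        {g \<in> continuous_linear_maps X Y. \<forall>x\<in>B. g x \<ominus>\<^bsub>Y\<^esub> f x \<in> N} \<subseteq> S \<inter> S'"
      using B B' bounded_in_Un[of X B B']
      by (intro exI[of _ "B \<union> B'"] exI[of _ "N \<inter> N'"]) auto
  qed
  moreover have "?op (\<Union>K)" if K: "\<forall>S\<in>K. ?op S" for K
  proof (intro conjI ballI)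
    show "\<Union>K \<subseteq> continuous_linear_maps X Y" using K by blast
    fix f assume "f \<in> \<Union>K"
    then obtain S where "S \<in> K" "f \<in> S" by blast
    with K show "\<exists>B N. bounded_in X B \<and> openin (topo Y) N \<and> \<zero>\<^bsub>Y\<^esub> \<in> N \<and>
        {g \<in> continuous_linear_maps X Y. \<forall>x\<in>B. g x \<ominus>\<^bsub>Y\<^esub> f x \<in> N} \<subseteq> \<Union>K"
      by (meson Sup_upper order_trans)
  qed
  ultimately have "istopology ?op"
    unfolding istopology_def by blast
  then show ?thesis
    unfolding strong_topology_def by (simp add: topology_inverse')
qed

definition strong_hom_space :: "'v cspace \<Rightarrow> 'w cspace \<Rightarrow> ('v \<Rightarrow> 'w) cspace"
  where "strong_hom_space X Y =
    \<lparr>carrier = continuous_linear_maps X Y,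
     monoid.mult = undefined, one = undefined,
     zero = (\<lambda>x\<in>carrier X. \<zero>\<^bsub>Y\<^esub>),
     add = (\<lambda>f g. \<lambda>x\<in>carrier X. f x \<oplus>\<^bsub>Y\<^esub> g x),
     module.smult = (\<lambda>c f. \<lambda>x\<in>carrier X. c \<odot>\<^bsub>Y\<^esub> f x),
     topo = strong_topology X Y\<rparr>"

text \<open>The inductive limit, in the category of (possibly non-Hausdorff) locally convex spaces, of a
  directed family of linear subspaces of \<open>V\<close>, each with its own locally convex topology: the union,
  with the finest locally convex topology making every inclusion continuous. That topology is
  the supremum of all locally convex topologies with this property. The topology of \<open>V\<close> is not
  used.\<close>

definition lc_union :: "'v cspace \<Rightarrow> 'v cspace set \<Rightarrow> 'v cspace"
  where "lc_union V \<X> = (let X = V\<lparr>carrier := (\<Union>Y\<in>\<X>. carrier Y)\<rparr> in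
    X\<lparr>topo := topology_generated_by
       {S. \<exists>\<sigma>. lcs (X\<lparr>topo := \<sigma>\<rparr>) \<and> (\<forall>Y\<in>\<X>. continuous_map (topo Y) \<sigma> (\<lambda>x. x)) \<and> openin \<sigma> S}\<rparr>)"


section \<open>Sheaves of algebras and modules\<close>

text \<open>Values at non-open sets, and of the restrictions outside the carriers, are irrelevant.\<close>

record ('p, 'k, 's) presheaf =
  sec :: "'p set \<Rightarrow> ('k, 's) module"
  res :: "'p set \<Rightarrow> 'p set \<Rightarrow> 's \<Rightarrow> 's"

definition set_presheaf :: "'p topology \<Rightarrow> ('p, 'k, 's) presheaf \<Rightarrow> bool"
  where "set_presheaf T P \<longleftrightarrow>
    (\<forall>U V. openin T U \<and> openin T V \<and> V \<subseteq> U \<longrightarrow>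
      res P U V \<in> carrier (sec P U) \<rightarrow> carrier (sec P V)) \<and>
    (\<forall>U. openin T U \<longrightarrow> (\<forall>s\<in>carrier (sec P U). res P U U s = s)) \<and>
    (\<forall>U V W. openin T U \<and> openin T V \<and> openin T W \<and> V \<subseteq> U \<and> W \<subseteq> V \<longrightarrow>
      (\<forall>s\<in>carrier (sec P U). res P V W (res P U V s) = res P U W s))"

definition set_sheaf :: "'p topology \<Rightarrow> ('p, 'k, 's) presheaf \<Rightarrow> bool"
  where "set_sheaf T P \<longleftrightarrow> set_presheaf T P \<and>
    (\<forall>\<U> s. (\<forall>V\<in>\<U>. openin T V \<and> s V \<in> carrier (sec P V)) \<and>
        (\<forall>V\<in>\<U>. \<forall>W\<in>\<U>. res P V (V \<inter> W) (s V) = res P W (V \<inter> W) (s W)) \<longrightarrow>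
      (\<exists>!t. t \<in> carrier (sec P (\<Union>\<U>)) \<and> (\<forall>V\<in>\<U>. res P (\<Union>\<U>) V t = s V)))"

definition algebra_sheaf :: "'p topology \<Rightarrow> ('p, complex, 'a) presheaf \<Rightarrow> bool"
  where "algebra_sheaf T \<O> \<longleftrightarrow> set_sheaf T \<O> \<and>
    (\<forall>U. openin T U \<longrightarrow> Module.algebra \<complex>\<^sub>R (sec \<O> U)) \<and>
    (\<forall>U V. openin T U \<and> openin T V \<and> V \<subseteq> U \<longrightarrow>
      res \<O> U V \<in> ring_hom (sec \<O> U) (sec \<O> V) \<and>
      (\<forall>c. \<forall>s\<in>carrier (sec \<O> U).
        res \<O> U V (c \<odot>\<^bsub>sec \<O> U\<^esub> s) = c \<odot>\<^bsub>sec \<O> V\<^esub> res \<O> U V s))"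

definition module_sheaf ::
    "'p topology \<Rightarrow> ('p, complex, 'a) presheaf \<Rightarrow> ('p, 'a, 'b) presheaf \<Rightarrow> bool"
  where "module_sheaf T \<O> \<F> \<longleftrightarrow> set_sheaf T \<F> \<and>
    (\<forall>U. openin T U \<longrightarrow> Module.module (sec \<O> U) (sec \<F> U)) \<and>
    (\<forall>U V. openin T U \<and> openin T V \<and> V \<subseteq> U \<longrightarrow>
      (\<forall>u\<in>carrier (sec \<F> U). \<forall>v\<in>carrier (sec \<F> U).
        res \<F> U V (u \<oplus>\<^bsub>sec \<F> U\<^esub> v) = res \<F> U V u \<oplus>\<^bsub>sec \<F> V\<^esub> res \<F> U V v) \<and>
      (\<forall>f\<in>carrier (sec \<O> U). \<forall>u\<in>carrier (sec \<F> U).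
        res \<F> U V (f \<odot>\<^bsub>sec \<F> U\<^esub> u) = res \<O> U V f \<odot>\<^bsub>sec \<F> V\<^esub> res \<F> U V u))"


section \<open>Locally ringed spaces over the complex numbers\<close>

definition germ ::
    "'p topology \<Rightarrow> ('p, 'k, 's) presheaf \<Rightarrow> 'p \<Rightarrow> 'p set \<Rightarrow> 's \<Rightarrow> ('p set \<times> 's) set"
  where "germ T P a U s = {(V, t). openin T V \<and> a \<in> V \<and> t \<in> carrier (sec P V) \<and>
    (\<exists>W. openin T W \<and> a \<in> W \<and> W \<subseteq> U \<inter> V \<and> res P U W s = res P V W t)}"

text \<open>The unions below run over all representatives; they all contribute the same germ.\<close>

definition stalk ::
    "'p topology \<Rightarrow> ('p, 'k, 's) presheaf \<Rightarrow> 'p \<Rightarrow> ('k, ('p set \<times> 's) set) module"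
  where "stalk T P a =
    \<lparr>carrier = {germ T P a U s | U s. openin T U \<and> a \<in> U \<and> s \<in> carrier (sec P U)},
     monoid.mult = (\<lambda>x y. \<Union>(U, s)\<in>x. \<Union>(V, t)\<in>y.
       germ T P a (U \<inter> V) (res P U (U \<inter> V) s \<otimes>\<^bsub>sec P (U \<inter> V)\<^esub> res P V (U \<inter> V) t)),
     one = germ T P a (topspace T) \<one>\<^bsub>sec P (topspace T)\<^esub>,
     zero = germ T P a (topspace T) \<zero>\<^bsub>sec P (topspace T)\<^esub>,
     add = (\<lambda>x y. \<Union>(U, s)\<in>x. \<Union>(V, t)\<in>y.
       germ T P a (U \<inter> V) (res P U (U \<inter> V) s \<oplus>\<^bsub>sec P (U \<inter> V)\<^esub> res P V (U \<inter> V) t)),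
     module.smult = (\<lambda>c x. \<Union>(U, s)\<in>x. germ T P a U (c \<odot>\<^bsub>sec P U\<^esub> s))\<rparr>"

definition local_ring :: "('a, 'm) ring_scheme \<Rightarrow> bool"
  where "local_ring R \<longleftrightarrow> cring R \<and> (\<exists>!I. maximalideal I R)"

definition locally_ringed_space :: "'p topology \<Rightarrow> ('p, complex, 'a) presheaf \<Rightarrow> bool"
  where "locally_ringed_space T \<O> \<longleftrightarrow>
    algebra_sheaf T \<O> \<and> (\<forall>a\<in>topspace T. local_ring (stalk T \<O> a))"

text \<open>Isomorphisms of (locally) ringed spaces over the complex numbers; an isomorphism of sheaves of
  algebras is automatically local on stalks.\<close>

definition isomorphic_ringed_spaces ::
    "'p topology \<Rightarrow> ('p, complex, 'a) presheaf \<Rightarrow> 'q topology \<Rightarrow> ('q, complex, 'b) presheaf \<Rightarrow> bool"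
  where "isomorphic_ringed_spaces X A Y B \<longleftrightarrow>
    (\<exists>\<phi> \<Phi>. homeomorphic_map X Y \<phi> \<and>
      (let pre = (\<lambda>W. {x \<in> topspace X. \<phi> x \<in> W}) in
        (\<forall>W. openin Y W \<longrightarrow>
          \<Phi> W \<in> ring_iso (sec B W) (sec A (pre W)) \<and>
          (\<forall>c. \<forall>s\<in>carrier (sec B W). \<Phi> W (c \<odot>\<^bsub>sec B W\<^esub> s) = c \<odot>\<^bsub>sec A (pre W)\<^esub> \<Phi> W s)) \<and>
        (\<forall>W W'. openin Y W \<and> openin Y W' \<and> W' \<subseteq> W \<longrightarrow>
          (\<forall>s\<in>carrier (sec B W). \<Phi> W' (res B W W' s) = res A (pre W) (pre W') (\<Phi> W s)))))"


section \<open>Formal manifolds\<close>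

definition partial_deriv :: "nat \<Rightarrow> ((nat \<Rightarrow> real) \<Rightarrow> complex) \<Rightarrow> (nat \<Rightarrow> real) \<Rightarrow> complex"
  where "partial_deriv i f x = vector_derivative (\<lambda>t. f (x(i := t))) (at (x i))"

primrec Ck_on :: "nat \<Rightarrow> nat \<Rightarrow> (nat \<Rightarrow> real) set \<Rightarrow> ((nat \<Rightarrow> real) \<Rightarrow> complex) \<Rightarrow> bool"
  where
    "Ck_on n 0 U f \<longleftrightarrow> continuous_map (subtopology (Euclidean_space n) U) euclidean f"
  | "Ck_on n (Suc r) U f \<longleftrightarrow>
      continuous_map (subtopology (Euclidean_space n) U) euclidean f \<and>
      (\<forall>i<n. (\<forall>x\<in>U. (\<lambda>t. f (x(i := t))) differentiable (at (x i))) \<and>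
        Ck_on n r U (partial_deriv i f))"

definition smooth_functions :: "nat \<Rightarrow> (nat \<Rightarrow> real) set \<Rightarrow> ((nat \<Rightarrow> real) \<Rightarrow> complex) set"
  where "smooth_functions n U = {f \<in> extensional U. \<forall>r. Ck_on n r U f}"

definition multi_indices :: "nat \<Rightarrow> (nat \<Rightarrow> nat) set"
  where "multi_indices k = {\<alpha>. \<forall>i\<ge>k. \<alpha> i = 0}"

text \<open>The sheaf on \<open>n\<close>-dimensional Euclidean space of formal power series in \<open>k\<close> variables with
  smooth complex coefficients; a power series is the family of its coefficients. In the Cauchy
  product, \<open>{\<beta>. \<beta> \<le> \<alpha>}\<close> is the finite set of multi-indices that are pointwise at most \<open>\<alpha>\<close>.\<close>

definition formal_model ::
    "nat \<Rightarrow> nat \<Rightarrow> (nat \<Rightarrow> real, complex, (nat \<Rightarrow> nat) \<Rightarrow> (nat \<Rightarrow> real) \<Rightarrow> complex) presheaf"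
  where "formal_model n k =
    \<lparr>sec = (\<lambda>U.
      \<lparr>carrier = multi_indices k \<rightarrow>\<^sub>E smooth_functions n U,
       monoid.mult = (\<lambda>f g. \<lambda>\<alpha>\<in>multi_indices k. \<lambda>x\<in>U.
         \<Sum>\<beta>\<in>{\<beta>. \<beta> \<le> \<alpha>}. f \<beta> x * g (\<lambda>i. \<alpha> i - \<beta> i) x),
       one = (\<lambda>\<alpha>\<in>multi_indices k. \<lambda>x\<in>U. if \<alpha> = (\<lambda>_. 0) then 1 else 0),
       zero = (\<lambda>\<alpha>\<in>multi_indices k. \<lambda>x\<in>U. 0),
       add = (\<lambda>f g. \<lambda>\<alpha>\<in>multi_indices k. \<lambda>x\<in>U. f \<alpha> x + g \<alpha> x),
       module.smult = (\<lambda>c f. \<lambda>\<alpha>\<in>multi_indices k. \<lambda>x\<in>U. c * f \<alpha> x)\<rparr>),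
     res = (\<lambda>U V f. \<lambda>\<alpha>\<in>multi_indices k. restrict (f \<alpha>) V)\<rparr>"

definition paracompact_space :: "'p topology \<Rightarrow> bool"
  where "paracompact_space T \<longleftrightarrow>
    (\<forall>\<U>. (\<forall>U\<in>\<U>. openin T U) \<and> \<Union>\<U> = topspace T \<longrightarrow>
      (\<exists>\<V>. (\<forall>V\<in>\<V>. openin T V) \<and> \<Union>\<V> = topspace T \<and>
        (\<forall>V\<in>\<V>. \<exists>U\<in>\<U>. V \<subseteq> U) \<and> locally_finite_in T \<V>))"

text \<open>The restriction of \<open>\<O>\<close> to an open \<open>U\<close> is \<open>\<O>\<close> itself, on the topology of \<open>U\<close>.\<close>

definition formal_manifold :: "'p topology \<Rightarrow> ('p, complex, 'a) presheaf \<Rightarrow> bool"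
  where "formal_manifold T \<O> \<longleftrightarrow>
    locally_ringed_space T \<O> \<and> Hausdorff_space T \<and> paracompact_space T \<and>
    (\<forall>a\<in>topspace T. \<exists>U n k. openin T U \<and> a \<in> U \<and>
      isomorphic_ringed_spaces (subtopology T U) \<O> (Euclidean_space n) (formal_model n k))"

text \<open>The value at \<open>a\<close> of a section \<open>f\<close>: the complex number whose class in the residue field of
  the stalk at \<open>a\<close> is that of the germ of \<open>f\<close>. On a formal manifold the residue fields are
  the complex numbers.\<close>

definition eval_at ::
    "'p topology \<Rightarrow> ('p, complex, 'a) presheaf \<Rightarrow> 'p set \<Rightarrow> 'a \<Rightarrow> 'p \<Rightarrow> complex"
  where "eval_at T \<O> U f a = (let R = stalk T \<O> a; I = (THE I. maximalideal I R) in
    THE c. I +>\<^bsub>R\<^esub> germ T \<O> a U f = I +>\<^bsub>R\<^esub> (c \<odot>\<^bsub>R\<^esub> \<one>\<^bsub>R\<^esub>))"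

text \<open>The reduced structure sheaf, i.e. the quotient of \<open>\<O>\<close> by the ideal sheaf of sections with all
  values zero. The presheaf quotient over \<open>V\<close> identifies two sections of \<open>\<O>\<close> with the same values,
  so it is the ring of functions \<open>b \<mapsto> f(b)\<close> with \<open>f\<close> a section over \<open>V\<close>; its sheafification
  consists of the functions that are locally of this form.\<close>

definition reduced_sections ::
    "'p topology \<Rightarrow> ('p, complex, 'a) presheaf \<Rightarrow> 'p set \<Rightarrow> ('p \<Rightarrow> complex) set"
  where "reduced_sections T \<O> U = {g \<in> extensional U. \<forall>a\<in>U. \<exists>V f. openin T V \<and> a \<in> V \<and> V \<subseteq> U \<and>
    f \<in> carrier (sec \<O> V) \<and> (\<forall>b\<in>V. g b = eval_at T \<O> V f b)}"


section \<open>Differential operators and the smooth topology\<close>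

text \<open>The action of complex scalars on sections of a module, through the structure sheaf.\<close>

definition scalar_mult ::
    "('p, complex, 'a) presheaf \<Rightarrow> ('p, 'a, 'b) presheaf \<Rightarrow> 'p set \<Rightarrow> complex \<Rightarrow> 'b \<Rightarrow> 'b"
  where "scalar_mult \<O> \<F> U c u = (c \<odot>\<^bsub>sec \<O> U\<^esub> \<one>\<^bsub>sec \<O> U\<^esub>) \<odot>\<^bsub>sec \<F> U\<^esub> u"

text \<open>Sheaf homomorphisms from \<open>\<F>\<close> to the reduced structure sheaf over \<open>U\<close>. Only the values of \<open>D\<close>
  at open subsets of \<open>U\<close> and at sections over these matter.\<close>

type_synonym ('p, 'b) sheaf_map = "'p set \<Rightarrow> 'b \<Rightarrow> 'p \<Rightarrow> complex"

definition sheaf_hom ::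
    "'p topology \<Rightarrow> ('p, complex, 'a) presheaf \<Rightarrow> ('p, 'a, 'b) presheaf \<Rightarrow> 'p set \<Rightarrow>
      ('p, 'b) sheaf_map \<Rightarrow> bool"
  where "sheaf_hom T \<O> \<F> U D \<longleftrightarrow>
    (\<forall>W. openin T W \<and> W \<subseteq> U \<longrightarrow>
      D W \<in> carrier (sec \<F> W) \<rightarrow> reduced_sections T \<O> W \<and>
      (\<forall>u\<in>carrier (sec \<F> W). \<forall>v\<in>carrier (sec \<F> W). \<forall>a\<in>W.
        D W (u \<oplus>\<^bsub>sec \<F> W\<^esub> v) a = D W u a + D W v a) \<and>
      (\<forall>c. \<forall>u\<in>carrier (sec \<F> W). \<forall>a\<in>W. D W (scalar_mult \<O> \<F> W c u) a = c * D W u a)) \<and>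
    (\<forall>W W'. openin T W \<and> openin T W' \<and> W' \<subseteq> W \<and> W \<subseteq> U \<longrightarrow>
      (\<forall>u\<in>carrier (sec \<F> W). D W' (res \<F> W W' u) = restrict (D W u) W'))"

definition zero_on :: "'p topology \<Rightarrow> ('p, 'a, 'b) presheaf \<Rightarrow> 'p set \<Rightarrow> ('p, 'b) sheaf_map \<Rightarrow> bool"
  where "zero_on T \<F> W D \<longleftrightarrow>
    (\<forall>V. openin T V \<and> V \<subseteq> W \<longrightarrow> (\<forall>u\<in>carrier (sec \<F> V). \<forall>a\<in>V. D V u a = 0))"

text \<open>\<open>[D, f]\<close> over \<open>W\<close>, for a section \<open>f\<close> of \<open>\<O>\<close> over \<open>W\<close>; note that \<open>f\<close> acts on the reduced
  structure sheaf by multiplication with its values.\<close>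

definition commutator ::
    "'p topology \<Rightarrow> ('p, complex, 'a) presheaf \<Rightarrow> ('p, 'a, 'b) presheaf \<Rightarrow> 'p set \<Rightarrow>
      ('p, 'b) sheaf_map \<Rightarrow> 'a \<Rightarrow> ('p, 'b) sheaf_map"
  where "commutator T \<O> \<F> W D f = (\<lambda>V u. \<lambda>a\<in>V.
    D V (res \<O> W V f \<odot>\<^bsub>sec \<F> V\<^esub> u) a - eval_at T \<O> W f a * D V u a)"

definition order_le ::
    "'p topology \<Rightarrow> ('p, complex, 'a) presheaf \<Rightarrow> ('p, 'a, 'b) presheaf \<Rightarrow> 'p set \<Rightarrow>
      ('p, 'b) sheaf_map \<Rightarrow> nat \<Rightarrow> bool"
  where "order_le T \<O> \<F> U D r \<longleftrightarrow>
    (\<forall>W fs. openin T W \<and> W \<subseteq> U \<and> length fs = Suc r \<and> set fs \<subseteq> carrier (sec \<O> W) \<longrightarrow>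
      zero_on T \<F> W (foldl (commutator T \<O> \<F> W) D fs))"

definition diff_operator ::
    "'p topology \<Rightarrow> ('p, complex, 'a) presheaf \<Rightarrow> ('p, 'a, 'b) presheaf \<Rightarrow> 'p set \<Rightarrow>
      ('p, 'b) sheaf_map \<Rightarrow> bool"
  where "diff_operator T \<O> \<F> U D \<longleftrightarrow> sheaf_hom T \<O> \<F> U D \<and>
    (\<forall>a\<in>U. \<exists>W r. openin T W \<and> a \<in> W \<and> W \<subseteq> U \<and> order_le T \<O> \<F> W D r)"

definition operator_support ::
    "'p topology \<Rightarrow> ('p, 'a, 'b) presheaf \<Rightarrow> 'p set \<Rightarrow> ('p, 'b) sheaf_map \<Rightarrow> 'p set"
  where "operator_support T \<F> U D = U - \<Union>{W. openin T W \<and> W \<subseteq> U \<and> zero_on T \<F> W D}"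

definition Diff_c ::
    "'p topology \<Rightarrow> ('p, complex, 'a) presheaf \<Rightarrow> ('p, 'a, 'b) presheaf \<Rightarrow> 'p set \<Rightarrow>
      ('p, 'b) sheaf_map set"
  where "Diff_c T \<O> \<F> U =
    {D. diff_operator T \<O> \<F> U D \<and> compactin T (operator_support T \<F> U D)}"

text \<open>Inserting \<open>0\<close> only matters for empty \<open>U\<close>, where it makes the supremum \<open>0\<close>.\<close>

definition diff_seminorm :: "'p set \<Rightarrow> ('p, 'b) sheaf_map \<Rightarrow> 'b \<Rightarrow> real"
  where "diff_seminorm U D u = Sup (insert 0 ((\<lambda>a. cmod (D U u a)) ` U))"

definition section_space ::
    "'p topology \<Rightarrow> ('p, complex, 'a) presheaf \<Rightarrow> ('p, 'a, 'b) presheaf \<Rightarrow> 'p set \<Rightarrow> 'b cspace"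
  where "section_space T \<O> \<F> U =
    \<lparr>carrier = carrier (sec \<F> U),
     monoid.mult = undefined, one = undefined,
     zero = \<zero>\<^bsub>sec \<F> U\<^esub>,
     add = (\<lambda>u v. u \<oplus>\<^bsub>sec \<F> U\<^esub> v),
     module.smult = scalar_mult \<O> \<F> U,
     topo = seminorm_topology (sec \<F> U) (diff_seminorm U ` Diff_c T \<O> \<F> U)\<rparr>"


section \<open>Test sections and distributions\<close>

definition section_support ::
    "'p topology \<Rightarrow> ('p, 'a, 'b) presheaf \<Rightarrow> 'p set \<Rightarrow> 'b \<Rightarrow> 'p set"
  where "section_support T \<F> U u =
    U - \<Union>{V. openin T V \<and> V \<subseteq> U \<and> res \<F> U V u = \<zero>\<^bsub>sec \<F> V\<^esub>}"

definition supported_space ::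
    "'p topology \<Rightarrow> ('p, complex, 'a) presheaf \<Rightarrow> ('p, 'a, 'b) presheaf \<Rightarrow> 'p set \<Rightarrow> 'p set \<Rightarrow> 'b cspace"
  where "supported_space T \<O> \<F> U K = linear_subspace (section_space T \<O> \<F> U)
    {u \<in> carrier (sec \<F> U). section_support T \<F> U u \<subseteq> K}"

definition test_space ::
    "'p topology \<Rightarrow> ('p, complex, 'a) presheaf \<Rightarrow> ('p, 'a, 'b) presheaf \<Rightarrow> 'p set \<Rightarrow> 'b cspace"
  where "test_space T \<O> \<F> U = lc_union (section_space T \<O> \<F> U)
    {supported_space T \<O> \<F> U K | K. compactin T K \<and> K \<subseteq> U}"

definition ext_by_zero ::
    "'p topology \<Rightarrow> ('p, 'a, 'b) presheaf \<Rightarrow> 'p set \<Rightarrow> 'p set \<Rightarrow> 'b \<Rightarrow> 'b"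
  where "ext_by_zero T \<F> U V u = (THE w. w \<in> carrier (sec \<F> U) \<and> res \<F> U V w = u \<and>
    (let W = U - section_support T \<F> V u in res \<F> U W w = \<zero>\<^bsub>sec \<F> W\<^esub>))"

definition distribution_space ::
    "'p topology \<Rightarrow> ('p, complex, 'a) presheaf \<Rightarrow> ('p, 'a, 'b) presheaf \<Rightarrow> 'v cspace \<Rightarrow> 'p set \<Rightarrow>
      ('b \<Rightarrow> 'v) cspace"
  where "distribution_space T \<O> \<F> E U = strong_hom_space (test_space T \<O> \<F> U) E"

definition restrict_distribution ::
    "'p topology \<Rightarrow> ('p, complex, 'a) presheaf \<Rightarrow> ('p, 'a, 'b) presheaf \<Rightarrow> 'p set \<Rightarrow> 'p set \<Rightarrow>
      ('b \<Rightarrow> 'v) \<Rightarrow> 'b \<Rightarrow> 'v"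
  where "restrict_distribution T \<O> \<F> U V \<eta> =
    restrict (\<eta> \<circ> ext_by_zero T \<F> U V) (carrier (test_space T \<O> \<F> V))"

end

theory Submission
  imports Defs "HOL-Algebra.Ring_Divisibility"
begin

text \<open>Let \<open>g\<^sub>i\<close> be a partition of unity with \<open>g\<^sub>i\<close> supported in \<open>U\<^bsub>c(i)\<^esub>\<close>. The restriction map \<open>S\<close> has the
  left inverse \<open>L (\<eta>\<^sub>\<gamma>) u = \<Sum>\<^sub>i \<eta>\<^bsub>c(i)\<^esub> (g\<^sub>i u)\<close>. Both are continuous, so \<open>S\<close> is an embedding, and its image is
  closed because the product is Hausdorff. Continuity of \<open>L\<close> needs that only finitely many \<open>g\<^sub>i\<close> act
  on a given bounded set of test sections; this is where the Hausdorff hypothesis on \<open>\<F>(M)\<close> enters.\<close>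

section \<open>Smooth functions on Euclidean space\<close>

text \<open>The sheaf \<open>\<F>\<close> is an arbitrary module sheaf, so nothing ensures that a
  bounded set of test sections lies in a single piece of sections supported in a fixed compact set.
  What can be had, and what suffices, is that a locally finite family of cutoffs sees a bounded set
  through finitely many members only. The maps between test spaces go both ways, and every seminorm
  estimate comes from moving a differential operator between \<open>M\<close> and an open set: an
  operator on an open set extends by zero because its support is compact, and an operator on
  \<open>M\<close> passes to an open set after composition with a cutoff section. Two things must be
  drawn from charts. Cutoffs equal to 1 on an open set start as power series with a single nonzero
  coefficient. Values of sections are defined through residue fields of stalks, and only in a chart
  do they turn out to be continuous functions; without that the suprema defining the smooth topology
  might be infinite.\<close>

definition flat :: "nat \<Rightarrow> real \<Rightarrow> real"
  where "flat k x = (if x \<le> 0 then 0 else exp (- (1 / x)) / x ^ k)"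

text \<open>This is the right-hand difference quotient of \<open>flat k\<close> at 0. With y = 1/x
  it becomes y^(k+1) / exp y, which decays at infinity.\<close>

lemma flat_over_id_tendsto_0: "((\<lambda>x. flat k x / x) \<longlongrightarrow> 0) (at_right 0)"
proof -
  have "((\<lambda>y::real. y ^ Suc k / exp y) \<longlongrightarrow> 0) at_top"
    by (rule tendsto_power_div_exp_0)
  then have "((\<lambda>x::real. inverse x ^ Suc k / exp (inverse x)) \<longlongrightarrow> 0) (at_right 0)"
    using filterlim_compose filterlim_inverse_at_top_right by blast
  moreover have "eventually (\<lambda>x::real. inverse x ^ Suc k / exp (inverse x) = flat k x / x) (at_right 0)"
    using eventually_at_right_less[of "0::real"]
    by eventually_elim (simp add: flat_def exp_minus field_simps)
  ultimately show ?thesis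
    using tendsto_cong by fastforce
qed

text \<open>The factor \<open>x ^ k\<close> in \<open>flat\<close> exists for this formula: the
  family of all \<open>flat k\<close> is closed under differentiation up to linear combinations, so
  the smoothness of exp(-1/x) at 0 needs no formula for its higher derivatives.\<close>

lemma has_real_derivative_flat:
  "(flat k has_real_derivative flat (k + 2) x - real k * flat (k + 1) x) (at x)"
proof (cases x "0::real" rule: linorder_cases)
  case less
  have "((\<lambda>_. 0) has_real_derivative 0) (at x)" by simp
  then have "(flat k has_real_derivative 0) (at x)"
    by (rule DERIV_cong_ev[THEN iffD1, rotated -1])
       (use less in \<open>auto simp: flat_def eventually_nhds intro!: exI[of _ "{..<0}"]\<close>)
  then show ?thesis using less by (simp add: flat_def)
next
  case equal
  have "((\<lambda>y. flat k y / y) \<longlongrightarrow> 0) (at_left 0)"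
    by (rule tendsto_eventually)
       (use eventually_at_left_field[of _ "0::real"] in \<open>auto simp: flat_def intro!: exI[of _ "-1"]\<close>)
  then have "((\<lambda>y. flat k y / y) \<longlongrightarrow> 0) (at 0)"
    using flat_over_id_tendsto_0 by (simp add: filterlim_split_at)
  then have "(flat k has_real_derivative 0) (at 0)"
    by (simp add: has_field_derivative_iff flat_def)
  then show ?thesis using equal by (simp add: flat_def)
next
  case greater
  have "((\<lambda>x. exp (- (1 / x)) / x ^ k) has_real_derivative flat (k + 2) x - real k * flat (k + 1) x) (at x)"
    using greater
    apply (auto intro!: derivative_eq_intros simp: flat_def)
    \<comment> \<open>The power rule produces the truncated exponent k - 1, so k = 0 is treated
      apart.\<close>
    apply (cases k)
     apply (auto simp: field_simps power2_eq_square)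
    done
  then show ?thesis
    by (rule DERIV_cong_ev[THEN iffD1, rotated -1])
       (use greater in \<open>auto simp: flat_def eventually_nhds intro!: exI[of _ "{0<..}"]\<close>)
qed

text \<open>A syntactic class that contains the cutoffs and is stable under partial derivatives.
  Smoothness of its members then follows by one induction on the order, and no chain rule for
  \<open>Ck_on\<close> is required. The members are functions on all sequences, which is why
  \<open>inverse\<close> asks for a denominator without any zero.\<close>

inductive_set elementary_smooth :: "((nat \<Rightarrow> real) \<Rightarrow> real) set" where
  const: "(\<lambda>x. c) \<in> elementary_smooth"
| coord: "(\<lambda>x. x i) \<in> elementary_smooth"
| add: "f \<in> elementary_smooth \<Longrightarrow> g \<in> elementary_smooth \<Longrightarrow> (\<lambda>x. f x + g x) \<in> elementary_smooth"
| mult: "f \<in> elementary_smooth \<Longrightarrow> g \<in> elementary_smooth \<Longrightarrow> (\<lambda>x. f x * g x) \<in> elementary_smooth"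
| inverse: "f \<in> elementary_smooth \<Longrightarrow> (\<And>x. f x \<noteq> 0) \<Longrightarrow> (\<lambda>x. inverse (f x)) \<in> elementary_smooth"
| flat: "f \<in> elementary_smooth \<Longrightarrow> (\<lambda>x. flat k (f x)) \<in> elementary_smooth"

lemma elementary_smooth_diff:
  assumes "f \<in> elementary_smooth" "g \<in> elementary_smooth"
  shows "(\<lambda>x. f x - g x) \<in> elementary_smooth"
proof -
  have "(\<lambda>x. f x + (-1) * g x) \<in> elementary_smooth"
    using assms by (intro elementary_smooth.intros)
  then show ?thesis by simp
qed

lemma elementary_smooth_sum:
  "(\<And>i. i \<in> I \<Longrightarrow> f i \<in> elementary_smooth) \<Longrightarrow> (\<lambda>x. \<Sum>i\<in>I. f i x) \<in> elementary_smooth"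
  by (induction I rule: infinite_finite_induct) (auto intro: elementary_smooth.intros)

text \<open>The derivative rule of each generator uses the generators alone; for
  \<open>flat k\<close> this is where the indices k + 1 and k + 2 are needed.\<close>

lemma elementary_smooth_partial:
  assumes "f \<in> elementary_smooth"
  shows "\<exists>f'\<in>elementary_smooth. \<forall>x. ((\<lambda>t. f (x(i := t))) has_real_derivative f' x) (at (x i))"
  using assms
proof induction
  case (const c)
  then show ?case by (intro bexI[of _ "\<lambda>_. 0"]) (auto intro: elementary_smooth.const)
next
  case (coord j)
  show ?case
    by (cases "i = j")
       (auto intro!: bexI[of _ "\<lambda>_. if i = j then 1 else 0"] elementary_smooth.const DERIV_ident)
next
  case (add f g)
  then obtain f' g' where
    "f' \<in> elementary_smooth" "\<forall>x. ((\<lambda>t. f (x(i := t))) has_real_derivative f' x) (at (x i))"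
    "g' \<in> elementary_smooth" "\<forall>x. ((\<lambda>t. g (x(i := t))) has_real_derivative g' x) (at (x i))" by blast
  then show ?case
    by (intro bexI[of _ "\<lambda>x. f' x + g' x"] ballI allI elementary_smooth.add DERIV_add; blast)
next
  case (mult f g)
  then obtain f' g' where
    "f' \<in> elementary_smooth" "\<forall>x. ((\<lambda>t. f (x(i := t))) has_real_derivative f' x) (at (x i))"
    "g' \<in> elementary_smooth" "\<forall>x. ((\<lambda>t. g (x(i := t))) has_real_derivative g' x) (at (x i))" by blast
  moreover from this have "((\<lambda>t. f (x(i := t)) * g (x(i := t))) has_real_derivative f' x * g x + g' x * f x) (at (x i))" for x
    using DERIV_mult[of "\<lambda>t. f (x(i := t))" "f' x" "x i" UNIV "\<lambda>t. g (x(i := t))" "g' x"] by simp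
  moreover have "(\<lambda>x. f' x * g x + g' x * f x) \<in> elementary_smooth"
    using calculation mult by (intro elementary_smooth.add elementary_smooth.mult)
  ultimately show ?case by (intro bexI[of _ "\<lambda>x. f' x * g x + g' x * f x"] allI)
next
  case (inverse f)
  then obtain f' where
    "f' \<in> elementary_smooth" "\<forall>x. ((\<lambda>t. f (x(i := t))) has_real_derivative f' x) (at (x i))" by blast
  moreover have "(\<lambda>x. (-1) * (inverse (f x) * f' x * inverse (f x))) \<in> elementary_smooth"
    using calculation inverse by (intro elementary_smooth.intros)
  moreover from calculation have "((\<lambda>t. inverse (f (x(i := t)))) has_real_derivative
      (-1) * (inverse (f x) * f' x * inverse (f x))) (at (x i))" for x
    using DERIV_inverse'[of "\<lambda>t. f (x(i := t))" "f' x" "x i" UNIV] inverse by simp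
  ultimately show ?case by (intro bexI[of _ "\<lambda>x. (-1) * (inverse (f x) * f' x * inverse (f x))"] allI)
next
  case (flat f k)
  then obtain f' where f':
    "f' \<in> elementary_smooth" "\<forall>x. ((\<lambda>t. f (x(i := t))) has_real_derivative f' x) (at (x i))" by blast
  have "(\<lambda>x. (flat (k + 2) (f x) - real k * flat (k + 1) (f x)) * f' x) \<in> elementary_smooth"
    using f' flat by (intro elementary_smooth.intros elementary_smooth_diff)
  moreover have "((\<lambda>t. flat k (f (x(i := t)))) has_real_derivative
      (flat (k + 2) (f x) - real k * flat (k + 1) (f x)) * f' x) (at (x i))" for x
    using DERIV_chain2[OF has_real_derivative_flat f'(2)[rule_format, of x]] by simp
  ultimately show ?case
    by (intro bexI[of _ "\<lambda>x. (flat (k + 2) (f x) - real k * flat (k + 1) (f x)) * f' x"] allI)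
qed

lemma continuous_map_flat: "continuous_map X euclideanreal f \<Longrightarrow> continuous_map X euclideanreal (\<lambda>x. flat k (f x))"
proof -
  assume f: "continuous_map X euclideanreal f"
  have "continuous_on UNIV (flat k)"
    by (meson DERIV_continuous has_real_derivative_flat continuous_at_imp_continuous_on)
  then have "continuous_map euclideanreal euclideanreal (flat k)" by simp
  from continuous_map_compose[OF f this] show ?thesis by (simp add: o_def)
qed

lemma continuous_map_elementary_smooth:
  assumes "f \<in> elementary_smooth"
  shows "continuous_map (Euclidean_space n) euclideanreal f"
  using assms
proof induction
  case (coord i)
  show ?case unfolding Euclidean_space_def
    by (intro continuous_map_from_subtopology) (metis UNIV_I continuous_map_product_coordinates)
next
  case (flat f k)
  then show ?case by (simp add: continuous_map_flat)
qed (auto intro: continuous_intros)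

lemma continuous_map_of_real:
  "continuous_map X euclideanreal f \<Longrightarrow> continuous_map X euclidean (\<lambda>x. complex_of_real (f x))"
  using continuous_map_compose[of X euclideanreal f euclidean complex_of_real]
  by (simp add: o_def continuous_on_of_real)

lemma continuous_map_complex_mult:
  fixes f g :: "'x \<Rightarrow> complex"
  assumes "continuous_map X euclidean f" "continuous_map X euclidean g"
  shows "continuous_map X euclidean (\<lambda>x. f x * g x)"
proof -
  have "continuous_map X (prod_topology euclidean euclidean) (\<lambda>x. (f x, g x))"
    using assms by (intro continuous_map_pairedI)
  moreover have "continuous_map (prod_topology euclidean euclidean) euclidean (\<lambda>(z::complex, w). z * w)"
    by (auto simp: case_prod_unfold intro!: continuous_intros)
  ultimately have "continuous_map X euclidean ((\<lambda>(z, w). z * w) \<circ> (\<lambda>x. (f x, g x)))"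
    by (rule continuous_map_compose)
  then show ?thesis by (simp add: o_def)
qed

lemma fun_upd_in_Euclidean_space:
  "x \<in> topspace (Euclidean_space n) \<Longrightarrow> i < n \<Longrightarrow> x(i := t) \<in> topspace (Euclidean_space n)"
  by (auto simp: topspace_Euclidean_space)

text \<open>A coordinate line through a point of an open \<open>U\<close> stays in \<open>U\<close>
  for a while. The condition \<open>i < n\<close> keeps the line inside the space, whose points
  vanish from index \<open>n\<close> on.\<close>

lemma eventually_fun_upd_in:
  assumes "openin (Euclidean_space n) U" "x \<in> U" "i < n"
  shows "eventually (\<lambda>t. x(i := t) \<in> U) (nhds (x i))"
proof -
  have x: "x \<in> topspace (Euclidean_space n)" using assms openin_subset by blast
  have "continuous_map euclideanreal (Euclidean_space n) (\<lambda>t. x(i := t))"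
    unfolding Euclidean_space_def continuous_map_in_subtopology
  proof
    have "continuous_map euclideanreal euclideanreal (\<lambda>t. (x(i := t)) j)" for j
      by (cases "i = j") auto
    then show "continuous_map euclideanreal (powertop_real UNIV) (\<lambda>t. x(i := t))"
      unfolding continuous_map_componentwise by (auto simp: extensional_def)
    show "(\<lambda>t. x(i := t)) \<in> topspace euclideanreal \<rightarrow> {x. \<forall>i\<ge>n. x i = 0}"
      using fun_upd_in_Euclidean_space[OF x assms(3)] by (auto simp: topspace_Euclidean_space)
  qed
  then have "open {t. x(i := t) \<in> U}"
    using assms(1) unfolding continuous_map_def by auto
  then show ?thesis
    using assms(2) by (auto simp: eventually_nhds intro!: exI[of _ "{t. x(i := t) \<in> U}"])
qed

text \<open>\<open>partial_deriv\<close> mentions the values of \<open>f\<close> on a whole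
  coordinate line, even outside \<open>U\<close>; openness of \<open>U\<close> confines the
  derivatives to values in \<open>U\<close>. This allows functions to be replaced by their
  restrictions, as the extensional sections of the model require.\<close>

lemma Ck_on_cong:
  assumes U: "openin (Euclidean_space n) U" and "Ck_on n r U f" and "\<And>x. x \<in> U \<Longrightarrow> f x = g x"
  shows "Ck_on n r U g"
  using assms(2,3)
proof (induction r arbitrary: f g)
  case 0
  then show ?case
    using continuous_map_eq[of "subtopology (Euclidean_space n) U" euclidean f g] by simp
next
  case (Suc r)
  have ev: "eventually (\<lambda>t. f (x(i := t)) = g (x(i := t))) (nhds (x i))" if "x \<in> U" "i < n" for x i
    using eventually_fun_upd_in[OF U that] by eventually_elim (rule Suc.prems)
  have "(\<lambda>t. g (x(i := t))) differentiable (at (x i))" if "x \<in> U" "i < n" for x i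
  proof -
    have "(\<lambda>t. f (x(i := t))) differentiable (at (x i))"
      using Suc.prems(1) that by simp
    then obtain D where "((\<lambda>t. f (x(i := t))) has_derivative D) (at (x i))"
      unfolding differentiable_def by blast
    moreover have "eventually (\<lambda>t. f (x(i := t)) = g (x(i := t))) (at (x i))"
      using ev[OF that] unfolding eventually_at_filter by (rule eventually_mono) simp
    ultimately have "((\<lambda>t. g (x(i := t))) has_derivative D) (at (x i))"
      by (rule has_derivative_transform_eventually) (use Suc.prems that in simp_all)
    then show ?thesis unfolding differentiable_def by blast
  qed
  moreover have "Ck_on n r U (partial_deriv i g)" if "i < n" for i
  proof (rule Suc.IH)
    show "Ck_on n r U (partial_deriv i f)" using Suc.prems that by simp
    show "partial_deriv i f x = partial_deriv i g x" if "x \<in> U" for x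
      unfolding partial_deriv_def
      by (rule vector_derivative_cong_eq) (use ev[OF that \<open>i < n\<close>] in auto)
  qed
  moreover have "continuous_map (subtopology (Euclidean_space n) U) euclidean g"
    using Suc.prems continuous_map_eq[of "subtopology (Euclidean_space n) U" euclidean f g] by simp
  ultimately show ?case by simp
qed

lemma Ck_on_SucD: "Ck_on n (Suc r) U f \<Longrightarrow> Ck_on n r U f"
  by (induction r arbitrary: f) auto

lemma differentiable_vector_derivative:
  "(f::real \<Rightarrow> complex) differentiable (at x) \<Longrightarrow> (f has_vector_derivative vector_derivative f (at x)) (at x)"
  by (simp add: vector_derivative_works)

lemma Ck_on_add:
  assumes U: "openin (Euclidean_space n) U" and "Ck_on n r U f" "Ck_on n r U g"
  shows "Ck_on n r U (\<lambda>x. f x + g x)"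
  using assms(2,3)
proof (induction r arbitrary: f g)
  case 0
  then show ?case by (auto intro: continuous_intros)
next
  case (Suc r)
  have "Ck_on n r U (partial_deriv i (\<lambda>x. f x + g x))" if "i < n" for i
  proof (rule Ck_on_cong[OF U])
    show "Ck_on n r U (\<lambda>x. partial_deriv i f x + partial_deriv i g x)"
      using Suc that by simp
    show "partial_deriv i f x + partial_deriv i g x = partial_deriv i (\<lambda>x. f x + g x) x" if "x \<in> U" for x
      using Suc.prems that \<open>i < n\<close> unfolding partial_deriv_def
      by (intro vector_derivative_at[symmetric] has_vector_derivative_add differentiable_vector_derivative) auto
  qed
  then show ?case using Suc.prems by (auto intro!: continuous_intros differentiable_add)
qed

lemma Ck_on_mult:
  assumes U: "openin (Euclidean_space n) U" and "Ck_on n r U f" "Ck_on n r U g"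
  shows "Ck_on n r U (\<lambda>x. f x * g x)"
  using assms(2,3)
proof (induction r arbitrary: f g)
  case 0
  then show ?case by (auto intro: continuous_map_complex_mult)
next
  case (Suc r)
  have "Ck_on n r U (partial_deriv i (\<lambda>x. f x * g x))" if "i < n" for i
  proof (rule Ck_on_cong[OF U])
    \<comment> \<open>In the Leibniz rule the undifferentiated factors are of order r + 1, so they
      are lowered to order r before the induction hypothesis applies.\<close>
    show "Ck_on n r U (\<lambda>x. f x * partial_deriv i g x + partial_deriv i f x * g x)"
      using Suc.prems that Suc.prems[THEN Ck_on_SucD] by (intro Ck_on_add[OF U] Suc.IH) simp_all
    show "f x * partial_deriv i g x + partial_deriv i f x * g x = partial_deriv i (\<lambda>x. f x * g x) x" if "x \<in> U" for x
    proof -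
      have "((\<lambda>t. f (x(i := t))) has_vector_derivative partial_deriv i f x) (at (x i))"
           "((\<lambda>t. g (x(i := t))) has_vector_derivative partial_deriv i g x) (at (x i))"
        using Suc.prems that \<open>i < n\<close> unfolding partial_deriv_def
        by (intro differentiable_vector_derivative; simp)+
      from has_vector_derivative_mult[OF this] show ?thesis
        unfolding partial_deriv_def by (simp add: vector_derivative_at)
    qed
  qed
  then show ?case using Suc.prems by (auto intro!: continuous_map_complex_mult differentiable_mult)
qed

lemma Ck_on_const: "Ck_on n r U (\<lambda>_. c)"
proof -
  have "partial_deriv i (\<lambda>_. d) = (\<lambda>_. 0)" for i d
    by (simp add: partial_deriv_def fun_eq_iff vector_derivative_const_at)
  then show ?thesis
    by (induction r arbitrary: c) auto
qed

lemma Ck_on_sum: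
  assumes "openin (Euclidean_space n) U" and "\<And>i. i \<in> I \<Longrightarrow> Ck_on n r U (f i)"
  shows "Ck_on n r U (\<lambda>x. \<Sum>i\<in>I. f i x)"
  using assms(2)
proof (induction I rule: infinite_finite_induct)
  case (insert i I)
  then have "Ck_on n r U (\<lambda>x. f i x + (\<Sum>i\<in>I. f i x))" by (intro Ck_on_add[OF assms(1)]) auto
  with insert show ?case by simp
qed (auto intro: Ck_on_const)

lemma Ck_on_elementary_smooth:
  "f \<in> elementary_smooth \<Longrightarrow> Ck_on n r (topspace (Euclidean_space n)) (\<lambda>x. complex_of_real (f x))"
proof (induction r arbitrary: f)
  case 0
  then show ?case
    by (auto intro!: continuous_map_of_real continuous_map_elementary_smooth)
next
  case (Suc r)
  have "(\<lambda>t. complex_of_real (f (x(i := t)))) differentiable (at (x i)) \<and>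
      Ck_on n r (topspace (Euclidean_space n)) (partial_deriv i (\<lambda>x. complex_of_real (f x)))" for i x
  proof -
    obtain f' where f': "f' \<in> elementary_smooth" "\<And>x. ((\<lambda>t. f (x(i := t))) has_real_derivative f' x) (at (x i))"
      using elementary_smooth_partial[OF Suc.prems] by blast
    have *: "((\<lambda>t. complex_of_real (f (x(i := t)))) has_vector_derivative complex_of_real (f' x)) (at (x i))" for x
      using f'(2) by (intro has_vector_derivative_of_real) auto
    then have "partial_deriv i (\<lambda>x. complex_of_real (f x)) = (\<lambda>x. complex_of_real (f' x))"
      by (simp add: fun_eq_iff partial_deriv_def vector_derivative_at)
    with Suc.IH[OF f'(1)] * show ?thesis
      by (auto simp: differentiable_def has_vector_derivative_def)
  qed
  then show ?case using Suc.prems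
    by (auto intro!: continuous_map_of_real continuous_map_elementary_smooth)
qed


text \<open>With q the squared distance to \<open>c\<close>, the cutoff is A / (A + B), where A =
  \<open>flat 0 (2 * e - q x)\<close> and B = \<open>flat 0 (q x - e)\<close>. The two arguments add
  up to e > 0, so A + B never vanishes; B = 0 where q < e gives the value 1, and A = 0 where q > 2e
  gives the value 0.\<close>

lemma Euclidean_bump:
  assumes W: "openin (Euclidean_space n) W" and c: "c \<in> W"
  obtains \<beta> G C where "\<beta> \<in> elementary_smooth" "openin (Euclidean_space n) G" "compactin (Euclidean_space n) C"
    "c \<in> G" "G \<subseteq> C" "C \<subseteq> W" "\<And>x. x \<in> G \<Longrightarrow> \<beta> x = 1" "\<And>x. x \<notin> C \<Longrightarrow> x \<in> topspace (Euclidean_space n) \<Longrightarrow> \<beta> x = 0"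
proof -
  let ?X = "topspace (Euclidean_space n)"
  have cX: "c \<in> ?X" using W c openin_subset by blast
  obtain W' where W': "openin (powertop_real UNIV) W'" "W = W' \<inter> {x. \<forall>i\<ge>n. x i = 0}"
    using W unfolding Euclidean_space_def openin_subtopology by blast
  then have "c \<in> W'" using c by simp
  \<comment> \<open>The topology is induced from the product topology, so a box around
    \<open>c\<close> fits into \<open>W'\<close>. Coordinates from \<open>n\<close> on impose
    nothing, since there all points of the space agree with \<open>c\<close>.\<close>
  with W'(1) obtain A where A: "\<And>i. openin euclideanreal (A i)" "c \<in> (\<Pi>\<^sub>E i\<in>UNIV. A i)" "(\<Pi>\<^sub>E i\<in>UNIV. A i) \<subseteq> W'"
    unfolding openin_product_topology_alt by (force dest: bspec[of W' _ c])
  have "\<exists>d>0. \<forall>t. \<bar>t - c i\<bar> < d \<longrightarrow> t \<in> A i" for i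
    using A(1)[of i] A(2) unfolding open_openin[symmetric] open_dist dist_real_def by (auto simp: PiE_iff)
  then obtain d where d: "\<And>i. d i > 0" "\<And>i t. \<bar>t - c i\<bar> < d i \<Longrightarrow> t \<in> A i" by metis
  \<comment> \<open>The smallest of the first \<open>n\<close> radii; the inserted 1 covers n =
    0.\<close>
  define \<delta> where "\<delta> = Min (insert 1 (d ` {..<n}))"
  have \<delta>: "\<delta> > 0" "\<And>i. i < n \<Longrightarrow> \<delta> \<le> d i" using d(1) by (auto simp: \<delta>_def)
  define q where "q = (\<lambda>x. \<Sum>i<n. (x i - c i) * (x i - c i))"
  \<comment> \<open>Chosen so that 2e is strictly below the square of \<open>\<delta>\<close>, which
    keeps \<open>C\<close> within distance \<open>\<delta>\<close> in each of the first
    \<open>n\<close> coordinates.\<close>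
  define e where "e = \<delta>\<^sup>2 / 4"
  have e: "e > 0" using \<delta> by (simp add: e_def)
  have qS: "q \<in> elementary_smooth"
    unfolding q_def by (intro elementary_smooth_sum elementary_smooth.mult elementary_smooth_diff elementary_smooth.const elementary_smooth.coord)
  have qc: "continuous_map (Euclidean_space n) euclideanreal q"
    by (rule continuous_map_elementary_smooth[OF qS])
  have small: "\<bar>x i - c i\<bar> < \<delta>" if "q x \<le> 2 * e" "i < n" for x i
  proof -
    have "(x i - c i) * (x i - c i) \<le> q x" unfolding q_def
      by (rule member_le_sum) (use that in auto)
    also have "\<dots> < \<delta>\<^sup>2" using that(1) zero_less_power[OF \<delta>(1), of 2] unfolding e_def by linarith
    finally have "\<bar>x i - c i\<bar>\<^sup>2 < \<delta>\<^sup>2" by (simp add: power2_eq_square)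
    then show ?thesis using \<delta> power2_less_imp_less by fastforce
  qed
  define C where "C = {x \<in> ?X. q x \<le> 2 * e}"
  define G where "G = {x \<in> ?X. q x < e}"
  define \<beta> where "\<beta> = (\<lambda>x. flat 0 (2 * e - q x) * inverse (flat 0 (2 * e - q x) + flat 0 (q x - e)))"
  have flat_pos: "flat 0 t > 0 \<longleftrightarrow> t > 0" and flat_ge: "flat 0 t \<ge> 0" for t by (auto simp: flat_def)
  have pos: "flat 0 (2 * e - q x) + flat 0 (q x - e) > 0" for x
    using e flat_pos[of "2 * e - q x"] flat_ge[of "2 * e - q x"] flat_pos[of "q x - e"] flat_ge[of "q x - e"] by linarith
  show thesis
  proof
    show "\<beta> \<in> elementary_smooth" unfolding \<beta>_def
      by (intro elementary_smooth.mult elementary_smooth.inverse elementary_smooth.add elementary_smooth.flat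
          elementary_smooth_diff elementary_smooth.const qS) (use pos in \<open>metis less_irrefl\<close>)
    have "openin (Euclidean_space n) {x \<in> ?X. q x \<in> {..<e}}"
      by (rule openin_continuous_map_preimage[OF qc]) auto
    then show "openin (Euclidean_space n) G" by (simp add: G_def)
    have "closedin (Euclidean_space n) {x \<in> ?X. q x \<in> {..2 * e}}"
      by (rule closedin_continuous_map_preimage[OF qc]) auto
    then have cl: "closedin (powertop_real UNIV) C"
      using closedin_Euclidean_space[of n] unfolding C_def
      by (simp add: Euclidean_space_def closedin_closed_subtopology topspace_Euclidean_space)
    \<comment> \<open>Tychonoff: intervals in the first \<open>n\<close> coordinates and the single
      point 0 in all the others give a compact box that contains the closed set
      \<open>C\<close>.\<close>
    have "compactin (powertop_real UNIV) (\<Pi>\<^sub>E i\<in>UNIV. if i < n then {c i - \<delta>..c i + \<delta>} else {0})"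
      by (auto simp: compactin_PiE)
    moreover have "C \<subseteq> (\<Pi>\<^sub>E i\<in>UNIV. if i < n then {c i - \<delta>..c i + \<delta>} else {0})"
    proof
      fix x assume x: "x \<in> C"
      have "x i \<in> (if i < n then {c i - \<delta>..c i + \<delta>} else {0})" for i
        using x small[of x i] by (auto simp: C_def topspace_Euclidean_space abs_if split: if_splits)
      then show "x \<in> (\<Pi>\<^sub>E i\<in>UNIV. if i < n then {c i - \<delta>..c i + \<delta>} else {0})" by blast
    qed
    ultimately have "compactin (powertop_real UNIV) C"
      using cl closed_compactin by blast
    then show "compactin (Euclidean_space n) C"
      by (auto simp: Euclidean_space_def compactin_subtopology C_def topspace_Euclidean_space)
    show "c \<in> G" using cX e by (simp add: G_def q_def)
    show "G \<subseteq> C" using e by (auto simp: G_def C_def)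
    show "C \<subseteq> W"
    proof
      fix x assume x: "x \<in> C"
      have "x i \<in> A i" for i
      proof (cases "i < n")
        case True
        then show ?thesis using small[of x i] x \<delta>(2)[of i] d(2)[of "x i" i] by (simp add: C_def)
      next
        case False
        then have "x i = c i" using x cX by (simp add: C_def topspace_Euclidean_space)
        then show ?thesis using A(2) by auto
      qed
      then have "x \<in> W'" using A(3) by blast
      then show "x \<in> W" using W'(2) x by (auto simp: C_def topspace_Euclidean_space)
    qed
    show "\<beta> x = 1" if "x \<in> G" for x
      using that pos[of x] by (auto simp: G_def \<beta>_def flat_def)
    show "\<beta> x = 0" if "x \<notin> C" "x \<in> ?X" for x
      using that by (auto simp: C_def \<beta>_def flat_def)
  qed
qed

section \<open>Locally convex spaces\<close>

lemma complex_ring_simps [simp]: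
  "carrier \<complex>\<^sub>R = UNIV" "a \<otimes>\<^bsub>\<complex>\<^sub>R\<^esub> b = a * b" "\<one>\<^bsub>\<complex>\<^sub>R\<^esub> = 1" "\<zero>\<^bsub>\<complex>\<^sub>R\<^esub> = 0" "a \<oplus>\<^bsub>\<complex>\<^sub>R\<^esub> b = a + b"
  by (simp_all add: complex_ring_def)

lemma cring_complex_ring: "cring \<complex>\<^sub>R"
proof (intro cringI abelian_groupI comm_monoidI)
  fix x :: complex
  show "\<exists>y\<in>carrier \<complex>\<^sub>R. y \<oplus>\<^bsub>\<complex>\<^sub>R\<^esub> x = \<zero>\<^bsub>\<complex>\<^sub>R\<^esub>"
    by (auto intro: exI[of _ "-x"])
qed (auto simp: algebra_simps)

lemma complex_ring_minus [simp]: "\<ominus>\<^bsub>\<complex>\<^sub>R\<^esub> a = - a"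
proof -
  interpret cring "\<complex>\<^sub>R" by (rule cring_complex_ring)
  show ?thesis using minus_equality[of "- a" a] by simp
qed

lemma linear_inD:
  assumes "linear_in X Y f"
  shows linear_in_closed: "x \<in> carrier X \<Longrightarrow> f x \<in> carrier Y"
    and linear_in_add: "x \<in> carrier X \<Longrightarrow> y \<in> carrier X \<Longrightarrow> f (x \<oplus>\<^bsub>X\<^esub> y) = f x \<oplus>\<^bsub>Y\<^esub> f y"
    and linear_in_smult: "x \<in> carrier X \<Longrightarrow> f (c \<odot>\<^bsub>X\<^esub> x) = c \<odot>\<^bsub>Y\<^esub> f x"
  using assms by (auto simp: linear_in_def)

lemma linear_in_compose:
  "linear_in X Y f \<Longrightarrow> linear_in Y Z g \<Longrightarrow> linear_in X Z (\<lambda>x. g (f x))"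
  by (auto simp: linear_in_def Pi_iff)

lemma module_minus_eq_smult:
  assumes "Module.module \<complex>\<^sub>R X" "x \<in> carrier X"
  shows "\<ominus>\<^bsub>X\<^esub> x = (- 1) \<odot>\<^bsub>X\<^esub> x"
proof -
  interpret Module.module "\<complex>\<^sub>R" X by fact
  show ?thesis using smult_l_minus[of 1 x] smult_one[of x] assms(2) by simp
qed

lemma linear_in_zero:
  assumes "Module.module \<complex>\<^sub>R X" "Module.module \<complex>\<^sub>R Y" "linear_in X Y f"
  shows "f \<zero>\<^bsub>X\<^esub> = \<zero>\<^bsub>Y\<^esub>"
proof -
  interpret X: Module.module "\<complex>\<^sub>R" X by fact
  interpret Y: Module.module "\<complex>\<^sub>R" Y by fact
  have "f (0 \<odot>\<^bsub>X\<^esub> \<zero>\<^bsub>X\<^esub>) = 0 \<odot>\<^bsub>Y\<^esub> f \<zero>\<^bsub>X\<^esub>"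
    by (rule linear_in_smult[OF assms(3)]) simp
  then show ?thesis
    using linear_inD[OF assms(3)] X.smult_l_null[of "\<zero>\<^bsub>X\<^esub>"] Y.smult_l_null[of "f \<zero>\<^bsub>X\<^esub>"] by simp
qed

lemma lcsD:
  assumes "lcs X"
  shows lcs_module: "Module.module \<complex>\<^sub>R X"
    and lcs_topspace: "topspace (topo X) = carrier X"
    and lcs_add: "continuous_map (prod_topology (topo X) (topo X)) (topo X) (\<lambda>(x, y). x \<oplus>\<^bsub>X\<^esub> y)"
    and lcs_smult: "continuous_map (prod_topology euclidean (topo X)) (topo X) (\<lambda>(c, x). c \<odot>\<^bsub>X\<^esub> x)"
    and lcs_convex: "openin (topo X) N \<Longrightarrow> \<zero>\<^bsub>X\<^esub> \<in> N \<Longrightarrow>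
      \<exists>W C. openin (topo X) W \<and> \<zero>\<^bsub>X\<^esub> \<in> W \<and> W \<subseteq> C \<and> C \<subseteq> N \<and> convex_in X C"
  using assms by (auto simp: lcs_def)

lemma lcsI:
  assumes "Module.module \<complex>\<^sub>R X" "topspace (topo X) = carrier X"
    "continuous_map (prod_topology (topo X) (topo X)) (topo X) (\<lambda>(x, y). x \<oplus>\<^bsub>X\<^esub> y)"
    "continuous_map (prod_topology euclidean (topo X)) (topo X) (\<lambda>(c, x). c \<odot>\<^bsub>X\<^esub> x)"
    "\<And>N. openin (topo X) N \<Longrightarrow> \<zero>\<^bsub>X\<^esub> \<in> N \<Longrightarrow>
      \<exists>W C. openin (topo X) W \<and> \<zero>\<^bsub>X\<^esub> \<in> W \<and> W \<subseteq> C \<and> C \<subseteq> N \<and> convex_in X C"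
  shows "lcs X"
  using assms by (auto simp: lcs_def)

lemma continuous_map_lcs_add:
  assumes "lcs Y" "continuous_map X (topo Y) f" "continuous_map X (topo Y) g"
  shows "continuous_map X (topo Y) (\<lambda>x. f x \<oplus>\<^bsub>Y\<^esub> g x)"
  using continuous_map_compose[OF continuous_map_pairedI[OF assms(2,3)] lcs_add[OF assms(1)]]
  by (simp add: o_def)

lemma continuous_map_lcs_smult:
  assumes "lcs Y" "continuous_map X euclidean f" "continuous_map X (topo Y) g"
  shows "continuous_map X (topo Y) (\<lambda>x. f x \<odot>\<^bsub>Y\<^esub> g x)"
  using continuous_map_compose[OF continuous_map_pairedI[OF assms(2,3)] lcs_smult[OF assms(1)]]
  by (simp add: o_def)

lemma module_topo_update [simp]:
  "carrier (X\<lparr>topo := \<tau>\<rparr>) = carrier X" "add (X\<lparr>topo := \<tau>\<rparr>) = add X" "zero (X\<lparr>topo := \<tau>\<rparr>) = zero X"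
  "smult (X\<lparr>topo := \<tau>\<rparr>) = smult X"
  by simp_all

lemma module_topo_update_iff [simp]:
  "Module.module R (X\<lparr>topo := \<tau>\<rparr>) \<longleftrightarrow> Module.module R X"
  unfolding Module.module_def module_axioms_def abelian_group_def abelian_group_axioms_def abelian_monoid_def
  by simp

lemma convex_in_topo_update [simp]: "convex_in (X\<lparr>topo := \<tau>\<rparr>) C \<longleftrightarrow> convex_in X C"
  by (simp add: convex_in_def)

text \<open>The initial topology of a linear map into a locally convex space. Its purpose is to
  supply members of the family of topologies over which \<open>lc_union\<close> takes the
  supremum.\<close>

lemma lcs_pullback:
  assumes X: "Module.module \<complex>\<^sub>R X" and Y: "lcs Y" and f: "linear_in X Y f"
  shows "lcs (X\<lparr>topo := pullback_topology (carrier X) f (topo Y)\<rparr>)"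
proof (rule lcsI)
  interpret X: Module.module "\<complex>\<^sub>R" X by fact
  let ?P = "pullback_topology (carrier X) f (topo Y)"
  show ts: "topspace (topo (X\<lparr>topo := ?P\<rparr>)) = carrier (X\<lparr>topo := ?P\<rparr>)"
    using linear_in_closed[OF f] by (auto simp: topspace_pullback_topology lcs_topspace[OF Y])
  have fc: "continuous_map ?P (topo Y) f"
    using continuous_map_pullback[OF continuous_map_id[of "topo Y"], of "carrier X" f] by (simp add: o_def id_def)
  have "continuous_map (prod_topology ?P ?P) (topo Y) (\<lambda>z. f (fst z) \<oplus>\<^bsub>Y\<^esub> f (snd z))"
    using continuous_map_compose[OF continuous_map_fst fc] continuous_map_compose[OF continuous_map_snd fc]
    by (intro continuous_map_lcs_add[OF Y]) (simp_all add: o_def)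
  then have "continuous_map (prod_topology ?P ?P) (topo Y) (f \<circ> (\<lambda>(x, y). x \<oplus>\<^bsub>X\<^esub> y))"
    by (rule continuous_map_eq) (use ts linear_in_add[OF f] in auto)
  then show "continuous_map (prod_topology (topo (X\<lparr>topo := ?P\<rparr>)) (topo (X\<lparr>topo := ?P\<rparr>))) (topo (X\<lparr>topo := ?P\<rparr>))
      (\<lambda>(x, y). x \<oplus>\<^bsub>X\<lparr>topo := ?P\<rparr>\<^esub> y)"
    using ts by (auto intro!: continuous_map_pullback')
  have "continuous_map (prod_topology euclidean ?P) (topo Y) (\<lambda>z. fst z \<odot>\<^bsub>Y\<^esub> f (snd z))"
    using continuous_map_fst continuous_map_compose[OF continuous_map_snd fc]
    by (intro continuous_map_lcs_smult[OF Y]) (auto simp add: o_def)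
  then have "continuous_map (prod_topology euclidean ?P) (topo Y) (f \<circ> (\<lambda>(c, x). c \<odot>\<^bsub>X\<^esub> x))"
    by (rule continuous_map_eq) (use ts linear_in_smult[OF f] in auto)
  then show "continuous_map (prod_topology euclidean (topo (X\<lparr>topo := ?P\<rparr>))) (topo (X\<lparr>topo := ?P\<rparr>))
      (\<lambda>(c, x). c \<odot>\<^bsub>X\<lparr>topo := ?P\<rparr>\<^esub> x)"
    using ts by (auto intro!: continuous_map_pullback')
  fix N assume "openin (topo (X\<lparr>topo := ?P\<rparr>)) N" and 0: "\<zero>\<^bsub>X\<lparr>topo := ?P\<rparr>\<^esub> \<in> N"
  then obtain N' where N': "openin (topo Y) N'" "N = f -` N' \<inter> carrier X"
    by (auto simp: openin_pullback_topology)
  have f0: "f \<zero>\<^bsub>X\<^esub> = \<zero>\<^bsub>Y\<^esub>" by (rule linear_in_zero[OF X lcs_module[OF Y] f])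
  then obtain W C where W: "openin (topo Y) W" "\<zero>\<^bsub>Y\<^esub> \<in> W" "W \<subseteq> C" "C \<subseteq> N'" "convex_in Y C"
    using lcs_convex[OF Y N'(1)] N'(2) 0 by auto
  show "\<exists>W C. openin (topo (X\<lparr>topo := ?P\<rparr>)) W \<and> \<zero>\<^bsub>X\<lparr>topo := ?P\<rparr>\<^esub> \<in> W \<and> W \<subseteq> C \<and> C \<subseteq> N \<and> convex_in (X\<lparr>topo := ?P\<rparr>) C"
  proof (intro exI conjI)
    show "openin (topo (X\<lparr>topo := ?P\<rparr>)) (f -` W \<inter> carrier X)"
      using W by (auto simp: openin_pullback_topology)
    show "convex_in (X\<lparr>topo := ?P\<rparr>) (f -` C \<inter> carrier X)"
      using W(5) linear_in_add[OF f] linear_in_smult[OF f] by (simp add: convex_in_def)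
  qed (use W N' f0 in auto)
qed (use X in simp)

section \<open>Inductive limits of locally convex spaces\<close>

lemma lc_union_simps:
  "carrier (lc_union V \<X>) = (\<Union>Y\<in>\<X>. carrier Y)" "add (lc_union V \<X>) = add V" "zero (lc_union V \<X>) = zero V"
  "smult (lc_union V \<X>) = smult V"
  by (simp_all add: lc_union_def Let_def)

lemma topo_lc_union:
  "topo (lc_union V \<X>) = topology_generated_by {S. \<exists>\<sigma>. lcs ((lc_union V \<X>)\<lparr>topo := \<sigma>\<rparr>) \<and>
     (\<forall>Y\<in>\<X>. continuous_map (topo Y) \<sigma> (\<lambda>x. x)) \<and> openin \<sigma> S}"
  by (simp add: lc_union_def Let_def)

lemma openin_lc_union:
  assumes "lcs ((lc_union V \<X>)\<lparr>topo := \<sigma>\<rparr>)" "\<And>Y. Y \<in> \<X> \<Longrightarrow> continuous_map (topo Y) \<sigma> (\<lambda>x. x)" "openin \<sigma> S"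
  shows "openin (topo (lc_union V \<X>)) S"
  unfolding topo_lc_union by (rule topology_generated_by_Basis) (use assms in blast)

text \<open>The limit topology is generated by the open sets of all admissible topologies, so
  continuity into it is tested against one of them at a time. The hypothesis \<open>ne\<close> is
  still to be established: a generated topology lives only on the union of its generators.\<close>

lemma continuous_map_into_lc_union:
  assumes f: "f \<in> topspace X \<rightarrow> carrier (lc_union V \<X>)" and ne: "topspace (topo (lc_union V \<X>)) = carrier (lc_union V \<X>)"
    and *: "\<And>\<sigma>. lcs ((lc_union V \<X>)\<lparr>topo := \<sigma>\<rparr>) \<Longrightarrow> (\<And>Y. Y \<in> \<X> \<Longrightarrow> continuous_map (topo Y) \<sigma> (\<lambda>x. x)) \<Longrightarrow>
      continuous_map X \<sigma> f"
  shows "continuous_map X (topo (lc_union V \<X>)) f"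
  unfolding topo_lc_union
proof (rule continuous_on_generated_topo)
  show "f ` topspace X \<subseteq> \<Union>{S. \<exists>\<sigma>. lcs ((lc_union V \<X>)\<lparr>topo := \<sigma>\<rparr>) \<and>
     (\<forall>Y\<in>\<X>. continuous_map (topo Y) \<sigma> (\<lambda>x. x)) \<and> openin \<sigma> S}"
    using ne f unfolding topo_lc_union topology_generated_by_topspace by auto
  fix S assume "S \<in> {S. \<exists>\<sigma>. lcs ((lc_union V \<X>)\<lparr>topo := \<sigma>\<rparr>) \<and>
     (\<forall>Y\<in>\<X>. continuous_map (topo Y) \<sigma> (\<lambda>x. x)) \<and> openin \<sigma> S}"
  then obtain \<sigma> where "lcs ((lc_union V \<X>)\<lparr>topo := \<sigma>\<rparr>)"
     "\<forall>Y\<in>\<X>. continuous_map (topo Y) \<sigma> (\<lambda>x. x)" "openin \<sigma> S" by blast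
  then show "openin X (f -` S \<inter> topspace X)"
    using *[of \<sigma>] unfolding continuous_map_alt by blast
qed

text \<open>Pulling back this one-point space yields the indiscrete topology on any carrier. That
  topology is always admissible for an inductive limit, so the limit topology covers the whole
  carrier.\<close>

definition trivial_cspace :: "unit cspace"
  where "trivial_cspace = \<lparr>carrier = UNIV, monoid.mult = undefined, one = undefined, zero = (), add = (\<lambda>_ _. ()),
    module.smult = (\<lambda>_ _. ()), topo = discrete_topology UNIV\<rparr>"

lemma lcs_trivial_cspace: "lcs trivial_cspace"
proof (rule lcsI)
  show "Module.module \<complex>\<^sub>R trivial_cspace"
    by (intro moduleI cring_complex_ring abelian_groupI) (auto simp: trivial_cspace_def)
qed (auto simp: trivial_cspace_def case_prod_unfold convex_in_def intro!: exI[of _ UNIV])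

lemma topspace_lc_union:
  assumes M: "Module.module \<complex>\<^sub>R (lc_union V \<X>)" and ts: "\<And>Y. Y \<in> \<X> \<Longrightarrow> topspace (topo Y) = carrier Y"
  shows "topspace (topo (lc_union V \<X>)) = carrier (lc_union V \<X>)"
proof
  let ?X = "lc_union V \<X>"
  show "topspace (topo ?X) \<subseteq> carrier ?X"
    unfolding topo_lc_union topology_generated_by_topspace
  proof clarify
    fix x S \<sigma> assume "x \<in> S" "lcs (?X\<lparr>topo := \<sigma>\<rparr>)" "openin \<sigma> S"
    then show "x \<in> carrier ?X" using lcs_topspace[of "?X\<lparr>topo := \<sigma>\<rparr>"] openin_subset[of \<sigma> S] by auto
  qed
  define \<sigma> where "\<sigma> = pullback_topology (carrier ?X) (\<lambda>_. ()) (topo trivial_cspace)"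
  have "linear_in ?X trivial_cspace (\<lambda>_. ())" by (simp add: linear_in_def trivial_cspace_def)
  then have "lcs (?X\<lparr>topo := \<sigma>\<rparr>)"
    unfolding \<sigma>_def by (rule lcs_pullback[OF M lcs_trivial_cspace])
  moreover have "continuous_map (topo Y) \<sigma> (\<lambda>x. x)" if "Y \<in> \<X>" for Y
    unfolding \<sigma>_def
    by (rule continuous_map_pullback')
       (use ts[OF that] that in \<open>auto simp: lc_union_simps o_def trivial_cspace_def continuous_map_def\<close>)
  moreover have "openin \<sigma> (carrier ?X)"
    unfolding \<sigma>_def openin_pullback_topology by (intro exI[of _ UNIV]) (simp add: trivial_cspace_def)
  ultimately have "openin (topo ?X) (carrier ?X)" by (rule openin_lc_union)
  then show "carrier ?X \<subseteq> topspace (topo ?X)" by (rule openin_subset)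
qed

lemma continuous_map_lc_union_id:
  assumes "Module.module \<complex>\<^sub>R (lc_union V \<X>)" "\<And>Y. Y \<in> \<X> \<Longrightarrow> topspace (topo Y) = carrier Y"
    and "lcs ((lc_union V \<X>)\<lparr>topo := \<sigma>\<rparr>)" "\<And>Y. Y \<in> \<X> \<Longrightarrow> continuous_map (topo Y) \<sigma> (\<lambda>x. x)"
  shows "continuous_map (topo (lc_union V \<X>)) \<sigma> (\<lambda>x. x)"
  unfolding continuous_map_def
proof (intro conjI allI impI)
  let ?X = "lc_union V \<X>"
  have ts: "topspace (topo ?X) = carrier ?X" "topspace \<sigma> = carrier ?X"
    using topspace_lc_union[OF assms(1,2)] lcs_topspace[OF assms(3)] by auto
  then show "(\<lambda>x. x) \<in> topspace (topo ?X) \<rightarrow> topspace \<sigma>" by simp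
  fix S assume S: "openin \<sigma> S"
  then have "{x \<in> topspace (topo ?X). x \<in> S} = S" using ts openin_subset by blast
  then show "openin (topo ?X) {x \<in> topspace (topo ?X). x \<in> S}"
    using openin_lc_union[OF assms(3,4) S] by simp
qed

text \<open>The identity is continuous from the limit topology to each admissible topology, and the
  operations are continuous there; hence they are continuous into the supremum. Local convexity is
  inherited along the generation of open sets.\<close>

lemma lcs_lc_union:
  assumes M: "Module.module \<complex>\<^sub>R (lc_union V \<X>)" and Y: "\<And>Y. Y \<in> \<X> \<Longrightarrow> topspace (topo Y) = carrier Y"
  shows "lcs (lc_union V \<X>)"
proof (rule lcsI)
  let ?X = "lc_union V \<X>"
  interpret Module.module "\<complex>\<^sub>R" ?X by fact
  show ts: "topspace (topo ?X) = carrier ?X" by (rule topspace_lc_union[OF M Y])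
  show "continuous_map (prod_topology (topo ?X) (topo ?X)) (topo ?X) (\<lambda>(x, y). x \<oplus>\<^bsub>?X\<^esub> y)"
  proof (rule continuous_map_into_lc_union[OF _ ts])
    fix \<sigma> assume \<sigma>: "lcs (?X\<lparr>topo := \<sigma>\<rparr>)" "\<And>Y. Y \<in> \<X> \<Longrightarrow> continuous_map (topo Y) \<sigma> (\<lambda>x. x)"
    have *: "continuous_map (topo ?X) \<sigma> (\<lambda>x. x)" by (rule continuous_map_lc_union_id[OF M Y \<sigma>])
    have "continuous_map (prod_topology (topo ?X) (topo ?X)) (topo (?X\<lparr>topo := \<sigma>\<rparr>)) (\<lambda>z. fst z \<oplus>\<^bsub>?X\<lparr>topo := \<sigma>\<rparr>\<^esub> snd z)"
      using continuous_map_compose[OF continuous_map_fst *] continuous_map_compose[OF continuous_map_snd *]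
      by (intro continuous_map_lcs_add[OF \<sigma>(1)]) (simp_all add: o_def)
    then show "continuous_map (prod_topology (topo ?X) (topo ?X)) \<sigma> (\<lambda>(x, y). x \<oplus>\<^bsub>?X\<^esub> y)"
      by (simp add: case_prod_unfold)
  qed (use ts in auto)
  show "continuous_map (prod_topology euclidean (topo ?X)) (topo ?X) (\<lambda>(c, x). c \<odot>\<^bsub>?X\<^esub> x)"
  proof (rule continuous_map_into_lc_union[OF _ ts])
    fix \<sigma> assume \<sigma>: "lcs (?X\<lparr>topo := \<sigma>\<rparr>)" "\<And>Y. Y \<in> \<X> \<Longrightarrow> continuous_map (topo Y) \<sigma> (\<lambda>x. x)"
    have *: "continuous_map (topo ?X) \<sigma> (\<lambda>x. x)" by (rule continuous_map_lc_union_id[OF M Y \<sigma>])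
    have "continuous_map (prod_topology euclidean (topo ?X)) (topo (?X\<lparr>topo := \<sigma>\<rparr>)) (\<lambda>z. fst z \<odot>\<^bsub>?X\<lparr>topo := \<sigma>\<rparr>\<^esub> snd z)"
      using continuous_map_fst continuous_map_compose[OF continuous_map_snd *]
      by (intro continuous_map_lcs_smult[OF \<sigma>(1)]) (auto simp add: o_def)
    then show "continuous_map (prod_topology euclidean (topo ?X)) \<sigma> (\<lambda>(c, x). c \<odot>\<^bsub>?X\<^esub> x)"
      by (simp add: case_prod_unfold)
  qed (auto simp: ts intro!: smult_closed)
  fix N assume "openin (topo ?X) N" and "\<zero>\<^bsub>?X\<^esub> \<in> N"
  then have "generate_topology_on {S. \<exists>\<sigma>. lcs (?X\<lparr>topo := \<sigma>\<rparr>) \<and>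
     (\<forall>Y\<in>\<X>. continuous_map (topo Y) \<sigma> (\<lambda>x. x)) \<and> openin \<sigma> S} N"
    unfolding topo_lc_union by (simp add: openin_topology_generated_by)
  then show "\<exists>W C. openin (topo ?X) W \<and> \<zero>\<^bsub>?X\<^esub> \<in> W \<and> W \<subseteq> C \<and> C \<subseteq> N \<and> convex_in ?X C"
    using \<open>\<zero>\<^bsub>?X\<^esub> \<in> N\<close>
  \<comment> \<open>A finite intersection is served by intersecting the open sets and the convex
    sets, a union by any member containing zero, and a generator by local convexity of the
    admissible topology it comes from.\<close>
  proof induction
    case (Int N N')
    then obtain W C W' C' where
      "openin (topo ?X) W" "\<zero>\<^bsub>?X\<^esub> \<in> W" "W \<subseteq> C" "C \<subseteq> N" "convex_in ?X C"
      "openin (topo ?X) W'" "\<zero>\<^bsub>?X\<^esub> \<in> W'" "W' \<subseteq> C'" "C' \<subseteq> N'" "convex_in ?X C'" by blast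
    then show ?case
      by (intro exI[of _ "W \<inter> W'"] exI[of _ "C \<inter> C'"]) (auto simp: convex_in_def)
  next
    case (UN K)
    then obtain k where "k \<in> K" "\<zero>\<^bsub>?X\<^esub> \<in> k" by blast
    with UN show ?case by (meson Sup_upper order_trans)
  next
    case (Basis N)
    then obtain \<sigma> where \<sigma>: "lcs (?X\<lparr>topo := \<sigma>\<rparr>)" "\<forall>Y\<in>\<X>. continuous_map (topo Y) \<sigma> (\<lambda>x. x)" "openin \<sigma> N" by blast
    then obtain W C where "openin \<sigma> W" "\<zero>\<^bsub>?X\<^esub> \<in> W" "W \<subseteq> C" "C \<subseteq> N" "convex_in ?X C"
      using lcs_convex[OF \<sigma>(1), of N] Basis by auto
    then show ?case using openin_lc_union[OF \<sigma>(1), of W] \<sigma>(2) by blast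
  qed simp
qed (rule M)

text \<open>The universal property of the limit: the topology pulled back along \<open>f\<close> is
  locally convex and makes all inclusions continuous, so it is coarser than the limit
  topology.\<close>

lemma continuous_map_from_lc_union:
  assumes M: "Module.module \<complex>\<^sub>R (lc_union V \<X>)" and ts: "\<And>Y. Y \<in> \<X> \<Longrightarrow> topspace (topo Y) = carrier Y"
    and E: "lcs E" and f: "linear_in (lc_union V \<X>) E f"
    and c: "\<And>Y. Y \<in> \<X> \<Longrightarrow> continuous_map (topo Y) (topo E) f"
  shows "continuous_map (topo (lc_union V \<X>)) (topo E) f"
proof -
  let ?X = "lc_union V \<X>"
  define \<sigma> where "\<sigma> = pullback_topology (carrier ?X) f (topo E)"
  have l: "lcs (?X\<lparr>topo := \<sigma>\<rparr>)"
    unfolding \<sigma>_def by (rule lcs_pullback[OF M E f])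
  have "continuous_map (topo ?X) \<sigma> (\<lambda>x. x)"
  proof (rule continuous_map_lc_union_id[OF M ts l])
    show "continuous_map (topo Y) \<sigma> (\<lambda>x. x)" if "Y \<in> \<X>" for Y
      unfolding \<sigma>_def
      by (rule continuous_map_pullback') (use c[OF that] ts[OF that] that in \<open>auto simp: lc_union_simps o_def\<close>)
  qed
  moreover have "continuous_map \<sigma> (topo E) f"
    unfolding \<sigma>_def
    using continuous_map_pullback[OF continuous_map_id[of "topo E"], of "carrier ?X" f] by (simp add: o_def id_def)
  ultimately show ?thesis using continuous_map_compose[of _ \<sigma> "\<lambda>x. x" _ f] by (simp add: o_def)
qed

lemma continuous_map_inclusion_lc_union:
  assumes M: "Module.module \<complex>\<^sub>R (lc_union V \<X>)" and ts: "\<And>Y. Y \<in> \<X> \<Longrightarrow> topspace (topo Y) = carrier Y"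
    and Y: "Y \<in> \<X>"
  shows "continuous_map (topo Y) (topo (lc_union V \<X>)) (\<lambda>x. x)"
  by (rule continuous_map_into_lc_union[OF _ topspace_lc_union[OF M ts]])
     (use Y ts in \<open>auto simp: lc_union_simps\<close>)

section \<open>Bounded sets\<close>

lemma bounded_in_image:
  assumes X: "lcs X" and Y: "lcs Y" and f: "linear_in X Y f" "continuous_map (topo X) (topo Y) f"
    and B: "bounded_in X B"
  shows "bounded_in Y (f ` B)"
  unfolding bounded_in_def
proof (intro conjI allI impI)
  show "f ` B \<subseteq> carrier Y" using B linear_in_closed[OF f(1)] by (auto simp: bounded_in_def)
  fix N assume N: "openin (topo Y) N \<and> \<zero>\<^bsub>Y\<^esub> \<in> N"
  interpret X: Module.module "\<complex>\<^sub>R" X by (rule lcs_module[OF X])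
  have "openin (topo X) {x \<in> topspace (topo X). f x \<in> N}"
    using openin_continuous_map_preimage[OF f(2)] N by blast
  moreover have "\<zero>\<^bsub>X\<^esub> \<in> {x \<in> topspace (topo X). f x \<in> N}"
    using linear_in_zero[OF lcs_module[OF X] lcs_module[OF Y] f(1)] N lcs_topspace[OF X] by simp
  ultimately obtain r where r: "r > 0" "\<And>c. cmod c \<ge> r \<Longrightarrow> B \<subseteq> (\<lambda>x. c \<odot>\<^bsub>X\<^esub> x) ` {x \<in> topspace (topo X). f x \<in> N}"
    using B unfolding bounded_in_def by meson
  have "f ` B \<subseteq> (\<lambda>x. c \<odot>\<^bsub>Y\<^esub> x) ` N" if "cmod c \<ge> r" for c
  proof
    fix y assume "y \<in> f ` B"
    then obtain x where "y = f x" "x \<in> B" by blast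
    with r(2)[OF that] obtain z where "x = c \<odot>\<^bsub>X\<^esub> z" "z \<in> topspace (topo X)" "f z \<in> N" by blast
    then show "y \<in> (\<lambda>x. c \<odot>\<^bsub>Y\<^esub> x) ` N"
      using \<open>y = f x\<close> linear_in_smult[OF f(1), of z c] lcs_topspace[OF X] by simp
  qed
  then show "\<exists>r>0. \<forall>c. r \<le> cmod c \<longrightarrow> f ` B \<subseteq> (\<lambda>x. c \<odot>\<^bsub>Y\<^esub> x) ` N" using r(1) by blast
qed

lemma bounded_in_singleton:
  assumes X: "lcs X" and x: "x \<in> carrier X"
  shows "bounded_in X {x}"
  unfolding bounded_in_def
proof (intro conjI allI impI)
  fix N assume N: "openin (topo X) N \<and> \<zero>\<^bsub>X\<^esub> \<in> N"
  interpret X: Module.module "\<complex>\<^sub>R" X by (rule lcs_module[OF X])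
  have "continuous_map euclidean (topo X) (\<lambda>c::complex. c \<odot>\<^bsub>X\<^esub> x)"
    by (intro continuous_map_lcs_smult[OF X]) (use x lcs_topspace[OF X] in auto)
  then have "open {c. c \<odot>\<^bsub>X\<^esub> x \<in> N}"
    using N openin_continuous_map_preimage[of euclidean "topo X" "\<lambda>c::complex. c \<odot>\<^bsub>X\<^esub> x" N] by simp
  moreover have "0 \<in> {c. c \<odot>\<^bsub>X\<^esub> x \<in> N}" using N x X.smult_l_null by simp
  ultimately obtain e where e: "e > 0" "\<And>c. cmod c < e \<Longrightarrow> c \<odot>\<^bsub>X\<^esub> x \<in> N"
    by (auto simp: open_dist)
  show "\<exists>r>0. \<forall>c. r \<le> cmod c \<longrightarrow> {x} \<subseteq> (\<lambda>x. c \<odot>\<^bsub>X\<^esub> x) ` N"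
  \<comment> \<open>The radius 2/e instead of 1/e makes the bound on the inverse scalar
    strict.\<close>
  proof (intro exI[of _ "2 / e"] conjI allI impI)
    fix c :: complex assume c: "2 / e \<le> cmod c"
    then have c0: "c \<noteq> 0" using e(1) by (auto simp: divide_le_0_iff)
    have "cmod (inverse c) < e" using c e(1) c0 by (simp add: norm_inverse norm_divide field_simps)
    then have "inverse c \<odot>\<^bsub>X\<^esub> x \<in> N" by (rule e(2))
    moreover have "c \<odot>\<^bsub>X\<^esub> (inverse c \<odot>\<^bsub>X\<^esub> x) = x"
      using X.smult_assoc1[of c "inverse c" x] X.smult_one[of x] x c0 by simp
    ultimately show "{x} \<subseteq> (\<lambda>x. c \<odot>\<^bsub>X\<^esub> x) ` N" by force
  qed (use e in simp)
qed (use x in simp)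

section \<open>Topologies defined by seminorms\<close>

lemma seminorm_ball_open:
  assumes R: "abelian_group R" and Q: "finite Q" "Q \<subseteq> P" and x: "x \<in> carrier R"
    and tri: "\<forall>p\<in>P. \<forall>y\<in>carrier R. \<forall>z\<in>carrier R. p (y \<oplus>\<^bsub>R\<^esub> z) \<le> p y + p z"
  shows "openin (seminorm_topology R P) {y \<in> carrier R. \<forall>p\<in>Q. p (y \<ominus>\<^bsub>R\<^esub> x) < e}"
  unfolding openin_seminorm_topology
proof (intro conjI ballI)
  interpret abelian_group R by fact
  fix y assume y: "y \<in> {y \<in> carrier R. \<forall>p\<in>Q. p (y \<ominus>\<^bsub>R\<^esub> x) < e}"
  \<comment> \<open>The least distance to the boundary among the seminorms in \<open>Q\<close>; the
    inserted 1 covers an empty \<open>Q\<close>.\<close>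
  define d where "d = Min (insert 1 ((\<lambda>p. e - p (y \<ominus>\<^bsub>R\<^esub> x)) ` Q))"
  have d: "d > 0" "\<And>p. p \<in> Q \<Longrightarrow> d \<le> e - p (y \<ominus>\<^bsub>R\<^esub> x)"
    using y Q by (auto simp: d_def)
  have "p (z \<ominus>\<^bsub>R\<^esub> x) < e" if "z \<in> carrier R" "p \<in> Q" "p (z \<ominus>\<^bsub>R\<^esub> y) < d" for z p
  proof -
    have "z \<ominus>\<^bsub>R\<^esub> x = (z \<ominus>\<^bsub>R\<^esub> y) \<oplus>\<^bsub>R\<^esub> (y \<ominus>\<^bsub>R\<^esub> x)"
      using that y x by (simp add: minus_eq a_assoc r_neg1)
    then have "p (z \<ominus>\<^bsub>R\<^esub> x) \<le> p (z \<ominus>\<^bsub>R\<^esub> y) + p (y \<ominus>\<^bsub>R\<^esub> x)"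
      using tri[rule_format, of p "z \<ominus>\<^bsub>R\<^esub> y" "y \<ominus>\<^bsub>R\<^esub> x"] that y x Q by auto
    then show ?thesis using that d(2)[of p] by simp
  qed
  then show "\<exists>Q' e'. finite Q' \<and> Q' \<subseteq> P \<and> e' > 0 \<and> {z \<in> carrier R. \<forall>p\<in>Q'. p (z \<ominus>\<^bsub>R\<^esub> y) < e'}
      \<subseteq> {y \<in> carrier R. \<forall>p\<in>Q. p (y \<ominus>\<^bsub>R\<^esub> x) < e}"
    using Q d(1) by (intro exI[of _ Q] exI[of _ d]) auto
qed auto

text \<open>A description of the subspace topology by balls taken inside \<open>S\<close>. For the
  converse direction the ambient open set is a union of balls, which are open by the triangle
  inequality and contain their centres because the seminorms vanish at zero.\<close>

lemma openin_subtopology_seminorm: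
  assumes R: "abelian_group R" and S: "S \<subseteq> carrier R"
    and tri: "\<forall>p\<in>P. \<forall>y\<in>carrier R. \<forall>z\<in>carrier R. p (y \<oplus>\<^bsub>R\<^esub> z) \<le> p y + p z"
    and zero: "\<forall>p\<in>P. p \<zero>\<^bsub>R\<^esub> = 0"
  shows "openin (subtopology (seminorm_topology R P) S) A \<longleftrightarrow> A \<subseteq> S \<and>
    (\<forall>x\<in>A. \<exists>Q e. finite Q \<and> Q \<subseteq> P \<and> e > 0 \<and> {y \<in> S. \<forall>p\<in>Q. p (y \<ominus>\<^bsub>R\<^esub> x) < e} \<subseteq> A)"
    (is "_ \<longleftrightarrow> _ \<and> ?r")
proof
  assume "openin (subtopology (seminorm_topology R P) S) A"
  then obtain G where G: "openin (seminorm_topology R P) G" "A = G \<inter> S"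
    by (auto simp: openin_subtopology)
  have ?r
  proof
    fix x assume "x \<in> A"
    then have "x \<in> G" using G by auto
    then obtain Q e where "finite Q" "Q \<subseteq> P" "e > 0" "{y \<in> carrier R. \<forall>p\<in>Q. p (y \<ominus>\<^bsub>R\<^esub> x) < e} \<subseteq> G"
      using G(1) unfolding openin_seminorm_topology by meson
    then show "\<exists>Q e. finite Q \<and> Q \<subseteq> P \<and> e > 0 \<and> {y \<in> S. \<forall>p\<in>Q. p (y \<ominus>\<^bsub>R\<^esub> x) < e} \<subseteq> A"
      using G(2) S by (intro exI[of _ Q] exI[of _ e]) auto
  qed
  then show "A \<subseteq> S \<and> ?r" using G by auto
next
  interpret abelian_group R by fact
  assume A: "A \<subseteq> S \<and> ?r"
  have "\<exists>G. openin (seminorm_topology R P) G \<and> x \<in> G \<and> G \<inter> S \<subseteq> A" if x: "x \<in> A" for x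
  proof -
    obtain Q e where Q: "finite Q" "Q \<subseteq> P" "e > 0" "{y \<in> S. \<forall>p\<in>Q. p (y \<ominus>\<^bsub>R\<^esub> x) < e} \<subseteq> A"
      using A x by meson
    have xR: "x \<in> carrier R" using A S x by auto
    have "x \<in> {y \<in> carrier R. \<forall>p\<in>Q. p (y \<ominus>\<^bsub>R\<^esub> x) < e}"
    proof -
      have "x \<ominus>\<^bsub>R\<^esub> x = \<zero>\<^bsub>R\<^esub>" using xR by (simp add: minus_eq r_neg)
      then have "p (x \<ominus>\<^bsub>R\<^esub> x) < e" if "p \<in> Q" for p
        using bspec[OF zero subsetD[OF Q(2) that]] Q(3) by simp
      then show ?thesis using xR Q(3) by simp
    qed
    then show ?thesis
      using seminorm_ball_open[OF R Q(1,2) xR tri, of e] Q(4) S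
      by (intro exI[of _ "{y \<in> carrier R. \<forall>p\<in>Q. p (y \<ominus>\<^bsub>R\<^esub> x) < e}"]) auto
  qed
  then obtain G where G: "\<And>x. x \<in> A \<Longrightarrow> openin (seminorm_topology R P) (G x) \<and> x \<in> G x \<and> G x \<inter> S \<subseteq> A"
    by metis
  have "openin (seminorm_topology R P) (\<Union>x\<in>A. G x)" using G by blast
  moreover have "A = (\<Union>x\<in>A. G x) \<inter> S" using G A by blast
  ultimately show "openin (subtopology (seminorm_topology R P) S) A"
    by (auto simp: openin_subtopology)
qed

lemma topspace_seminorm_topology: "topspace (seminorm_topology R P) = carrier R"
proof -
  have "openin (seminorm_topology R P) (carrier R)"
    unfolding openin_seminorm_topology by (auto intro!: exI[of _ "{}"] exI[of _ 1])
  then show ?thesis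
    using openin_subset openin_topspace[of "seminorm_topology R P", unfolded openin_seminorm_topology, THEN conjunct1]
    by blast
qed

text \<open>Compatibility with differences moves every comparison to the origin, so an estimate of
  \<open>p' (m z)\<close> by finitely many seminorms of \<open>z\<close> suffices. Working on
  subsets \<open>S\<close> and \<open>S'\<close> fits the spaces of sections with prescribed
  support, which carry subspace topologies.\<close>

lemma continuous_map_seminorm_topology:
  assumes R: "abelian_group R" "S \<subseteq> carrier R"
      "\<forall>p\<in>P. \<forall>y\<in>carrier R. \<forall>z\<in>carrier R. p (y \<oplus>\<^bsub>R\<^esub> z) \<le> p y + p z"
      "\<forall>p\<in>P. p \<zero>\<^bsub>R\<^esub> = 0"
    and R': "abelian_group R'" "S' \<subseteq> carrier R'"
      "\<forall>p\<in>P'. \<forall>y\<in>carrier R'. \<forall>z\<in>carrier R'. p (y \<oplus>\<^bsub>R'\<^esub> z) \<le> p y + p z"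
      "\<forall>p\<in>P'. p \<zero>\<^bsub>R'\<^esub> = 0"
    and m: "m \<in> S \<rightarrow> S'" "\<And>x y. x \<in> S \<Longrightarrow> y \<in> S \<Longrightarrow> y \<ominus>\<^bsub>R\<^esub> x \<in> S \<and> m (y \<ominus>\<^bsub>R\<^esub> x) = m y \<ominus>\<^bsub>R'\<^esub> m x"
    and le: "\<And>p' e. p' \<in> P' \<Longrightarrow> e > 0 \<Longrightarrow>
      \<exists>Q d. finite Q \<and> Q \<subseteq> P \<and> d > 0 \<and> (\<forall>z\<in>S. (\<forall>p\<in>Q. p z < d) \<longrightarrow> p' (m z) < e)"
  shows "continuous_map (subtopology (seminorm_topology R P) S) (subtopology (seminorm_topology R' P') S') m"
  unfolding continuous_map_def
proof (intro conjI allI impI)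
  show "m \<in> topspace (subtopology (seminorm_topology R P) S) \<rightarrow> topspace (subtopology (seminorm_topology R' P') S')"
    using m(1) R(2) R'(2) by (auto simp: topspace_seminorm_topology)
  fix A assume A: "openin (subtopology (seminorm_topology R' P') S') A"
  have ts: "topspace (subtopology (seminorm_topology R P) S) = S"
    using R(2) by (auto simp: topspace_seminorm_topology)
  show "openin (subtopology (seminorm_topology R P) S) {x \<in> topspace (subtopology (seminorm_topology R P) S). m x \<in> A}"
    unfolding openin_subtopology_seminorm[where R = R and S = S and P = P, OF R] ts
  proof (intro conjI ballI)
    fix x assume x: "x \<in> {x \<in> S. m x \<in> A}"
    then have mx: "m x \<in> A" by simp
    obtain Q e where Q: "finite Q" "Q \<subseteq> P'" "e > 0" "{y \<in> S'. \<forall>p\<in>Q. p (y \<ominus>\<^bsub>R'\<^esub> m x) < e} \<subseteq> A"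
      using A[unfolded openin_subtopology_seminorm[where R = R' and S = S' and P = P', OF R'], THEN conjunct2,
          rule_format, OF mx] by blast
    have "\<forall>p'\<in>Q. \<exists>Q' d. finite Q' \<and> Q' \<subseteq> P \<and> d > 0 \<and> (\<forall>z\<in>S. (\<forall>p\<in>Q'. p z < d) \<longrightarrow> p' (m z) < e)"
      using le Q(2,3) by (meson subsetD)
    then obtain \<phi> \<delta> where \<phi>: "\<And>p'. p' \<in> Q \<Longrightarrow> finite (\<phi> p') \<and> \<phi> p' \<subseteq> P \<and> \<delta> p' > 0 \<and>
        (\<forall>z\<in>S. (\<forall>p\<in>\<phi> p'. p z < \<delta> p') \<longrightarrow> p' (m z) < e)"
      by metis
    define d where "d = Min (insert 1 (\<delta> ` Q))"
    have d: "d > 0" "\<And>p. p \<in> Q \<Longrightarrow> d \<le> \<delta> p" using Q(1) \<phi> by (auto simp: d_def)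
    have "m y \<in> A" if y: "y \<in> S" "\<forall>p\<in>\<Union>(\<phi> ` Q). p (y \<ominus>\<^bsub>R\<^esub> x) < d" for y
    proof -
      have yx: "y \<ominus>\<^bsub>R\<^esub> x \<in> S" "m (y \<ominus>\<^bsub>R\<^esub> x) = m y \<ominus>\<^bsub>R'\<^esub> m x" using m(2)[of x y] x y(1) by auto
      have "p (m y \<ominus>\<^bsub>R'\<^esub> m x) < e" if p: "p \<in> Q" for p
      proof -
        have "\<forall>p'\<in>\<phi> p. p' (y \<ominus>\<^bsub>R\<^esub> x) < \<delta> p"
          using y(2) d(2)[OF p] p by (meson UN_I less_le_trans)
        then have "p (m (y \<ominus>\<^bsub>R\<^esub> x)) < e" using \<phi>[OF p] yx(1) by blast
        then show ?thesis using yx(2) by simp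
      qed
      then show ?thesis using Q(4) m(1) y(1) by blast
    qed
    then show "\<exists>Q e. finite Q \<and> Q \<subseteq> P \<and> e > 0 \<and> {y \<in> S. \<forall>p\<in>Q. p (y \<ominus>\<^bsub>R\<^esub> x) < e} \<subseteq> {x \<in> S. m x \<in> A}"
      using Q(1) \<phi> d(1) by (intro exI[of _ "\<Union>(\<phi> ` Q)"] exI[of _ d]) auto
  qed auto
qed

lemma openin_single_seminorm_topology:
  "openin (seminorm_topology R {q}) S \<longleftrightarrow> S \<subseteq> carrier R \<and>
    (\<forall>x\<in>S. \<exists>e>0. {y \<in> carrier R. q (y \<ominus>\<^bsub>R\<^esub> x) < e} \<subseteq> S)"
proof -
  have "(\<exists>Q e. finite Q \<and> Q \<subseteq> {q} \<and> e > 0 \<and> {y \<in> carrier R. \<forall>p\<in>Q. p (y \<ominus>\<^bsub>R\<^esub> x) < e} \<subseteq> S) \<longleftrightarrow>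
    (\<exists>e>0. {y \<in> carrier R. q (y \<ominus>\<^bsub>R\<^esub> x) < e} \<subseteq> S)" (is "?l \<longleftrightarrow> ?r") for x
  proof
    assume ?l
    then obtain Q e where Q: "Q \<subseteq> {q}" "e > 0" "{y \<in> carrier R. \<forall>p\<in>Q. p (y \<ominus>\<^bsub>R\<^esub> x) < e} \<subseteq> S" by blast
    then have "{y \<in> carrier R. q (y \<ominus>\<^bsub>R\<^esub> x) < e} \<subseteq> S" by blast
    then show ?r using Q(2) by blast
  next
    assume ?r
    then obtain e where "e > 0" "{y \<in> carrier R. q (y \<ominus>\<^bsub>R\<^esub> x) < e} \<subseteq> S" by blast
    then show ?l by (intro exI[of _ "{q}"] exI[of _ e]) simp
  qed
  then show ?thesis unfolding openin_seminorm_topology by simp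
qed

lemma lcs_topo_updateI:
  assumes "Module.module \<complex>\<^sub>R X" "topspace \<tau> = carrier X"
    "continuous_map (prod_topology \<tau> \<tau>) \<tau> (\<lambda>(x, y). x \<oplus>\<^bsub>X\<^esub> y)"
    "continuous_map (prod_topology euclidean \<tau>) \<tau> (\<lambda>(c, x). c \<odot>\<^bsub>X\<^esub> x)"
    "\<And>N. openin \<tau> N \<Longrightarrow> \<zero>\<^bsub>X\<^esub> \<in> N \<Longrightarrow>
      \<exists>W C. openin \<tau> W \<and> \<zero>\<^bsub>X\<^esub> \<in> W \<and> W \<subseteq> C \<and> C \<subseteq> N \<and> convex_in X C"
  shows "lcs (X\<lparr>topo := \<tau>\<rparr>)"
  by (rule lcsI) (use assms in simp_all)

text \<open>This makes the topology of one specially built seminorm available as an admissible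
  topology on a test space, so that the unit ball of that seminorm is a neighbourhood of zero in the
  inductive limit.\<close>

lemma lcs_single_seminorm:
  assumes X: "Module.module \<complex>\<^sub>R X"
    and tri: "\<And>x y. x \<in> carrier X \<Longrightarrow> y \<in> carrier X \<Longrightarrow> q (x \<oplus>\<^bsub>X\<^esub> y) \<le> q x + q y"
    and hom: "\<And>c x. x \<in> carrier X \<Longrightarrow> q (c \<odot>\<^bsub>X\<^esub> x) = cmod c * q x"
  shows "lcs (X\<lparr>topo := seminorm_topology X {q}\<rparr>)"
proof -
  interpret X: Module.module "\<complex>\<^sub>R" X by fact
  let ?T = "seminorm_topology X {q}"
  have q0: "q \<zero>\<^bsub>X\<^esub> = 0" using hom[of "\<zero>\<^bsub>X\<^esub>" 0] by (simp add: X.smult_l_null)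
  have qm: "q (\<ominus>\<^bsub>X\<^esub> x) = q x" if "x \<in> carrier X" for x
    using hom[OF that, of "-1"] that by (simp add: module_minus_eq_smult[OF X])
  \<comment> \<open>Positivity is derived: 0 = q(x - x) is at most 2 q(x).\<close>
  have qpos: "q x \<ge> 0" if "x \<in> carrier X" for x
  proof -
    have "0 = q (x \<oplus>\<^bsub>X\<^esub> \<ominus>\<^bsub>X\<^esub> x)" using q0 that by (simp add: X.r_neg)
    also have "\<dots> \<le> q x + q x" using tri[of x "\<ominus>\<^bsub>X\<^esub> x"] qm that by simp
    finally show ?thesis by simp
  qed
  have ball: "openin ?T {y \<in> carrier X. q (y \<ominus>\<^bsub>X\<^esub> x) < e}" if "x \<in> carrier X" for x e
    using seminorm_ball_open[of X "{q}" "{q}" x e] tri that X.abelian_group_axioms by simp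
  have self: "q (x \<ominus>\<^bsub>X\<^esub> x) = 0" if "x \<in> carrier X" for x using q0 that by (simp add: X.minus_eq X.r_neg)
  have ts: "topspace ?T = carrier X" by (rule topspace_seminorm_topology)
  show ?thesis
  proof (rule lcs_topo_updateI)
    show "Module.module \<complex>\<^sub>R X" by fact
    show "topspace ?T = carrier X" by fact
    show "continuous_map (prod_topology ?T ?T) ?T (\<lambda>(x, y). x \<oplus>\<^bsub>X\<^esub> y)"
      unfolding continuous_map_def
    proof (intro conjI allI impI)
      fix S assume S: "openin ?T S"
      show "openin (prod_topology ?T ?T) {z \<in> topspace (prod_topology ?T ?T). (case z of (x, y) \<Rightarrow> x \<oplus>\<^bsub>X\<^esub> y) \<in> S}"
        unfolding openin_prod_topology_alt
      proof (intro allI impI)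
        fix x y assume "(x, y) \<in> {z \<in> topspace (prod_topology ?T ?T). (case z of (x, y) \<Rightarrow> x \<oplus>\<^bsub>X\<^esub> y) \<in> S}"
        then have x: "x \<in> carrier X" and y: "y \<in> carrier X" and "x \<oplus>\<^bsub>X\<^esub> y \<in> S" using ts by auto
        then obtain e where e: "e > 0" "{z \<in> carrier X. q (z \<ominus>\<^bsub>X\<^esub> (x \<oplus>\<^bsub>X\<^esub> y)) < e} \<subseteq> S"
          using S unfolding openin_single_seminorm_topology by blast
        define h where "h = e / 2"
        let ?B = "\<lambda>x. {z \<in> carrier X. q (z \<ominus>\<^bsub>X\<^esub> x) < h}"
        have "u \<oplus>\<^bsub>X\<^esub> v \<in> S" if "u \<in> ?B x" "v \<in> ?B y" for u v
        proof -
          have "(u \<oplus>\<^bsub>X\<^esub> v) \<ominus>\<^bsub>X\<^esub> (x \<oplus>\<^bsub>X\<^esub> y) = (u \<ominus>\<^bsub>X\<^esub> x) \<oplus>\<^bsub>X\<^esub> (v \<ominus>\<^bsub>X\<^esub> y)"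
            using that x y by (simp add: X.minus_eq X.minus_add X.a_ac)
          then have "q ((u \<oplus>\<^bsub>X\<^esub> v) \<ominus>\<^bsub>X\<^esub> (x \<oplus>\<^bsub>X\<^esub> y)) < e"
            using tri[of "u \<ominus>\<^bsub>X\<^esub> x" "v \<ominus>\<^bsub>X\<^esub> y"] that x y by (simp add: h_def)
          then show ?thesis using e(2) that by auto
        qed
        moreover have "h > 0" using e by (simp add: h_def)
        ultimately show "\<exists>U V. openin ?T U \<and> openin ?T V \<and> x \<in> U \<and> y \<in> V \<and>
            U \<times> V \<subseteq> {z \<in> topspace (prod_topology ?T ?T). (case z of (x, y) \<Rightarrow> x \<oplus>\<^bsub>X\<^esub> y) \<in> S}"
          using ball[OF x] ball[OF y] self[OF x] self[OF y] e(1) x y ts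
          by - (rule exI[of _ "?B x"], rule exI[of _ "?B y"], auto)
      qed
    qed (use ts in auto)
    show "continuous_map (prod_topology euclidean ?T) ?T (\<lambda>(c, x). c \<odot>\<^bsub>X\<^esub> x)"
      unfolding continuous_map_def
    proof (intro conjI allI impI)
      fix S assume S: "openin ?T S"
      show "openin (prod_topology euclidean ?T) {z \<in> topspace (prod_topology euclidean ?T). (case z of (c, x) \<Rightarrow> c \<odot>\<^bsub>X\<^esub> x) \<in> S}"
        unfolding openin_prod_topology_alt
      proof (intro allI impI)
        fix c x assume "(c, x) \<in> {z \<in> topspace (prod_topology euclidean ?T). (case z of (c, x) \<Rightarrow> c \<odot>\<^bsub>X\<^esub> x) \<in> S}"
        then have x: "x \<in> carrier X" and "c \<odot>\<^bsub>X\<^esub> x \<in> S" using ts by auto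
        then obtain e where e: "e > 0" "{z \<in> carrier X. q (z \<ominus>\<^bsub>X\<^esub> (c \<odot>\<^bsub>X\<^esub> x)) < e} \<subseteq> S"
          using S unfolding openin_single_seminorm_topology by blast
        \<comment> \<open>The estimate below bounds the error by d * K, where d at most 1 is used to
          bound the modulus of the perturbed scalar by that of \<open>c\<close> plus 1. Dividing
          \<open>e\<close> by K + 1 makes the final inequality strict.\<close>
        define K where "K = cmod c + 1 + q x"
        have K: "K > 0" using qpos[OF x] norm_ge_zero[of c] unfolding K_def by linarith
        define d where "d = min 1 (e / (K + 1))"
        have d: "d > 0" "d \<le> 1" "d * K < e"
        proof -
          show "d > 0" "d \<le> 1" using e K by (auto simp: d_def)
          have "d * K \<le> e / (K + 1) * K" using K by (intro mult_right_mono) (auto simp: d_def)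
          also have "\<dots> < e" using e K by (simp add: field_simps)
          finally show "d * K < e" .
        qed
        let ?B = "{z \<in> carrier X. q (z \<ominus>\<^bsub>X\<^esub> x) < d}"
        \<comment> \<open>Uses b u - c x = b (u - x) + (b - c) x, where the first term is small
          through \<open>u\<close> and the second through \<open>b\<close>.\<close>
        have "b \<odot>\<^bsub>X\<^esub> u \<in> S" if "b \<in> ball c d" "u \<in> ?B" for b u
        proof -
          have u: "u \<in> carrier X" "q (u \<ominus>\<^bsub>X\<^esub> x) < d" using that by auto
          have bc: "cmod (b - c) < d" using that by (simp add: dist_norm norm_minus_commute)
          have "cmod b \<le> cmod c + 1" using bc d(2) norm_triangle_ineq2[of b c] by linarith
          have "b \<odot>\<^bsub>X\<^esub> x = (b - c) \<odot>\<^bsub>X\<^esub> x \<oplus>\<^bsub>X\<^esub> c \<odot>\<^bsub>X\<^esub> x"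
            using X.smult_l_distr[of "b - c" c x] x by simp
          then have "(b \<odot>\<^bsub>X\<^esub> u) \<ominus>\<^bsub>X\<^esub> (c \<odot>\<^bsub>X\<^esub> x) = (b \<odot>\<^bsub>X\<^esub> u \<ominus>\<^bsub>X\<^esub> b \<odot>\<^bsub>X\<^esub> x) \<oplus>\<^bsub>X\<^esub> (b - c) \<odot>\<^bsub>X\<^esub> x"
          proof -
            have "a \<ominus>\<^bsub>X\<^esub> w = (a \<ominus>\<^bsub>X\<^esub> (v \<oplus>\<^bsub>X\<^esub> w)) \<oplus>\<^bsub>X\<^esub> v"
              if "a \<in> carrier X" "v \<in> carrier X" "w \<in> carrier X" for a v w
              using that by (simp add: X.minus_eq X.minus_add X.a_assoc X.a_comm[of "\<ominus>\<^bsub>X\<^esub> w" v] X.r_neg1)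
            then show ?thesis unfolding \<open>b \<odot>\<^bsub>X\<^esub> x = _\<close> by this (use u x in auto)
          qed
          also have "b \<odot>\<^bsub>X\<^esub> u \<ominus>\<^bsub>X\<^esub> b \<odot>\<^bsub>X\<^esub> x = b \<odot>\<^bsub>X\<^esub> (u \<ominus>\<^bsub>X\<^esub> x)"
            using u x by (simp add: X.minus_eq X.smult_r_distr X.smult_r_minus)
          finally have "q ((b \<odot>\<^bsub>X\<^esub> u) \<ominus>\<^bsub>X\<^esub> (c \<odot>\<^bsub>X\<^esub> x)) \<le> cmod b * q (u \<ominus>\<^bsub>X\<^esub> x) + cmod (b - c) * q x"
            using tri[of "b \<odot>\<^bsub>X\<^esub> (u \<ominus>\<^bsub>X\<^esub> x)" "(b - c) \<odot>\<^bsub>X\<^esub> x"] u x by (simp add: hom)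
          also have "\<dots> \<le> (cmod c + 1) * d + d * q x"
            using \<open>cmod b \<le> cmod c + 1\<close> u(2) bc qpos[of "u \<ominus>\<^bsub>X\<^esub> x"] qpos[OF x] u(1) x
            by (intro add_mono mult_mono) auto
          also have "\<dots> = d * K" by (simp add: K_def algebra_simps)
          finally show ?thesis using e(2) d(3) u by auto
        qed
        then show "\<exists>U V. openin euclidean U \<and> openin ?T V \<and> c \<in> U \<and> x \<in> V \<and>
            U \<times> V \<subseteq> {z \<in> topspace (prod_topology euclidean ?T). (case z of (c, x) \<Rightarrow> c \<odot>\<^bsub>X\<^esub> x) \<in> S}"
          using ball[OF x] self[OF x] d(1) x ts
          by (intro exI[of _ "ball c d"] exI[of _ ?B]) auto
      qed
    qed (auto simp: ts intro!: X.smult_closed)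
    fix N assume N: "openin ?T N" "\<zero>\<^bsub>X\<^esub> \<in> N"
    then obtain e where e: "e > 0" "{z \<in> carrier X. q (z \<ominus>\<^bsub>X\<^esub> \<zero>\<^bsub>X\<^esub>) < e} \<subseteq> N"
      unfolding openin_single_seminorm_topology by blast
    let ?B = "{z \<in> carrier X. q (z \<ominus>\<^bsub>X\<^esub> \<zero>\<^bsub>X\<^esub>) < e}"
    have "\<ominus>\<^bsub>X\<^esub> \<zero>\<^bsub>X\<^esub> = \<zero>\<^bsub>X\<^esub>" using X.r_neg[of "\<zero>\<^bsub>X\<^esub>"] by simp
    then have "x \<ominus>\<^bsub>X\<^esub> \<zero>\<^bsub>X\<^esub> = x" if "x \<in> carrier X" for x
      unfolding X.minus_eq using that by (metis X.r_zero)
    then have B: "?B = {z \<in> carrier X. q z < e}" by auto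
    have "convex_in X ?B"
      unfolding convex_in_def B
    proof (intro ballI allI impI)
      fix x y and t :: real assume xy: "x \<in> {z \<in> carrier X. q z < e}" "y \<in> {z \<in> carrier X. q z < e}" and t: "0 \<le> t \<and> t \<le> 1"
      have "q (complex_of_real t \<odot>\<^bsub>X\<^esub> x \<oplus>\<^bsub>X\<^esub> complex_of_real (1 - t) \<odot>\<^bsub>X\<^esub> y) \<le> t * q x + (1 - t) * q y"
        using tri[of "complex_of_real t \<odot>\<^bsub>X\<^esub> x" "complex_of_real (1 - t) \<odot>\<^bsub>X\<^esub> y"] xy t
        by (simp add: hom del: of_real_diff)
      also have "\<dots> < e" using xy t by (intro convex_bound_lt) auto
      finally have "q (complex_of_real t \<odot>\<^bsub>X\<^esub> x \<oplus>\<^bsub>X\<^esub> complex_of_real (1 - t) \<odot>\<^bsub>X\<^esub> y) < e" .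
      moreover have "complex_of_real t \<odot>\<^bsub>X\<^esub> x \<oplus>\<^bsub>X\<^esub> complex_of_real (1 - t) \<odot>\<^bsub>X\<^esub> y \<in> carrier X"
        using xy by (intro X.a_closed X.smult_closed) simp_all
      ultimately show "complex_of_real t \<odot>\<^bsub>X\<^esub> x \<oplus>\<^bsub>X\<^esub> complex_of_real (1 - t) \<odot>\<^bsub>X\<^esub> y \<in> {z \<in> carrier X. q z < e}" by blast
    qed
    moreover have "openin ?T ?B" by (rule ball) simp
    ultimately show "\<exists>W C. openin ?T W \<and> \<zero>\<^bsub>X\<^esub> \<in> W \<and> W \<subseteq> C \<and> C \<subseteq> N \<and> convex_in X C"
      using e self[of "\<zero>\<^bsub>X\<^esub>"] by (intro exI[of _ ?B]) auto
  qed
qed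

section \<open>The strong topology\<close>

lemma lcs_half_neighbourhood:
  assumes Y: "lcs Y" and N: "openin (topo Y) N" "\<zero>\<^bsub>Y\<^esub> \<in> N"
  obtains N' where "openin (topo Y) N'" "\<zero>\<^bsub>Y\<^esub> \<in> N'" "\<And>a b. a \<in> N' \<Longrightarrow> b \<in> N' \<Longrightarrow> a \<oplus>\<^bsub>Y\<^esub> b \<in> N"
proof -
  interpret Y: Module.module "\<complex>\<^sub>R" Y by (rule lcs_module[OF Y])
  have "openin (prod_topology (topo Y) (topo Y)) {z \<in> topspace (prod_topology (topo Y) (topo Y)). (case z of (x, y) \<Rightarrow> x \<oplus>\<^bsub>Y\<^esub> y) \<in> N}"
    by (rule openin_continuous_map_preimage[OF lcs_add[OF Y] N(1)])
  moreover have "(\<zero>\<^bsub>Y\<^esub>, \<zero>\<^bsub>Y\<^esub>) \<in> {z \<in> topspace (prod_topology (topo Y) (topo Y)). (case z of (x, y) \<Rightarrow> x \<oplus>\<^bsub>Y\<^esub> y) \<in> N}"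
    using N by (simp add: lcs_topspace[OF Y])
  ultimately obtain U V where UV: "openin (topo Y) U" "openin (topo Y) V" "\<zero>\<^bsub>Y\<^esub> \<in> U" "\<zero>\<^bsub>Y\<^esub> \<in> V"
    "U \<times> V \<subseteq> {z \<in> topspace (prod_topology (topo Y) (topo Y)). (case z of (x, y) \<Rightarrow> x \<oplus>\<^bsub>Y\<^esub> y) \<in> N}"
    unfolding openin_prod_topology_alt by meson
  show thesis
    by (rule that[of "U \<inter> V"]) (use UV in auto)
qed

text \<open>The neighbourhood is halved once for each summand, so its size depends on the index set
  and not on the summands. This uniformity is what a topology of uniform convergence calls
  for.\<close>

lemma lcs_finsum_neighbourhood:
  assumes Y: "lcs Y" and N: "openin (topo Y) N" "\<zero>\<^bsub>Y\<^esub> \<in> N" and A: "finite A"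
  obtains N' where "openin (topo Y) N'" "\<zero>\<^bsub>Y\<^esub> \<in> N'"
    "\<And>f. (\<And>i. i \<in> A \<Longrightarrow> f i \<in> N') \<Longrightarrow> finsum Y f A \<in> N"
proof -
  interpret Y: Module.module "\<complex>\<^sub>R" Y by (rule lcs_module[OF Y])
  have "\<exists>N'. openin (topo Y) N' \<and> \<zero>\<^bsub>Y\<^esub> \<in> N' \<and> (\<forall>f. (\<forall>i\<in>A. f i \<in> N') \<longrightarrow> finsum Y f A \<in> N)"
    using A N
  proof (induction A arbitrary: N)
    case (insert i A)
    obtain N1 where N1: "openin (topo Y) N1" "\<zero>\<^bsub>Y\<^esub> \<in> N1" "\<And>a b. a \<in> N1 \<Longrightarrow> b \<in> N1 \<Longrightarrow> a \<oplus>\<^bsub>Y\<^esub> b \<in> N"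
      using lcs_half_neighbourhood[OF Y insert.prems] by blast
    obtain N2 where N2: "openin (topo Y) N2" "\<zero>\<^bsub>Y\<^esub> \<in> N2" "\<forall>f. (\<forall>i\<in>A. f i \<in> N2) \<longrightarrow> finsum Y f A \<in> N1"
      using insert.IH[OF N1(1,2)] by blast
    have "finsum Y f (insert i A) \<in> N" if f: "\<forall>j\<in>insert i A. f j \<in> N1 \<inter> N2" for f
    proof -
      have "f \<in> insert i A \<rightarrow> carrier Y"
        using f openin_subset[OF N1(1)] lcs_topspace[OF Y] by auto
      then have "finsum Y f (insert i A) = f i \<oplus>\<^bsub>Y\<^esub> finsum Y f A"
        using insert.hyps by (intro Y.finsum_insert) auto
      then show ?thesis using f N1(3) N2(3) by simp
    qed
    then show ?case using N1 N2 by (intro exI[of _ "N1 \<inter> N2"]) auto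
  qed auto
  then show thesis using that by blast
qed

lemma continuous_map_finsum:
  assumes Y: "lcs Y" and A: "finite A" and f: "\<And>i. i \<in> A \<Longrightarrow> continuous_map X (topo Y) (f i)"
  shows "continuous_map X (topo Y) (\<lambda>x. finsum Y (\<lambda>i. f i x) A)"
proof -
  interpret Y: Module.module "\<complex>\<^sub>R" Y by (rule lcs_module[OF Y])
  show ?thesis
    using A f
  proof (induction A)
    case (insert i A)
    have "continuous_map X (topo Y) (\<lambda>x. f i x \<oplus>\<^bsub>Y\<^esub> finsum Y (\<lambda>i. f i x) A)"
      using insert by (intro continuous_map_lcs_add[OF Y]) auto
    moreover have "f j x \<in> carrier Y" if "x \<in> topspace X" "j \<in> insert i A" for x j
      using insert.prems[OF that(2)] that(1) lcs_topspace[OF Y] by (auto simp: continuous_map_def)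
    ultimately show ?case
      using insert.hyps by (elim continuous_map_eq) (subst Y.finsum_insert; auto)
  qed (simp add: lcs_topspace[OF Y])
qed

lemma openin_translate:
  assumes Y: "lcs Y" and "openin (topo Y) A" "y \<in> carrier Y"
  shows "openin (topo Y) {z \<in> carrier Y. z \<oplus>\<^bsub>Y\<^esub> y \<in> A}"
proof -
  have "continuous_map (topo Y) (topo Y) (\<lambda>z. z \<oplus>\<^bsub>Y\<^esub> y)"
    by (intro continuous_map_lcs_add[OF Y]) (use assms(3) lcs_topspace[OF Y] in auto)
  from openin_continuous_map_preimage[OF this assms(2)] show ?thesis
    by (simp add: lcs_topspace[OF Y])
qed

lemma topspace_strong_topology:
  assumes "lcs Y"
  shows "topspace (strong_topology X Y) = continuous_linear_maps X Y"
proof -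
  interpret Y: Module.module "\<complex>\<^sub>R" Y by (rule lcs_module[OF assms])
  have "bounded_in X {}" by (auto simp: bounded_in_def intro!: exI[of _ 1])
  moreover have "openin (topo Y) (carrier Y)" using lcs_topspace[OF assms] openin_topspace by metis
  ultimately have "openin (strong_topology X Y) (continuous_linear_maps X Y)"
    unfolding openin_strong_topology using Y.zero_closed by blast
  then show ?thesis
    using openin_subset openin_topspace[of "strong_topology X Y", unfolded openin_strong_topology, THEN conjunct1]
    by blast
qed

lemma continuous_linear_mapsD:
  assumes "f \<in> continuous_linear_maps X Y"
  shows continuous_linear_maps_linear: "linear_in X Y f"
    and continuous_linear_maps_continuous: "continuous_map (topo X) (topo Y) f"
    and continuous_linear_maps_extensional: "f \<in> extensional (carrier X)"
  using assms by (auto simp: continuous_linear_maps_def)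

text \<open>The maps within \<open>N\<close> of \<open>f\<close> on all of \<open>B\<close> need not
  form an open set, since along an infinite \<open>B\<close> the differences may approach the
  complement of \<open>N\<close>. The open set \<open>V\<close> is the interior: the maps around
  which some basic set stays inside.\<close>

lemma strong_neighbourhood:
  assumes Y: "lcs Y" and f: "f \<in> continuous_linear_maps X Y" and B: "bounded_in X B"
    and N: "openin (topo Y) N" "\<zero>\<^bsub>Y\<^esub> \<in> N"
  shows "\<exists>V. openin (strong_topology X Y) V \<and> f \<in> V \<and> (\<forall>g\<in>V. \<forall>x\<in>B. g x \<ominus>\<^bsub>Y\<^esub> f x \<in> N)"
proof -
  interpret Y: Module.module "\<complex>\<^sub>R" Y by (rule lcs_module[OF Y])
  have cl: "h x \<in> carrier Y" if "h \<in> continuous_linear_maps X Y" "bounded_in X B" "x \<in> B" for h x B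
    using that linear_in_closed[OF continuous_linear_maps_linear[OF that(1)]] by (auto simp: bounded_in_def)
  let ?b = "\<lambda>g B N. {h \<in> continuous_linear_maps X Y. \<forall>x\<in>B. h x \<ominus>\<^bsub>Y\<^esub> g x \<in> N}"
  define V where "V = {g \<in> continuous_linear_maps X Y. \<exists>B' N'. bounded_in X B' \<and> openin (topo Y) N' \<and> \<zero>\<^bsub>Y\<^esub> \<in> N' \<and>
    ?b g B' N' \<subseteq> ?b f B N}"
  have "openin (strong_topology X Y) V"
    unfolding openin_strong_topology
  proof (intro conjI ballI)
    fix g assume "g \<in> V"
    then obtain B' N' where g: "g \<in> continuous_linear_maps X Y" and B': "bounded_in X B'"
        "openin (topo Y) N'" "\<zero>\<^bsub>Y\<^esub> \<in> N'" "?b g B' N' \<subseteq> ?b f B N"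
      unfolding V_def by blast
    obtain M where M: "openin (topo Y) M" "\<zero>\<^bsub>Y\<^esub> \<in> M" "\<And>a b. a \<in> M \<Longrightarrow> b \<in> M \<Longrightarrow> a \<oplus>\<^bsub>Y\<^esub> b \<in> N'"
      using lcs_half_neighbourhood[OF Y B'(2,3)] by blast
    \<comment> \<open>Two differences in \<open>M\<close> add up to one in \<open>N'\<close>, so the
      same bounded set together with the halved neighbourhood \<open>M\<close> witnesses openness at
      \<open>g\<close>.\<close>
    have "?b h B' M \<subseteq> ?b g B' N'" if h: "h \<in> ?b g B' M" for h
    proof
      fix k assume k: "k \<in> ?b h B' M"
      have "k x \<ominus>\<^bsub>Y\<^esub> g x \<in> N'" if x: "x \<in> B'" for x
      proof -
        have "k x \<in> carrier Y" "h x \<in> carrier Y" "g x \<in> carrier Y"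
          using cl[OF _ B'(1) x] k h g by auto
        then have "k x \<ominus>\<^bsub>Y\<^esub> g x = (k x \<ominus>\<^bsub>Y\<^esub> h x) \<oplus>\<^bsub>Y\<^esub> (h x \<ominus>\<^bsub>Y\<^esub> g x)"
          by (simp add: Y.minus_eq Y.a_assoc Y.r_neg1)
        then show ?thesis using M(3) k h x by simp
      qed
      then show "k \<in> ?b g B' N'" using k by simp
    qed
    note sub = this
    have "?b g B' M \<subseteq> V"
    proof
      fix h assume h: "h \<in> ?b g B' M"
      have "?b h B' M \<subseteq> ?b f B N" using sub[OF h] B'(4) by (rule subset_trans)
      then show "h \<in> V" unfolding V_def
        using h B'(1) M(1,2) by (intro CollectI conjI exI[of _ B'] exI[of _ M]) simp_all
    qed
    then show "\<exists>B N. bounded_in X B \<and> openin (topo Y) N \<and> \<zero>\<^bsub>Y\<^esub> \<in> N \<and> ?b g B N \<subseteq> V"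
      using B'(1) M(1,2) by blast
  qed (auto simp: V_def)
  moreover have "f \<in> V"
    unfolding V_def using f B N by (intro CollectI conjI exI[of _ B] exI[of _ N]) simp_all
  moreover have "\<forall>x\<in>B. g x \<ominus>\<^bsub>Y\<^esub> f x \<in> N" if "g \<in> V" for g
  proof -
    obtain B' N' where g: "g \<in> continuous_linear_maps X Y" and B': "bounded_in X B'"
        "openin (topo Y) N'" "\<zero>\<^bsub>Y\<^esub> \<in> N'" "?b g B' N' \<subseteq> ?b f B N"
      using \<open>g \<in> V\<close> unfolding V_def by blast
    have "g \<in> ?b g B' N'"
      using g B'(3) cl[OF g B'(1)] by (simp add: Y.minus_eq Y.r_neg)
    then show ?thesis using B'(4) by blast
  qed
  ultimately show ?thesis by blast
qed

lemma continuous_map_into_strong_topology: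
  assumes Y: "lcs Y" and F: "F \<in> topspace Z \<rightarrow> continuous_linear_maps X Y"
    and *: "\<And>z B N. z \<in> topspace Z \<Longrightarrow> bounded_in X B \<Longrightarrow> openin (topo Y) N \<Longrightarrow> \<zero>\<^bsub>Y\<^esub> \<in> N \<Longrightarrow>
      \<exists>V. openin Z V \<and> z \<in> V \<and> (\<forall>w\<in>V. \<forall>x\<in>B. F w x \<ominus>\<^bsub>Y\<^esub> F z x \<in> N)"
  shows "continuous_map Z (strong_topology X Y) F"
  unfolding continuous_map_def
proof (intro conjI allI impI)
  show "F \<in> topspace Z \<rightarrow> topspace (strong_topology X Y)" by (subst topspace_strong_topology[OF Y]) (rule F)
  fix S assume S: "openin (strong_topology X Y) S"
  show "openin Z {z \<in> topspace Z. F z \<in> S}"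
  proof (subst openin_subopen, intro ballI)
    fix z assume z: "z \<in> {z \<in> topspace Z. F z \<in> S}"
    then obtain B N where B: "bounded_in X B" "openin (topo Y) N" "\<zero>\<^bsub>Y\<^esub> \<in> N"
        "{g \<in> continuous_linear_maps X Y. \<forall>x\<in>B. g x \<ominus>\<^bsub>Y\<^esub> F z x \<in> N} \<subseteq> S"
      using S unfolding openin_strong_topology by blast
    then obtain V where V: "openin Z V" "z \<in> V" "\<forall>w\<in>V. \<forall>x\<in>B. F w x \<ominus>\<^bsub>Y\<^esub> F z x \<in> N"
      using *[of z B N] z by blast
    have "V \<subseteq> {z \<in> topspace Z. F z \<in> S}"
      using V(3) B(4) F openin_subset[OF V(1)] by blast
    then show "\<exists>V. openin Z V \<and> z \<in> V \<and> V \<subseteq> {z \<in> topspace Z. F z \<in> S}" using V by blast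
  qed
qed

text \<open>Single points are bounded sets, so the strong topology refines pointwise convergence.
  This lets it inherit the Hausdorff property from \<open>Y\<close>.\<close>

lemma continuous_map_eval_strong_topology:
  assumes X: "lcs X" and Y: "lcs Y" and x: "x \<in> carrier X"
  shows "continuous_map (strong_topology X Y) (topo Y) (\<lambda>f. f x)"
  unfolding continuous_map_def
proof (intro conjI allI impI)
  interpret Y: Module.module "\<complex>\<^sub>R" Y by (rule lcs_module[OF Y])
  have cl: "f x \<in> carrier Y" if "f \<in> continuous_linear_maps X Y" for f
    using linear_in_closed[OF continuous_linear_maps_linear[OF that] x] .
  then show "(\<lambda>f. f x) \<in> topspace (strong_topology X Y) \<rightarrow> topspace (topo Y)"
    using topspace_strong_topology[OF Y] lcs_topspace[OF Y] by auto
  fix S assume S: "openin (topo Y) S"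
  show "openin (strong_topology X Y) {f \<in> topspace (strong_topology X Y). f x \<in> S}"
    unfolding openin_strong_topology topspace_strong_topology[OF Y]
  proof (intro conjI ballI)
    fix f assume f: "f \<in> {f \<in> continuous_linear_maps X Y. f x \<in> S}"
    let ?N = "{z \<in> carrier Y. z \<oplus>\<^bsub>Y\<^esub> f x \<in> S}"
    have "openin (topo Y) ?N" using openin_translate[OF Y S] cl f by blast
    moreover have "\<zero>\<^bsub>Y\<^esub> \<in> ?N" using f cl by simp
    moreover have "g x \<in> S" if "g \<in> continuous_linear_maps X Y" "g x \<ominus>\<^bsub>Y\<^esub> f x \<in> ?N" for g
    proof -
      have "g x \<ominus>\<^bsub>Y\<^esub> f x \<oplus>\<^bsub>Y\<^esub> f x = g x"
        using that(1) f cl[of g] cl[of f] by (simp add: Y.minus_eq Y.a_assoc Y.l_neg)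
      then show ?thesis using that(2) by simp
    qed
    ultimately show "\<exists>B N. bounded_in X B \<and> openin (topo Y) N \<and> \<zero>\<^bsub>Y\<^esub> \<in> N \<and>
        {g \<in> continuous_linear_maps X Y. \<forall>x\<in>B. g x \<ominus>\<^bsub>Y\<^esub> f x \<in> N} \<subseteq> {f \<in> continuous_linear_maps X Y. f x \<in> S}"
      using bounded_in_singleton[OF X x] by (intro exI[of _ "{x}"] exI[of _ ?N]) auto
  qed auto
qed

lemma Hausdorff_strong_topology:
  assumes X: "lcs X" and Y: "lcs Y" and H: "Hausdorff_space (topo Y)"
  shows "Hausdorff_space (strong_topology X Y)"
  unfolding Hausdorff_space_def
proof (intro allI impI)
  fix f g assume fg: "f \<in> topspace (strong_topology X Y) \<and> g \<in> topspace (strong_topology X Y) \<and> f \<noteq> g"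
  then have f: "f \<in> continuous_linear_maps X Y" and g: "g \<in> continuous_linear_maps X Y"
    using topspace_strong_topology[OF Y] by auto
  obtain x where x: "x \<in> carrier X" "f x \<noteq> g x"
    using fg extensionalityI[OF continuous_linear_maps_extensional[OF f] continuous_linear_maps_extensional[OF g]] by blast
  have "f x \<in> topspace (topo Y)" "g x \<in> topspace (topo Y)"
    using linear_in_closed[OF continuous_linear_maps_linear[OF f] x(1)]
      linear_in_closed[OF continuous_linear_maps_linear[OF g] x(1)] lcs_topspace[OF Y] by auto
  then obtain A B where AB: "openin (topo Y) A" "openin (topo Y) B" "f x \<in> A" "g x \<in> B" "disjnt A B"
    using H x(2) unfolding Hausdorff_space_def by metis
  note ev = openin_continuous_map_preimage[OF continuous_map_eval_strong_topology[OF X Y x(1)]]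
  show "\<exists>U V. openin (strong_topology X Y) U \<and> openin (strong_topology X Y) V \<and> f \<in> U \<and> g \<in> V \<and> disjnt U V"
    using ev[OF AB(1)] ev[OF AB(2)] AB(3-5) fg
    by (intro exI[of _ "{h \<in> topspace (strong_topology X Y). h x \<in> A}"]
        exI[of _ "{h \<in> topspace (strong_topology X Y). h x \<in> B}"]) (auto simp: disjnt_iff)
qed

lemma precompose_continuous_linear:
  assumes X: "lcs X" and m: "linear_in X Y m" "continuous_map (topo X) (topo Y) m"
    and \<eta>: "\<eta> \<in> continuous_linear_maps Y E"
  shows "restrict (\<eta> \<circ> m) (carrier X) \<in> continuous_linear_maps X E"
proof -
  interpret X: Module.module "\<complex>\<^sub>R" X by (rule lcs_module[OF X])
  have "linear_in X E (restrict (\<eta> \<circ> m) (carrier X))"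
    using linear_in_compose[OF m(1) continuous_linear_maps_linear[OF \<eta>]]
    by (auto simp: linear_in_def)
  moreover have "continuous_map (topo X) (topo E) (restrict (\<eta> \<circ> m) (carrier X))"
    by (rule continuous_map_eq[OF continuous_map_compose[OF m(2) continuous_linear_maps_continuous[OF \<eta>]]])
       (simp add: lcs_topspace[OF X])
  ultimately show ?thesis by (simp add: continuous_linear_maps_def)
qed

text \<open>Continuous linear maps preserve boundedness, so closeness on \<open>B\<close> after
  composition follows from closeness on the image of \<open>B\<close>.\<close>

lemma continuous_map_precompose:
  assumes X: "lcs X" and Y: "lcs Y" and E: "lcs E" and m: "linear_in X Y m" "continuous_map (topo X) (topo Y) m"
  shows "continuous_map (strong_topology Y E) (strong_topology X E) (\<lambda>\<eta>. restrict (\<eta> \<circ> m) (carrier X))"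
proof (rule continuous_map_into_strong_topology[OF E])
  show "(\<lambda>\<eta>. restrict (\<eta> \<circ> m) (carrier X)) \<in> topspace (strong_topology Y E) \<rightarrow> continuous_linear_maps X E"
    using precompose_continuous_linear[OF X m] topspace_strong_topology[OF E] by auto
  fix \<eta> B N assume \<eta>: "\<eta> \<in> topspace (strong_topology Y E)" and B: "bounded_in X B"
    and N: "openin (topo E) N" "\<zero>\<^bsub>E\<^esub> \<in> N"
  have "B \<subseteq> carrier X" using B by (simp add: bounded_in_def)
  moreover obtain V where "openin (strong_topology Y E) V" "\<eta> \<in> V" "\<forall>g\<in>V. \<forall>x\<in>m ` B. g x \<ominus>\<^bsub>E\<^esub> \<eta> x \<in> N"
    using strong_neighbourhood[OF E _ bounded_in_image[OF X Y m B] N, of \<eta>] \<eta> topspace_strong_topology[OF E] by blast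
  ultimately show "\<exists>V. openin (strong_topology Y E) V \<and> \<eta> \<in> V \<and>
      (\<forall>\<omega>\<in>V. \<forall>x\<in>B. restrict (\<omega> \<circ> m) (carrier X) x \<ominus>\<^bsub>E\<^esub> restrict (\<eta> \<circ> m) (carrier X) x \<in> N)"
    by (intro exI[of _ V]) auto
qed

section \<open>Sheaves\<close>

lemma locally_finite_in_compactin:
  assumes "locally_finite_in X \<A>" "compactin X K"
  shows "finite {A \<in> \<A>. A \<inter> K \<noteq> {}}"
proof -
  have K: "K \<subseteq> topspace X" using assms(2) by (rule compactin_subset_topspace)
  have "\<exists>V. openin X V \<and> x \<in> V \<and> finite {A \<in> \<A>. A \<inter> V \<noteq> {}}" if "x \<in> K" for x
    by (rule assms(1)[unfolded locally_finite_in_def, THEN conjunct2, rule_format]) (rule subsetD[OF K that])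
  then obtain V where V: "\<And>x. x \<in> K \<Longrightarrow> openin X (V x) \<and> x \<in> V x \<and> finite {A \<in> \<A>. A \<inter> V x \<noteq> {}}"
    by metis
  then have "(\<forall>U\<in>V ` K. openin X U) \<and> K \<subseteq> \<Union>(V ` K)" by blast
  then have "\<exists>\<F>. finite \<F> \<and> \<F> \<subseteq> V ` K \<and> K \<subseteq> \<Union>\<F>"
    using assms(2) unfolding compactin_def by blast
  then obtain S where S: "finite S" "S \<subseteq> K" "K \<subseteq> \<Union>(V ` S)"
    by (metis finite_subset_image)
  have "{A \<in> \<A>. A \<inter> K \<noteq> {}} \<subseteq> (\<Union>x\<in>S. {A \<in> \<A>. A \<inter> V x \<noteq> {}})" using S(3) by blast
  then show ?thesis by (rule finite_subset) (use S V in blast)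
qed

context
  fixes T :: "'p topology" and P :: "('p, 'k, 's) presheaf"
  assumes P: "set_sheaf T P"
begin

lemma set_sheaf_presheaf: "set_presheaf T P"
  using P unfolding set_sheaf_def by (rule conjunct1)

lemma sheaf_res_closed:
  "openin T U \<Longrightarrow> openin T V \<Longrightarrow> V \<subseteq> U \<Longrightarrow> s \<in> carrier (sec P U) \<Longrightarrow> res P U V s \<in> carrier (sec P V)"
  using set_sheaf_presheaf[unfolded set_presheaf_def, THEN conjunct1] by blast

lemma sheaf_res_id: "openin T U \<Longrightarrow> s \<in> carrier (sec P U) \<Longrightarrow> res P U U s = s"
  using set_sheaf_presheaf[unfolded set_presheaf_def, THEN conjunct2, THEN conjunct1] by blast

lemma sheaf_res_res:
  "openin T U \<Longrightarrow> openin T V \<Longrightarrow> openin T W \<Longrightarrow> V \<subseteq> U \<Longrightarrow> W \<subseteq> V \<Longrightarrow> s \<in> carrier (sec P U) \<Longrightarrow>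
    res P V W (res P U V s) = res P U W s"
  using set_sheaf_presheaf[unfolded set_presheaf_def, THEN conjunct2, THEN conjunct2, rule_format, of U V W s] by blast

lemma sheaf_glue:
  assumes "\<And>V. V \<in> \<U> \<Longrightarrow> openin T V" "\<And>V. V \<in> \<U> \<Longrightarrow> s V \<in> carrier (sec P V)"
    "\<And>V W. V \<in> \<U> \<Longrightarrow> W \<in> \<U> \<Longrightarrow> res P V (V \<inter> W) (s V) = res P W (V \<inter> W) (s W)"
  shows "\<exists>!t. t \<in> carrier (sec P (\<Union>\<U>)) \<and> (\<forall>V\<in>\<U>. res P (\<Union>\<U>) V t = s V)"
proof -
  have "(\<forall>V\<in>\<U>. openin T V \<and> s V \<in> carrier (sec P V)) \<and>
        (\<forall>V\<in>\<U>. \<forall>W\<in>\<U>. res P V (V \<inter> W) (s V) = res P W (V \<inter> W) (s W))"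
    by (intro conjI ballI; rule assms; assumption)
  then show ?thesis
    using P[unfolded set_sheaf_def, THEN conjunct2, rule_format, of \<U> s] by blast
qed

lemma sheaf_eqI_cover:
  assumes "\<And>V. V \<in> \<U> \<Longrightarrow> openin T V" "s \<in> carrier (sec P (\<Union>\<U>))" "t \<in> carrier (sec P (\<Union>\<U>))"
    "\<And>V. V \<in> \<U> \<Longrightarrow> res P (\<Union>\<U>) V s = res P (\<Union>\<U>) V t"
  shows "s = t"
proof -
  have U: "openin T (\<Union>\<U>)" using assms(1) by blast
  have "\<exists>!t. t \<in> carrier (sec P (\<Union>\<U>)) \<and> (\<forall>V\<in>\<U>. res P (\<Union>\<U>) V t = res P (\<Union>\<U>) V s)"
  proof (rule sheaf_glue[OF assms(1)])
    fix V W assume VW: "V \<in> \<U>" "W \<in> \<U>"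
    then have "openin T (V \<inter> W)" using assms(1) by blast
    then show "res P V (V \<inter> W) (res P (\<Union>\<U>) V s) = res P W (V \<inter> W) (res P (\<Union>\<U>) W s)"
      using VW assms(1,2) U sheaf_res_res[of "\<Union>\<U>" V "V \<inter> W" s] sheaf_res_res[of "\<Union>\<U>" W "V \<inter> W" s]
      by (metis Union_upper inf_le1 inf_le2)
  qed (use assms U sheaf_res_closed in \<open>auto simp: Union_upper\<close>)
  then show ?thesis using assms by metis
qed

lemma sheaf_eqI:
  assumes U: "openin T U" and "s \<in> carrier (sec P U)" "t \<in> carrier (sec P U)"
    "\<And>a. a \<in> U \<Longrightarrow> \<exists>V. openin T V \<and> a \<in> V \<and> V \<subseteq> U \<and> res P U V s = res P U V t"
  shows "s = t"
proof -
  let ?\<U> = "{V. openin T V \<and> V \<subseteq> U \<and> res P U V s = res P U V t}"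
  have eq: "\<Union>?\<U> = U" using assms(4) by blast
  show ?thesis
    by (rule sheaf_eqI_cover[of ?\<U>]) (use assms(2,3) in \<open>auto simp: eq\<close>)
qed

lemma sheaf_eqI_Un:
  assumes "openin T A" "openin T B" "s \<in> carrier (sec P (A \<union> B))" "t \<in> carrier (sec P (A \<union> B))"
    "res P (A \<union> B) A s = res P (A \<union> B) A t" "res P (A \<union> B) B s = res P (A \<union> B) B t"
  shows "s = t"
  by (rule sheaf_eqI_cover[of "{A, B}"]) (use assms in auto)

text \<open>The empty family covers the empty set, and gluing over it is unique.\<close>

lemma sheaf_sec_empty_eq: "s \<in> carrier (sec P {}) \<Longrightarrow> t \<in> carrier (sec P {}) \<Longrightarrow> s = t"
  using sheaf_eqI_cover[of "{}" s t] by simp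

lemma sheaf_glue_Un:
  assumes A: "openin T A" and B: "openin T B" and s: "s \<in> carrier (sec P A)" and t: "t \<in> carrier (sec P B)"
    and st: "res P A (A \<inter> B) s = res P B (A \<inter> B) t"
  obtains w where "w \<in> carrier (sec P (A \<union> B))" "res P (A \<union> B) A w = s" "res P (A \<union> B) B w = t"
proof -
  \<comment> \<open>The two sections are encoded as one function on the cover {A, B}, so A = B must
    be compatible with this: then the overlap condition forces s = t.\<close>
  have eq: "A = B \<Longrightarrow> s = t" using assms sheaf_res_id by force
  let ?f = "\<lambda>V. if V = A then s else t"
  have "\<exists>!w. w \<in> carrier (sec P (\<Union>{A, B})) \<and> (\<forall>V\<in>{A, B}. res P (\<Union>{A, B}) V w = ?f V)"
    by (rule sheaf_glue) (use A B s t st eq in \<open>auto simp: Int_commute\<close>)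
  then obtain w where w: "w \<in> carrier (sec P (A \<union> B))" "\<forall>V\<in>{A, B}. res P (A \<union> B) V w = ?f V" by auto
  show thesis by (rule that[OF w(1)]) (use w(2) eq in auto)
qed

end

section \<open>Telescoping products in commutative rings\<close>

lemma (in cring) telescope_step:
  assumes "a \<in> carrier R" "p \<in> carrier R" "s \<in> carrier R"
  shows "(a \<otimes> p \<oplus> s) \<oplus> (\<one> \<ominus> a) \<otimes> p = s \<oplus> p"
proof -
  have "(\<one> \<ominus> a) \<otimes> p = p \<oplus> \<ominus> (a \<otimes> p)"
    using assms by (simp add: minus_eq l_distr l_minus)
  moreover have "(a \<otimes> p \<oplus> s) \<oplus> (p \<oplus> \<ominus> (a \<otimes> p)) = (a \<otimes> p \<oplus> \<ominus> (a \<otimes> p)) \<oplus> (s \<oplus> p)"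
    using assms by (simp add: a_ac)
  ultimately show ?thesis using assms by (simp add: r_neg)
qed

text \<open>Remove the greatest index m of \<open>J\<close>: its own summand is f(m) times the
  product over all the others, and no other summand involves m. Adding the new remainder restores
  the identity for the smaller set. The order is a relation on the index type because the indices
  will be sets of points, which carry no linear order of their own.\<close>

lemma (in cring) telescope_finprod:
  assumes J: "finite J" and r: "linear_order r" and f: "f \<in> J \<rightarrow> carrier R"
  shows "finsum R (\<lambda>j. f j \<otimes> finprod R (\<lambda>i. \<one> \<ominus> f i) {i \<in> J. (i, j) \<in> r \<and> i \<noteq> j}) J \<oplus>
    finprod R (\<lambda>i. \<one> \<ominus> f i) J = \<one>"
  using J f
proof (induction J rule: finite_psubset_induct)
  case (psubset J)
  have r': "refl r" "trans r" "antisym r" "total r"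
    using r by (auto simp: linear_order_on_def partial_order_on_def preorder_on_def)
  have tot: "(x, y) \<in> r \<or> (y, x) \<in> r" for x y
    using r'(1,4) by (cases "x = y") (auto simp: total_on_def dest: refl_onD)
  show ?case
  proof (cases "J = {}")
    case False
    have "\<exists>m\<in>J. \<forall>x\<in>J. (x, m) \<in> r"
      using psubset.hyps False
    proof (induction J rule: finite_ne_induct)
      case (singleton x)
      then show ?case using r'(1) by (auto dest: refl_onD)
    next
      case (insert x A)
      then obtain m where m: "m \<in> A" "\<forall>x\<in>A. (x, m) \<in> r" by blast
      show ?case
      proof (cases "(x, m) \<in> r")
        case False
        then have "(m, x) \<in> r" using tot by blast
        then have "(y, x) \<in> r" if "y \<in> insert x A" for y
          using m(2) that r'(1,2) by (metis UNIV_I insertE refl_onD transD)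
        then show ?thesis by blast
      qed (use m in blast)
    qed
    then obtain m where m: "m \<in> J" "\<And>x. x \<in> J \<Longrightarrow> (x, m) \<in> r" by blast
    let ?K = "J - {m}"
    have K: "finite ?K" "m \<notin> ?K" "J = insert m ?K" using psubset.hyps m by auto
    have fc: "f i \<in> carrier R" if "i \<in> J" for i using psubset.prems that by auto
    have fp: "(\<lambda>i. \<one> \<ominus> f i) \<in> A \<rightarrow> carrier R" if "A \<subseteq> J" for A using fc that by auto
    let ?t = "\<lambda>J j. f j \<otimes> finprod R (\<lambda>i. \<one> \<ominus> f i) {i \<in> J. (i, j) \<in> r \<and> i \<noteq> j}"
    have tc: "?t J j \<in> carrier R" if "j \<in> J" for j
      using fc[OF that] fp[of "{i \<in> J. (i, j) \<in> r \<and> i \<noteq> j}"] by (intro m_closed finprod_closed) auto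
    \<comment> \<open>The greatest element precedes no other index, so it occurs in none of the
      remaining products.\<close>
    have "{i \<in> J. (i, j) \<in> r \<and> i \<noteq> j} = {i \<in> ?K. (i, j) \<in> r \<and> i \<noteq> j}" if "j \<in> ?K" for j
      using that m(2)[of j] r'(3) by (auto dest: antisymD)
    then have same: "?t J j = ?t ?K j" if "j \<in> ?K" for j using that by simp
    have last: "{i \<in> J. (i, m) \<in> r \<and> i \<noteq> m} = ?K" using m by auto
    have IH: "finsum R (?t ?K) ?K \<oplus> finprod R (\<lambda>i. \<one> \<ominus> f i) ?K = \<one>"
      using psubset.IH[of ?K] m(1) psubset.prems by auto
    let ?p = "finprod R (\<lambda>i. \<one> \<ominus> f i) ?K" and ?s = "finsum R (?t ?K) ?K"
    have pc: "?p \<in> carrier R" by (intro finprod_closed fp) auto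
    have tK: "?t ?K j \<in> carrier R" if "j \<in> ?K" for j
      unfolding same[OF that, symmetric] by (rule tc) (use that in simp)
    have sc: "?s \<in> carrier R" by (intro finsum_closed Pi_I tK)
    have "finsum R (?t J) J = finsum R (?t J) (insert m ?K)" using K(3) by simp
    also have "\<dots> = ?t J m \<oplus> finsum R (?t J) ?K"
      by (rule finsum_insert[OF K(1,2)]) (use tc m(1) in \<open>blast+\<close>)
    also have "finsum R (?t J) ?K = ?s"
      by (rule finsum_cong'[OF refl]) (use tK same in \<open>blast+\<close>)
    finally have 1: "finsum R (?t J) J = f m \<otimes> ?p \<oplus> ?s" unfolding last .
    have "finprod R (\<lambda>i. \<one> \<ominus> f i) J = finprod R (\<lambda>i. \<one> \<ominus> f i) (insert m ?K)" using K(3) by simp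
    also have "\<dots> = (\<one> \<ominus> f m) \<otimes> ?p"
      using fp[of ?K] fc[OF m(1)] by (intro finprod_insert[OF K(1,2)]) auto
    finally have "finsum R (?t J) J \<oplus> finprod R (\<lambda>i. \<one> \<ominus> f i) J = (f m \<otimes> ?p \<oplus> ?s) \<oplus> (\<one> \<ominus> f m) \<otimes> ?p"
      using 1 by simp
    also have "\<dots> = ?s \<oplus> ?p"
      by (rule telescope_step[OF fc[OF m(1)] pc sc])
    finally show ?thesis using IH by simp
  qed simp
qed

section \<open>Cutoff sections of a sheaf of algebras\<close>

locale algebra_sheaf_space =
  fixes T :: "'p topology" and \<O> :: "('p, complex, 'a) presheaf"
  assumes algebra_sheaf: "algebra_sheaf T \<O>"
begin

lemma set_sheaf_O: "set_sheaf T \<O>"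
  using algebra_sheaf by (simp add: algebra_sheaf_def)

lemmas O_res_closed = sheaf_res_closed[OF set_sheaf_O]
  and O_res_id = sheaf_res_id[OF set_sheaf_O]
  and O_res_res = sheaf_res_res[OF set_sheaf_O]
  and O_eqI = sheaf_eqI[OF set_sheaf_O]

lemma O_algebra: "openin T U \<Longrightarrow> Module.algebra \<complex>\<^sub>R (sec \<O> U)"
  using algebra_sheaf by (simp add: algebra_sheaf_def)

lemma O_cring: "openin T U \<Longrightarrow> cring (sec \<O> U)"
  using O_algebra by (simp add: algebra_def)

lemma O_module: "openin T U \<Longrightarrow> Module.module \<complex>\<^sub>R (sec \<O> U)"
  using O_algebra by (simp add: algebra_def)

lemma O_res_hom: "openin T U \<Longrightarrow> openin T V \<Longrightarrow> V \<subseteq> U \<Longrightarrow> res \<O> U V \<in> ring_hom (sec \<O> U) (sec \<O> V)"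
  using algebra_sheaf unfolding algebra_sheaf_def by blast

lemma O_res_hom_cring: "openin T U \<Longrightarrow> openin T V \<Longrightarrow> V \<subseteq> U \<Longrightarrow> ring_hom_cring (sec \<O> U) (sec \<O> V) (res \<O> U V)"
  by (intro ring_hom_cring.intro ring_hom_cring_axioms.intro O_cring O_res_hom)

lemma O_res_smult:
  "openin T U \<Longrightarrow> openin T V \<Longrightarrow> V \<subseteq> U \<Longrightarrow> s \<in> carrier (sec \<O> U) \<Longrightarrow>
    res \<O> U V (c \<odot>\<^bsub>sec \<O> U\<^esub> s) = c \<odot>\<^bsub>sec \<O> V\<^esub> res \<O> U V s"
  using algebra_sheaf unfolding algebra_sheaf_def by blast

lemma O_res_one: "openin T U \<Longrightarrow> openin T V \<Longrightarrow> V \<subseteq> U \<Longrightarrow> res \<O> U V \<one>\<^bsub>sec \<O> U\<^esub> = \<one>\<^bsub>sec \<O> V\<^esub>"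
  by (rule ring_hom_one[OF O_res_hom])

lemma O_res_zero: "openin T U \<Longrightarrow> openin T V \<Longrightarrow> V \<subseteq> U \<Longrightarrow> res \<O> U V \<zero>\<^bsub>sec \<O> U\<^esub> = \<zero>\<^bsub>sec \<O> V\<^esub>"
  by (rule ring_hom_zero[OF O_res_hom]) (auto dest: O_cring cring.axioms(1))

lemma O_res_minus:
  assumes "openin T U" "openin T V" "V \<subseteq> U" "s \<in> carrier (sec \<O> U)" "t \<in> carrier (sec \<O> U)"
  shows "res \<O> U V (s \<ominus>\<^bsub>sec \<O> U\<^esub> t) = res \<O> U V s \<ominus>\<^bsub>sec \<O> V\<^esub> res \<O> U V t"
proof -
  interpret ring_hom_cring "sec \<O> U" "sec \<O> V" "res \<O> U V" by (rule O_res_hom_cring[OF assms(1-3)])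
  show ?thesis using assms by (simp add: a_minus_def)
qed

lemma openin_Diff_closedin: "closedin T Z \<Longrightarrow> openin T (topspace T - Z)"
  by blast

text \<open>The set \<open>Z\<close> is any closed set containing the support of \<open>f\<close>.
  Carrying it as a parameter avoids computing the supports of sums and products.\<close>

definition vanishes_off :: "'a \<Rightarrow> 'p set \<Rightarrow> bool" where
  "vanishes_off f Z \<longleftrightarrow> f \<in> carrier (sec \<O> (topspace T)) \<and> closedin T Z \<and>
    res \<O> (topspace T) (topspace T - Z) f = \<zero>\<^bsub>sec \<O> (topspace T - Z)\<^esub>"

lemma vanishes_offD:
  assumes "vanishes_off f Z"
  shows "f \<in> carrier (sec \<O> (topspace T))" "closedin T Z"
    "openin T W \<Longrightarrow> W \<inter> Z = {} \<Longrightarrow> res \<O> (topspace T) W f = \<zero>\<^bsub>sec \<O> W\<^esub>"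
proof -
  show f: "f \<in> carrier (sec \<O> (topspace T))" and Z: "closedin T Z"
    using assms by (auto simp: vanishes_off_def)
  assume W: "openin T W" "W \<inter> Z = {}"
  then have sub: "W \<subseteq> topspace T - Z" using openin_subset by blast
  have "res \<O> (topspace T) W f = res \<O> (topspace T - Z) W (res \<O> (topspace T) (topspace T - Z) f)"
    using sub W Z f by (intro O_res_res[symmetric]) auto
  also have "\<dots> = \<zero>\<^bsub>sec \<O> W\<^esub>"
    using assms sub W Z by (simp add: vanishes_off_def O_res_zero openin_Diff_closedin)
  finally show "res \<O> (topspace T) W f = \<zero>\<^bsub>sec \<O> W\<^esub>" .
qed

text \<open>The cutoff equals 1 on the open set \<open>G\<close>, and is not merely invertible
  there: a product containing its factor 1 - f then vanishes on \<open>G\<close>, which is what lets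
  a partition of unity be built by telescoping.\<close>

definition bump :: "'p set \<Rightarrow> 'p set \<Rightarrow> bool" where
  "bump G Z \<longleftrightarrow> openin T G \<and> (\<exists>f. vanishes_off f Z \<and> res \<O> (topspace T) G f = \<one>\<^bsub>sec \<O> G\<^esub>)"

lemma bump_mono:
  assumes b: "bump G Z" and G': "openin T G'" "G' \<subseteq> G"
  shows "bump G' Z"
proof -
  obtain f where f: "vanishes_off f Z" "res \<O> (topspace T) G f = \<one>\<^bsub>sec \<O> G\<^esub>" and G: "openin T G"
    using b by (auto simp: bump_def)
  have "res \<O> (topspace T) G' f = res \<O> G G' (res \<O> (topspace T) G f)"
    using G G' vanishes_offD(1)[OF f(1)] by (intro O_res_res[symmetric]) (auto dest: openin_subset)
  then show ?thesis using f G G' unfolding bump_def by (metis O_res_one)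
qed

lemma bump_empty: "bump {} {}"
proof -
  interpret cring "sec \<O> (topspace T)" by (rule O_cring) simp
  interpret E: cring "sec \<O> {}" by (rule O_cring) simp
  have "vanishes_off \<zero>\<^bsub>sec \<O> (topspace T)\<^esub> {}"
    by (simp add: vanishes_off_def O_res_zero)
  moreover have "res \<O> (topspace T) {} \<zero>\<^bsub>sec \<O> (topspace T)\<^esub> = \<one>\<^bsub>sec \<O> {}\<^esub>"
    by (rule sheaf_sec_empty_eq[OF set_sheaf_O]) (auto intro: O_res_closed)
  ultimately show ?thesis by (auto simp: bump_def)
qed

text \<open>The section f + f' - f f' equals 1 - (1 - f)(1 - f'), hence is 1 wherever one of the two
  cutoffs is 1, and it vanishes where both vanish.\<close>

lemma bump_Un:
  assumes "bump G Z" "bump G' Z'"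
  shows "bump (G \<union> G') (Z \<union> Z')"
proof -
  let ?M = "topspace T"
  obtain f f' where G: "openin T G" "openin T G'" and f: "vanishes_off f Z" "vanishes_off f' Z'"
      and f1: "res \<O> ?M G f = \<one>\<^bsub>sec \<O> G\<^esub>" "res \<O> ?M G' f' = \<one>\<^bsub>sec \<O> G'\<^esub>"
    using assms by (auto simp: bump_def)
  interpret M: cring "sec \<O> ?M" by (rule O_cring) simp
  have fc: "f \<in> carrier (sec \<O> ?M)" "f' \<in> carrier (sec \<O> ?M)" using f vanishes_offD(1) by auto
  let ?g = "f \<oplus>\<^bsub>sec \<O> ?M\<^esub> f' \<ominus>\<^bsub>sec \<O> ?M\<^esub> f \<otimes>\<^bsub>sec \<O> ?M\<^esub> f'"
  have gc: "?g \<in> carrier (sec \<O> ?M)" using fc by simp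
  have res_g: "res \<O> ?M W ?g = res \<O> ?M W f \<oplus>\<^bsub>sec \<O> W\<^esub> res \<O> ?M W f' \<ominus>\<^bsub>sec \<O> W\<^esub> res \<O> ?M W f \<otimes>\<^bsub>sec \<O> W\<^esub> res \<O> ?M W f'"
    if "openin T W" for W
  proof -
    interpret h: ring_hom_cring "sec \<O> ?M" "sec \<O> W" "res \<O> ?M W"
      by (rule O_res_hom_cring) (use that openin_subset in auto)
    show ?thesis using fc by (simp add: a_minus_def)
  qed
  have wc: "res \<O> ?M W f \<in> carrier (sec \<O> W)" "res \<O> ?M W f' \<in> carrier (sec \<O> W)" if "openin T W" for W
    using that fc by (auto intro!: O_res_closed dest: openin_subset)
  have "vanishes_off ?g (Z \<union> Z')"
    unfolding vanishes_off_def
  proof (intro conjI)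
    show cl: "closedin T (Z \<union> Z')" using f by (auto dest: vanishes_offD(2))
    let ?W = "?M - (Z \<union> Z')"
    have W: "openin T ?W" using cl by blast
    interpret W: cring "sec \<O> ?W" by (rule O_cring[OF W])
    have "res \<O> ?M ?W f = \<zero>\<^bsub>sec \<O> ?W\<^esub>" "res \<O> ?M ?W f' = \<zero>\<^bsub>sec \<O> ?W\<^esub>"
      by (rule vanishes_offD(3)[OF f(1) W] vanishes_offD(3)[OF f(2) W]; blast)+
    then show "res \<O> ?M ?W ?g = \<zero>\<^bsub>sec \<O> ?W\<^esub>"
      using res_g[OF W] by (simp add: W.minus_eq)
  qed (use gc in simp)
  moreover have "res \<O> ?M (G \<union> G') ?g = \<one>\<^bsub>sec \<O> (G \<union> G')\<^esub>"
  proof (rule sheaf_eqI_Un[OF set_sheaf_O G])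
    have sub: "G \<subseteq> ?M" "G' \<subseteq> ?M" using G openin_subset by auto
    have op: "openin T (G \<union> G')" using G by blast
    show "res \<O> ?M (G \<union> G') ?g \<in> carrier (sec \<O> (G \<union> G'))"
      using gc op sub by (auto intro: O_res_closed)
    interpret U: cring "sec \<O> (G \<union> G')" by (rule O_cring[OF op])
    show "\<one>\<^bsub>sec \<O> (G \<union> G')\<^esub> \<in> carrier (sec \<O> (G \<union> G'))" by simp
    interpret G: cring "sec \<O> G" by (rule O_cring[OF G(1)])
    interpret G': cring "sec \<O> G'" by (rule O_cring[OF G(2)])
    have "res \<O> (G \<union> G') W (res \<O> ?M (G \<union> G') ?g) = res \<O> ?M W ?g" if "W \<subseteq> G \<union> G'" "openin T W" for W
      using that gc op sub by (intro O_res_res) auto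
    moreover have "res \<O> ?M G ?g = \<one>\<^bsub>sec \<O> G\<^esub>"
      unfolding res_g[OF G(1)] f1(1) using wc[OF G(1)] by (simp add: G.minus_eq G.a_assoc G.r_neg)
    moreover have "res \<O> ?M G' ?g = \<one>\<^bsub>sec \<O> G'\<^esub>"
      unfolding res_g[OF G(2)] f1(2) using wc[OF G(2)]
      by (simp add: G'.minus_eq G'.a_ac G'.r_neg G'.r_neg1 G'.r_neg2)
    ultimately show "res \<O> (G \<union> G') G (res \<O> ?M (G \<union> G') ?g) = res \<O> (G \<union> G') G \<one>\<^bsub>sec \<O> (G \<union> G')\<^esub>"
      "res \<O> (G \<union> G') G' (res \<O> ?M (G \<union> G') ?g) = res \<O> (G \<union> G') G' \<one>\<^bsub>sec \<O> (G \<union> G')\<^esub>"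
      using op G by (auto simp: O_res_one)
  qed
  ultimately show ?thesis using G by (auto simp: bump_def)
qed

lemma bump_UN: "finite I \<Longrightarrow> (\<And>i. i \<in> I \<Longrightarrow> bump (G i) (Z i)) \<Longrightarrow> bump (\<Union>i\<in>I. G i) (\<Union>i\<in>I. Z i)"
  by (induction I rule: finite_induct) (auto simp: bump_empty bump_Un)

end

section \<open>Charts, bump sections and partitions of unity on a formal manifold\<close>

locale formal_manifold_space =
  fixes T :: "'p topology" and \<O> :: "('p, complex, 'a) presheaf"
  assumes formal_manifold: "formal_manifold T \<O>"

sublocale formal_manifold_space \<subseteq> algebra_sheaf_space
  using formal_manifold by unfold_locales (simp add: formal_manifold_def locally_ringed_space_def)

context formal_manifold_space
begin

lemma Hausdorff: "Hausdorff_space T"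
  using formal_manifold by (simp add: formal_manifold_def)

lemma paracompact: "paracompact_space T"
  using formal_manifold by (simp add: formal_manifold_def)

text \<open>Names the witnesses hidden in \<open>isomorphic_ringed_spaces\<close>, with the
  preimages written as subsets of \<open>U\<close>.\<close>

definition is_chart ::
    "'p set \<Rightarrow> nat \<Rightarrow> nat \<Rightarrow> ('p \<Rightarrow> nat \<Rightarrow> real) \<Rightarrow>
      ((nat \<Rightarrow> real) set \<Rightarrow> ((nat \<Rightarrow> nat) \<Rightarrow> (nat \<Rightarrow> real) \<Rightarrow> complex) \<Rightarrow> 'a) \<Rightarrow> bool" where
  "is_chart U n k \<phi> \<Phi> \<longleftrightarrow> openin T U \<and> homeomorphic_map (subtopology T U) (Euclidean_space n) \<phi> \<and>
    (\<forall>W. openin (Euclidean_space n) W \<longrightarrow>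
      \<Phi> W \<in> ring_iso (sec (formal_model n k) W) (sec \<O> {x \<in> U. \<phi> x \<in> W}) \<and>
      (\<forall>c. \<forall>s\<in>carrier (sec (formal_model n k) W).
        \<Phi> W (c \<odot>\<^bsub>sec (formal_model n k) W\<^esub> s) = c \<odot>\<^bsub>sec \<O> {x \<in> U. \<phi> x \<in> W}\<^esub> \<Phi> W s)) \<and>
    (\<forall>W W'. openin (Euclidean_space n) W \<and> openin (Euclidean_space n) W' \<and> W' \<subseteq> W \<longrightarrow>
      (\<forall>s\<in>carrier (sec (formal_model n k) W).
        \<Phi> W' (res (formal_model n k) W W' s) = res \<O> {x \<in> U. \<phi> x \<in> W} {x \<in> U. \<phi> x \<in> W'} (\<Phi> W s)))"

lemma chart_exists:
  assumes "a \<in> topspace T"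
  obtains U n k \<phi> \<Phi> where "is_chart U n k \<phi> \<Phi>" "a \<in> U"
proof -
  obtain U n k where U: "openin T U" "a \<in> U"
      "isomorphic_ringed_spaces (subtopology T U) \<O> (Euclidean_space n) (formal_model n k)"
    using formal_manifold assms unfolding formal_manifold_def by blast
  have ts: "topspace (subtopology T U) = U" using U(1) openin_subset by fastforce
  have "\<exists>\<phi> \<Phi>. is_chart U n k \<phi> \<Phi>"
    using U(3,1) unfolding isomorphic_ringed_spaces_def Let_def ts is_chart_def by simp
  then show thesis using that U(2) by blast
qed

context
  fixes U n k \<phi> \<Phi>
  assumes chart: "is_chart U n k \<phi> \<Phi>"
begin

lemma chart_open: "openin T U"
  using chart by (simp add: is_chart_def)

lemma chart_homeomorphic: "homeomorphic_map (subtopology T U) (Euclidean_space n) \<phi>"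
  using chart by (simp add: is_chart_def)

lemma chart_topspace: "topspace (subtopology T U) = U"
  using openin_subset[OF chart_open] by auto

lemma chart_image: "x \<in> U \<Longrightarrow> \<phi> x \<in> topspace (Euclidean_space n)"
  using homeomorphic_imp_surjective_map[OF chart_homeomorphic] chart_topspace by blast

lemma chart_iso:
  "openin (Euclidean_space n) W \<Longrightarrow> \<Phi> W \<in> ring_iso (sec (formal_model n k) W) (sec \<O> {x \<in> U. \<phi> x \<in> W})"
  using chart unfolding is_chart_def by blast

lemma chart_smult:
  "openin (Euclidean_space n) W \<Longrightarrow> s \<in> carrier (sec (formal_model n k) W) \<Longrightarrow>
    \<Phi> W (c \<odot>\<^bsub>sec (formal_model n k) W\<^esub> s) = c \<odot>\<^bsub>sec \<O> {x \<in> U. \<phi> x \<in> W}\<^esub> \<Phi> W s"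
  using chart unfolding is_chart_def by blast

lemma chart_res:
  "openin (Euclidean_space n) W \<Longrightarrow> openin (Euclidean_space n) W' \<Longrightarrow> W' \<subseteq> W \<Longrightarrow>
    s \<in> carrier (sec (formal_model n k) W) \<Longrightarrow>
    res \<O> {x \<in> U. \<phi> x \<in> W} {x \<in> U. \<phi> x \<in> W'} (\<Phi> W s) = \<Phi> W' (res (formal_model n k) W W' s)"
  by (rule chart[unfolded is_chart_def, THEN conjunct2, THEN conjunct2, THEN conjunct2, rule_format, symmetric]) simp_all

lemma chart_preimage_open: "openin (Euclidean_space n) W \<Longrightarrow> openin T {x \<in> U. \<phi> x \<in> W}"
proof -
  assume "openin (Euclidean_space n) W"
  then have "openin (subtopology T U) {x \<in> topspace (subtopology T U). \<phi> x \<in> W}"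
    using chart_homeomorphic homeomorphic_imp_continuous_map openin_continuous_map_preimage by blast
  then show ?thesis
    unfolding chart_topspace using chart_open openin_trans_full by blast
qed

lemma chart_open_image:
  assumes "openin T V" "V \<subseteq> U"
  shows "openin (Euclidean_space n) (\<phi> ` V)" "{x \<in> U. \<phi> x \<in> \<phi> ` V} = V"
proof -
  have "openin (subtopology T U) V" using assms by (simp add: openin_open_subtopology chart_open)
  then show "openin (Euclidean_space n) (\<phi> ` V)"
    using homeomorphic_imp_open_map[OF chart_homeomorphic] by (simp add: open_map_def)
  show "{x \<in> U. \<phi> x \<in> \<phi> ` V} = V"
    using homeomorphic_imp_injective_map[OF chart_homeomorphic] chart_topspace assms(2)
    by (auto simp: inj_on_def)
qed

lemma chart_one: "openin (Euclidean_space n) W \<Longrightarrow> \<Phi> W \<one>\<^bsub>sec (formal_model n k) W\<^esub> = \<one>\<^bsub>sec \<O> {x \<in> U. \<phi> x \<in> W}\<^esub>"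
  using chart_iso by (auto simp: ring_iso_def dest: ring_hom_one)

text \<open>The model has not been shown to be a ring, so the usual rule for ring homomorphisms is
  out of reach. Instead 0 is obtained as 0 times a section, and \<open>\<Phi> W\<close> respects
  complex scalars.\<close>

lemma chart_zero:
  assumes W: "openin (Euclidean_space n) W"
  shows "\<Phi> W \<zero>\<^bsub>sec (formal_model n k) W\<^esub> = \<zero>\<^bsub>sec \<O> {x \<in> U. \<phi> x \<in> W}\<^esub>"
proof -
  let ?V = "{x \<in> U. \<phi> x \<in> W}"
  interpret Module.module "\<complex>\<^sub>R" "sec \<O> ?V" by (rule O_module[OF chart_preimage_open[OF W]])
  have "\<zero>\<^bsub>sec \<O> ?V\<^esub> \<in> \<Phi> W ` carrier (sec (formal_model n k) W)"
    using chart_iso[OF W] by (simp add: ring_iso_def bij_betw_def)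
  then obtain s where s: "s \<in> carrier (sec (formal_model n k) W)" "\<Phi> W s = \<zero>\<^bsub>sec \<O> ?V\<^esub>" by auto
  have "0 \<odot>\<^bsub>sec (formal_model n k) W\<^esub> s = \<zero>\<^bsub>sec (formal_model n k) W\<^esub>"
    by (simp add: formal_model_def fun_eq_iff restrict_def)
  then have "\<Phi> W \<zero>\<^bsub>sec (formal_model n k) W\<^esub> = 0 \<odot>\<^bsub>sec \<O> ?V\<^esub> \<Phi> W s"
    using chart_smult[OF W s(1), of 0] by simp
  then show ?thesis using s(2) smult_l_null[of "\<zero>\<^bsub>sec \<O> ?V\<^esub>"] by simp
qed

text \<open>A Euclidean cutoff, taken as the power series having it as its coefficient of index 0
  and zero elsewhere, is carried to the chart domain and glued with the zero section on the
  complement of \<open>Z\<close>.\<close>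

lemma chart_bump:
  assumes a: "a \<in> U" "a \<in> N" and N: "openin T N"
  shows "\<exists>G Z. bump G Z \<and> a \<in> G \<and> G \<subseteq> Z \<and> Z \<subseteq> N \<and> compactin T Z"
proof -
  let ?E = "Euclidean_space n" let ?X = "topspace ?E" let ?M = "topspace T"
  let ?B = "formal_model n k"
  have NU: "openin T (N \<inter> U)" using N chart_open by blast
  obtain \<beta> G C where \<beta>: "\<beta> \<in> elementary_smooth" and G: "openin ?E G" and C: "compactin ?E C"
    and aG: "\<phi> a \<in> G" "G \<subseteq> C" "C \<subseteq> \<phi> ` (N \<inter> U)" and \<beta>1: "\<And>x. x \<in> G \<Longrightarrow> \<beta> x = 1"
    and \<beta>0: "\<And>x. x \<notin> C \<Longrightarrow> x \<in> ?X \<Longrightarrow> \<beta> x = 0"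
    by (rule Euclidean_bump[of n "\<phi> ` (N \<inter> U)" "\<phi> a"]) (use chart_open_image(1)[OF NU] a in auto)
  define b where "b = (\<lambda>\<alpha>\<in>multi_indices k. if \<alpha> = (\<lambda>_. 0) then (\<lambda>x\<in>?X. complex_of_real (\<beta> x)) else (\<lambda>x\<in>?X. 0))"
  have "(\<lambda>x\<in>?X. complex_of_real (\<gamma> x)) \<in> smooth_functions n ?X" if "\<gamma> \<in> elementary_smooth" for \<gamma>
    unfolding smooth_functions_def
    using Ck_on_cong[OF openin_topspace Ck_on_elementary_smooth[OF that], where g = "\<lambda>x\<in>?X. complex_of_real (\<gamma> x)"]
    by simp
  from this[OF \<beta>] this[OF elementary_smooth.const[of 0]] have bc: "b \<in> carrier (sec ?B ?X)"
    by (auto simp: b_def formal_model_def)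
  have topX: "openin ?E ?X" by simp
  have preX: "{x \<in> U. \<phi> x \<in> ?X} = U" using chart_image by auto
  define f0 where "f0 = \<Phi> ?X b"
  have f0: "f0 \<in> carrier (sec \<O> U)"
    using chart_iso[OF topX] bc unfolding preX f0_def by (auto simp: ring_iso_def ring_hom_def)
  define Z where "Z = {x \<in> U. \<phi> x \<in> C}"
  obtain \<psi> where \<psi>: "homeomorphic_maps (subtopology T U) ?E \<phi> \<psi>"
    using chart_homeomorphic homeomorphic_map_maps by blast
  have "Z = \<psi> ` C"
  proof
    show "Z \<subseteq> \<psi> ` C" using \<psi> chart_topspace by (force simp: Z_def homeomorphic_maps_def)
    show "\<psi> ` C \<subseteq> Z"
      using \<psi> compactin_subset_topspace[OF C] chart_topspace
      unfolding Z_def homeomorphic_maps_def continuous_map_def by fastforce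
  qed
  then have "compactin (subtopology T U) Z"
    using image_compactin[OF C, of "subtopology T U" \<psi>] \<psi> by (simp only: homeomorphic_maps_def)
  then have Zcomp: "compactin T Z" by (simp add: compactin_subtopology)
  \<comment> \<open>\<open>Z\<close> is built inside one chart; it is closed in the whole space
    because it is compact and the space is Hausdorff. Only so is its complement open and available
    for gluing.\<close>
  then have Zcl: "closedin T Z" using Hausdorff compactin_imp_closedin by blast
  have ZN: "Z \<subseteq> N" using aG(3) chart_open_image(2)[OF NU] unfolding Z_def by blast
  have "closedin ?E C" using C Hausdorff_Euclidean_space compactin_imp_closedin by blast
  then have W: "openin ?E (?X - C)" by blast
  have preW: "{x \<in> U. \<phi> x \<in> ?X - C} = U - Z" using chart_image by (auto simp: Z_def)
  have "res ?B ?X (?X - C) b = \<zero>\<^bsub>sec ?B (?X - C)\<^esub>"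
    using \<beta>0 by (auto simp: formal_model_def b_def fun_eq_iff restrict_def)
  then have off: "res \<O> U (U - Z) f0 = \<zero>\<^bsub>sec \<O> (U - Z)\<^esub>"
    using chart_res[OF topX W _ bc] chart_zero[OF W] unfolding preX preW f0_def by auto
  let ?G = "{x \<in> U. \<phi> x \<in> G}"
  have "res ?B ?X G b = \<one>\<^bsub>sec ?B G\<^esub>"
    using \<beta>1 openin_subset[OF G] by (auto simp: formal_model_def b_def fun_eq_iff restrict_def)
  then have on: "res \<O> U ?G f0 = \<one>\<^bsub>sec \<O> ?G\<^esub>"
    using chart_res[OF topX G _ bc] chart_one[OF G] openin_subset[OF G] unfolding preX f0_def by auto
  have oZ: "openin T (?M - Z)" using Zcl by blast
  interpret R: cring "sec \<O> (?M - Z)" by (rule O_cring[OF oZ])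
  have UM: "U \<union> (?M - Z) = ?M" and int: "U \<inter> (?M - Z) = U - Z"
    using openin_subset[OF chart_open] by (auto simp: Z_def)
  have oUZ: "openin T (U - Z)" using chart_preimage_open[OF W] by (simp only: preW)
  have "res \<O> U (U \<inter> (?M - Z)) f0 = res \<O> (?M - Z) (U \<inter> (?M - Z)) \<zero>\<^bsub>sec \<O> (?M - Z)\<^esub>"
    unfolding int using off O_res_zero[OF oZ oUZ] UM by (metis Diff_mono order_refl Un_upper1)
  then obtain f where f: "f \<in> carrier (sec \<O> ?M)" "res \<O> ?M U f = f0" "res \<O> ?M (?M - Z) f = \<zero>\<^bsub>sec \<O> (?M - Z)\<^esub>"
    using sheaf_glue_Un[OF set_sheaf_O chart_open oZ f0 R.zero_closed] unfolding UM by metis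
  have "vanishes_off f Z" using f Zcl by (simp add: vanishes_off_def)
  moreover have "res \<O> ?M ?G f = \<one>\<^bsub>sec \<O> ?G\<^esub>"
    using on O_res_res[OF _ chart_open chart_preimage_open[OF G] _ _ f(1)] f(2) openin_subset[OF chart_open] by auto
  ultimately have "bump ?G Z" unfolding bump_def using chart_preimage_open[OF G] by blast
  moreover have "?G \<subseteq> Z" using aG(2) by (auto simp: Z_def)
  ultimately show ?thesis using a aG(1) ZN Zcomp by (intro exI[of _ ?G] exI[of _ Z]) auto
qed

end

lemma local_bump:
  assumes "openin T N" "a \<in> N"
  shows "\<exists>G Z. bump G Z \<and> a \<in> G \<and> G \<subseteq> Z \<and> Z \<subseteq> N \<and> compactin T Z"
proof -
  have "a \<in> topspace T" using assms openin_subset by blast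
  then obtain U n k \<phi> \<Phi> where "is_chart U n k \<phi> \<Phi>" "a \<in> U" by (rule chart_exists)
  then show ?thesis using chart_bump assms by blast
qed

lemma bump_open: "bump G Z \<Longrightarrow> openin T G"
  by (simp add: bump_def)

lemma compact_bump:
  assumes "compactin T K" "openin T N" "K \<subseteq> N"
  obtains G Z where "bump G Z" "K \<subseteq> G" "Z \<subseteq> N"
proof -
  have "\<forall>a\<in>K. \<exists>G Z. bump G Z \<and> a \<in> G \<and> Z \<subseteq> N" using local_bump[OF assms(2)] assms(3) by blast
  then obtain G Z where GZ: "\<And>a. a \<in> K \<Longrightarrow> bump (G a) (Z a) \<and> a \<in> G a \<and> Z a \<subseteq> N" by metis
  then have "(\<forall>U\<in>G ` K. openin T U) \<and> K \<subseteq> \<Union>(G ` K)" using bump_open by blast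
  then have "\<exists>\<F>. finite \<F> \<and> \<F> \<subseteq> G ` K \<and> K \<subseteq> \<Union>\<F>"
    using assms(1) unfolding compactin_def by blast
  then obtain S where S: "finite S" "S \<subseteq> K" "K \<subseteq> \<Union>(G ` S)" by (metis finite_subset_image)
  have "bump (\<Union>a\<in>S. G a) (\<Union>a\<in>S. Z a)" using S GZ by (intro bump_UN) auto
  then show thesis using that[of "\<Union>a\<in>S. G a" "\<Union>a\<in>S. Z a"] S GZ by blast
qed

text \<open>Paracompactness returns sets that are merely contained in members of the given cover, so
  \<open>Q\<close> has to be hereditary for open subsets.\<close>

lemma refinement:
  assumes "\<And>a. a \<in> topspace T \<Longrightarrow> \<exists>G. openin T G \<and> a \<in> G \<and> Q G" and mono: "\<And>G G'. Q G \<Longrightarrow> G' \<subseteq> G \<Longrightarrow> openin T G' \<Longrightarrow> Q G'"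
  obtains \<V> where "locally_finite_in T \<V>" "\<And>V. V \<in> \<V> \<Longrightarrow> openin T V \<and> Q V" "\<Union>\<V> = topspace T"
proof -
  let ?\<U> = "{G. openin T G \<and> Q G}"
  have cov: "(\<forall>U\<in>?\<U>. openin T U) \<and> \<Union>?\<U> = topspace T"
  proof
    show "\<Union>?\<U> = topspace T"
    proof
      show "\<Union>?\<U> \<subseteq> topspace T" using openin_subset by blast
      show "topspace T \<subseteq> \<Union>?\<U>" using assms(1) by blast
    qed
  qed simp
  then obtain \<V> where \<V>: "\<forall>V\<in>\<V>. openin T V" "\<Union>\<V> = topspace T" "\<forall>V\<in>\<V>. \<exists>U\<in>?\<U>. V \<subseteq> U" "locally_finite_in T \<V>"
    using paracompact[unfolded paracompact_space_def, THEN spec, THEN mp, OF cov] by (elim exE conjE)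
  have "openin T V \<and> Q V" if V: "V \<in> \<V>" for V
  proof -
    obtain G where "Q G" "V \<subseteq> G" using \<V>(3) V by blast
    then show ?thesis using mono[of G V] \<V>(1) V by blast
  qed
  then show thesis by (rule that[OF \<V>(4) _ \<V>(2)])
qed

text \<open>One refinement is not enough: shrinking a set \<open>G\<close> keeps its set
  \<open>Z\<close>, and these sets \<open>Z\<close> need not be locally finite. So a locally finite
  cover \<open>\<V>\<close> by sets contained in compact ones is fixed first, then a second one by
  small bumps with \<open>Z\<close> inside some member of \<open>\<V>\<close>. All bumps assigned to
  the same member are united. They are finitely many, because that member lies in a compact
  set.\<close>

lemma bump_cover:
  fixes \<Gamma> :: "'g set" and U :: "'g \<Rightarrow> 'p set"
  assumes U: "\<And>\<gamma>. \<gamma> \<in> \<Gamma> \<Longrightarrow> openin T (U \<gamma>)" "(\<Union>\<gamma>\<in>\<Gamma>. U \<gamma>) = topspace T"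
  obtains \<V> and c :: "'p set \<Rightarrow> 'g" and W Z where "locally_finite_in T \<V>"
    "\<And>V. V \<in> \<V> \<Longrightarrow> openin T V" "\<And>V. V \<in> \<V> \<Longrightarrow> c V \<in> \<Gamma>" "\<And>V. V \<in> \<V> \<Longrightarrow> V \<subseteq> U (c V)"
    "\<And>V. V \<in> \<V> \<Longrightarrow> bump (W V) (Z V)" "\<And>V. V \<in> \<V> \<Longrightarrow> Z V \<subseteq> V" "(\<Union>V\<in>\<V>. W V) = topspace T"
proof -
  define Q1 where "Q1 = (\<lambda>V. \<exists>\<gamma>\<in>\<Gamma>. \<exists>K. V \<subseteq> U \<gamma> \<and> V \<subseteq> K \<and> compactin T K)"
  obtain \<V> where \<V>: "locally_finite_in T \<V>" "\<And>V. V \<in> \<V> \<Longrightarrow> openin T V \<and> Q1 V" "\<Union>\<V> = topspace T"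
  proof (rule refinement[of Q1])
    fix a assume "a \<in> topspace T"
    then obtain \<gamma> where "\<gamma> \<in> \<Gamma>" "a \<in> U \<gamma>" using U(2) by blast
    then show "\<exists>G. openin T G \<and> a \<in> G \<and> Q1 G"
      using local_bump[OF U(1)] bump_open unfolding Q1_def by (meson order_trans)
  next
    fix G G' assume "Q1 G" "G' \<subseteq> G"
    then show "Q1 G'" unfolding Q1_def by (meson order_trans)
  qed (rule that)
  obtain c K where c: "\<And>V. V \<in> \<V> \<Longrightarrow> c V \<in> \<Gamma> \<and> V \<subseteq> U (c V) \<and> V \<subseteq> K V \<and> compactin T (K V)"
    using \<V>(2) unfolding Q1_def by metis
  define Q2 where "Q2 = (\<lambda>G. \<exists>V\<in>\<V>. \<exists>Z. bump G Z \<and> G \<subseteq> Z \<and> Z \<subseteq> V)"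
  obtain \<Q> where \<Q>: "locally_finite_in T \<Q>" "\<And>G. G \<in> \<Q> \<Longrightarrow> openin T G \<and> Q2 G" "\<Union>\<Q> = topspace T"
  proof (rule refinement[of Q2])
    fix a assume "a \<in> topspace T"
    then obtain V where V: "V \<in> \<V>" "a \<in> V" using \<V>(3) by blast
    then obtain G Z where "bump G Z" "a \<in> G" "G \<subseteq> Z" "Z \<subseteq> V" using local_bump[of V a] \<V>(2) by blast
    then show "\<exists>G. openin T G \<and> a \<in> G \<and> Q2 G"
      using V(1) bump_open unfolding Q2_def by blast
  next
    fix G G' assume "Q2 G" "G' \<subseteq> G" "openin T G'"
    then show "Q2 G'" unfolding Q2_def using bump_mono by (meson order_trans)
  qed (rule that)
  obtain j Y where j: "\<And>G. G \<in> \<Q> \<Longrightarrow> j G \<in> \<V> \<and> bump G (Y G) \<and> G \<subseteq> Y G \<and> Y G \<subseteq> j G"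
    using \<Q>(2) unfolding Q2_def by metis
  define L where "L = (\<lambda>V. {G \<in> \<Q>. G \<noteq> {} \<and> j G = V})"
  have "finite (L V)" if V: "V \<in> \<V>" for V
  proof -
    \<comment> \<open>A nonempty \<open>G\<close> assigned to \<open>V\<close> is a subset of
      \<open>V\<close>, hence meets the compact set around \<open>V\<close>. The empty set would
      escape this count, and so it is excluded from \<open>L\<close>.\<close>
    have "L V \<subseteq> {G \<in> \<Q>. G \<inter> K V \<noteq> {}}" using j c[OF V] unfolding L_def by blast
    then show ?thesis using locally_finite_in_compactin[OF \<Q>(1)] c[OF V] finite_subset by blast
  qed
  then have b: "bump (\<Union>G\<in>L V. G) (\<Union>G\<in>L V. Y G)" if "V \<in> \<V>" for V
    using that j by (intro bump_UN) (auto simp: L_def)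
  have cov: "(\<Union>V\<in>\<V>. \<Union>G\<in>L V. G) = topspace T"
  proof
    show "(\<Union>V\<in>\<V>. \<Union>G\<in>L V. G) \<subseteq> topspace T" using \<Q>(3) unfolding L_def by blast
    show "topspace T \<subseteq> (\<Union>V\<in>\<V>. \<Union>G\<in>L V. G)"
    proof
      fix a assume "a \<in> topspace T"
      then obtain G where "G \<in> \<Q>" "a \<in> G" using \<Q>(3) by blast
      then show "a \<in> (\<Union>V\<in>\<V>. \<Union>G\<in>L V. G)" using j[of G] unfolding L_def by blast
    qed
  qed
  have sub: "(\<Union>G\<in>L V. Y G) \<subseteq> V" for V using j unfolding L_def by blast
  show thesis
    by (rule that[of \<V> c "\<lambda>V. \<Union>G\<in>L V. G" "\<lambda>V. \<Union>G\<in>L V. Y G"])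
       (simp_all only: \<V>(1) \<V>(2) c b cov sub)
qed

text \<open>No division is needed: the products \<open>f\<^sub>V \<Prod>\<^bsub>V' < V\<^esub> (1 - f\<^bsub>V'\<^esub>)\<close>, over any linear order on the
  locally finite cover, telescope to \<open>1 - \<Prod>\<^sub>V (1 - f\<^sub>V)\<close>, which is \<open>1\<close> since some \<open>f\<^sub>V\<close> is \<open>1\<close> near every point.\<close>

lemma partition_of_unity:
  fixes \<Gamma> :: "'g set" and U :: "'g \<Rightarrow> 'p set"
  assumes U: "\<And>\<gamma>. \<gamma> \<in> \<Gamma> \<Longrightarrow> openin T (U \<gamma>)" "(\<Union>\<gamma>\<in>\<Gamma>. U \<gamma>) = topspace T"
  obtains I g Z and c :: "'p set \<Rightarrow> 'g" where
    "\<And>i. i \<in> I \<Longrightarrow> c i \<in> \<Gamma>" "\<And>i. i \<in> I \<Longrightarrow> Z i \<subseteq> U (c i)" "\<And>i. i \<in> I \<Longrightarrow> vanishes_off (g i) (Z i)"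
    "\<And>K. compactin T K \<Longrightarrow> finite {i \<in> I. Z i \<inter> K \<noteq> {}}"
    "\<And>a. a \<in> topspace T \<Longrightarrow> \<exists>Q J. openin T Q \<and> a \<in> Q \<and> finite J \<and> J \<subseteq> I \<and> (\<forall>i\<in>I - J. Z i \<inter> Q = {}) \<and>
      finsum (sec \<O> Q) (\<lambda>i. res \<O> (topspace T) Q (g i)) J = \<one>\<^bsub>sec \<O> Q\<^esub>"
proof -
  let ?M = "topspace T"
  obtain \<V> and c :: "'p set \<Rightarrow> 'g" and W Z where lf: "locally_finite_in T \<V>"
    and \<V>: "\<And>V. V \<in> \<V> \<Longrightarrow> openin T V" "\<And>V. V \<in> \<V> \<Longrightarrow> c V \<in> \<Gamma>" "\<And>V. V \<in> \<V> \<Longrightarrow> V \<subseteq> U (c V)"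
    "\<And>V. V \<in> \<V> \<Longrightarrow> bump (W V) (Z V)" "\<And>V. V \<in> \<V> \<Longrightarrow> Z V \<subseteq> V" and W: "(\<Union>V\<in>\<V>. W V) = ?M"
    using U by (rule bump_cover[where \<Gamma> = \<Gamma> and U = U]) (assumption | rule that)+
  obtain f where f: "\<And>V. V \<in> \<V> \<Longrightarrow> vanishes_off (f V) (Z V)" "\<And>V. V \<in> \<V> \<Longrightarrow> res \<O> ?M (W V) (f V) = \<one>\<^bsub>sec \<O> (W V)\<^esub>"
    using \<V>(4) unfolding bump_def by metis
  have fc: "f V \<in> carrier (sec \<O> ?M)" if "V \<in> \<V>" for V using f(1)[OF that] by (rule vanishes_offD(1))
  \<comment> \<open>Any linear order on sets of points will do; the well-ordering theorem supplies
    one.\<close>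
  obtain r :: "'p set rel" where "Well_order r \<and> Field r = UNIV" using well_ordering ..
  then have "well_order r" by metis
  then have r: "linear_order r" by (simp add: well_order_on_def)
  define J where "J = (\<lambda>Q. {V \<in> \<V>. V \<inter> Q \<noteq> {}})"
  \<comment> \<open>The members preceding a given one may be infinitely many, so their product
    exists only over open sets that meet finitely many members. These local products
    \<open>s V Q\<close> are glued afterwards.\<close>
  define \<Q> where "\<Q> = {Q. openin T Q \<and> finite (J Q)}"
  define pr where "pr = (\<lambda>Q. \<lambda>A. finprod (sec \<O> Q) (\<lambda>V. \<one>\<^bsub>sec \<O> Q\<^esub> \<ominus>\<^bsub>sec \<O> Q\<^esub> res \<O> ?M Q (f V)) A)"
  define s where "s = (\<lambda>V Q. pr Q {V' \<in> J Q. (V', V) \<in> r \<and> V' \<noteq> V})"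
  have rfc: "res \<O> ?M Q (f V) \<in> carrier (sec \<O> Q)" if "V \<in> \<V>" "openin T Q" for V Q
    using fc[OF that(1)] that(2) by (auto intro: O_res_closed dest: openin_subset)
  have fac: "\<one>\<^bsub>sec \<O> Q\<^esub> \<ominus>\<^bsub>sec \<O> Q\<^esub> res \<O> ?M Q (f V) \<in> carrier (sec \<O> Q)" if "V \<in> \<V>" "openin T Q" for V Q
  proof -
    interpret cring "sec \<O> Q" by (rule O_cring[OF that(2)])
    show ?thesis using rfc[OF that] by simp
  qed
  have prc: "pr Q A \<in> carrier (sec \<O> Q)" if "A \<subseteq> \<V>" "openin T Q" for Q A
  proof -
    interpret cring "sec \<O> Q" by (rule O_cring[OF that(2)])
    show ?thesis unfolding pr_def using fac that by (intro finprod_closed) auto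
  qed
  have res_pr: "res \<O> Q Q' (pr Q A) = pr Q' A" if A: "A \<subseteq> \<V>" and Q: "openin T Q" "openin T Q'" "Q' \<subseteq> Q" for Q Q' A
  proof -
    interpret h: ring_hom_cring "sec \<O> Q" "sec \<O> Q'" "res \<O> Q Q'" by (rule O_res_hom_cring[OF Q])
    have "res \<O> Q Q' (pr Q A) = finprod (sec \<O> Q') (res \<O> Q Q' \<circ> (\<lambda>V. \<one>\<^bsub>sec \<O> Q\<^esub> \<ominus>\<^bsub>sec \<O> Q\<^esub> res \<O> ?M Q (f V))) A"
      unfolding pr_def using fac A Q(1) by (intro h.hom_finprod) auto
    also have "\<dots> = pr Q' A"
      unfolding pr_def
    proof (rule h.S.finprod_cong'[OF refl])
      show "(\<lambda>V. \<one>\<^bsub>sec \<O> Q'\<^esub> \<ominus>\<^bsub>sec \<O> Q'\<^esub> res \<O> ?M Q' (f V)) \<in> A \<rightarrow> carrier (sec \<O> Q')"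
        using fac A Q(2) by auto
      fix V assume "V \<in> A"
      then have V: "V \<in> \<V>" using A by auto
      have "res \<O> Q Q' (res \<O> ?M Q (f V)) = res \<O> ?M Q' (f V)"
        using fc[OF V] Q by (intro O_res_res) (auto dest: openin_subset)
      then show "(res \<O> Q Q' \<circ> (\<lambda>V. \<one>\<^bsub>sec \<O> Q\<^esub> \<ominus>\<^bsub>sec \<O> Q\<^esub> res \<O> ?M Q (f V))) V = \<one>\<^bsub>sec \<O> Q'\<^esub> \<ominus>\<^bsub>sec \<O> Q'\<^esub> res \<O> ?M Q' (f V)"
        using O_res_minus[OF Q h.R.one_closed rfc[OF V Q(1)]] by simp
    qed
    finally show ?thesis .
  qed
  \<comment> \<open>A member disjoint from \<open>Q\<close> has a cutoff vanishing on
    \<open>Q\<close> and contributes the factor 1. Therefore shrinking \<open>Q\<close> and dropping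
    such members leaves the product unchanged, and the local products agree on overlaps.\<close>
  have pr_mono: "pr Q A = pr Q A'" if "finite A" "A' \<subseteq> A" "A \<subseteq> \<V>" "openin T Q" "\<And>V. V \<in> A - A' \<Longrightarrow> V \<inter> Q = {}" for Q A A'
  proof -
    interpret cring "sec \<O> Q" by (rule O_cring[OF that(4)])
    note sub = \<open>A \<subseteq> \<V>\<close> and oQ = \<open>openin T Q\<close> and disj = that(5)
    have z: "\<one>\<^bsub>sec \<O> Q\<^esub> \<ominus>\<^bsub>sec \<O> Q\<^esub> res \<O> ?M Q (f V) = \<one>\<^bsub>sec \<O> Q\<^esub>" if V: "V \<in> A - A'" for V
    proof -
      have "V \<in> \<V>" "Q \<inter> Z V = {}" using V sub disj[OF V] \<V>(5) by blast+
      then have "res \<O> ?M Q (f V) = \<zero>\<^bsub>sec \<O> Q\<^esub>" using vanishes_offD(3)[OF f(1) oQ] by blast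
      then show ?thesis by (simp add: minus_eq)
    qed
    show ?thesis unfolding pr_def
      by (rule finprod_mono_neutral_cong_right) (use that z fac in auto)
  qed
  have res_s: "res \<O> Q Q' (s V Q) = s V Q'" if "Q \<in> \<Q>" "openin T Q'" "Q' \<subseteq> Q" for V Q Q'
  proof -
    have "res \<O> Q Q' (s V Q) = pr Q' {V' \<in> J Q. (V', V) \<in> r \<and> V' \<noteq> V}"
      unfolding s_def using that by (intro res_pr) (auto simp: \<Q>_def J_def)
    also have "\<dots> = pr Q' {V' \<in> J Q'. (V', V) \<in> r \<and> V' \<noteq> V}"
    proof (rule pr_mono)
      show "finite {V' \<in> J Q. (V', V) \<in> r \<and> V' \<noteq> V}"
        using that(1) by (simp add: \<Q>_def)
    qed (use that in \<open>auto simp: J_def\<close>)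
    finally show ?thesis by (simp add: s_def)
  qed
  have \<Q>M: "\<Union>\<Q> = ?M"
  proof
    show "\<Union>\<Q> \<subseteq> ?M" unfolding \<Q>_def using openin_subset by blast
    show "?M \<subseteq> \<Union>\<Q>"
    proof
      fix a assume "a \<in> ?M"
      then have "\<exists>Q. openin T Q \<and> a \<in> Q \<and> finite (J Q)"
        unfolding J_def by (rule lf[unfolded locally_finite_in_def, THEN conjunct2, rule_format])
      then show "a \<in> \<Union>\<Q>" unfolding \<Q>_def by blast
    qed
  qed
  have "\<exists>!p. p \<in> carrier (sec \<O> (\<Union>\<Q>)) \<and> (\<forall>Q\<in>\<Q>. res \<O> (\<Union>\<Q>) Q p = s V Q)" for V
  proof (rule sheaf_glue[OF set_sheaf_O])
    show "openin T Q" if "Q \<in> \<Q>" for Q using that by (simp add: \<Q>_def)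
    show "s V Q \<in> carrier (sec \<O> Q)" if "Q \<in> \<Q>" for Q
      unfolding s_def using that by (intro prc) (auto simp: \<Q>_def J_def)
    show "res \<O> Q (Q \<inter> Q') (s V Q) = res \<O> Q' (Q \<inter> Q') (s V Q')" if "Q \<in> \<Q>" "Q' \<in> \<Q>" for Q Q'
    proof -
      have "openin T (Q \<inter> Q')" using that by (auto simp: \<Q>_def)
      then show ?thesis using res_s[OF that(1), of "Q \<inter> Q'" V] res_s[OF that(2), of "Q \<inter> Q'" V] by simp
    qed
  qed
  then obtain p where p: "\<And>V. p V \<in> carrier (sec \<O> ?M)" "\<And>V Q. Q \<in> \<Q> \<Longrightarrow> res \<O> ?M Q (p V) = s V Q"
    unfolding \<Q>M by metis
  define g where "g = (\<lambda>V. f V \<otimes>\<^bsub>sec \<O> ?M\<^esub> p V)"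
  have res_g: "res \<O> ?M Q (g V) = res \<O> ?M Q (f V) \<otimes>\<^bsub>sec \<O> Q\<^esub> res \<O> ?M Q (p V)" if "V \<in> \<V>" "openin T Q" for V Q
    unfolding g_def using that fc p(1) openin_subset[OF that(2)]
    by (intro ring_hom_mult[OF O_res_hom]) auto
  show thesis
  proof (rule that[of \<V> c Z g])
    show "vanishes_off (g V) (Z V)" if V: "V \<in> \<V>" for V
    proof -
      have cl: "closedin T (Z V)" using f(1)[OF V] by (rule vanishes_offD(2))
      let ?W = "?M - Z V"
      have oW: "openin T ?W" using cl by blast
      interpret R: cring "sec \<O> ?M" by (rule O_cring) simp
      interpret S: cring "sec \<O> ?W" by (rule O_cring[OF oW])
      have "res \<O> ?M ?W (f V) = \<zero>\<^bsub>sec \<O> ?W\<^esub>" using f(1)[OF V] by (simp add: vanishes_off_def)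
      moreover have "res \<O> ?M ?W (p V) \<in> carrier (sec \<O> ?W)" using p(1) oW by (intro O_res_closed) auto
      ultimately have "res \<O> ?M ?W (g V) = \<zero>\<^bsub>sec \<O> ?W\<^esub>" using res_g[OF V oW] by simp
      then show ?thesis using cl fc[OF V] p(1)[of V] by (simp add: vanishes_off_def g_def)
    qed
    show "finite {V \<in> \<V>. Z V \<inter> K \<noteq> {}}" if "compactin T K" for K
      by (rule finite_subset[OF _ locally_finite_in_compactin[OF lf that]]) (use \<V>(5) in blast)
    fix a assume a: "a \<in> ?M"
    then obtain Q where Q: "Q \<in> \<Q>" "a \<in> Q" using \<Q>M by blast
    then have oQ: "openin T Q" and fin: "finite (J Q)" by (auto simp: \<Q>_def)
    interpret R: cring "sec \<O> Q" by (rule O_cring[OF oQ])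
    have JV: "J Q \<subseteq> \<V>" by (auto simp: J_def)
    \<comment> \<open>The remainder of the telescoping sum vanishes: near each point some cutoff
      equals 1, which makes one factor of the product zero.\<close>
    have "pr Q (J Q) = \<zero>\<^bsub>sec \<O> Q\<^esub>"
    proof (rule O_eqI[OF oQ])
      show "pr Q (J Q) \<in> carrier (sec \<O> Q)" by (rule prc[OF JV oQ])
      fix b assume b: "b \<in> Q"
      then obtain V where V: "V \<in> \<V>" "b \<in> W V" using W openin_subset[OF oQ] by blast
      have oW: "openin T (W V)" using \<V>(4)[OF V(1)] by (rule bump_open)
      let ?X = "Q \<inter> W V"
      have oX: "openin T ?X" using oQ oW by blast
      interpret X: cring "sec \<O> ?X" by (rule O_cring[OF oX])
      have "res \<O> ?M ?X (f V) = res \<O> (W V) ?X (res \<O> ?M (W V) (f V))"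
        using fc[OF V(1)] oW oX by (intro O_res_res[symmetric]) (auto dest: openin_subset)
      then have one: "res \<O> ?M ?X (f V) = \<one>\<^bsub>sec \<O> ?X\<^esub>"
        using f(2)[OF V(1)] O_res_one[OF oW oX] by simp
      \<comment> \<open>The cover data do not say that \<open>W V\<close> lies in \<open>V\<close>,
        so \<open>V\<close> might miss \<open>Q\<close> and be absent from \<open>J Q\<close>.
        Inserting it is harmless, since its factor over \<open>Q\<close> would then be 1.\<close>
      have eq: "pr Q (J Q) = pr Q (insert V (J Q))"
        by (rule pr_mono[symmetric]) (use fin JV V oQ in \<open>auto simp: J_def\<close>)
      have ins: "insert V (J Q) = insert V (J Q - {V})" by auto
      have "res \<O> Q ?X (pr Q (insert V (J Q))) = pr ?X (insert V (J Q))"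
        using JV V(1) oQ oX by (intro res_pr) auto
      also have "\<dots> = (\<one>\<^bsub>sec \<O> ?X\<^esub> \<ominus>\<^bsub>sec \<O> ?X\<^esub> res \<O> ?M ?X (f V)) \<otimes>\<^bsub>sec \<O> ?X\<^esub> pr ?X (J Q - {V})"
        unfolding pr_def ins using fin fac oX JV V(1) by (intro X.finprod_insert) auto
      also have "\<dots> = \<zero>\<^bsub>sec \<O> ?X\<^esub>"
        using prc[OF order_trans[OF Diff_subset JV] oX] unfolding one by (simp add: X.minus_eq X.r_neg)
      finally have "res \<O> Q ?X (pr Q (J Q)) = res \<O> Q ?X \<zero>\<^bsub>sec \<O> Q\<^esub>"
        using O_res_zero[OF oQ oX] unfolding eq by simp
      then show "\<exists>X. openin T X \<and> b \<in> X \<and> X \<subseteq> Q \<and> res \<O> Q X (pr Q (J Q)) = res \<O> Q X \<zero>\<^bsub>sec \<O> Q\<^esub>"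
        using oX b V(2) by (intro exI[of _ ?X]) auto
    qed simp
    moreover have "finsum (sec \<O> Q) (\<lambda>V. res \<O> ?M Q (f V) \<otimes>\<^bsub>sec \<O> Q\<^esub> s V Q) (J Q) \<oplus>\<^bsub>sec \<O> Q\<^esub> pr Q (J Q) = \<one>\<^bsub>sec \<O> Q\<^esub>"
      unfolding s_def pr_def by (rule R.telescope_finprod[OF fin r]) (use rfc oQ JV in auto)
    moreover have tc: "(\<lambda>V. res \<O> ?M Q (f V) \<otimes>\<^bsub>sec \<O> Q\<^esub> s V Q) \<in> J Q \<rightarrow> carrier (sec \<O> Q)"
    proof (intro Pi_I R.m_closed)
      fix V assume V: "V \<in> J Q"
      show "res \<O> ?M Q (f V) \<in> carrier (sec \<O> Q)" using V JV by (intro rfc oQ) blast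
      show "s V Q \<in> carrier (sec \<O> Q)" unfolding s_def by (rule prc[OF _ oQ]) (use JV in blast)
    qed
    ultimately have "finsum (sec \<O> Q) (\<lambda>V. res \<O> ?M Q (f V) \<otimes>\<^bsub>sec \<O> Q\<^esub> s V Q) (J Q) = \<one>\<^bsub>sec \<O> Q\<^esub>"
      using R.finsum_closed[OF tc] by simp
    moreover have "finsum (sec \<O> Q) (\<lambda>V. res \<O> ?M Q (g V)) (J Q) = finsum (sec \<O> Q) (\<lambda>V. res \<O> ?M Q (f V) \<otimes>\<^bsub>sec \<O> Q\<^esub> s V Q) (J Q)"
      by (rule R.finsum_cong'[OF refl tc]) (use res_g oQ JV p(2)[OF Q(1)] in auto)
    ultimately show "\<exists>Q J. openin T Q \<and> a \<in> Q \<and> finite J \<and> J \<subseteq> \<V> \<and> (\<forall>i\<in>\<V> - J. Z i \<inter> Q = {}) \<and>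
        finsum (sec \<O> Q) (\<lambda>i. res \<O> ?M Q (g i)) J = \<one>\<^bsub>sec \<O> Q\<^esub>"
      using oQ Q(2) fin JV \<V>(5) by (intro exI[of _ Q] exI[of _ "J Q"]) (auto simp: J_def)
  qed (use \<V> in blast)+
qed

end

section \<open>Stalks and values\<close>

text \<open>Krull's theorem by Zorn's lemma on the ideals that contain \<open>a\<close> but not 1.
  Since \<open>a\<close> is not a unit, the principal ideal it generates is one of them, and both
  conditions survive unions of chains.\<close>

lemma (in cring) nonunit_in_maximalideal:
  assumes a: "a \<in> carrier R" "a \<notin> Units R"
  shows "\<exists>M. maximalideal M R \<and> a \<in> M"
proof -
  define A where "A = {J. ideal J R \<and> a \<in> J \<and> \<one> \<notin> J}"
  have "\<one> \<notin> PIdl a"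
  proof
    assume "\<one> \<in> PIdl a"
    then obtain x where "x \<in> carrier R" "\<one> = x \<otimes> a" unfolding cgenideal_def by blast
    then show False using a unfolding Units_def using m_comm by auto
  qed
  then have "PIdl a \<in> A" using a cgenideal_ideal cgenideal_self by (simp add: A_def)
  then have "A \<noteq> {}" by blast
  then have "\<exists>M\<in>A. \<forall>X\<in>A. M \<subseteq> X \<longrightarrow> X = M"
  proof (rule subset_Zorn_nonempty)
    fix C assume C: "C \<noteq> {}" "subset.chain A C"
    then have sub: "C \<subseteq> A" by (simp add: subset.chain_def)
    have "subset.chain {I. ideal I R} C"
      using C(2) unfolding subset.chain_def A_def by blast
    then have "ideal (\<Union>C) R" using chain_Union_is_ideal[of C] C(1) by simp
    moreover have "a \<in> \<Union>C" "\<one> \<notin> \<Union>C" using C(1) sub unfolding A_def by blast+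
    ultimately show "\<Union>C \<in> A" by (simp add: A_def)
  qed
  then obtain M where M: "ideal M R" "a \<in> M" "\<one> \<notin> M" "\<And>X. X \<in> A \<Longrightarrow> M \<subseteq> X \<Longrightarrow> X = M"
    unfolding A_def by blast
  have "maximalideal M R"
  proof (rule maximalidealI[OF M(1)])
    show "carrier R \<noteq> M" using M(3) one_closed by blast
    fix J assume J: "ideal J R" "M \<subseteq> J" "J \<subseteq> carrier R"
    show "J = M \<or> J = carrier R"
    proof (cases "\<one> \<in> J")
      case True
      then show ?thesis using ideal.one_imp_carrier[OF J(1)] by blast
    next
      case False
      then have "J \<in> A" using J M(2) by (auto simp: A_def)
      then show ?thesis using M(4) J(2) by blast
    qed
  qed
  then show ?thesis using M(2) by blast
qed

lemma germ_eqI: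
  assumes P: "set_sheaf T P" and U: "openin T U" "s \<in> carrier (sec P U)" and V: "openin T V" "t \<in> carrier (sec P V)"
    and W: "openin T W" "a \<in> W" "W \<subseteq> U" "W \<subseteq> V" "res P U W s = res P V W t"
  shows "germ T P a U s = germ T P a V t"
proof -
  have *: "germ T P a U s \<subseteq> germ T P a V t" if U: "openin T U" "s \<in> carrier (sec P U)" and V: "openin T V" "t \<in> carrier (sec P V)"
    and W: "openin T W" "a \<in> W" "W \<subseteq> U" "W \<subseteq> V" "res P U W s = res P V W t" for U V W s t
  proof
    fix z assume "z \<in> germ T P a U s"
    then obtain X x Y where z: "z = (X, x)" and X: "openin T X" "a \<in> X" "x \<in> carrier (sec P X)"
      and Y: "openin T Y" "a \<in> Y" "Y \<subseteq> U \<inter> X" "res P U Y s = res P X Y x"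
      unfolding germ_def by blast
    have oWY: "openin T (W \<inter> Y)" using W Y by blast
    have "res P V (W \<inter> Y) t = res P W (W \<inter> Y) (res P V W t)"
      using sheaf_res_res[OF P V(1) W(1) oWY W(4) _ V(2)] by simp
    also have "\<dots> = res P U (W \<inter> Y) s"
      using sheaf_res_res[OF P U(1) W(1) oWY W(3) _ U(2)] W(5) by simp
    also have "\<dots> = res P Y (W \<inter> Y) (res P U Y s)"
      using sheaf_res_res[OF P U(1) Y(1) oWY _ _ U(2)] Y(3) by simp
    also have "\<dots> = res P X (W \<inter> Y) x"
      using sheaf_res_res[OF P X(1) Y(1) oWY _ _ X(3)] Y(3,4) by simp
    finally show "z \<in> germ T P a V t"
      unfolding germ_def z using X W Y oWY by (auto intro!: exI[of _ "W \<inter> Y"])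
  qed
  show ?thesis
    by (intro equalityI *[OF U V W] *[OF V U W(1,2,4,3) W(5)[symmetric]])
qed

lemma germ_self:
  "openin T U \<Longrightarrow> a \<in> U \<Longrightarrow> s \<in> carrier (sec P U) \<Longrightarrow> (U, s) \<in> germ T P a U s"
  unfolding germ_def by auto

context algebra_sheaf_space
begin

lemma germ_res:
  assumes "openin T U" "openin T V" "a \<in> V" "V \<subseteq> U" "s \<in> carrier (sec \<O> U)"
  shows "germ T \<O> a V (res \<O> U V s) = germ T \<O> a U s"
  by (rule germ_eqI[OF set_sheaf_O, of _ _ _ _ V])
     (use assms O_res_closed O_res_id in auto)

lemma stalk_smult:
  assumes U: "openin T U" "a \<in> U" "s \<in> carrier (sec \<O> U)"
  shows "c \<odot>\<^bsub>stalk T \<O> a\<^esub> germ T \<O> a U s = germ T \<O> a U (c \<odot>\<^bsub>sec \<O> U\<^esub> s)"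
proof -
  have cc: "c \<odot>\<^bsub>sec \<O> W\<^esub> x \<in> carrier (sec \<O> W)" if "openin T W" "x \<in> carrier (sec \<O> W)" for W x
    using module.smult_closed[OF O_module[OF that(1)], of c x] that(2) by simp
  have "germ T \<O> a V (c \<odot>\<^bsub>sec \<O> V\<^esub> t) = germ T \<O> a U (c \<odot>\<^bsub>sec \<O> U\<^esub> s)" if z: "(V, t) \<in> germ T \<O> a U s" for V t
  proof -
    obtain W where V: "openin T V" "t \<in> carrier (sec \<O> V)" and W: "openin T W" "a \<in> W" "W \<subseteq> U" "W \<subseteq> V" "res \<O> U W s = res \<O> V W t"
      using z unfolding germ_def by blast
    show ?thesis
      by (rule germ_eqI[OF set_sheaf_O V(1) cc[OF V] U(1) cc[OF U(1,3)] W(1,2,4,3)])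
         (simp only: O_res_smult[OF U(1) W(1,3) U(3)] O_res_smult[OF V(1) W(1,4) V(2)] W(5))
  qed
  then have "(\<Union>(V, t)\<in>germ T \<O> a U s. germ T \<O> a V (c \<odot>\<^bsub>sec \<O> V\<^esub> t)) = germ T \<O> a U (c \<odot>\<^bsub>sec \<O> U\<^esub> s)"
    using germ_self[where P = \<O>, OF U] by (intro SUP_eq_const) (blast, clarify)
  then show ?thesis by (simp add: stalk_def)
qed

text \<open>The operations of \<open>stalk\<close> are unions over all pairs of representatives, so
  well-definedness amounts to all these germs coinciding. Any two pairs are compared on the
  intersection of the neighbourhoods where the representatives agree. The operation \<open>b\<close>
  stays abstract to cover both sum and product.\<close>

lemma stalk_binop:
  assumes U: "openin T U" "a \<in> U" "s \<in> carrier (sec \<O> U)" and V: "openin T V" "a \<in> V" "t \<in> carrier (sec \<O> V)"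
    and cl: "\<And>W x y. openin T W \<Longrightarrow> x \<in> carrier (sec \<O> W) \<Longrightarrow> y \<in> carrier (sec \<O> W) \<Longrightarrow> b W x y \<in> carrier (sec \<O> W)"
    and res: "\<And>W W' x y. openin T W \<Longrightarrow> openin T W' \<Longrightarrow> W' \<subseteq> W \<Longrightarrow> x \<in> carrier (sec \<O> W) \<Longrightarrow> y \<in> carrier (sec \<O> W) \<Longrightarrow>
      res \<O> W W' (b W x y) = b W' (res \<O> W W' x) (res \<O> W W' y)"
  shows "(\<Union>(U', s')\<in>germ T \<O> a U s. \<Union>(V', t')\<in>germ T \<O> a V t.
      germ T \<O> a (U' \<inter> V') (b (U' \<inter> V') (res \<O> U' (U' \<inter> V') s') (res \<O> V' (U' \<inter> V') t')))
    = germ T \<O> a (U \<inter> V) (b (U \<inter> V) (res \<O> U (U \<inter> V) s) (res \<O> V (U \<inter> V) t))"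
proof -
  let ?g = "\<lambda>U s V t. germ T \<O> a (U \<inter> V) (b (U \<inter> V) (res \<O> U (U \<inter> V) s) (res \<O> V (U \<inter> V) t))"
  have "?g U' s' V' t' = ?g U s V t" if s': "(U', s') \<in> germ T \<O> a U s" and t': "(V', t') \<in> germ T \<O> a V t" for U' s' V' t'
  proof -
    obtain X where U': "openin T U'" "s' \<in> carrier (sec \<O> U')" and X: "openin T X" "a \<in> X" "X \<subseteq> U" "X \<subseteq> U'" "res \<O> U X s = res \<O> U' X s'"
      using s' unfolding germ_def by blast
    obtain Y where V': "openin T V'" "t' \<in> carrier (sec \<O> V')" and Y: "openin T Y" "a \<in> Y" "Y \<subseteq> V" "Y \<subseteq> V'" "res \<O> V Y t = res \<O> V' Y t'"
      using t' unfolding germ_def by blast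
    have oXY: "openin T (X \<inter> Y)" and oUV: "openin T (U \<inter> V)" "openin T (U' \<inter> V')" using X Y U V U' V' by auto
    have c: "b (P \<inter> Q) (res \<O> P (P \<inter> Q) p) (res \<O> Q (P \<inter> Q) q) \<in> carrier (sec \<O> (P \<inter> Q))"
      if "openin T P" "openin T Q" "p \<in> carrier (sec \<O> P)" "q \<in> carrier (sec \<O> Q)" for P Q p q
      using that by (intro cl O_res_closed) auto
    have r: "res \<O> (P \<inter> Q) (X \<inter> Y) (b (P \<inter> Q) (res \<O> P (P \<inter> Q) p) (res \<O> Q (P \<inter> Q) q)) = b (X \<inter> Y) (res \<O> P (X \<inter> Y) p) (res \<O> Q (X \<inter> Y) q)"
      if "openin T P" "openin T Q" "p \<in> carrier (sec \<O> P)" "q \<in> carrier (sec \<O> Q)" "X \<inter> Y \<subseteq> P \<inter> Q" for P Q p q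
    proof -
      have oPQ: "openin T (P \<inter> Q)" using that by auto
      then show ?thesis
        using that oXY by (subst res) (auto intro!: O_res_closed simp: O_res_res)
    qed
    have 1: "res \<O> U (X \<inter> Y) s = res \<O> U' (X \<inter> Y) s'"
      using O_res_res[OF U(1) X(1) oXY X(3) _ U(3)] O_res_res[OF U'(1) X(1) oXY X(4) _ U'(2)] X(5) by simp
    have 2: "res \<O> V (X \<inter> Y) t = res \<O> V' (X \<inter> Y) t'"
      using O_res_res[OF V(1) Y(1) oXY Y(3) _ V(3)] O_res_res[OF V'(1) Y(1) oXY Y(4) _ V'(2)] Y(5) by simp
    have sub: "X \<inter> Y \<subseteq> U \<inter> V" "X \<inter> Y \<subseteq> U' \<inter> V'" using X Y by blast+
    show ?thesis
    proof (rule germ_eqI[OF set_sheaf_O oUV(2) c[OF U'(1) V'(1) U'(2) V'(2)] oUV(1) c[OF U(1) V(1) U(3) V(3)] oXY _ sub(2,1)])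
      show "a \<in> X \<inter> Y" using X Y by blast
      show "res \<O> (U' \<inter> V') (X \<inter> Y) (b (U' \<inter> V') (res \<O> U' (U' \<inter> V') s') (res \<O> V' (U' \<inter> V') t')) =
          res \<O> (U \<inter> V) (X \<inter> Y) (b (U \<inter> V) (res \<O> U (U \<inter> V) s) (res \<O> V (U \<inter> V) t))"
        unfolding r[OF U'(1) V'(1) U'(2) V'(2) sub(2)] r[OF U(1) V(1) U(3) V(3) sub(1)] 1 2 ..
    qed
  qed
  moreover have "(U, s) \<in> germ T \<O> a U s" "(V, t) \<in> germ T \<O> a V t"
    using germ_self[where P = \<O>, OF U] germ_self[where P = \<O>, OF V] by auto
  ultimately show ?thesis by fast
qed

lemma stalk_mult:
  assumes U: "openin T U" "a \<in> U" "s \<in> carrier (sec \<O> U)" and V: "openin T V" "a \<in> V" "t \<in> carrier (sec \<O> V)"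
  shows "germ T \<O> a U s \<otimes>\<^bsub>stalk T \<O> a\<^esub> germ T \<O> a V t =
    germ T \<O> a (U \<inter> V) (res \<O> U (U \<inter> V) s \<otimes>\<^bsub>sec \<O> (U \<inter> V)\<^esub> res \<O> V (U \<inter> V) t)"
proof -
  have "x \<otimes>\<^bsub>sec \<O> W\<^esub> y \<in> carrier (sec \<O> W)"
    if "openin T W" "x \<in> carrier (sec \<O> W)" "y \<in> carrier (sec \<O> W)" for W x y
    using O_cring[OF that(1)] that(2,3) by (rule cring.cring_simprules(5))
  from stalk_binop[OF U V, of "\<lambda>W. mult (sec \<O> W)", OF this ring_hom_mult[OF O_res_hom]]
  show ?thesis by (simp add: stalk_def)
qed

lemma stalk_add:
  assumes U: "openin T U" "a \<in> U" "s \<in> carrier (sec \<O> U)" and V: "openin T V" "a \<in> V" "t \<in> carrier (sec \<O> V)"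
  shows "germ T \<O> a U s \<oplus>\<^bsub>stalk T \<O> a\<^esub> germ T \<O> a V t =
    germ T \<O> a (U \<inter> V) (res \<O> U (U \<inter> V) s \<oplus>\<^bsub>sec \<O> (U \<inter> V)\<^esub> res \<O> V (U \<inter> V) t)"
proof -
  have "x \<oplus>\<^bsub>sec \<O> W\<^esub> y \<in> carrier (sec \<O> W)"
    if "openin T W" "x \<in> carrier (sec \<O> W)" "y \<in> carrier (sec \<O> W)" for W x y
    using O_cring[OF that(1)] that(2,3) by (rule cring.cring_simprules(1))
  from stalk_binop[OF U V, of "\<lambda>W. add (sec \<O> W)", OF this ring_hom_add[OF O_res_hom]]
  show ?thesis by (simp add: stalk_def)
qed

lemma stalk_add_same:
  assumes U: "openin T U" "a \<in> U" "s \<in> carrier (sec \<O> U)" "t \<in> carrier (sec \<O> U)"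
  shows "germ T \<O> a U s \<oplus>\<^bsub>stalk T \<O> a\<^esub> germ T \<O> a U t = germ T \<O> a U (s \<oplus>\<^bsub>sec \<O> U\<^esub> t)"
  using stalk_add[OF U(1,2,3) U(1,2,4)] U by (simp add: O_res_id)

lemma stalk_mult_same:
  assumes U: "openin T U" "a \<in> U" "s \<in> carrier (sec \<O> U)" "t \<in> carrier (sec \<O> U)"
  shows "germ T \<O> a U s \<otimes>\<^bsub>stalk T \<O> a\<^esub> germ T \<O> a U t = germ T \<O> a U (s \<otimes>\<^bsub>sec \<O> U\<^esub> t)"
  using stalk_mult[OF U(1,2,3) U(1,2,4)] U by (simp add: O_res_id)

lemma stalk_one:
  assumes "openin T U" "a \<in> U"
  shows "\<one>\<^bsub>stalk T \<O> a\<^esub> = germ T \<O> a U \<one>\<^bsub>sec \<O> U\<^esub>"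
proof -
  interpret cring "sec \<O> (topspace T)" by (rule O_cring) simp
  show ?thesis
    using germ_res[of "topspace T" U a "\<one>\<^bsub>sec \<O> (topspace T)\<^esub>"] assms openin_subset[OF assms(1)]
    by (simp add: stalk_def O_res_one)
qed

lemma germ_in_stalk:
  "openin T U \<Longrightarrow> a \<in> U \<Longrightarrow> s \<in> carrier (sec \<O> U) \<Longrightarrow> germ T \<O> a U s \<in> carrier (stalk T \<O> a)"
  by (auto simp: stalk_def)

end

context formal_manifold_space
begin

lemma local_ring_stalk: "a \<in> topspace T \<Longrightarrow> local_ring (stalk T \<O> a)"
  using formal_manifold by (simp add: formal_manifold_def locally_ringed_space_def)

definition max_ideal :: "'p \<Rightarrow> ('p set \<times> 'a) set set" where
  "max_ideal a = (THE I. maximalideal I (stalk T \<O> a))"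

lemma max_ideal: "a \<in> topspace T \<Longrightarrow> maximalideal (max_ideal a) (stalk T \<O> a)"
  using local_ring_stalk theI'[of "\<lambda>I. maximalideal I (stalk T \<O> a)"]
  by (simp add: local_ring_def max_ideal_def)

lemma nonunit_in_max_ideal:
  assumes a: "a \<in> topspace T" and x: "x \<in> carrier (stalk T \<O> a)" "x \<notin> Units (stalk T \<O> a)"
  shows "x \<in> max_ideal a"
proof -
  have cr: "cring (stalk T \<O> a)" and u: "\<exists>!I. maximalideal I (stalk T \<O> a)"
    using local_ring_stalk[OF a] by (auto simp: local_ring_def)
  then obtain M where "maximalideal M (stalk T \<O> a)" "x \<in> M"
    using cring.nonunit_in_maximalideal[OF cr x] by blast
  then show ?thesis using max_ideal[OF a] u by blast
qed

text \<open>\<open>eval_at\<close> is a definite description, so uniqueness has to be secured: two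
  different values would place the germ of a nonzero constant, which is invertible, into the maximal
  ideal.\<close>

lemma eval_at_eqI:
  assumes U: "openin T U" "a \<in> U" "f \<in> carrier (sec \<O> U)"
    and f: "germ T \<O> a U (f \<ominus>\<^bsub>sec \<O> U\<^esub> c \<odot>\<^bsub>sec \<O> U\<^esub> \<one>\<^bsub>sec \<O> U\<^esub>) \<in> max_ideal a"
  shows "eval_at T \<O> U f a = c"
proof -
  let ?R = "stalk T \<O> a" and ?S = "sec \<O> U"
  have a: "a \<in> topspace T" using U openin_subset by blast
  interpret S: Module.algebra "\<complex>\<^sub>R" ?S by (rule O_algebra[OF U(1)])
  interpret R: cring ?R using local_ring_stalk[OF a] by (simp add: local_ring_def)
  interpret I: maximalideal "max_ideal a" ?R by (rule max_ideal[OF a])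
  let ?g = "germ T \<O> a U"
  have g: "?g s \<in> carrier ?R" if "s \<in> carrier ?S" for s by (rule germ_in_stalk[OF U(1,2) that])
  have k: "k \<odot>\<^bsub>?S\<^esub> \<one>\<^bsub>?S\<^esub> \<in> carrier ?S" for k by (rule S.smult_closed) simp_all
  have kR: "k \<odot>\<^bsub>?R\<^esub> \<one>\<^bsub>?R\<^esub> = ?g (k \<odot>\<^bsub>?S\<^esub> \<one>\<^bsub>?S\<^esub>)" for k
    using stalk_smult[OF U(1,2)] stalk_one[OF U(1,2)] by simp
  have diff: "?g s \<ominus>\<^bsub>?R\<^esub> ?g t = ?g (s \<ominus>\<^bsub>?S\<^esub> t)" if "s \<in> carrier ?S" "t \<in> carrier ?S" for s t
  proof -
    have "?g (s \<ominus>\<^bsub>?S\<^esub> t) \<oplus>\<^bsub>?R\<^esub> ?g t = ?g s"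
      using stalk_add_same[OF U(1,2), of "s \<ominus>\<^bsub>?S\<^esub> t" t] that by (simp add: S.minus_eq S.a_assoc S.l_neg)
    then have "?g s \<ominus>\<^bsub>?R\<^esub> ?g t = ?g (s \<ominus>\<^bsub>?S\<^esub> t) \<oplus>\<^bsub>?R\<^esub> ?g t \<ominus>\<^bsub>?R\<^esub> ?g t" by simp
    also have "\<dots> = ?g (s \<ominus>\<^bsub>?S\<^esub> t)"
      using g[of t] g[of "s \<ominus>\<^bsub>?S\<^esub> t"] that by (simp add: R.minus_eq R.a_assoc R.r_neg)
    finally show ?thesis .
  qed
  have coset: "max_ideal a +>\<^bsub>?R\<^esub> ?g f = max_ideal a +>\<^bsub>?R\<^esub> (d \<odot>\<^bsub>?R\<^esub> \<one>\<^bsub>?R\<^esub>) \<longleftrightarrow>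
      ?g (f \<ominus>\<^bsub>?S\<^esub> d \<odot>\<^bsub>?S\<^esub> \<one>\<^bsub>?S\<^esub>) \<in> max_ideal a" for d
    using R.quotient_eq_iff_same_a_r_cos[OF I.ideal_axioms g[OF U(3)] g[OF k[of d]]] diff[OF U(3) k[of d]]
    by (simp add: kR)
  have "d = c" if d: "?g (f \<ominus>\<^bsub>?S\<^esub> d \<odot>\<^bsub>?S\<^esub> \<one>\<^bsub>?S\<^esub>) \<in> max_ideal a" for d
  proof (rule ccontr)
    assume "d \<noteq> c"
    let ?x = "f \<ominus>\<^bsub>?S\<^esub> c \<odot>\<^bsub>?S\<^esub> \<one>\<^bsub>?S\<^esub>" and ?y = "f \<ominus>\<^bsub>?S\<^esub> d \<odot>\<^bsub>?S\<^esub> \<one>\<^bsub>?S\<^esub>"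
    have xy: "?x \<in> carrier ?S" "?y \<in> carrier ?S" using U(3) k by simp_all
    have "?g ?x \<ominus>\<^bsub>?R\<^esub> ?g ?y \<in> max_ideal a"
      using f d unfolding R.minus_eq by (intro I.a_closed I.a_inv_closed)
    then have "?g (?x \<ominus>\<^bsub>?S\<^esub> ?y) \<in> max_ideal a" using diff[OF xy] by simp
    moreover have "?x \<ominus>\<^bsub>?S\<^esub> ?y = (d - c) \<odot>\<^bsub>?S\<^esub> \<one>\<^bsub>?S\<^esub>"
    proof -
      have "?x \<ominus>\<^bsub>?S\<^esub> ?y = d \<odot>\<^bsub>?S\<^esub> \<one>\<^bsub>?S\<^esub> \<ominus>\<^bsub>?S\<^esub> c \<odot>\<^bsub>?S\<^esub> \<one>\<^bsub>?S\<^esub>"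
        using U(3) k[of c] k[of d] by (simp add: S.minus_eq S.minus_add S.a_ac S.r_neg1 S.r_neg2)
      also have "\<dots> = d \<odot>\<^bsub>?S\<^esub> \<one>\<^bsub>?S\<^esub> \<oplus>\<^bsub>?S\<^esub> (- c) \<odot>\<^bsub>?S\<^esub> \<one>\<^bsub>?S\<^esub>"
        using S.smult_l_minus[of c "\<one>\<^bsub>?S\<^esub>"] by (simp add: S.minus_eq)
      also have "\<dots> = (d - c) \<odot>\<^bsub>?S\<^esub> \<one>\<^bsub>?S\<^esub>"
        using S.smult_l_distr[of d "- c" "\<one>\<^bsub>?S\<^esub>"] by simp
      finally show ?thesis .
    qed
    ultimately have m: "?g ((d - c) \<odot>\<^bsub>?S\<^esub> \<one>\<^bsub>?S\<^esub>) \<in> max_ideal a" by simp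
    let ?i = "inverse (d - c)"
    \<comment> \<open>The constants d - c and its inverse multiply to 1 already over
      \<open>U\<close>, before passing to germs.\<close>
    have "((d - c) \<odot>\<^bsub>?S\<^esub> \<one>\<^bsub>?S\<^esub>) \<otimes>\<^bsub>?S\<^esub> (?i \<odot>\<^bsub>?S\<^esub> \<one>\<^bsub>?S\<^esub>) = (d - c) \<odot>\<^bsub>?S\<^esub> (?i \<odot>\<^bsub>?S\<^esub> \<one>\<^bsub>?S\<^esub>)"
      using S.smult_assoc2[of "d - c" "\<one>\<^bsub>?S\<^esub>" "?i \<odot>\<^bsub>?S\<^esub> \<one>\<^bsub>?S\<^esub>"] k[of ?i] by simp
    also have "\<dots> = \<one>\<^bsub>?S\<^esub>"
      using S.smult_assoc1[of "d - c" ?i "\<one>\<^bsub>?S\<^esub>"] S.smult_one[of "\<one>\<^bsub>?S\<^esub>"] \<open>d \<noteq> c\<close> by simp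
    finally have "?g ((d - c) \<odot>\<^bsub>?S\<^esub> \<one>\<^bsub>?S\<^esub>) \<otimes>\<^bsub>?R\<^esub> ?g (?i \<odot>\<^bsub>?S\<^esub> \<one>\<^bsub>?S\<^esub>) = \<one>\<^bsub>?R\<^esub>"
      using stalk_mult_same[OF U(1,2) k[of "d - c"] k[of ?i]] stalk_one[OF U(1,2)] by simp
    then have "\<one>\<^bsub>?R\<^esub> \<in> max_ideal a"
      using I.I_r_closed[OF m g[OF k[of ?i]]] by simp
    then show False using I.one_imp_carrier I.I_notcarr by blast
  qed
  then have "(THE d. max_ideal a +>\<^bsub>?R\<^esub> ?g f = max_ideal a +>\<^bsub>?R\<^esub> (d \<odot>\<^bsub>?R\<^esub> \<one>\<^bsub>?R\<^esub>)) = c"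
    unfolding coset by - (rule the_equality, rule f)
  then show ?thesis by (simp add: eval_at_def Let_def max_ideal_def)
qed

lemma eval_at_res:
  assumes "openin T U" "openin T V" "a \<in> V" "V \<subseteq> U" "f \<in> carrier (sec \<O> U)"
  shows "eval_at T \<O> V (res \<O> U V f) a = eval_at T \<O> U f a"
  using germ_res[OF assms] by (simp add: eval_at_def)

lemma eval_at_zero:
  assumes U: "openin T U" "a \<in> U"
  shows "eval_at T \<O> U \<zero>\<^bsub>sec \<O> U\<^esub> a = 0"
proof (rule eval_at_eqI[OF U])
  let ?S = "sec \<O> U"
  have a: "a \<in> topspace T" using U openin_subset by blast
  interpret S: Module.algebra "\<complex>\<^sub>R" ?S by (rule O_algebra[OF U(1)])
  interpret R: cring "stalk T \<O> a" using local_ring_stalk[OF a] by (simp add: local_ring_def)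
  interpret I: maximalideal "max_ideal a" "stalk T \<O> a" by (rule max_ideal[OF a])
  show "\<zero>\<^bsub>?S\<^esub> \<in> carrier ?S" by simp
  let ?z = "germ T \<O> a U \<zero>\<^bsub>?S\<^esub>"
  have zc: "?z \<in> carrier (stalk T \<O> a)" by (rule germ_in_stalk[OF U]) simp
  have "?z \<oplus>\<^bsub>stalk T \<O> a\<^esub> ?z = ?z"
    using stalk_add_same[OF U, of "\<zero>\<^bsub>?S\<^esub>" "\<zero>\<^bsub>?S\<^esub>"] by simp
  then have "?z \<oplus>\<^bsub>stalk T \<O> a\<^esub> (?z \<oplus>\<^bsub>stalk T \<O> a\<^esub> \<ominus>\<^bsub>stalk T \<O> a\<^esub> ?z) = ?z \<oplus>\<^bsub>stalk T \<O> a\<^esub> \<ominus>\<^bsub>stalk T \<O> a\<^esub> ?z"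
    using R.a_assoc[of ?z ?z "\<ominus>\<^bsub>stalk T \<O> a\<^esub> ?z"] zc by simp
  then have "?z = \<zero>\<^bsub>stalk T \<O> a\<^esub>" using zc by (simp add: R.r_neg)
  moreover have n: "0 \<odot>\<^bsub>?S\<^esub> \<one>\<^bsub>?S\<^esub> = \<zero>\<^bsub>?S\<^esub>"
    using S.smult_l_null[of "\<one>\<^bsub>?S\<^esub>"] by simp
  moreover have "\<zero>\<^bsub>?S\<^esub> \<ominus>\<^bsub>?S\<^esub> \<zero>\<^bsub>?S\<^esub> = \<zero>\<^bsub>?S\<^esub>"
    unfolding S.minus_eq by (rule S.r_neg) simp
  ultimately show "germ T \<O> a U (\<zero>\<^bsub>?S\<^esub> \<ominus>\<^bsub>?S\<^esub> 0 \<odot>\<^bsub>?S\<^esub> \<one>\<^bsub>?S\<^esub>) \<in> max_ideal a"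
    using I.zero_closed by (simp only:)
qed

end

section \<open>Sections of the formal model and their values\<close>

lemma Ck_on_subset:
  "V \<subseteq> U \<Longrightarrow> Ck_on n r U f \<Longrightarrow> Ck_on n r V f"
  by (induction r arbitrary: f) (auto intro: continuous_map_from_subtopology_mono)

lemma smooth_functionsI:
  assumes "openin (Euclidean_space n) U" "\<And>r. Ck_on n r U f"
  shows "(\<lambda>x\<in>U. f x) \<in> smooth_functions n U"
  unfolding smooth_functions_def using Ck_on_cong[OF assms, where g = "\<lambda>x\<in>U. f x"] by simp

lemma smooth_functionsD: "f \<in> smooth_functions n U \<Longrightarrow> Ck_on n r U f"
  by (simp add: smooth_functions_def)

lemma formal_model_simps:
  "carrier (sec (formal_model n k) U) = multi_indices k \<rightarrow>\<^sub>E smooth_functions n U"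
  "f \<otimes>\<^bsub>sec (formal_model n k) U\<^esub> g = (\<lambda>\<alpha>\<in>multi_indices k. \<lambda>x\<in>U. \<Sum>\<beta>\<in>{\<beta>. \<beta> \<le> \<alpha>}. f \<beta> x * g (\<lambda>i. \<alpha> i - \<beta> i) x)"
  "\<one>\<^bsub>sec (formal_model n k) U\<^esub> = (\<lambda>\<alpha>\<in>multi_indices k. \<lambda>x\<in>U. if \<alpha> = (\<lambda>_. 0) then 1 else 0)"
  "f \<oplus>\<^bsub>sec (formal_model n k) U\<^esub> g = (\<lambda>\<alpha>\<in>multi_indices k. \<lambda>x\<in>U. f \<alpha> x + g \<alpha> x)"
  "c \<odot>\<^bsub>sec (formal_model n k) U\<^esub> f = (\<lambda>\<alpha>\<in>multi_indices k. \<lambda>x\<in>U. c * f \<alpha> x)"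
  "res (formal_model n k) U V f = (\<lambda>\<alpha>\<in>multi_indices k. restrict (f \<alpha>) V)"
  by (simp_all add: formal_model_def)

lemma zero_multi_index: "(\<lambda>_. 0) \<in> multi_indices k"
  by (simp add: multi_indices_def)

context
  fixes n k :: nat and U :: "(nat \<Rightarrow> real) set"
  assumes U: "openin (Euclidean_space n) U"
begin

lemma formal_model_mult_closed:
  assumes "f \<in> carrier (sec (formal_model n k) U)" "g \<in> carrier (sec (formal_model n k) U)"
  shows "f \<otimes>\<^bsub>sec (formal_model n k) U\<^esub> g \<in> carrier (sec (formal_model n k) U)"
  unfolding formal_model_simps
proof (intro restrict_PiE_iff[THEN iffD2] ballI smooth_functionsI[OF U] Ck_on_sum[OF U] Ck_on_mult[OF U])
  fix \<alpha> \<beta> r assume "\<alpha> \<in> multi_indices k" "\<beta> \<in> {\<beta>. \<beta> \<le> \<alpha>}"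
  then have "\<beta> \<in> multi_indices k" "(\<lambda>i. \<alpha> i - \<beta> i) \<in> multi_indices k"
    by (auto simp: multi_indices_def le_fun_def) (metis le_zero_eq)
  then show "Ck_on n r U (f \<beta>)" "Ck_on n r U (g (\<lambda>i. \<alpha> i - \<beta> i))"
    using assms by (auto simp: formal_model_simps intro: smooth_functionsD)
qed

lemma formal_model_add_closed:
  assumes "f \<in> carrier (sec (formal_model n k) U)" "g \<in> carrier (sec (formal_model n k) U)"
  shows "f \<oplus>\<^bsub>sec (formal_model n k) U\<^esub> g \<in> carrier (sec (formal_model n k) U)"
  unfolding formal_model_simps
  by (intro restrict_PiE_iff[THEN iffD2] ballI smooth_functionsI[OF U] Ck_on_add[OF U])
     (use assms in \<open>auto simp: formal_model_simps intro: smooth_functionsD\<close>)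

lemma formal_model_smult_closed:
  assumes "f \<in> carrier (sec (formal_model n k) U)"
  shows "c \<odot>\<^bsub>sec (formal_model n k) U\<^esub> f \<in> carrier (sec (formal_model n k) U)"
  unfolding formal_model_simps
  by (intro restrict_PiE_iff[THEN iffD2] ballI smooth_functionsI[OF U] Ck_on_mult[OF U] Ck_on_const)
     (use assms in \<open>auto simp: formal_model_simps intro: smooth_functionsD\<close>)

lemma formal_model_one_closed: "\<one>\<^bsub>sec (formal_model n k) U\<^esub> \<in> carrier (sec (formal_model n k) U)"
  unfolding formal_model_simps
  by (intro restrict_PiE_iff[THEN iffD2] ballI smooth_functionsI[OF U] Ck_on_const)

lemma formal_model_res_closed:
  assumes "f \<in> carrier (sec (formal_model n k) V)" "U \<subseteq> V"
  shows "res (formal_model n k) V U f \<in> carrier (sec (formal_model n k) U)"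
  unfolding formal_model_simps
  by (intro restrict_PiE_iff[THEN iffD2] ballI smooth_functionsI[OF U] Ck_on_subset[OF assms(2)])
     (use assms in \<open>auto simp: formal_model_simps intro: smooth_functionsD\<close>)

end

context formal_manifold_space
begin

text \<open>With \<open>c\<close> the value of the coefficient of index \<open>0\<close>, the germ of \<open>\<Phi> W s - c\<close> is not a unit: comparing
  the coefficients of index \<open>0\<close> would give \<open>0 = 1\<close>. As the stalk is local, it lies in the maximal ideal.\<close>

lemma eval_at_chart:
  assumes chart: "is_chart U n k \<phi> \<Phi>" and W: "openin (Euclidean_space n) W"
    and s: "s \<in> carrier (sec (formal_model n k) W)" and b: "b \<in> U" "\<phi> b \<in> W"
  shows "eval_at T \<O> {x \<in> U. \<phi> x \<in> W} (\<Phi> W s) b = s (\<lambda>_. 0) (\<phi> b)"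
proof -
  let ?V = "{x \<in> U. \<phi> x \<in> W}" and ?B = "formal_model n k"
  define c where "c = s (\<lambda>_. 0) (\<phi> b)"
  have V: "openin T ?V" "b \<in> ?V" using chart_preimage_open[OF chart W] b by auto
  have bT: "b \<in> topspace T" using V openin_subset by blast
  interpret S: Module.algebra "\<complex>\<^sub>R" "sec \<O> ?V" by (rule O_algebra[OF V(1)])
  have hom: "\<Phi> W' \<in> ring_hom (sec ?B W') (sec \<O> {x \<in> U. \<phi> x \<in> W'})" "inj_on (\<Phi> W') (carrier (sec ?B W'))"
    "\<Phi> W' ` carrier (sec ?B W') = carrier (sec \<O> {x \<in> U. \<phi> x \<in> W'})" if "openin (Euclidean_space n) W'" for W'
    using chart_iso[OF chart that] by (auto simp: ring_iso_def bij_betw_def)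
  have fc: "\<Phi> W s \<in> carrier (sec \<O> ?V)" using ring_hom_closed[OF hom(1)[OF W] s] .
  have kc: "c \<odot>\<^bsub>sec \<O> ?V\<^esub> \<one>\<^bsub>sec \<O> ?V\<^esub> \<in> carrier (sec \<O> ?V)" by (rule S.smult_closed) simp_all
  let ?x = "\<Phi> W s \<ominus>\<^bsub>sec \<O> ?V\<^esub> c \<odot>\<^bsub>sec \<O> ?V\<^esub> \<one>\<^bsub>sec \<O> ?V\<^esub>"
  have xc: "?x \<in> carrier (sec \<O> ?V)" using fc kc by simp
  let ?R = "stalk T \<O> b"
  have "germ T \<O> b ?V ?x \<notin> Units ?R"
  proof
    assume "germ T \<O> b ?V ?x \<in> Units ?R"
    then obtain y where y: "y \<in> carrier ?R" "germ T \<O> b ?V ?x \<otimes>\<^bsub>?R\<^esub> y = \<one>\<^bsub>?R\<^esub>"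
      unfolding Units_def by blast
    then obtain V' t where V': "openin T V'" "b \<in> V'" "t \<in> carrier (sec \<O> V')" "y = germ T \<O> b V' t"
      unfolding stalk_def by auto
    let ?I = "?V \<inter> V'"
    have oI: "openin T ?I" "b \<in> ?I" using V V' by auto
    interpret I: cring "sec \<O> ?I" by (rule O_cring[OF oI(1)])
    have rc: "res \<O> ?V ?I ?x \<in> carrier (sec \<O> ?I)" "res \<O> V' ?I t \<in> carrier (sec \<O> ?I)"
      using V V' oI xc by (auto intro!: O_res_closed simp del: mem_Collect_eq)
    have "germ T \<O> b ?I (res \<O> ?V ?I ?x \<otimes>\<^bsub>sec \<O> ?I\<^esub> res \<O> V' ?I t) = germ T \<O> b ?I \<one>\<^bsub>sec \<O> ?I\<^esub>"
      using stalk_mult[OF V xc V'(1,2,3)] y(2) V'(4) stalk_one[OF oI] by simp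
    moreover have "(?I, res \<O> ?V ?I ?x \<otimes>\<^bsub>sec \<O> ?I\<^esub> res \<O> V' ?I t) \<in> germ T \<O> b ?I (res \<O> ?V ?I ?x \<otimes>\<^bsub>sec \<O> ?I\<^esub> res \<O> V' ?I t)"
      by (rule germ_self[where P = \<O>, OF oI I.m_closed[OF rc]])
    ultimately have "(?I, res \<O> ?V ?I ?x \<otimes>\<^bsub>sec \<O> ?I\<^esub> res \<O> V' ?I t) \<in> germ T \<O> b ?I \<one>\<^bsub>sec \<O> ?I\<^esub>" by simp
    \<comment> \<open>Equality of germs becomes an honest equation of sections on some neighbourhood
      \<open>X\<close>, which can be carried back to the model.\<close>
    then obtain X where X: "openin T X" "b \<in> X" "X \<subseteq> ?I" and eq:
        "res \<O> ?I X \<one>\<^bsub>sec \<O> ?I\<^esub> = res \<O> ?I X (res \<O> ?V ?I ?x \<otimes>\<^bsub>sec \<O> ?I\<^esub> res \<O> V' ?I t)"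
      unfolding germ_def by blast
    have XU: "X \<subseteq> U" using X(3) by blast
    let ?W = "\<phi> ` X"
    have oW: "openin (Euclidean_space n) ?W" and pre: "{x \<in> U. \<phi> x \<in> ?W} = X"
      using chart_open_image[OF chart X(1) XU] by auto
    have WW: "?W \<subseteq> W" using X(3) by blast
    interpret X: Module.algebra "\<complex>\<^sub>R" "sec \<O> X" by (rule O_algebra[OF X(1)])
    have XV: "X \<subseteq> ?V" and XV': "X \<subseteq> V'" using X(3) by auto
    let ?s = "res ?B W ?W s"
    have sc: "?s \<in> carrier (sec ?B ?W)" by (rule formal_model_res_closed[OF oW s WW])
    have "res \<O> V' X t \<in> carrier (sec \<O> X)" using V' X(1) XV' by (intro O_res_closed)
    then have "res \<O> V' X t \<in> \<Phi> ?W ` carrier (sec ?B ?W)"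
      using hom(3)[OF oW] unfolding pre by (simp only:)
    then obtain t' where t': "res \<O> V' X t = \<Phi> ?W t'" "t' \<in> carrier (sec ?B ?W)"
      by (rule imageE)
    have rs: "res \<O> ?V X (\<Phi> W s) = \<Phi> ?W ?s"
      using chart_res[OF chart W oW WW s] unfolding pre .
    have Psc: "\<Phi> ?W ?s \<in> carrier (sec \<O> X)" and Ptc: "\<Phi> ?W t' \<in> carrier (sec \<O> X)"
      using ring_hom_closed[OF hom(1)[OF oW]] sc t'(2) unfolding pre by auto
    have cX: "c \<odot>\<^bsub>sec \<O> X\<^esub> \<one>\<^bsub>sec \<O> X\<^esub> \<in> carrier (sec \<O> X)" by (rule X.smult_closed) simp_all
    have rx: "res \<O> ?V X ?x = \<Phi> ?W ?s \<ominus>\<^bsub>sec \<O> X\<^esub> c \<odot>\<^bsub>sec \<O> X\<^esub> \<one>\<^bsub>sec \<O> X\<^esub>"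
      using O_res_minus[OF V(1) X(1) XV fc kc] rs O_res_smult[OF V(1) X(1) XV, of "\<one>\<^bsub>sec \<O> ?V\<^esub>" c]
        O_res_one[OF V(1) X(1) XV] by simp
    have "\<one>\<^bsub>sec \<O> X\<^esub> = res \<O> ?I X (res \<O> ?V ?I ?x) \<otimes>\<^bsub>sec \<O> X\<^esub> res \<O> ?I X (res \<O> V' ?I t)"
      using eq O_res_one[OF oI(1) X(1,3)] ring_hom_mult[OF O_res_hom[OF oI(1) X(1,3)] rc] by simp
    also have "\<dots> = res \<O> ?V X ?x \<otimes>\<^bsub>sec \<O> X\<^esub> res \<O> V' X t"
      using O_res_res[OF V(1) oI(1) X(1) _ X(3) xc] O_res_res[OF V'(1) oI(1) X(1) _ X(3) V'(3)] by simp
    also have "\<dots> = (\<Phi> ?W ?s \<ominus>\<^bsub>sec \<O> X\<^esub> c \<odot>\<^bsub>sec \<O> X\<^esub> \<one>\<^bsub>sec \<O> X\<^esub>) \<otimes>\<^bsub>sec \<O> X\<^esub> \<Phi> ?W t'"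
      unfolding rx t'(1) ..
    also have "\<dots> = \<Phi> ?W ?s \<otimes>\<^bsub>sec \<O> X\<^esub> \<Phi> ?W t' \<ominus>\<^bsub>sec \<O> X\<^esub> (c \<odot>\<^bsub>sec \<O> X\<^esub> \<one>\<^bsub>sec \<O> X\<^esub>) \<otimes>\<^bsub>sec \<O> X\<^esub> \<Phi> ?W t'"
      using Psc Ptc cX by (simp add: X.minus_eq X.l_distr X.l_minus)
    also have "(c \<odot>\<^bsub>sec \<O> X\<^esub> \<one>\<^bsub>sec \<O> X\<^esub>) \<otimes>\<^bsub>sec \<O> X\<^esub> \<Phi> ?W t' = c \<odot>\<^bsub>sec \<O> X\<^esub> \<Phi> ?W t'"
      using X.smult_assoc2[of c "\<one>\<^bsub>sec \<O> X\<^esub>" "\<Phi> ?W t'"] Ptc by simp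
    finally have 1: "\<one>\<^bsub>sec \<O> X\<^esub> = \<Phi> ?W ?s \<otimes>\<^bsub>sec \<O> X\<^esub> \<Phi> ?W t' \<ominus>\<^bsub>sec \<O> X\<^esub> c \<odot>\<^bsub>sec \<O> X\<^esub> \<Phi> ?W t'" .
    have ctc: "c \<odot>\<^bsub>sec \<O> X\<^esub> \<Phi> ?W t' \<in> carrier (sec \<O> X)" by (rule X.smult_closed) (use Ptc in simp_all)
    \<comment> \<open>Moving the term with \<open>c\<close> to the other side removes the
      subtraction, so that only sum, product, scalar multiple and unit are transported, all of which
      have explicit formulas in the model.\<close>
    have "\<one>\<^bsub>sec \<O> X\<^esub> \<oplus>\<^bsub>sec \<O> X\<^esub> c \<odot>\<^bsub>sec \<O> X\<^esub> \<Phi> ?W t' = \<Phi> ?W ?s \<otimes>\<^bsub>sec \<O> X\<^esub> \<Phi> ?W t'"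
      unfolding 1 using Psc Ptc ctc by (simp add: X.minus_eq X.a_assoc X.l_neg)
    then have "\<Phi> ?W (\<one>\<^bsub>sec ?B ?W\<^esub> \<oplus>\<^bsub>sec ?B ?W\<^esub> c \<odot>\<^bsub>sec ?B ?W\<^esub> t') = \<Phi> ?W (?s \<otimes>\<^bsub>sec ?B ?W\<^esub> t')"
      using ring_hom_add[OF hom(1)[OF oW] formal_model_one_closed[OF oW] formal_model_smult_closed[OF oW t'(2)]]
        ring_hom_mult[OF hom(1)[OF oW] sc t'(2)] chart_smult[OF chart oW t'(2)] chart_one[OF chart oW]
      unfolding pre by simp
    then have "\<one>\<^bsub>sec ?B ?W\<^esub> \<oplus>\<^bsub>sec ?B ?W\<^esub> c \<odot>\<^bsub>sec ?B ?W\<^esub> t' = ?s \<otimes>\<^bsub>sec ?B ?W\<^esub> t'"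
      using inj_onD[OF hom(2)[OF oW]] formal_model_add_closed[OF oW formal_model_one_closed[OF oW] formal_model_smult_closed[OF oW t'(2)]]
        formal_model_mult_closed[OF oW sc t'(2)] by blast
    then have "(\<one>\<^bsub>sec ?B ?W\<^esub> \<oplus>\<^bsub>sec ?B ?W\<^esub> c \<odot>\<^bsub>sec ?B ?W\<^esub> t') (\<lambda>_. 0) (\<phi> b) = (?s \<otimes>\<^bsub>sec ?B ?W\<^esub> t') (\<lambda>_. 0) (\<phi> b)"
      by simp
    \<comment> \<open>In the coefficient of index 0 the Cauchy product has a single term, so it is
      the ordinary product of the coefficients of index 0.\<close>
    moreover have "{\<beta>. \<beta> \<le> (\<lambda>_::nat. 0::nat)} = {\<lambda>_. 0}" by (auto simp: le_fun_def)
    ultimately have "1 + c * t' (\<lambda>_. 0) (\<phi> b) = c * t' (\<lambda>_. 0) (\<phi> b)"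
      using X(2) by (simp add: formal_model_simps zero_multi_index c_def)
    then show False by simp
  qed
  then have "germ T \<O> b ?V ?x \<in> max_ideal b"
    by (rule nonunit_in_max_ideal[OF bT germ_in_stalk[OF V xc]])
  then show ?thesis using eval_at_eqI[OF V fc] by (simp add: c_def)
qed

text \<open>In a chart the values of a section are the coefficient of index 0, which is continuous;
  local continuity is then pasted together. This makes the suprema in the smooth topology
  finite.\<close>

lemma reduced_sections_continuous:
  assumes W: "openin T W" and g: "g \<in> reduced_sections T \<O> W"
  shows "continuous_map (subtopology T W) euclidean g"
proof -
  have "\<exists>X. openin (subtopology T W) X \<and> a \<in> X \<and> continuous_map (subtopology (subtopology T W) X) euclidean g"
    if a: "a \<in> W" for a
  proof -
    obtain V f where V: "openin T V" "a \<in> V" "V \<subseteq> W" "f \<in> carrier (sec \<O> V)" "\<And>b. b \<in> V \<Longrightarrow> g b = eval_at T \<O> V f b"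
      using g a unfolding reduced_sections_def by blast
    obtain U n k \<phi> \<Phi> where chart: "is_chart U n k \<phi> \<Phi>" "a \<in> U"
      by (rule chart_exists[OF subsetD[OF openin_subset[OF V(1)] V(2)]])
    let ?X = "V \<inter> U" let ?Y = "\<phi> ` ?X"
    have X: "openin T ?X" "?X \<subseteq> U" using V chart_open[OF chart(1)] by auto
    note Y = chart_open_image[OF chart(1) X]
    have "res \<O> V ?X f \<in> carrier (sec \<O> {x \<in> U. \<phi> x \<in> ?Y})"
      unfolding Y(2) using V X by (intro O_res_closed) auto
    moreover have "\<Phi> ?Y ` carrier (sec (formal_model n k) ?Y) = carrier (sec \<O> {x \<in> U. \<phi> x \<in> ?Y})"
      using chart_iso[OF chart(1) Y(1)] by (simp add: ring_iso_def bij_betw_def)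
    ultimately have "res \<O> V ?X f \<in> \<Phi> ?Y ` carrier (sec (formal_model n k) ?Y)" by (simp only:)
    then obtain s where s: "res \<O> V ?X f = \<Phi> ?Y s" "s \<in> carrier (sec (formal_model n k) ?Y)"
      by (rule imageE)
    have val: "s (\<lambda>_. 0) (\<phi> b) = g b" if "b \<in> ?X" for b
      using eval_at_chart[OF chart(1) Y(1) s(2), of b] that s(1) eval_at_res[OF V(1) X(1) that _ V(4)] V(5)[of b]
      unfolding Y(2) by auto
    have "s (\<lambda>_. 0) \<in> smooth_functions n ?Y"
      using s(2) zero_multi_index by (auto simp: formal_model_simps)
    then have "continuous_map (subtopology (Euclidean_space n) ?Y) euclidean (s (\<lambda>_. 0))"
      using smooth_functionsD[of _ n ?Y 0] by simp
    moreover have "continuous_map (subtopology T ?X) (subtopology (Euclidean_space n) ?Y) \<phi>"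
      unfolding continuous_map_in_subtopology
    proof
      show "continuous_map (subtopology T ?X) (Euclidean_space n) \<phi>"
        by (rule continuous_map_from_subtopology_mono[OF homeomorphic_imp_continuous_map[OF chart_homeomorphic[OF chart(1)]] X(2)])
    qed auto
    ultimately have "continuous_map (subtopology T ?X) euclidean (s (\<lambda>_. 0) \<circ> \<phi>)"
      using continuous_map_compose by blast
    then have "continuous_map (subtopology T ?X) euclidean g"
      by (rule continuous_map_eq) (use val in auto)
    moreover have "subtopology (subtopology T W) ?X = subtopology T ?X"
      using V(3) by (simp add: subtopology_subtopology Int_absorb1 le_infI1)
    moreover have "openin (subtopology T W) ?X"
      using X V(3) W by (auto simp: openin_open_subtopology)
    ultimately show ?thesis using V(2) chart(2) by (intro exI[of _ ?X]) auto
  qed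
  then obtain X where X: "\<And>a. a \<in> W \<Longrightarrow> openin (subtopology T W) (X a) \<and> a \<in> X a \<and>
      continuous_map (subtopology (subtopology T W) (X a)) euclidean g"
    by metis
  show ?thesis
    by (rule pasting_lemma[where I = W and T = X and f = "\<lambda>_. g"]) (use X in auto)
qed

end

section \<open>Differential operators\<close>

locale module_sheaf_space = formal_manifold_space T \<O>
  for T :: "'p topology" and \<O> :: "('p, complex, 'a) presheaf" +
  fixes \<F> :: "('p, 'a, 'b) presheaf"
  assumes module_sheaf: "module_sheaf T \<O> \<F>"
begin

lemma set_sheaf_F: "set_sheaf T \<F>"
  using module_sheaf by (simp add: module_sheaf_def)

lemmas F_res_closed = sheaf_res_closed[OF set_sheaf_F]
  and F_res_id = sheaf_res_id[OF set_sheaf_F]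
  and F_res_res = sheaf_res_res[OF set_sheaf_F]
  and F_eqI = sheaf_eqI[OF set_sheaf_F]

lemma F_module: "openin T U \<Longrightarrow> Module.module (sec \<O> U) (sec \<F> U)"
  using module_sheaf by (simp add: module_sheaf_def)

lemma F_abelian_group: "openin T U \<Longrightarrow> abelian_group (sec \<F> U)"
  using F_module by (simp add: Module.module_def)

lemma F_res_add:
  "openin T U \<Longrightarrow> openin T V \<Longrightarrow> V \<subseteq> U \<Longrightarrow> u \<in> carrier (sec \<F> U) \<Longrightarrow> v \<in> carrier (sec \<F> U) \<Longrightarrow>
    res \<F> U V (u \<oplus>\<^bsub>sec \<F> U\<^esub> v) = res \<F> U V u \<oplus>\<^bsub>sec \<F> V\<^esub> res \<F> U V v"
  using module_sheaf[unfolded module_sheaf_def, THEN conjunct2, THEN conjunct2, rule_format, of U V] by blast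

lemma F_res_smult:
  "openin T U \<Longrightarrow> openin T V \<Longrightarrow> V \<subseteq> U \<Longrightarrow> f \<in> carrier (sec \<O> U) \<Longrightarrow> u \<in> carrier (sec \<F> U) \<Longrightarrow>
    res \<F> U V (f \<odot>\<^bsub>sec \<F> U\<^esub> u) = res \<O> U V f \<odot>\<^bsub>sec \<F> V\<^esub> res \<F> U V u"
  using module_sheaf[unfolded module_sheaf_def, THEN conjunct2, THEN conjunct2, rule_format, of U V] by blast

lemma F_zero_closed: "openin T U \<Longrightarrow> \<zero>\<^bsub>sec \<F> U\<^esub> \<in> carrier (sec \<F> U)"
  using F_abelian_group by (simp add: abelian_group_def abelian_monoid.zero_closed)

lemma F_add_closed: "openin T U \<Longrightarrow> u \<in> carrier (sec \<F> U) \<Longrightarrow> v \<in> carrier (sec \<F> U) \<Longrightarrow>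
    u \<oplus>\<^bsub>sec \<F> U\<^esub> v \<in> carrier (sec \<F> U)"
  using F_abelian_group by (simp add: abelian_group_def abelian_monoid.a_closed)

lemma F_smult_closed: "openin T U \<Longrightarrow> f \<in> carrier (sec \<O> U) \<Longrightarrow> u \<in> carrier (sec \<F> U) \<Longrightarrow>
    f \<odot>\<^bsub>sec \<F> U\<^esub> u \<in> carrier (sec \<F> U)"
  by (rule module.smult_closed[OF F_module])

lemma F_res_zero:
  assumes "openin T U" "openin T V" "V \<subseteq> U"
  shows "res \<F> U V \<zero>\<^bsub>sec \<F> U\<^esub> = \<zero>\<^bsub>sec \<F> V\<^esub>"
proof -
  interpret U: Module.module "sec \<O> U" "sec \<F> U" by (rule F_module[OF assms(1)])
  interpret V: Module.module "sec \<O> V" "sec \<F> V" by (rule F_module[OF assms(2)])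
  have "res \<F> U V (\<zero>\<^bsub>sec \<O> U\<^esub> \<odot>\<^bsub>sec \<F> U\<^esub> \<zero>\<^bsub>sec \<F> U\<^esub>) = \<zero>\<^bsub>sec \<O> V\<^esub> \<odot>\<^bsub>sec \<F> V\<^esub> res \<F> U V \<zero>\<^bsub>sec \<F> U\<^esub>"
    using F_res_smult[OF assms cring.cring_simprules(2)[OF O_cring[OF assms(1)]] F_zero_closed[OF assms(1)]]
      O_res_zero[OF assms] by simp
  moreover have "res \<F> U V \<zero>\<^bsub>sec \<F> U\<^esub> \<in> carrier (sec \<F> V)" using F_res_closed[OF assms] by simp
  ultimately show ?thesis using V.smult_l_null U.smult_l_null by simp
qed

lemma const_closed: "openin T U \<Longrightarrow> c \<odot>\<^bsub>sec \<O> U\<^esub> \<one>\<^bsub>sec \<O> U\<^esub> \<in> carrier (sec \<O> U)"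
  using module.smult_closed[OF O_module, of U c "\<one>\<^bsub>sec \<O> U\<^esub>"] cring.cring_simprules(6)[OF O_cring, of U] by simp

lemma res_const: "openin T U \<Longrightarrow> openin T V \<Longrightarrow> V \<subseteq> U \<Longrightarrow>
    res \<O> U V (c \<odot>\<^bsub>sec \<O> U\<^esub> \<one>\<^bsub>sec \<O> U\<^esub>) = c \<odot>\<^bsub>sec \<O> V\<^esub> \<one>\<^bsub>sec \<O> V\<^esub>"
  using O_res_smult O_res_one cring.cring_simprules(6)[OF O_cring, of U] by simp

lemma res_scalar_mult: "openin T U \<Longrightarrow> openin T V \<Longrightarrow> V \<subseteq> U \<Longrightarrow> u \<in> carrier (sec \<F> U) \<Longrightarrow>
    res \<F> U V (scalar_mult \<O> \<F> U c u) = scalar_mult \<O> \<F> V c (res \<F> U V u)"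
  unfolding scalar_mult_def by (simp add: F_res_smult const_closed res_const)

lemma smult_commute:
  assumes "openin T U" "f \<in> carrier (sec \<O> U)" "g \<in> carrier (sec \<O> U)" "u \<in> carrier (sec \<F> U)"
  shows "f \<odot>\<^bsub>sec \<F> U\<^esub> (g \<odot>\<^bsub>sec \<F> U\<^esub> u) = g \<odot>\<^bsub>sec \<F> U\<^esub> (f \<odot>\<^bsub>sec \<F> U\<^esub> u)"
proof -
  interpret Module.module "sec \<O> U" "sec \<F> U" by (rule F_module[OF assms(1)])
  interpret R: cring "sec \<O> U" by (rule O_cring[OF assms(1)])
  show ?thesis using assms smult_assoc1[of f g u] smult_assoc1[of g f u] R.m_comm[of f g] by simp
qed

lemma smult_scalar_mult:
  assumes "openin T U" "f \<in> carrier (sec \<O> U)" "u \<in> carrier (sec \<F> U)"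
  shows "f \<odot>\<^bsub>sec \<F> U\<^esub> scalar_mult \<O> \<F> U c u = scalar_mult \<O> \<F> U c (f \<odot>\<^bsub>sec \<F> U\<^esub> u)"
  unfolding scalar_mult_def by (rule smult_commute[OF assms(1,2) const_closed[OF assms(1)] assms(3)])

text \<open>Equality of sheaf maps would be too fine, as their values at sets that are not open, at
  arguments that are not sections and at points outside the set are arbitrary. Everything about
  orders and supports depends only on this weaker relation.\<close>

definition agree :: "'p set \<Rightarrow> ('p, 'b) sheaf_map \<Rightarrow> ('p, 'b) sheaf_map \<Rightarrow> bool" where
  "agree W D D' \<longleftrightarrow> (\<forall>V. openin T V \<and> V \<subseteq> W \<longrightarrow> (\<forall>u\<in>carrier (sec \<F> V). \<forall>a\<in>V. D V u a = D' V u a))"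

lemma agreeD: "agree W D D' \<Longrightarrow> openin T V \<Longrightarrow> V \<subseteq> W \<Longrightarrow> u \<in> carrier (sec \<F> V) \<Longrightarrow> a \<in> V \<Longrightarrow> D V u a = D' V u a"
  unfolding agree_def by blast

lemma agree_trans: "agree W D D' \<Longrightarrow> agree W D' D'' \<Longrightarrow> agree W D D''"
  unfolding agree_def by simp

lemma agree_mono: "agree W D D' \<Longrightarrow> W' \<subseteq> W \<Longrightarrow> agree W' D D'"
  unfolding agree_def by (meson order_trans)

lemma zero_on_iff_agree: "zero_on T \<F> W D \<longleftrightarrow> agree W D (\<lambda>V u a. 0)"
  by (simp add: zero_on_def agree_def)

lemma zero_onD: "zero_on T \<F> W D \<Longrightarrow> openin T V \<Longrightarrow> V \<subseteq> W \<Longrightarrow> u \<in> carrier (sec \<F> V) \<Longrightarrow> a \<in> V \<Longrightarrow> D V u a = 0"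
  unfolding zero_on_def by blast

lemma zero_on_mono: "zero_on T \<F> W D \<Longrightarrow> W' \<subseteq> W \<Longrightarrow> zero_on T \<F> W' D"
  unfolding zero_on_iff_agree by (rule agree_mono)

lemma zero_on_agree: "agree W D D' \<Longrightarrow> zero_on T \<F> W D' \<Longrightarrow> zero_on T \<F> W D"
  unfolding zero_on_iff_agree by (rule agree_trans)

abbreviation "comm \<equiv> commutator T \<O> \<F>"

lemma res_smult_closed:
  "openin T W \<Longrightarrow> openin T V \<Longrightarrow> V \<subseteq> W \<Longrightarrow> f \<in> carrier (sec \<O> W) \<Longrightarrow> u \<in> carrier (sec \<F> V) \<Longrightarrow>
    res \<O> W V f \<odot>\<^bsub>sec \<F> V\<^esub> u \<in> carrier (sec \<F> V)"
  by (intro F_smult_closed O_res_closed)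

lemma agree_commutator:
  assumes "agree W D D'" "openin T W" "f \<in> carrier (sec \<O> W)"
  shows "agree W (comm W D f) (comm W D' f)"
  unfolding agree_def commutator_def
  using agreeD[OF assms(1)] res_smult_closed[OF assms(2) _ _ assms(3)] by simp

lemma agree_foldl_commutator:
  "agree W D D' \<Longrightarrow> openin T W \<Longrightarrow> set fs \<subseteq> carrier (sec \<O> W) \<Longrightarrow> agree W (foldl (comm W) D fs) (foldl (comm W) D' fs)"
  by (induction fs arbitrary: D D') (simp_all add: agree_commutator)

lemma zero_on_foldl_commutator:
  assumes "zero_on T \<F> W D" "openin T W" "set fs \<subseteq> carrier (sec \<O> W)"
  shows "zero_on T \<F> W (foldl (comm W) D fs)"
  using assms(1,3)
proof (induction fs arbitrary: D)
  case (Cons f fs)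
  have "zero_on T \<F> W (comm W D f)"
    unfolding zero_on_def commutator_def
    using zero_onD[OF Cons.prems(1)] res_smult_closed[OF assms(2), of _ f] Cons.prems(2) by simp
  then show ?case using Cons by simp
qed simp

lemma order_le_agree:
  assumes "agree W D D'" "order_le T \<O> \<F> W D' r"
  shows "order_le T \<O> \<F> W D r"
  unfolding order_le_def
proof (intro allI impI)
  fix V fs assume V: "openin T V \<and> V \<subseteq> W \<and> length fs = Suc r \<and> set fs \<subseteq> carrier (sec \<O> V)"
  then have "zero_on T \<F> V (foldl (comm V) D' fs)" using assms(2) unfolding order_le_def by blast
  then show "zero_on T \<F> V (foldl (comm V) D fs)"
    using agree_foldl_commutator[OF agree_mono[OF assms(1)]] V zero_on_agree by blast
qed

lemma order_le_mono: "order_le T \<O> \<F> W D r \<Longrightarrow> W' \<subseteq> W \<Longrightarrow> order_le T \<O> \<F> W' D r"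
  unfolding order_le_def by (meson order_trans)

lemma zero_on_order_le: "zero_on T \<F> W D \<Longrightarrow> order_le T \<O> \<F> W D r"
  unfolding order_le_def using zero_on_foldl_commutator zero_on_mono by blast

text \<open>Composition of an operator with multiplication by \<open>f\<close>. Its seminorm at
  \<open>u\<close> is the seminorm of \<open>D\<close> at \<open>f u\<close>, so that continuity of
  multiplication becomes a statement about operators.\<close>

definition premult :: "'p set \<Rightarrow> 'a \<Rightarrow> ('p, 'b) sheaf_map \<Rightarrow> ('p, 'b) sheaf_map" where
  "premult V f D = (\<lambda>W u. D W (res \<O> V W f \<odot>\<^bsub>sec \<F> W\<^esub> u))"

context
  fixes V f
  assumes V: "openin T V" and f: "f \<in> carrier (sec \<O> V)"
begin

text \<open>Only the commutation of two multiplications on \<open>\<F>\<close> is involved. Iterated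
  over a list, this shows that composing with multiplication by \<open>f\<close> does not raise the
  order.\<close>

lemma commutator_premult:
  assumes W: "openin T W" "W \<subseteq> V" and g: "g \<in> carrier (sec \<O> W)"
  shows "agree W (comm W (premult V f D) g) (premult V f (comm W D g))"
  unfolding agree_def
proof (intro allI impI ballI)
  fix X u a assume X: "openin T X \<and> X \<subseteq> W" and u: "u \<in> carrier (sec \<F> X)" and a: "a \<in> X"
  then have "res \<O> V X f \<in> carrier (sec \<O> X)" "res \<O> W X g \<in> carrier (sec \<O> X)"
    using V W f g by (auto intro!: O_res_closed)
  then show "comm W (premult V f D) g X u a = premult V f (comm W D g) X u a"
    using a smult_commute[of X "res \<O> V X f" "res \<O> W X g" u] X u by (simp add: commutator_def premult_def)
qed

lemma agree_premult:
  assumes "agree W D D'" "W \<subseteq> V"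
  shows "agree W (premult V f D) (premult V f D')"
  unfolding agree_def premult_def
  using agreeD[OF assms(1)] res_smult_closed[OF V _ _ f] assms(2) by (meson order_trans)

lemma foldl_commutator_premult:
  assumes W: "openin T W" "W \<subseteq> V"
  shows "set fs \<subseteq> carrier (sec \<O> W) \<Longrightarrow> agree W (foldl (comm W) (premult V f D) fs) (premult V f (foldl (comm W) D fs))"
proof (induction fs arbitrary: D)
  case Nil
  then show ?case by (simp add: agree_def)
next
  case (Cons g fs)
  then have "agree W (foldl (comm W) (comm W (premult V f D) g) fs) (foldl (comm W) (premult V f (comm W D g)) fs)"
    by (intro agree_foldl_commutator commutator_premult W) auto
  then show ?case using Cons by (auto intro: agree_trans)
qed

lemma zero_on_premult: "zero_on T \<F> W D \<Longrightarrow> W \<subseteq> V \<Longrightarrow> zero_on T \<F> W (premult V f D)"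
  unfolding zero_on_iff_agree using agree_premult[of W D "\<lambda>V u a. 0"] by (simp add: premult_def)

lemma order_le_premult:
  assumes "order_le T \<O> \<F> W D r" "W \<subseteq> V"
  shows "order_le T \<O> \<F> W (premult V f D) r"
  unfolding order_le_def
proof (intro allI impI)
  fix X fs assume X: "openin T X \<and> X \<subseteq> W \<and> length fs = Suc r \<and> set fs \<subseteq> carrier (sec \<O> X)"
  then have XV: "openin T X" "X \<subseteq> V" "set fs \<subseteq> carrier (sec \<O> X)" using assms(2) by auto
  have "zero_on T \<F> X (foldl (comm X) D fs)" using assms(1) X unfolding order_le_def by blast
  then have "zero_on T \<F> X (premult V f (foldl (comm X) D fs))" using zero_on_premult XV(2) by blast
  then show "zero_on T \<F> X (foldl (comm X) (premult V f D) fs)"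
    by (rule zero_on_agree[OF foldl_commutator_premult[OF XV]])
qed

end

lemma sheaf_homD:
  assumes "sheaf_hom T \<O> \<F> U D" "openin T W" "W \<subseteq> U"
  shows sheaf_hom_closed: "u \<in> carrier (sec \<F> W) \<Longrightarrow> D W u \<in> reduced_sections T \<O> W"
    and sheaf_hom_add: "u \<in> carrier (sec \<F> W) \<Longrightarrow> v \<in> carrier (sec \<F> W) \<Longrightarrow> a \<in> W \<Longrightarrow>
      D W (u \<oplus>\<^bsub>sec \<F> W\<^esub> v) a = D W u a + D W v a"
    and sheaf_hom_smult: "u \<in> carrier (sec \<F> W) \<Longrightarrow> a \<in> W \<Longrightarrow> D W (scalar_mult \<O> \<F> W c u) a = c * D W u a"
  using assms(1)[unfolded sheaf_hom_def, THEN conjunct1, rule_format, of W] assms(2,3) by blast+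

lemma sheaf_hom_res:
  "sheaf_hom T \<O> \<F> U D \<Longrightarrow> openin T W \<Longrightarrow> openin T W' \<Longrightarrow> W' \<subseteq> W \<Longrightarrow> W \<subseteq> U \<Longrightarrow> u \<in> carrier (sec \<F> W) \<Longrightarrow>
    D W' (res \<F> W W' u) = restrict (D W u) W'"
  by (rule sheaf_hom_def[THEN iffD1, THEN conjunct2, rule_format]) simp_all

lemma sheaf_hom_res_apply:
  assumes "sheaf_hom T \<O> \<F> U D" "openin T W" "openin T W'" "W' \<subseteq> W" "W \<subseteq> U" "u \<in> carrier (sec \<F> W)" "a \<in> W'"
  shows "D W' (res \<F> W W' u) a = D W u a"
  using sheaf_hom_res[OF assms(1-6)] assms(7) by simp

lemma sheaf_hom_zero:
  assumes D: "sheaf_hom T \<O> \<F> U D" and W: "openin T W" "W \<subseteq> U" "a \<in> W"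
  shows "D W \<zero>\<^bsub>sec \<F> W\<^esub> a = 0"
proof -
  interpret Module.module "sec \<O> W" "sec \<F> W" by (rule F_module[OF W(1)])
  show ?thesis using sheaf_hom_add[OF D W(1,2), of "\<zero>\<^bsub>sec \<F> W\<^esub>" "\<zero>\<^bsub>sec \<F> W\<^esub>" a] W(3) by simp
qed

lemma sheaf_hom_premult:
  assumes D: "sheaf_hom T \<O> \<F> U D" and V: "openin T V" "V \<subseteq> U" and f: "f \<in> carrier (sec \<O> V)"
  shows "sheaf_hom T \<O> \<F> V (premult V f D)"
proof -
  have fc: "res \<O> V W f \<in> carrier (sec \<O> W)" if "openin T W" "W \<subseteq> V" for W
    using that V f by (intro O_res_closed)
  show ?thesis
    unfolding sheaf_hom_def premult_def
  proof (intro conjI allI impI ballI funcsetI)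
    fix W assume W: "openin T W \<and> W \<subseteq> V"
    then have WU: "openin T W" "W \<subseteq> U" using V by auto
    interpret Module.module "sec \<O> W" "sec \<F> W" by (rule F_module[OF WU(1)])
    note fW = fc[of W]
    fix u assume u: "u \<in> carrier (sec \<F> W)"
    show "D W (res \<O> V W f \<odot>\<^bsub>sec \<F> W\<^esub> u) \<in> reduced_sections T \<O> W"
      using sheaf_hom_closed[OF D WU] W u fW by simp
    fix a assume a: "a \<in> W"
    show "D W (res \<O> V W f \<odot>\<^bsub>sec \<F> W\<^esub> scalar_mult \<O> \<F> W c u) a = c * D W (res \<O> V W f \<odot>\<^bsub>sec \<F> W\<^esub> u) a" for c
      using sheaf_hom_smult[OF D WU] smult_scalar_mult[OF WU(1)] W u fW a by simp
    fix v assume v: "v \<in> carrier (sec \<F> W)"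
    show "D W (res \<O> V W f \<odot>\<^bsub>sec \<F> W\<^esub> (u \<oplus>\<^bsub>sec \<F> W\<^esub> v)) a =
        D W (res \<O> V W f \<odot>\<^bsub>sec \<F> W\<^esub> u) a + D W (res \<O> V W f \<odot>\<^bsub>sec \<F> W\<^esub> v) a"
      using sheaf_hom_add[OF D WU] W u v fW a smult_r_distr[of "res \<O> V W f" u v] by simp
  next
    fix W W' u assume W: "openin T W \<and> openin T W' \<and> W' \<subseteq> W \<and> W \<subseteq> V" and u: "u \<in> carrier (sec \<F> W)"
    have "res \<O> V W' f \<odot>\<^bsub>sec \<F> W'\<^esub> res \<F> W W' u = res \<F> W W' (res \<O> V W f \<odot>\<^bsub>sec \<F> W\<^esub> u)"
      using W u fc[of W] V f by (simp add: F_res_smult O_res_res)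
    then show "D W' (res \<O> V W' f \<odot>\<^bsub>sec \<F> W'\<^esub> res \<F> W W' u) = restrict (D W (res \<O> V W f \<odot>\<^bsub>sec \<F> W\<^esub> u)) W'"
      using sheaf_hom_res[OF D, of W W' "res \<O> V W f \<odot>\<^bsub>sec \<F> W\<^esub> u"] W V u fc[of W] F_smult_closed[of W] by auto
  qed
qed

lemma diff_operator_premult:
  assumes D: "diff_operator T \<O> \<F> U D" and V: "openin T V" "V \<subseteq> U" and f: "f \<in> carrier (sec \<O> V)"
  shows "diff_operator T \<O> \<F> V (premult V f D)"
  unfolding diff_operator_def
proof (intro conjI ballI)
  show "sheaf_hom T \<O> \<F> V (premult V f D)"
    using D V f by (intro sheaf_hom_premult) (auto simp: diff_operator_def)
  fix a assume a: "a \<in> V"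
  then obtain W r where W: "openin T W" "a \<in> W" "order_le T \<O> \<F> W D r"
    using D V unfolding diff_operator_def by blast
  have "order_le T \<O> \<F> (W \<inter> V) (premult V f D) r"
    using order_le_premult[OF V(1) f order_le_mono[OF W(3)]] by simp
  then show "\<exists>W r. openin T W \<and> a \<in> W \<and> W \<subseteq> V \<and> order_le T \<O> \<F> W (premult V f D) r"
    using W a V by (intro exI[of _ "W \<inter> V"] exI[of _ r]) auto
qed

text \<open>The new operator is zero outside \<open>Z\<close> and outside the support of
  \<open>D\<close>. Thus its support is the intersection of a closed set with a compact one,
  provided \<open>Z\<close> is closed in the whole space. This is how an operator on
  \<open>U\<close> yields one with compact support on the smaller open set \<open>V\<close>.\<close>

lemma premult_Diff_c:
  assumes D: "D \<in> Diff_c T \<O> \<F> U" and V: "openin T V" "V \<subseteq> U" and f: "f \<in> carrier (sec \<O> V)"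
    and Z: "closedin T Z" "Z \<subseteq> V" "res \<O> V (V - Z) f = \<zero>\<^bsub>sec \<O> (V - Z)\<^esub>"
  shows "premult V f D \<in> Diff_c T \<O> \<F> V"
proof -
  let ?S = "operator_support T \<F> U D"
  define X where "X = \<Union>{W. openin T W \<and> W \<subseteq> V \<and> zero_on T \<F> W (premult V f D)}"
  have oX: "openin T X" unfolding X_def by blast
  have dD: "diff_operator T \<O> \<F> U D" and S: "compactin T ?S" using D by (auto simp: Diff_c_def)
  have hom: "sheaf_hom T \<O> \<F> U D" using dD by (simp add: diff_operator_def)
  have oVZ: "openin T (V - Z)" using V Z by blast
  have "zero_on T \<F> (V - Z) (premult V f D)"
    unfolding zero_on_def
  proof (intro allI impI ballI)
    fix W u a assume W: "openin T W \<and> W \<subseteq> V - Z" and u: "u \<in> carrier (sec \<F> W)" and a: "a \<in> W"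
    interpret Module.module "sec \<O> W" "sec \<F> W" by (rule F_module) (use W in blast)
    have "res \<O> V W f = res \<O> (V - Z) W (res \<O> V (V - Z) f)"
      using O_res_res[OF V(1) oVZ, of W f] W f by auto
    also have "\<dots> = \<zero>\<^bsub>sec \<O> W\<^esub>" using Z(3) O_res_zero[OF oVZ] W by simp
    finally show "premult V f D W u a = 0"
      using smult_l_null[OF u] sheaf_hom_zero[OF hom, of W a] W V a by (auto simp: premult_def)
  qed
  then have VZ: "V - Z \<subseteq> X" unfolding X_def using oVZ by blast
  have VS: "V - ?S \<subseteq> X"
  proof
    fix a assume a: "a \<in> V - ?S"
    then obtain W where W: "openin T W" "a \<in> W" "zero_on T \<F> W D"
      using V(2) unfolding operator_support_def by blast
    have "zero_on T \<F> (W \<inter> V) (premult V f D)"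
      by (rule zero_on_premult[OF V(1) f zero_on_mono[OF W(3)]]) auto
    then show "a \<in> X" unfolding X_def using W a V by blast
  qed
  have "operator_support T \<F> V (premult V f D) = V - X" by (simp add: operator_support_def X_def)
  also have "\<dots> = (Z - X) \<inter> ?S" using VZ VS Z(2) by blast
  finally have "compactin T (operator_support T \<F> V (premult V f D))"
    using closed_Int_compactin[OF closedin_diff[OF Z(1) oX] S] by (simp only:)
  then show ?thesis using diff_operator_premult[OF dD V f] by (simp add: Diff_c_def)
qed

definition zero_ext :: "'p set \<Rightarrow> ('p, 'b) sheaf_map \<Rightarrow> ('p, 'b) sheaf_map" where
  "zero_ext V D = (\<lambda>W u. \<lambda>a\<in>W. if a \<in> V then D (W \<inter> V) (res \<F> W (W \<inter> V) u) a else 0)"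

text \<open>The support of \<open>D\<close> is compact, hence closed in the Hausdorff space
  \<open>T\<close>, so a point outside \<open>V\<close> has a neighbourhood avoiding it on which the
  extended operator is zero. There the values come from the zero section and the operator has order
  at most 0; inside \<open>V\<close> nothing changes.\<close>

lemma zero_ext_Diff_c:
  assumes D: "D \<in> Diff_c T \<O> \<F> V" and V: "openin T V"
  shows "zero_ext V D \<in> Diff_c T \<O> \<F> (topspace T)"
proof -
  let ?S = "operator_support T \<F> V D" and ?M = "topspace T"
  have dD: "diff_operator T \<O> \<F> V D" and S: "compactin T ?S" using D by (auto simp: Diff_c_def)
  have hom: "sheaf_hom T \<O> \<F> V D" using dD by (simp add: diff_operator_def)
  have Scl: "closedin T ?S" using S Hausdorff compactin_imp_closedin by blast
  have SV: "?S \<subseteq> V" by (auto simp: operator_support_def)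
  have oS: "openin T (?M - ?S)" using Scl by blast
  \<comment> \<open>Off the support the extension vanishes also at points of \<open>V\<close>,
    because there \<open>D\<close> is zero on a neighbourhood.\<close>
  have zero: "zero_ext V D W u a = 0" if W: "openin T W" "u \<in> carrier (sec \<F> W)" "a \<in> W" "a \<notin> ?S" for W u a
  proof (cases "a \<in> V")
    case True
    then obtain X where X: "openin T X" "a \<in> X" "X \<subseteq> V" "zero_on T \<F> X D"
      using W(4) unfolding operator_support_def by blast
    have op: "openin T (W \<inter> V)" "openin T (X \<inter> W)" using X V W by auto
    have c: "res \<F> W (W \<inter> V) u \<in> carrier (sec \<F> (W \<inter> V))" using W(1,2) op by (intro F_res_closed) auto
    have "D (W \<inter> V) (res \<F> W (W \<inter> V) u) a = D (X \<inter> W) (res \<F> (W \<inter> V) (X \<inter> W) (res \<F> W (W \<inter> V) u)) a"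
      by (rule sheaf_hom_res_apply[OF hom op _ _ c, symmetric]) (use X W in auto)
    also have "\<dots> = 0"
      by (rule zero_onD[OF X(4) op(2)]) (use c op X W in \<open>auto intro!: F_res_closed[OF op]\<close>)
    finally show ?thesis using W True by (simp add: zero_ext_def)
  qed (use W in \<open>simp add: zero_ext_def\<close>)
  have homM: "sheaf_hom T \<O> \<F> ?M (zero_ext V D)"
    unfolding sheaf_hom_def
  proof (intro conjI allI impI ballI funcsetI)
    fix W assume "openin T W \<and> W \<subseteq> ?M"
    then have W: "openin T W" by blast
    have WV: "openin T (W \<inter> V)" "W \<inter> V \<subseteq> V" using W V by auto
    fix u assume u: "u \<in> carrier (sec \<F> W)"
    have ru: "res \<F> W (W \<inter> V) u \<in> carrier (sec \<F> (W \<inter> V))" if "u \<in> carrier (sec \<F> W)" for u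
      by (rule F_res_closed[OF W WV(1) _ that]) simp
    show "zero_ext V D W u \<in> reduced_sections T \<O> W"
      unfolding reduced_sections_def
    proof (intro CollectI conjI ballI)
      show "zero_ext V D W u \<in> extensional W" by (simp add: zero_ext_def)
      fix a assume a: "a \<in> W"
      show "\<exists>X f. openin T X \<and> a \<in> X \<and> X \<subseteq> W \<and> f \<in> carrier (sec \<O> X) \<and> (\<forall>b\<in>X. zero_ext V D W u b = eval_at T \<O> X f b)"
      proof (cases "a \<in> V")
        case True
        then obtain X f where X: "openin T X" "a \<in> X" "X \<subseteq> W \<inter> V" "f \<in> carrier (sec \<O> X)"
          "\<forall>b\<in>X. D (W \<inter> V) (res \<F> W (W \<inter> V) u) b = eval_at T \<O> X f b"
          using sheaf_hom_closed[OF hom WV ru[OF u]] a unfolding reduced_sections_def by blast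
        then have "\<forall>b\<in>X. zero_ext V D W u b = eval_at T \<O> X f b" by (auto simp: zero_ext_def)
        then show ?thesis using X by (intro exI[of _ X] exI[of _ f]) auto
      next
        case False
        have oX: "openin T (W - ?S)" using W Scl by blast
        interpret cring "sec \<O> (W - ?S)" by (rule O_cring[OF oX])
        have "\<forall>b\<in>W - ?S. zero_ext V D W u b = eval_at T \<O> (W - ?S) \<zero>\<^bsub>sec \<O> (W - ?S)\<^esub> b"
          using zero[OF W u] eval_at_zero[OF oX] by simp
        then show ?thesis
          using oX a False SV by (intro exI[of _ "W - ?S"] exI[of _ "\<zero>\<^bsub>sec \<O> (W - ?S)\<^esub>"]) auto
      qed
    qed
    fix a assume a: "a \<in> W"
    show "zero_ext V D W (scalar_mult \<O> \<F> W c u) a = c * zero_ext V D W u a" for c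
      using a sheaf_hom_smult[OF hom WV ru[OF u]] res_scalar_mult[OF W WV(1) _ u] by (simp add: zero_ext_def)
    fix v assume v: "v \<in> carrier (sec \<F> W)"
    show "zero_ext V D W (u \<oplus>\<^bsub>sec \<F> W\<^esub> v) a = zero_ext V D W u a + zero_ext V D W v a"
      using a sheaf_hom_add[OF hom WV ru[OF u] ru[OF v]] F_res_add[OF W WV(1) _ u v] by (simp add: zero_ext_def)
  next
    fix W W' u assume W: "openin T W \<and> openin T W' \<and> W' \<subseteq> W \<and> W \<subseteq> ?M" and u: "u \<in> carrier (sec \<F> W)"
    have op: "openin T W" "openin T W'" "openin T (W \<inter> V)" "openin T (W' \<inter> V)" "W' \<subseteq> W" using W V by auto
    have c: "res \<F> W (W \<inter> V) u \<in> carrier (sec \<F> (W \<inter> V))" using op u by (intro F_res_closed) auto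
    have "res \<F> W' (W' \<inter> V) (res \<F> W W' u) = res \<F> (W \<inter> V) (W' \<inter> V) (res \<F> W (W \<inter> V) u)"
    proof -
      have "res \<F> W' (W' \<inter> V) (res \<F> W W' u) = res \<F> W (W' \<inter> V) u"
        by (rule F_res_res[OF op(1,2,4,5) _ u]) simp
      also have "\<dots> = res \<F> (W \<inter> V) (W' \<inter> V) (res \<F> W (W \<inter> V) u)"
        by (rule F_res_res[OF op(1,3,4) _ _ u, symmetric]) (use op in auto)
      finally show ?thesis .
    qed
    then have "D (W' \<inter> V) (res \<F> W' (W' \<inter> V) (res \<F> W W' u)) a = D (W \<inter> V) (res \<F> W (W \<inter> V) u) a" if "a \<in> W' \<inter> V" for a
      using sheaf_hom_res_apply[OF hom op(3,4) _ _ c that] op(5) by auto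
    then show "zero_ext V D W' (res \<F> W W' u) = restrict (zero_ext V D W u) W'"
    proof (intro ext)
      fix a
      show "zero_ext V D W' (res \<F> W W' u) a = restrict (zero_ext V D W u) W' a"
        using op(5) \<open>\<And>a. a \<in> W' \<inter> V \<Longrightarrow> _ a = _ a\<close>[of a]
        by (cases "a \<in> W'"; cases "a \<in> V") (auto simp: zero_ext_def)
    qed
  qed
  have zS: "zero_on T \<F> (?M - ?S) (zero_ext V D)"
    unfolding zero_on_def using zero by blast
  have "diff_operator T \<O> \<F> ?M (zero_ext V D)"
    unfolding diff_operator_def
  proof (intro conjI ballI homM)
    fix a assume a: "a \<in> ?M"
    show "\<exists>W r. openin T W \<and> a \<in> W \<and> W \<subseteq> ?M \<and> order_le T \<O> \<F> W (zero_ext V D) r"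
    proof (cases "a \<in> V")
      case True
      then obtain W r where W: "openin T W" "a \<in> W" "W \<subseteq> V" "order_le T \<O> \<F> W D r"
        using dD unfolding diff_operator_def by blast
      have "agree W (zero_ext V D) D"
        unfolding agree_def
      proof (intro allI impI ballI)
        fix X u b assume X: "openin T X \<and> X \<subseteq> W" and u: "u \<in> carrier (sec \<F> X)" and b: "b \<in> X"
        then have "X \<inter> V = X" using W(3) by blast
        then show "zero_ext V D X u b = D X u b" using X u b F_res_id[of X u] by (auto simp: zero_ext_def)
      qed
      then have "order_le T \<O> \<F> W (zero_ext V D) r" using W(4) by (rule order_le_agree)
      then show ?thesis using W openin_subset by blast
    next
      case False
      then show ?thesis using zero_on_order_le[OF zS] oS a SV by (intro exI[of _ "?M - ?S"] exI[of _ 0]) auto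
    qed
  qed
  moreover have "compactin T (operator_support T \<F> ?M (zero_ext V D))"
  proof -
    define X where "X = \<Union>{W. openin T W \<and> W \<subseteq> ?M \<and> zero_on T \<F> W (zero_ext V D)}"
    have oX: "openin T X" unfolding X_def by blast
    have MS: "?M - ?S \<subseteq> X" unfolding X_def using oS zS by blast
    have SM: "?S \<subseteq> ?M" using openin_subset[OF V] SV by (rule order_trans[rotated])
    have "operator_support T \<F> ?M (zero_ext V D) = ?M - X" by (simp add: operator_support_def X_def)
    also have "\<dots> = (?M - X) \<inter> ?S" using MS SM by blast
    finally show ?thesis
      using closed_Int_compactin[OF closedin_diff[OF closedin_topspace oX] S] by (simp only:)
  qed
  ultimately show ?thesis by (simp add: Diff_c_def)
qed

text \<open>A continuous function is bounded on the compact support and zero elsewhere. Without this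
  bound the real supremum in \<open>diff_seminorm\<close> would carry no information.\<close>

lemma Diff_c_bdd_above:
  assumes D: "D \<in> Diff_c T \<O> \<F> U" and U: "openin T U" and u: "u \<in> carrier (sec \<F> U)"
  shows "bdd_above (insert 0 ((\<lambda>a. cmod (D U u a)) ` U))"
proof -
  let ?S = "operator_support T \<F> U D"
  have hom: "sheaf_hom T \<O> \<F> U D" and S: "compactin T ?S"
    using D by (auto simp: Diff_c_def diff_operator_def)
  have SU: "?S \<subseteq> U" by (auto simp: operator_support_def)
  have "compactin (subtopology T U) ?S" using S SU by (simp add: compactin_subtopology)
  then have "compactin euclidean (D U u ` ?S)"
    using image_compactin reduced_sections_continuous[OF U sheaf_hom_closed[OF hom U order_refl u]] by blast
  then have "bounded (D U u ` ?S)" by (simp add: compact_imp_bounded)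
  then obtain B where B: "\<And>a. a \<in> ?S \<Longrightarrow> cmod (D U u a) \<le> B" by (auto simp: bounded_iff)
  have "cmod (D U u a) \<le> max 0 B" if a: "a \<in> U" for a
  proof (cases "a \<in> ?S")
    case False
    then obtain W where W: "openin T W" "a \<in> W" "W \<subseteq> U" "zero_on T \<F> W D"
      using a unfolding operator_support_def by blast
    have "D U u a = D W (res \<F> U W u) a" by (rule sheaf_hom_res_apply[OF hom U W(1,3) _ u W(2), symmetric]) simp
    also have "\<dots> = 0" by (rule zero_onD[OF W(4,1) _ _ W(2)]) (use U u W in \<open>auto intro: F_res_closed\<close>)
    finally show ?thesis by simp
  qed (use B in fastforce)
  then show ?thesis by (auto intro!: bdd_aboveI[of _ "max 0 B"])
qed

lemma Diff_c_sheaf_hom: "D \<in> Diff_c T \<O> \<F> U \<Longrightarrow> sheaf_hom T \<O> \<F> U D"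
  by (simp add: Diff_c_def diff_operator_def)

lemma diff_seminorm_ge:
  assumes "D \<in> Diff_c T \<O> \<F> U" "openin T U" "u \<in> carrier (sec \<F> U)" "a \<in> U"
  shows "cmod (D U u a) \<le> diff_seminorm U D u"
  unfolding diff_seminorm_def by (rule cSup_upper[OF _ Diff_c_bdd_above[OF assms(1-3)]]) (use assms(4) in simp)

lemma diff_seminorm_nonneg:
  assumes "D \<in> Diff_c T \<O> \<F> U" "openin T U" "u \<in> carrier (sec \<F> U)"
  shows "0 \<le> diff_seminorm U D u"
  unfolding diff_seminorm_def by (rule cSup_upper[OF _ Diff_c_bdd_above[OF assms]]) simp

lemma diff_seminorm_le: "0 \<le> B \<Longrightarrow> (\<And>a. a \<in> U \<Longrightarrow> cmod (D U u a) \<le> B) \<Longrightarrow> diff_seminorm U D u \<le> B"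
  unfolding diff_seminorm_def by (rule cSup_least) auto

lemma diff_seminorm_triangle:
  assumes D: "D \<in> Diff_c T \<O> \<F> U" and U: "openin T U" and u: "u \<in> carrier (sec \<F> U)" and v: "v \<in> carrier (sec \<F> U)"
  shows "diff_seminorm U D (u \<oplus>\<^bsub>sec \<F> U\<^esub> v) \<le> diff_seminorm U D u + diff_seminorm U D v"
proof (rule diff_seminorm_le)
  show "0 \<le> diff_seminorm U D u + diff_seminorm U D v"
    using diff_seminorm_nonneg[OF D U u] diff_seminorm_nonneg[OF D U v] by simp
  fix a assume a: "a \<in> U"
  have "cmod (D U (u \<oplus>\<^bsub>sec \<F> U\<^esub> v) a) = cmod (D U u a + D U v a)"
    using sheaf_hom_add[OF Diff_c_sheaf_hom[OF D] U order_refl u v a] by simp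
  also have "\<dots> \<le> cmod (D U u a) + cmod (D U v a)" by (rule norm_triangle_ineq)
  also have "\<dots> \<le> diff_seminorm U D u + diff_seminorm U D v"
    by (intro add_mono diff_seminorm_ge D U u v a)
  finally show "cmod (D U (u \<oplus>\<^bsub>sec \<F> U\<^esub> v) a) \<le> \<dots>" .
qed

lemma diff_seminorm_zero:
  assumes D: "D \<in> Diff_c T \<O> \<F> U" and U: "openin T U"
  shows "diff_seminorm U D \<zero>\<^bsub>sec \<F> U\<^esub> = 0"
proof (rule antisym)
  show "diff_seminorm U D \<zero>\<^bsub>sec \<F> U\<^esub> \<le> 0"
    by (rule diff_seminorm_le) (use sheaf_hom_zero[OF Diff_c_sheaf_hom[OF D] U order_refl] in auto)
  show "0 \<le> diff_seminorm U D \<zero>\<^bsub>sec \<F> U\<^esub>"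
    by (rule diff_seminorm_nonneg[OF D U F_zero_closed[OF U]])
qed

lemma diff_seminorm_zero_ext:
  assumes V: "openin T V" and u: "u \<in> carrier (sec \<F> (topspace T))"
  shows "diff_seminorm (topspace T) (zero_ext V D) u = diff_seminorm V D (res \<F> (topspace T) V u)"
proof -
  have "topspace T \<inter> V = V" using openin_subset[OF V] by blast
  then have "insert 0 ((\<lambda>a. cmod (zero_ext V D (topspace T) u a)) ` topspace T) =
      insert 0 ((\<lambda>a. cmod (D V (res \<F> (topspace T) V u) a)) ` V)"
  proof (intro equalityI subsetI)
    fix y assume "y \<in> insert 0 ((\<lambda>a. cmod (zero_ext V D (topspace T) u a)) ` topspace T)"
    then consider "y = 0" | a where "a \<in> topspace T" "y = cmod (zero_ext V D (topspace T) u a)" by blast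
    then show "y \<in> insert 0 ((\<lambda>a. cmod (D V (res \<F> (topspace T) V u) a)) ` V)"
      using \<open>topspace T \<inter> V = V\<close> by cases (auto simp: zero_ext_def)
  next
    fix y assume "y \<in> insert 0 ((\<lambda>a. cmod (D V (res \<F> (topspace T) V u) a)) ` V)"
    then consider "y = 0" | a where "a \<in> V" "y = cmod (D V (res \<F> (topspace T) V u) a)" by blast
    then show "y \<in> insert 0 ((\<lambda>a. cmod (zero_ext V D (topspace T) u a)) ` topspace T)"
    proof cases
      case (2 a)
      then have "y = cmod (zero_ext V D (topspace T) u a)" "a \<in> topspace T"
        using \<open>topspace T \<inter> V = V\<close> by (auto simp: zero_ext_def)
      then show ?thesis by blast
    qed simp
  qed
  then show ?thesis by (simp add: diff_seminorm_def)
qed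

lemma diff_seminorm_premult:
  assumes "openin T U" "f \<in> carrier (sec \<O> U)"
  shows "diff_seminorm U (premult U f D) u = diff_seminorm U D (f \<odot>\<^bsub>sec \<F> U\<^esub> u)"
  using assms by (simp add: diff_seminorm_def premult_def O_res_id)

end

section \<open>Test sections\<close>

lemma module_subspace:
  fixes X Y :: "'v cspace"
  assumes X: "Module.module \<complex>\<^sub>R X"
    and Y: "add Y = add X" "zero Y = zero X" "smult Y = smult X" "carrier Y \<subseteq> carrier X"
    and cl: "\<zero>\<^bsub>X\<^esub> \<in> carrier Y" "\<And>x y. x \<in> carrier Y \<Longrightarrow> y \<in> carrier Y \<Longrightarrow> x \<oplus>\<^bsub>X\<^esub> y \<in> carrier Y"
      "\<And>c x. x \<in> carrier Y \<Longrightarrow> c \<odot>\<^bsub>X\<^esub> x \<in> carrier Y"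
  shows "Module.module \<complex>\<^sub>R Y"
proof -
  interpret X: Module.module "\<complex>\<^sub>R" X by fact
  note in_X = subsetD[OF Y(4)]
  show ?thesis
  proof (intro moduleI cring_complex_ring abelian_groupI, unfold Y complex_ring_simps)
    fix x assume x: "x \<in> carrier Y"
    have "(- 1) \<odot>\<^bsub>X\<^esub> x \<oplus>\<^bsub>X\<^esub> x = \<zero>\<^bsub>X\<^esub>"
      using module_minus_eq_smult[OF X in_X[OF x]] X.l_neg[OF in_X[OF x]] by simp
    then show "\<exists>y\<in>carrier Y. y \<oplus>\<^bsub>X\<^esub> x = \<zero>\<^bsub>X\<^esub>" using cl(3)[OF x] by blast
  qed (use cl in_X X.a_assoc X.a_comm X.smult_l_distr X.smult_r_distr X.smult_assoc1 X.smult_one in auto)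
qed

lemma linear_in_finsum:
  assumes X: "Module.module \<complex>\<^sub>R X" and Y: "Module.module \<complex>\<^sub>R Y" and f: "linear_in X Y f"
    and A: "finite A" "\<And>i. i \<in> A \<Longrightarrow> x i \<in> carrier X"
  shows "f (finsum X x A) = finsum Y (\<lambda>i. f (x i)) A"
proof -
  interpret X: Module.module "\<complex>\<^sub>R" X by fact
  interpret Y: Module.module "\<complex>\<^sub>R" Y by fact
  show ?thesis
    using A
  proof (induction A)
    case empty
    then show ?case by (simp add: linear_in_zero[OF X Y f])
  next
    case (insert i A)
    have x: "x \<in> A \<rightarrow> carrier X" "x i \<in> carrier X" using insert.prems by auto
    then have fx: "(\<lambda>i. f (x i)) \<in> A \<rightarrow> carrier Y" "f (x i) \<in> carrier Y"
      using linear_in_closed[OF f] by auto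
    have "f (finsum X x (insert i A)) = f (x i \<oplus>\<^bsub>X\<^esub> finsum X x A)"
      using X.finsum_insert[OF insert.hyps x] by simp
    also have "\<dots> = f (x i) \<oplus>\<^bsub>Y\<^esub> f (finsum X x A)"
      using linear_in_add[OF f x(2) X.finsum_closed[OF x(1)]] .
    also have "\<dots> = finsum Y (\<lambda>i. f (x i)) (insert i A)"
      using Y.finsum_insert[OF insert.hyps fx] insert by simp
    finally show ?case .
  qed
qed

lemma (in abelian_monoid) finsum_neutral_superset:
  assumes "finite B" "A \<subseteq> B" "\<And>i. i \<in> B - A \<Longrightarrow> f i = \<zero>" "\<And>i. i \<in> A \<Longrightarrow> f i \<in> carrier G"
  shows "finsum G f A = finsum G f B"
proof -
  have f: "f i \<in> carrier G" if "i \<in> B" for i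
    using that assms(3,4) by (cases "i \<in> A") auto
  show ?thesis
    by (rule add.finprod_mono_neutral_cong_left) (use assms f in auto)
qed

context module_sheaf_space
begin

abbreviation "M \<equiv> topspace T"
abbreviation "sections \<equiv> section_space T \<O> \<F>"
abbreviation "test \<equiv> test_space T \<O> \<F>"

lemma section_space_simps:
  "carrier (sections U) = carrier (sec \<F> U)" "zero (sections U) = zero (sec \<F> U)"
  "add (sections U) = add (sec \<F> U)" "smult (sections U) = scalar_mult \<O> \<F> U"
  "topo (sections U) = seminorm_topology (sec \<F> U) (diff_seminorm U ` Diff_c T \<O> \<F> U)"
  by (simp_all add: section_space_def fun_eq_iff)

lemma section_space_module:
  assumes U: "openin T U"
  shows "Module.module \<complex>\<^sub>R (sections U)"
proof -
  interpret F: Module.module "sec \<O> U" "sec \<F> U" by (rule F_module[OF U])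
  interpret O: Module.algebra "\<complex>\<^sub>R" "sec \<O> U" by (rule O_algebra[OF U])
  have k: "c \<odot>\<^bsub>sec \<O> U\<^esub> \<one>\<^bsub>sec \<O> U\<^esub> \<in> carrier (sec \<O> U)" for c by (rule const_closed[OF U])
  have "abelian_group (sections U)"
    by (rule abelian_groupI)
       (auto simp: section_space_simps F.a_ac intro!: bexI[of _ "\<ominus>\<^bsub>sec \<F> U\<^esub> _"] F.l_neg)
  then show ?thesis
  proof (intro moduleI cring_complex_ring, assumption, unfold section_space_simps complex_ring_simps scalar_mult_def)
    fix c d u v assume u: "u \<in> carrier (sec \<F> U)"
    show "c \<odot>\<^bsub>sec \<O> U\<^esub> \<one>\<^bsub>sec \<O> U\<^esub> \<odot>\<^bsub>sec \<F> U\<^esub> u \<in> carrier (sec \<F> U)" using k u by simp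
    show "(c + d) \<odot>\<^bsub>sec \<O> U\<^esub> \<one>\<^bsub>sec \<O> U\<^esub> \<odot>\<^bsub>sec \<F> U\<^esub> u =
        c \<odot>\<^bsub>sec \<O> U\<^esub> \<one>\<^bsub>sec \<O> U\<^esub> \<odot>\<^bsub>sec \<F> U\<^esub> u \<oplus>\<^bsub>sec \<F> U\<^esub> d \<odot>\<^bsub>sec \<O> U\<^esub> \<one>\<^bsub>sec \<O> U\<^esub> \<odot>\<^bsub>sec \<F> U\<^esub> u"
      using O.smult_l_distr[of c d "\<one>\<^bsub>sec \<O> U\<^esub>"] F.smult_l_distr[OF k[of c] k[of d] u] by simp
    have "(c * d) \<odot>\<^bsub>sec \<O> U\<^esub> \<one>\<^bsub>sec \<O> U\<^esub> = (c \<odot>\<^bsub>sec \<O> U\<^esub> \<one>\<^bsub>sec \<O> U\<^esub>) \<otimes>\<^bsub>sec \<O> U\<^esub> (d \<odot>\<^bsub>sec \<O> U\<^esub> \<one>\<^bsub>sec \<O> U\<^esub>)"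
      using O.smult_assoc1[of c d "\<one>\<^bsub>sec \<O> U\<^esub>"] O.smult_assoc2[of c "\<one>\<^bsub>sec \<O> U\<^esub>" "d \<odot>\<^bsub>sec \<O> U\<^esub> \<one>\<^bsub>sec \<O> U\<^esub>"] k[of d] by simp
    then show "(c * d) \<odot>\<^bsub>sec \<O> U\<^esub> \<one>\<^bsub>sec \<O> U\<^esub> \<odot>\<^bsub>sec \<F> U\<^esub> u =
        c \<odot>\<^bsub>sec \<O> U\<^esub> \<one>\<^bsub>sec \<O> U\<^esub> \<odot>\<^bsub>sec \<F> U\<^esub> (d \<odot>\<^bsub>sec \<O> U\<^esub> \<one>\<^bsub>sec \<O> U\<^esub> \<odot>\<^bsub>sec \<F> U\<^esub> u)"
      using F.smult_assoc1[OF k[of c] k[of d] u] by simp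
    show "1 \<odot>\<^bsub>sec \<O> U\<^esub> \<one>\<^bsub>sec \<O> U\<^esub> \<odot>\<^bsub>sec \<F> U\<^esub> u = u"
      using O.smult_one[of "\<one>\<^bsub>sec \<O> U\<^esub>"] F.smult_one[OF u] by simp
    assume v: "v \<in> carrier (sec \<F> U)"
    show "c \<odot>\<^bsub>sec \<O> U\<^esub> \<one>\<^bsub>sec \<O> U\<^esub> \<odot>\<^bsub>sec \<F> U\<^esub> (u \<oplus>\<^bsub>sec \<F> U\<^esub> v) =
        c \<odot>\<^bsub>sec \<O> U\<^esub> \<one>\<^bsub>sec \<O> U\<^esub> \<odot>\<^bsub>sec \<F> U\<^esub> u \<oplus>\<^bsub>sec \<F> U\<^esub> c \<odot>\<^bsub>sec \<O> U\<^esub> \<one>\<^bsub>sec \<O> U\<^esub> \<odot>\<^bsub>sec \<F> U\<^esub> v"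
      by (rule F.smult_r_distr[OF k u v])
  qed
qed

lemma openin_Diff_compactin: "openin T U \<Longrightarrow> compactin T K \<Longrightarrow> openin T (U - K)"
  using Hausdorff compactin_imp_closedin by blast

definition supp_in :: "'p set \<Rightarrow> 'p set \<Rightarrow> 'b set" where
  "supp_in U K = {u \<in> carrier (sec \<F> U). section_support T \<F> U u \<subseteq> K}"

text \<open>By the sheaf property, vanishing near each point off \<open>K\<close> is vanishing on
  the one open set \<open>U - K\<close>. In this form support conditions are checked by plain
  restriction.\<close>

lemma supp_in_iff:
  assumes U: "openin T U" and K: "compactin T K"
  shows "u \<in> supp_in U K \<longleftrightarrow> u \<in> carrier (sec \<F> U) \<and> res \<F> U (U - K) u = \<zero>\<^bsub>sec \<F> (U - K)\<^esub>"
proof -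
  have o: "openin T (U - K)" by (rule openin_Diff_compactin[OF U K])
  have "res \<F> U (U - K) u = \<zero>\<^bsub>sec \<F> (U - K)\<^esub>" if u: "u \<in> carrier (sec \<F> U)" and K: "section_support T \<F> U u \<subseteq> K"
  proof (rule F_eqI[OF o])
    show "res \<F> U (U - K) u \<in> carrier (sec \<F> (U - K))" by (rule F_res_closed[OF U o _ u]) blast
    show "\<zero>\<^bsub>sec \<F> (U - K)\<^esub> \<in> carrier (sec \<F> (U - K))" by (rule F_zero_closed[OF o])
    fix a assume a: "a \<in> U - K"
    then obtain V where V: "openin T V" "a \<in> V" "V \<subseteq> U" "res \<F> U V u = \<zero>\<^bsub>sec \<F> V\<^esub>"
      using K unfolding section_support_def by blast
    let ?W = "V \<inter> (U - K)"
    have oW: "openin T ?W" using V o by blast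
    have "res \<F> (U - K) ?W (res \<F> U (U - K) u) = res \<F> U ?W u"
      by (rule F_res_res[OF U o oW _ _ u]) auto
    also have "\<dots> = res \<F> V ?W (res \<F> U V u)"
      by (rule F_res_res[OF U V(1) oW V(3) _ u, symmetric]) auto
    also have "\<dots> = res \<F> (U - K) ?W \<zero>\<^bsub>sec \<F> (U - K)\<^esub>"
      using V(4) F_res_zero[OF V(1) oW] F_res_zero[OF o oW] by simp
    finally show "\<exists>W. openin T W \<and> a \<in> W \<and> W \<subseteq> U - K \<and> res \<F> (U - K) W (res \<F> U (U - K) u) = res \<F> (U - K) W \<zero>\<^bsub>sec \<F> (U - K)\<^esub>"
      using oW a V(2) by (intro exI[of _ ?W]) auto
  qed
  moreover have "section_support T \<F> U u \<subseteq> K" if "res \<F> U (U - K) u = \<zero>\<^bsub>sec \<F> (U - K)\<^esub>"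
    using that o unfolding section_support_def by blast
  ultimately show ?thesis unfolding supp_in_def by blast
qed

lemma supp_in_carrier: "supp_in U K \<subseteq> carrier (sec \<F> U)"
  by (auto simp: supp_in_def)

lemma supp_in_mono: "K \<subseteq> K' \<Longrightarrow> supp_in U K \<subseteq> supp_in U K'"
  by (auto simp: supp_in_def)

lemma supp_in_zero: "openin T U \<Longrightarrow> compactin T K \<Longrightarrow> \<zero>\<^bsub>sec \<F> U\<^esub> \<in> supp_in U K"
  by (simp add: supp_in_iff F_zero_closed F_res_zero openin_Diff_compactin)

lemma supp_in_add:
  assumes "openin T U" "compactin T K" "u \<in> supp_in U K" "v \<in> supp_in U K"
  shows "u \<oplus>\<^bsub>sec \<F> U\<^esub> v \<in> supp_in U K"
proof -
  have o: "openin T (U - K)" by (rule openin_Diff_compactin[OF assms(1,2)])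
  interpret Module.module "sec \<O> (U - K)" "sec \<F> (U - K)" by (rule F_module[OF o])
  show ?thesis using assms o by (simp add: supp_in_iff F_add_closed F_res_add)
qed

lemma supp_in_smult:
  assumes "openin T U" "compactin T K" "u \<in> supp_in U K" "f \<in> carrier (sec \<O> U)"
  shows "f \<odot>\<^bsub>sec \<F> U\<^esub> u \<in> supp_in U K"
proof -
  have o: "openin T (U - K)" by (rule openin_Diff_compactin[OF assms(1,2)])
  interpret Module.module "sec \<O> (U - K)" "sec \<F> (U - K)" by (rule F_module[OF o])
  have "res \<O> U (U - K) f \<in> carrier (sec \<O> (U - K))" using assms o by (intro O_res_closed) auto
  moreover have "(res \<O> U (U - K) f) \<odot>\<^bsub>sec \<F> (U - K)\<^esub> \<zero>\<^bsub>sec \<F> (U - K)\<^esub> = \<zero>\<^bsub>sec \<F> (U - K)\<^esub>"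
    using smult_r_null calculation by simp
  ultimately show ?thesis using assms o by (simp add: supp_in_iff F_smult_closed F_res_smult)
qed

lemma test_space_simps:
  "carrier (test U) = (\<Union>K\<in>{K. compactin T K \<and> K \<subseteq> U}. supp_in U K)" "zero (test U) = zero (sec \<F> U)"
  "add (test U) = add (sec \<F> U)" "smult (test U) = scalar_mult \<O> \<F> U"
  by (auto simp: test_space_def lc_union_simps section_space_simps supported_space_def linear_subspace_def supp_in_def)

lemma test_carrierE:
  assumes "u \<in> carrier (test U)"
  obtains K where "compactin T K" "K \<subseteq> U" "u \<in> supp_in U K"
  using assms by (auto simp: test_space_simps)

lemma test_carrierI: "compactin T K \<Longrightarrow> K \<subseteq> U \<Longrightarrow> u \<in> supp_in U K \<Longrightarrow> u \<in> carrier (test U)"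
  by (auto simp: test_space_simps)

lemma test_subset: "carrier (test U) \<subseteq> carrier (sec \<F> U)"
  using supp_in_carrier by (auto simp: test_space_simps)

lemma test_common_support:
  assumes "u \<in> carrier (test U)" "v \<in> carrier (test U)"
  obtains K where "compactin T K" "K \<subseteq> U" "u \<in> supp_in U K" "v \<in> supp_in U K"
proof -
  obtain K K' where K: "compactin T K" "K \<subseteq> U" "u \<in> supp_in U K" "compactin T K'" "K' \<subseteq> U" "v \<in> supp_in U K'"
    using assms by (metis test_carrierE)
  show thesis
    by (rule that[of "K \<union> K'"])
       (use K supp_in_mono[of K "K \<union> K'" U] supp_in_mono[of K' "K \<union> K'" U] in \<open>auto intro: compactin_Un\<close>)
qed

lemma test_module:
  assumes U: "openin T U"
  shows "Module.module \<complex>\<^sub>R (test U)"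
proof (rule module_subspace[OF section_space_module[OF U]])
  show "carrier (test U) \<subseteq> carrier (sections U)" using test_subset by (simp add: section_space_simps)
  show "\<zero>\<^bsub>sections U\<^esub> \<in> carrier (test U)"
    using supp_in_zero[OF U, of "{}"] by (intro test_carrierI[of "{}"]) (auto simp: section_space_simps)
  show "x \<oplus>\<^bsub>sections U\<^esub> y \<in> carrier (test U)" if "x \<in> carrier (test U)" "y \<in> carrier (test U)" for x y
    using that by (rule test_common_support) (auto simp: section_space_simps intro: test_carrierI supp_in_add[OF U])
  show "c \<odot>\<^bsub>sections U\<^esub> x \<in> carrier (test U)" if "x \<in> carrier (test U)" for c x
    using that
    by (rule test_carrierE)
       (auto simp: section_space_simps scalar_mult_def intro!: test_carrierI supp_in_smult[OF U] const_closed[OF U])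
qed (simp_all add: test_space_simps section_space_simps)

abbreviation "piece U K \<equiv> supported_space T \<O> \<F> U K"

lemma piece_simps:
  "carrier (piece U K) = supp_in U K"
  "topo (piece U K) = subtopology (seminorm_topology (sec \<F> U) (diff_seminorm U ` Diff_c T \<O> \<F> U)) (supp_in U K)"
  by (auto simp: supported_space_def linear_subspace_def supp_in_def section_space_simps)

lemma piece_topspace: "topspace (topo (piece U K)) = carrier (piece U K)"
  using supp_in_carrier by (auto simp: piece_simps topspace_seminorm_topology)

lemma test_pieces: "Y \<in> {piece U K | K. compactin T K \<and> K \<subseteq> U} \<Longrightarrow> topspace (topo Y) = carrier Y"
  using piece_topspace by auto

lemma lcs_test: "openin T U \<Longrightarrow> lcs (test U)"
  unfolding test_space_def
  by (rule lcs_lc_union[OF _ test_pieces]) (use test_module in \<open>simp_all add: test_space_def\<close>)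

lemma continuous_map_from_test:
  assumes U: "openin T U" and E: "lcs E" and f: "linear_in (test U) E f"
    and c: "\<And>K. compactin T K \<Longrightarrow> K \<subseteq> U \<Longrightarrow> continuous_map (topo (piece U K)) (topo E) f"
  shows "continuous_map (topo (test U)) (topo E) f"
  using test_module[OF U] f c unfolding test_space_def
  by (intro continuous_map_from_lc_union[OF _ test_pieces E]) auto

lemma continuous_map_piece_test:
  assumes U: "openin T U" and K: "compactin T K" "K \<subseteq> U"
  shows "continuous_map (topo (piece U K)) (topo (test U)) (\<lambda>x. x)"
  using test_module[OF U] K unfolding test_space_def
  by (intro continuous_map_inclusion_lc_union[OF _ test_pieces]) auto

lemma seminorms_subadditive:
  assumes "openin T U"
  shows "\<forall>p\<in>diff_seminorm U ` Diff_c T \<O> \<F> U. \<forall>y\<in>carrier (sec \<F> U). \<forall>z\<in>carrier (sec \<F> U).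
      p (y \<oplus>\<^bsub>sec \<F> U\<^esub> z) \<le> p y + p z"
    "\<forall>p\<in>diff_seminorm U ` Diff_c T \<O> \<F> U. p \<zero>\<^bsub>sec \<F> U\<^esub> = 0"
  using diff_seminorm_triangle[OF _ assms] diff_seminorm_zero[OF _ assms] by blast+

text \<open>Linearity in the sense of \<open>linear_in\<close> speaks only of sums and complex
  multiples; differences, which define the topology, have to be written through these.\<close>

lemma F_minus_eq:
  assumes U: "openin T U" and u: "u \<in> carrier (sec \<F> U)" and v: "v \<in> carrier (sec \<F> U)"
  shows "v \<ominus>\<^bsub>sec \<F> U\<^esub> u = v \<oplus>\<^bsub>sec \<F> U\<^esub> scalar_mult \<O> \<F> U (-1) u"
proof -
  interpret F: Module.module "sec \<O> U" "sec \<F> U" by (rule F_module[OF U])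
  have "\<ominus>\<^bsub>sections U\<^esub> u = scalar_mult \<O> \<F> U (-1) u"
    using module_minus_eq_smult[OF section_space_module[OF U], of u] u by (simp add: section_space_simps)
  moreover have "\<ominus>\<^bsub>sections U\<^esub> u = \<ominus>\<^bsub>sec \<F> U\<^esub> u"
    by (simp add: a_inv_def m_inv_def section_space_simps)
  ultimately show ?thesis by (simp add: F.minus_eq)
qed

lemma supp_in_minus:
  assumes U: "openin T U" and K: "compactin T K" and u: "u \<in> supp_in U K" and v: "v \<in> supp_in U K"
  shows "v \<ominus>\<^bsub>sec \<F> U\<^esub> u \<in> supp_in U K"
  using u v supp_in_carrier supp_in_add[OF U K v supp_in_smult[OF U K u const_closed[OF U, of "-1"]]]
  by (subst F_minus_eq[OF U]) (auto simp: scalar_mult_def)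

text \<open>A criterion adapted to inductive limits: each space of sections supported in a compact
  \<open>K\<close> goes into a single such space of the target, and on it every target seminorm is
  dominated by one source seminorm. The dominating operator may depend on \<open>K\<close>.\<close>

lemma continuous_map_tests:
  assumes U: "openin T U" and V: "openin T V" and m: "linear_in (test U) (test V) m"
    and K: "\<And>K. compactin T K \<Longrightarrow> K \<subseteq> U \<Longrightarrow> \<exists>K'. compactin T K' \<and> K' \<subseteq> V \<and> m ` supp_in U K \<subseteq> supp_in V K' \<and>
      (\<forall>D'\<in>Diff_c T \<O> \<F> V. \<exists>D\<in>Diff_c T \<O> \<F> U. \<forall>z\<in>supp_in U K. diff_seminorm V D' (m z) \<le> diff_seminorm U D z)"
  shows "continuous_map (topo (test U)) (topo (test V)) m"
proof (rule continuous_map_from_test[OF U lcs_test[OF V] m])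
  fix K assume c: "compactin T K" "K \<subseteq> U"
  then obtain K' where K': "compactin T K'" "K' \<subseteq> V" "m ` supp_in U K \<subseteq> supp_in V K'"
    "\<And>D'. D' \<in> Diff_c T \<O> \<F> V \<Longrightarrow> \<exists>D\<in>Diff_c T \<O> \<F> U. \<forall>z\<in>supp_in U K. diff_seminorm V D' (m z) \<le> diff_seminorm U D z"
    using K by meson
  have "continuous_map (topo (piece U K)) (topo (piece V K')) m"
    unfolding piece_simps
  proof (rule continuous_map_seminorm_topology[OF F_abelian_group[OF U] supp_in_carrier seminorms_subadditive[OF U]
        F_abelian_group[OF V] supp_in_carrier seminorms_subadditive[OF V]])
    show "m \<in> supp_in U K \<rightarrow> supp_in V K'" using K'(3) by blast
    fix x y assume xy: "x \<in> supp_in U K" "y \<in> supp_in U K"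
    have tx: "x \<in> carrier (test U)" "y \<in> carrier (test U)" using xy c test_carrierI by blast+
    have xU: "x \<in> carrier (sec \<F> U)" "y \<in> carrier (sec \<F> U)" using tx test_subset by blast+
    have mV: "m x \<in> carrier (sec \<F> V)" "m y \<in> carrier (sec \<F> V)"
      using tx linear_in_closed[OF m] test_subset by blast+
    have sx: "scalar_mult \<O> \<F> U (- 1) x \<in> carrier (test U)"
      using module.smult_closed[OF test_module[OF U], of "-1" x] tx by (simp add: test_space_simps(4))
    have "m (y \<ominus>\<^bsub>sec \<F> U\<^esub> x) = m y \<ominus>\<^bsub>sec \<F> V\<^esub> m x"
      unfolding F_minus_eq[OF U xU] F_minus_eq[OF V mV]
      using linear_in_add[OF m tx(2) sx] linear_in_smult[OF m tx(1), of "-1"] by (simp add: test_space_simps)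
    then show "y \<ominus>\<^bsub>sec \<F> U\<^esub> x \<in> supp_in U K \<and> m (y \<ominus>\<^bsub>sec \<F> U\<^esub> x) = m y \<ominus>\<^bsub>sec \<F> V\<^esub> m x"
      using supp_in_minus[OF U c(1) xy] by simp
  next
    fix p' and e :: real assume "p' \<in> diff_seminorm V ` Diff_c T \<O> \<F> V" "e > 0"
    then obtain D' D where "p' = diff_seminorm V D'" "D \<in> Diff_c T \<O> \<F> U"
      "\<forall>z\<in>supp_in U K. diff_seminorm V D' (m z) \<le> diff_seminorm U D z"
      using K'(4) by blast
    then show "\<exists>Q d. finite Q \<and> Q \<subseteq> diff_seminorm U ` Diff_c T \<O> \<F> U \<and> d > 0 \<and>
        (\<forall>z\<in>supp_in U K. (\<forall>p\<in>Q. p z < d) \<longrightarrow> p' (m z) < e)"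
      using \<open>e > 0\<close> by (intro exI[of _ "{diff_seminorm U D}"] exI[of _ e]) fastforce
  qed
  from continuous_map_compose[OF this continuous_map_piece_test[OF V K'(1,2)]]
  show "continuous_map (topo (piece U K)) (topo (test V)) m" by (simp add: o_def)
qed

text \<open>Multiplication by a cutoff followed by restriction. It goes from test sections on
  \<open>M\<close> to test sections on \<open>V\<close>, against the direction of extension by
  zero.\<close>

definition mult_res :: "'p set \<Rightarrow> 'a \<Rightarrow> 'b \<Rightarrow> 'b" where
  "mult_res V f u = res \<F> M V (f \<odot>\<^bsub>sec \<F> M\<^esub> u)"

context
  fixes V f Z
  assumes V: "openin T V" and f: "vanishes_off f Z" and Z: "Z \<subseteq> V"
begin

text \<open>The product vanishes off \<open>Z\<close> and off \<open>K\<close>, hence, by gluing,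
  off their intersection. That set is compact as \<open>Z\<close> is closed, and it lies in
  \<open>V\<close>.\<close>

lemma mult_res_supp:
  assumes K: "compactin T K" and u: "u \<in> supp_in M K"
  shows "f \<odot>\<^bsub>sec \<F> M\<^esub> u \<in> supp_in M (Z \<inter> K)" "mult_res V f u \<in> supp_in V (Z \<inter> K)" "compactin T (Z \<inter> K)"
proof -
  have fM: "f \<in> carrier (sec \<O> M)" and Zc: "closedin T Z" using f vanishes_offD by auto
  have uM: "u \<in> carrier (sec \<F> M)" using u supp_in_carrier by blast
  have fu: "f \<odot>\<^bsub>sec \<F> M\<^esub> u \<in> carrier (sec \<F> M)" by (rule F_smult_closed[OF openin_topspace fM uM])
  show ZK: "compactin T (Z \<inter> K)" using closed_Int_compactin[OF Zc K] .
  have o: "openin T (M - Z)" "openin T (M - K)" "openin T (M - Z \<inter> K)"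
    using Zc openin_Diff_compactin[OF openin_topspace] K ZK by auto
  have "res \<F> M (M - Z \<inter> K) (f \<odot>\<^bsub>sec \<F> M\<^esub> u) = \<zero>\<^bsub>sec \<F> (M - Z \<inter> K)\<^esub>"
  proof (rule sheaf_eqI_Un[OF set_sheaf_F o(1,2)])
    have eq: "(M - Z) \<union> (M - K) = M - Z \<inter> K" by blast
    have s: "M - Z \<subseteq> M - Z \<inter> K" "M - K \<subseteq> M - Z \<inter> K" by auto
    show "res \<F> M (M - Z \<inter> K) (f \<odot>\<^bsub>sec \<F> M\<^esub> u) \<in> carrier (sec \<F> ((M - Z) \<union> (M - K)))"
      unfolding eq by (rule F_res_closed[OF openin_topspace o(3) _ fu]) blast
    show "\<zero>\<^bsub>sec \<F> (M - Z \<inter> K)\<^esub> \<in> carrier (sec \<F> ((M - Z) \<union> (M - K)))"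
      unfolding eq by (rule F_zero_closed[OF o(3)])
    have r: "res \<F> (M - Z \<inter> K) W (res \<F> M (M - Z \<inter> K) (f \<odot>\<^bsub>sec \<F> M\<^esub> u)) = res \<O> M W f \<odot>\<^bsub>sec \<F> W\<^esub> res \<F> M W u"
      if "openin T W" "W \<subseteq> M - Z \<inter> K" for W
      using that F_res_res[OF openin_topspace o(3) that(1) _ that(2) fu] F_res_smult[OF openin_topspace that(1) _ fM uM] by auto
    have z: "res \<F> (M - Z \<inter> K) W \<zero>\<^bsub>sec \<F> (M - Z \<inter> K)\<^esub> = \<zero>\<^bsub>sec \<F> W\<^esub>" if "openin T W" "W \<subseteq> M - Z \<inter> K" for W
      by (rule F_res_zero[OF o(3) that])
    interpret A: Module.module "sec \<O> (M - Z)" "sec \<F> (M - Z)" by (rule F_module[OF o(1)])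
    interpret B: Module.module "sec \<O> (M - K)" "sec \<F> (M - K)" by (rule F_module[OF o(2)])
    have "res \<O> M (M - Z) f \<odot>\<^bsub>sec \<F> (M - Z)\<^esub> res \<F> M (M - Z) u = \<zero>\<^bsub>sec \<F> (M - Z)\<^esub>"
      using f A.smult_l_null[OF F_res_closed[OF openin_topspace o(1) _ uM]] by (simp add: vanishes_off_def)
    then show "res \<F> ((M - Z) \<union> (M - K)) (M - Z) (res \<F> M (M - Z \<inter> K) (f \<odot>\<^bsub>sec \<F> M\<^esub> u)) =
        res \<F> ((M - Z) \<union> (M - K)) (M - Z) \<zero>\<^bsub>sec \<F> (M - Z \<inter> K)\<^esub>"
      unfolding eq r[OF o(1) s(1)] z[OF o(1) s(1)] .
    have "res \<O> M (M - K) f \<odot>\<^bsub>sec \<F> (M - K)\<^esub> res \<F> M (M - K) u = \<zero>\<^bsub>sec \<F> (M - K)\<^esub>"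
      using u supp_in_iff[OF openin_topspace K] B.smult_r_null[OF O_res_closed[OF openin_topspace o(2) _ fM]] by simp
    then show "res \<F> ((M - Z) \<union> (M - K)) (M - K) (res \<F> M (M - Z \<inter> K) (f \<odot>\<^bsub>sec \<F> M\<^esub> u)) =
        res \<F> ((M - Z) \<union> (M - K)) (M - K) \<zero>\<^bsub>sec \<F> (M - Z \<inter> K)\<^esub>"
      unfolding eq r[OF o(2) s(2)] z[OF o(2) s(2)] .
  qed
  then show s: "f \<odot>\<^bsub>sec \<F> M\<^esub> u \<in> supp_in M (Z \<inter> K)" using fu by (simp add: supp_in_iff ZK)
  have VM: "V \<subseteq> M" using V openin_subset by blast
  have oV: "openin T (V - Z \<inter> K)" by (rule openin_Diff_compactin[OF V ZK])
  have "res \<F> V (V - Z \<inter> K) (mult_res V f u) = res \<F> M (V - Z \<inter> K) (f \<odot>\<^bsub>sec \<F> M\<^esub> u)"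
    unfolding mult_res_def by (rule F_res_res[OF openin_topspace V oV VM _ fu]) blast
  also have "\<dots> = res \<F> (M - Z \<inter> K) (V - Z \<inter> K) (res \<F> M (M - Z \<inter> K) (f \<odot>\<^bsub>sec \<F> M\<^esub> u))"
    by (rule F_res_res[OF openin_topspace o(3) oV _ _ fu, symmetric]) (use VM in auto)
  also have "\<dots> = \<zero>\<^bsub>sec \<F> (V - Z \<inter> K)\<^esub>"
    using s F_res_zero[OF o(3) oV] VM by (auto simp: supp_in_iff[OF openin_topspace ZK])
  finally show "mult_res V f u \<in> supp_in V (Z \<inter> K)"
    using F_res_closed[OF openin_topspace V VM fu] by (simp add: supp_in_iff[OF V ZK] mult_res_def)
qed

lemma mult_res_test: "u \<in> carrier (test M) \<Longrightarrow> mult_res V f u \<in> carrier (test V)"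
proof (erule test_carrierE)
  fix K assume "compactin T K" "u \<in> supp_in M K"
  then show "mult_res V f u \<in> carrier (test V)"
    using mult_res_supp[of K u] Z by (intro test_carrierI[of "Z \<inter> K"]) auto
qed

lemma mult_res_linear: "linear_in (test M) (test V) (mult_res V f)"
  unfolding linear_in_def test_space_simps(3,4)
proof (intro conjI ballI allI)
  have fM: "f \<in> carrier (sec \<O> M)" using f vanishes_offD by auto
  have VM: "V \<subseteq> M" using V openin_subset by blast
  interpret F: Module.module "sec \<O> M" "sec \<F> M" by (rule F_module) simp
  fix x assume x: "x \<in> carrier (test M)"
  then have x': "x \<in> carrier (sec \<F> M)" using test_subset by blast
  show "mult_res V f (scalar_mult \<O> \<F> M c x) = scalar_mult \<O> \<F> V c (mult_res V f x)" for c
    using smult_scalar_mult[OF openin_topspace fM x'] res_scalar_mult[OF openin_topspace V VM] fM x'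
    by (simp add: mult_res_def)
  fix y assume "y \<in> carrier (test M)"
  then have y': "y \<in> carrier (sec \<F> M)" using test_subset by blast
  show "mult_res V f (x \<oplus>\<^bsub>sec \<F> M\<^esub> y) = mult_res V f x \<oplus>\<^bsub>sec \<F> V\<^esub> mult_res V f y"
    using F.smult_r_distr[OF fM x' y'] F_res_add[OF openin_topspace V VM] fM x' y' by (simp add: mult_res_def)
qed (use mult_res_test in auto)

text \<open>An operator on \<open>V\<close> is extended by zero to \<open>M\<close> and then
  composed with multiplication by \<open>f\<close>; its seminorm on the source equals the one to be
  estimated.\<close>

lemma mult_res_continuous: "continuous_map (topo (test M)) (topo (test V)) (mult_res V f)"
proof (rule continuous_map_tests[OF openin_topspace V mult_res_linear])
  fix K assume K: "compactin T K" "K \<subseteq> M"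
  have fM: "f \<in> carrier (sec \<O> M)" using f vanishes_offD by auto
  have "\<exists>D\<in>Diff_c T \<O> \<F> M. \<forall>z\<in>supp_in M K. diff_seminorm V D' (mult_res V f z) \<le> diff_seminorm M D z"
    if D': "D' \<in> Diff_c T \<O> \<F> V" for D'
  proof (intro bexI ballI)
    \<comment> \<open>No shrinking of supports is wanted here, so the closed set taken is
      \<open>M\<close> itself and the vanishing condition concerns the empty set.\<close>
    have e: "openin T (M - M)" by simp
    have "res \<O> M (M - M) f = \<zero>\<^bsub>sec \<O> (M - M)\<^esub>"
      by (rule vanishes_offD(3)[OF f e]) simp
    then show "premult M f (zero_ext V D') \<in> Diff_c T \<O> \<F> M"
      by (intro premult_Diff_c[OF zero_ext_Diff_c[OF D' V] _ _ fM, of M]) auto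
    fix z assume "z \<in> supp_in M K"
    then have "f \<odot>\<^bsub>sec \<F> M\<^esub> z \<in> carrier (sec \<F> M)" using supp_in_carrier F_smult_closed[OF openin_topspace fM] by blast
    then show "diff_seminorm V D' (mult_res V f z) \<le> diff_seminorm M (premult M f (zero_ext V D')) z"
      by (simp add: diff_seminorm_premult[OF openin_topspace fM] diff_seminorm_zero_ext[OF V] mult_res_def)
  qed
  then show "\<exists>K'. compactin T K' \<and> K' \<subseteq> V \<and> mult_res V f ` supp_in M K \<subseteq> supp_in V K' \<and>
      (\<forall>D'\<in>Diff_c T \<O> \<F> V. \<exists>D\<in>Diff_c T \<O> \<F> M. \<forall>z\<in>supp_in M K. diff_seminorm V D' (mult_res V f z) \<le> diff_seminorm M D z)"
    using mult_res_supp[OF K(1)] Z closed_Int_compactin[OF vanishes_offD(2)[OF f] K(1)]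
    by (intro exI[of _ "Z \<inter> K"]) auto
qed

end

end

section \<open>Extension by zero\<close>

context module_sheaf_space
begin

text \<open>The definition refers to the exact support of \<open>u\<close>, while in practice only a
  compact set \<open>K\<close> around it is known. Both conditions amount to the same, since the
  complement of the support is the union of \<open>M - K\<close> and the largest open set where
  \<open>u\<close> vanishes.\<close>

lemma ext_by_zero_eqI:
  assumes V: "openin T V" and K: "compactin T K" "K \<subseteq> V" and u: "u \<in> supp_in V K"
    and w: "w \<in> carrier (sec \<F> M)" "res \<F> M V w = u" "res \<F> M (M - K) w = \<zero>\<^bsub>sec \<F> (M - K)\<^esub>"
  shows "ext_by_zero T \<F> M V u = w"
proof -
  let ?S = "section_support T \<F> V u"
  have uV: "u \<in> carrier (sec \<F> V)" and SK: "?S \<subseteq> K" using u by (auto simp: supp_in_def)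
  have VM: "V \<subseteq> M" using V openin_subset by blast
  define X where "X = \<Union>{W. openin T W \<and> W \<subseteq> V \<and> res \<F> V W u = \<zero>\<^bsub>sec \<F> W\<^esub>}"
  have SX: "?S = V - X" by (simp add: section_support_def X_def)
  have XV: "X \<subseteq> V" unfolding X_def by blast
  have oX: "openin T X" unfolding X_def by blast
  have oK: "openin T (M - K)" by (rule openin_Diff_compactin[OF openin_topspace K(1)])
  have MS: "M - ?S = (M - K) \<union> X" unfolding SX using SK[unfolded SX] XV VM K(2) by blast
  have oS: "openin T (M - ?S)" unfolding MS using oX oK by blast
  have wS: "res \<F> M (M - ?S) w = \<zero>\<^bsub>sec \<F> (M - ?S)\<^esub>"
  proof (rule F_eqI[OF oS])
    show "res \<F> M (M - ?S) w \<in> carrier (sec \<F> (M - ?S))"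
      by (rule F_res_closed[OF openin_topspace oS _ w(1)]) blast
    show "\<zero>\<^bsub>sec \<F> (M - ?S)\<^esub> \<in> carrier (sec \<F> (M - ?S))" by (rule F_zero_closed[OF oS])
    fix a assume a: "a \<in> M - ?S"
    have "\<exists>W. openin T W \<and> a \<in> W \<and> W \<subseteq> M - ?S \<and> res \<F> M W w = \<zero>\<^bsub>sec \<F> W\<^esub>"
    proof (cases "a \<in> X")
      case True
      then obtain W where W: "openin T W" "a \<in> W" "W \<subseteq> V" "W \<subseteq> X" "res \<F> V W u = \<zero>\<^bsub>sec \<F> W\<^esub>"
        unfolding X_def by blast
      have "res \<F> M W w = \<zero>\<^bsub>sec \<F> W\<^esub>"
        using F_res_res[OF openin_topspace V W(1) VM W(3) w(1)] w(2) W(5) by simp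
      then show ?thesis using W MS by blast
    next
      case False
      then show ?thesis using a MS oK w(3) by (intro exI[of _ "M - K"]) auto
    qed
    then obtain W where W: "openin T W" "a \<in> W" "W \<subseteq> M - ?S" "res \<F> M W w = \<zero>\<^bsub>sec \<F> W\<^esub>" by blast
    have "res \<F> (M - ?S) W (res \<F> M (M - ?S) w) = res \<F> (M - ?S) W \<zero>\<^bsub>sec \<F> (M - ?S)\<^esub>"
      using F_res_res[OF openin_topspace oS W(1) _ W(3) w(1)] W(4) F_res_zero[OF oS W(1,3)] by auto
    then show "\<exists>W. openin T W \<and> a \<in> W \<and> W \<subseteq> M - ?S \<and>
        res \<F> (M - ?S) W (res \<F> M (M - ?S) w) = res \<F> (M - ?S) W \<zero>\<^bsub>sec \<F> (M - ?S)\<^esub>"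
      using W by blast
  qed
  have uniq: "w' = w" if w': "w' \<in> carrier (sec \<F> M)" "res \<F> M V w' = u" "res \<F> M (M - ?S) w' = \<zero>\<^bsub>sec \<F> (M - ?S)\<^esub>" for w'
  proof (rule sheaf_eqI_Un[OF set_sheaf_F V oS])
    have eq: "V \<union> (M - ?S) = M" unfolding SX using VM by blast
    show "w' \<in> carrier (sec \<F> (V \<union> (M - ?S)))" unfolding eq by (rule w'(1))
    show "w \<in> carrier (sec \<F> (V \<union> (M - ?S)))" unfolding eq by (rule w(1))
    show "res \<F> (V \<union> (M - ?S)) V w' = res \<F> (V \<union> (M - ?S)) V w" unfolding eq w(2) w'(2) ..
    show "res \<F> (V \<union> (M - ?S)) (M - ?S) w' = res \<F> (V \<union> (M - ?S)) (M - ?S) w" unfolding eq wS w'(3) ..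
  qed
  show ?thesis
    unfolding ext_by_zero_def Let_def
    by (rule the_equality, intro conjI w wS, elim conjE, rule uniq)
qed

lemma ext_by_zero:
  assumes V: "openin T V" and K: "compactin T K" "K \<subseteq> V" and u: "u \<in> supp_in V K"
  shows "ext_by_zero T \<F> M V u \<in> supp_in M K" "res \<F> M V (ext_by_zero T \<F> M V u) = u"
proof -
  have uV: "u \<in> carrier (sec \<F> V)" "res \<F> V (V - K) u = \<zero>\<^bsub>sec \<F> (V - K)\<^esub>"
    using u by (auto simp: supp_in_iff[OF V K(1)])
  have VM: "V \<subseteq> M" using V openin_subset by blast
  have oK: "openin T (M - K)" "openin T (V - K)"
    using openin_Diff_compactin[OF _ K(1)] V by auto
  have eq: "V \<union> (M - K) = M" "V \<inter> (M - K) = V - K" using VM K(2) by auto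
  have "res \<F> V (V \<inter> (M - K)) u = res \<F> (M - K) (V \<inter> (M - K)) \<zero>\<^bsub>sec \<F> (M - K)\<^esub>"
    unfolding eq using uV F_res_zero[OF oK Diff_mono[OF VM order_refl]] by simp
  then obtain w where w: "w \<in> carrier (sec \<F> M)" "res \<F> M V w = u" "res \<F> M (M - K) w = \<zero>\<^bsub>sec \<F> (M - K)\<^esub>"
    using sheaf_glue_Un[OF set_sheaf_F V oK(1) uV(1) F_zero_closed[OF oK(1)]] unfolding eq by metis
  have "ext_by_zero T \<F> M V u = w" by (rule ext_by_zero_eqI[OF V K u w])
  then show "ext_by_zero T \<F> M V u \<in> supp_in M K" "res \<F> M V (ext_by_zero T \<F> M V u) = u"
    using w by (auto simp: supp_in_iff[OF openin_topspace K(1)])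
qed

lemma ext_by_zero_test: "openin T V \<Longrightarrow> u \<in> carrier (test V) \<Longrightarrow> ext_by_zero T \<F> M V u \<in> carrier (test M)"
  by (meson ext_by_zero(1) openin_subset order_trans test_carrierE test_carrierI)

lemma ext_by_zero_linear:
  assumes V: "openin T V"
  shows "linear_in (test V) (test M) (ext_by_zero T \<F> M V)"
  unfolding linear_in_def test_space_simps(3,4)
proof (intro conjI ballI allI)
  have VM: "V \<subseteq> M" using V openin_subset by blast
  let ?e = "ext_by_zero T \<F> M V"
  fix x assume x: "x \<in> carrier (test V)"
  have sc: "f \<odot>\<^bsub>sec \<F> V\<^esub> u \<in> supp_in V K" if "compactin T K" "u \<in> supp_in V K" "f \<in> carrier (sec \<O> V)" for f u K
    by (rule supp_in_smult[OF V that])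
  show "?e (scalar_mult \<O> \<F> V c x) = scalar_mult \<O> \<F> M c (?e x)" for c
  proof -
    obtain K where K: "compactin T K" "K \<subseteq> V" "x \<in> supp_in V K" using x by (rule test_carrierE)
    note e = ext_by_zero[OF V K]
    have eM: "?e x \<in> carrier (sec \<F> M)" using e(1) supp_in_carrier by blast
    have "scalar_mult \<O> \<F> M c (?e x) \<in> supp_in M K"
      unfolding scalar_mult_def by (rule supp_in_smult[OF openin_topspace K(1) e(1) const_closed[OF openin_topspace]])
    then show ?thesis
      using supp_in_smult[OF V K(1,3) const_closed[OF V]] res_scalar_mult[OF openin_topspace V VM eM] e(2)
      by (intro ext_by_zero_eqI[OF V K(1,2)]) (auto simp: scalar_mult_def supp_in_iff[OF openin_topspace K(1)])
  qed
  fix y assume y: "y \<in> carrier (test V)"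
  obtain K where K: "compactin T K" "K \<subseteq> V" "x \<in> supp_in V K" "y \<in> supp_in V K"
    using x y by (rule test_common_support)
  note e = ext_by_zero[OF V K(1,2,3)] ext_by_zero[OF V K(1,2,4)]
  have eM: "?e x \<in> carrier (sec \<F> M)" "?e y \<in> carrier (sec \<F> M)" using e(1,3) supp_in_carrier by blast+
  show "?e (x \<oplus>\<^bsub>sec \<F> V\<^esub> y) = ?e x \<oplus>\<^bsub>sec \<F> M\<^esub> ?e y"
    using supp_in_add[OF openin_topspace K(1) e(1,3)] supp_in_add[OF V K(1,3,4)] F_res_add[OF openin_topspace V VM eM] e(2,4)
    by (intro ext_by_zero_eqI[OF V K(1,2)]) (auto simp: supp_in_iff[OF openin_topspace K(1)])
qed (use ext_by_zero_test V in auto)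

text \<open>Restricted to \<open>V\<close>, an operator on \<open>M\<close> may lose the compactness
  of its support. It is therefore composed with a cutoff that is 1 near \<open>K\<close> and
  vanishes off a closed subset of \<open>V\<close>; on sections supported in \<open>K\<close> this
  changes nothing. That the cutoff depends on \<open>K\<close> is harmless, because continuity is
  tested for one \<open>K\<close> at a time.\<close>

lemma ext_by_zero_continuous:
  assumes V: "openin T V"
  shows "continuous_map (topo (test V)) (topo (test M)) (ext_by_zero T \<F> M V)"
proof (rule continuous_map_tests[OF V openin_topspace ext_by_zero_linear[OF V]])
  fix K assume K: "compactin T K" "K \<subseteq> V"
  let ?e = "ext_by_zero T \<F> M V"
  have VM: "V \<subseteq> M" using V openin_subset by blast
  obtain G Z where GZ: "bump G Z" "K \<subseteq> G" "Z \<subseteq> V" using compact_bump[OF K(1) V K(2)] by blast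
  then obtain f where f: "vanishes_off f Z" "res \<O> M G f = \<one>\<^bsub>sec \<O> G\<^esub>" and G: "openin T G"
    by (auto simp: bump_def)
  have fM: "f \<in> carrier (sec \<O> M)" and Z: "closedin T Z" using f vanishes_offD by auto
  let ?f = "res \<O> M V f"
  have fV: "?f \<in> carrier (sec \<O> V)" by (rule O_res_closed[OF openin_topspace V VM fM])
  have oVZ: "openin T (V - Z)" using V Z by blast
  have fZ: "res \<O> V (V - Z) ?f = \<zero>\<^bsub>sec \<O> (V - Z)\<^esub>"
    using O_res_res[OF openin_topspace V oVZ VM _ fM] vanishes_offD(3)[OF f(1) oVZ] by auto
  \<comment> \<open>Checked on two open sets covering \<open>V\<close>: on \<open>G\<close> the
    cutoff is 1, and off \<open>K\<close> both sides are zero.\<close>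
  have f1: "?f \<odot>\<^bsub>sec \<F> V\<^esub> u = u" if u: "u \<in> supp_in V K" for u
  proof (rule F_eqI[OF V])
    show uV: "u \<in> carrier (sec \<F> V)" using u supp_in_carrier by blast
    show fu: "?f \<odot>\<^bsub>sec \<F> V\<^esub> u \<in> carrier (sec \<F> V)" by (rule F_smult_closed[OF V fV uV])
    have r: "res \<F> V W (?f \<odot>\<^bsub>sec \<F> V\<^esub> u) = res \<O> M W f \<odot>\<^bsub>sec \<F> W\<^esub> res \<F> V W u" if "openin T W" "W \<subseteq> V" for W
      using F_res_smult[OF V that fV uV] O_res_res[OF openin_topspace V that(1) VM that(2) fM] by simp
    fix a assume a: "a \<in> V"
    show "\<exists>W. openin T W \<and> a \<in> W \<and> W \<subseteq> V \<and> res \<F> V W (?f \<odot>\<^bsub>sec \<F> V\<^esub> u) = res \<F> V W u"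
    proof (cases "a \<in> K")
      case True
      let ?W = "G \<inter> V"
      have W: "openin T ?W" using G V by blast
      interpret Module.module "sec \<O> ?W" "sec \<F> ?W" by (rule F_module[OF W])
      have "res \<O> M ?W f = \<one>\<^bsub>sec \<O> ?W\<^esub>"
        using O_res_res[OF openin_topspace G W openin_subset[OF G] _ fM] f(2) O_res_one[OF G W] by simp
      then have "res \<F> V ?W (?f \<odot>\<^bsub>sec \<F> V\<^esub> u) = res \<F> V ?W u"
        using r[OF W] smult_one[OF F_res_closed[OF V W _ uV]] by simp
      then show ?thesis using W True a GZ(2) by (intro exI[of _ ?W]) auto
    next
      case False
      let ?W = "V - K"
      have W: "openin T ?W" by (rule openin_Diff_compactin[OF V K(1)])
      interpret Module.module "sec \<O> ?W" "sec \<F> ?W" by (rule F_module[OF W])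
      have "res \<F> V ?W u = \<zero>\<^bsub>sec \<F> ?W\<^esub>" using u by (simp add: supp_in_iff[OF V K(1)])
      then have "res \<F> V ?W (?f \<odot>\<^bsub>sec \<F> V\<^esub> u) = res \<F> V ?W u"
        using r[OF W] smult_r_null[OF O_res_closed[OF openin_topspace W _ fM]] VM by auto
      then show ?thesis using W False a by (intro exI[of _ ?W]) auto
    qed
  qed
  have "\<exists>D'\<in>Diff_c T \<O> \<F> V. \<forall>z\<in>supp_in V K. diff_seminorm M D (?e z) \<le> diff_seminorm V D' z"
    if D: "D \<in> Diff_c T \<O> \<F> M" for D
  proof (intro bexI ballI)
    show D': "premult V ?f D \<in> Diff_c T \<O> \<F> V" by (rule premult_Diff_c[OF D V VM fV Z GZ(3) fZ])
    fix z assume z: "z \<in> supp_in V K"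
    note e = ext_by_zero[OF V K z]
    have hom: "sheaf_hom T \<O> \<F> M D" by (rule Diff_c_sheaf_hom[OF D])
    have zV: "z \<in> carrier (sec \<F> V)" and eM: "?e z \<in> carrier (sec \<F> M)" using z e(1) supp_in_carrier by blast+
    have eK: "res \<F> M (M - K) (?e z) = \<zero>\<^bsub>sec \<F> (M - K)\<^esub>" using e(1) by (simp add: supp_in_iff[OF openin_topspace K(1)])
    have oK: "openin T (M - K)" by (rule openin_Diff_compactin[OF openin_topspace K(1)])
    show "diff_seminorm M D (?e z) \<le> diff_seminorm V (premult V ?f D) z"
    proof (rule diff_seminorm_le[OF diff_seminorm_nonneg[OF D' V zV]])
      fix a assume a: "a \<in> M"
      show "cmod (D M (?e z) a) \<le> diff_seminorm V (premult V ?f D) z"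
      proof (cases "a \<in> V")
        case True
        have "premult V ?f D V z a = D V z a" unfolding premult_def O_res_id[OF V fV] f1[OF z] ..
        also have "\<dots> = D M (?e z) a"
          using sheaf_hom_res_apply[OF hom openin_topspace V VM order_refl eM True] e(2) by simp
        finally show ?thesis using diff_seminorm_ge[OF D' V zV True] by simp
      next
        case False
        then have aK: "a \<in> M - K" using a K(2) by blast
        have "D M (?e z) a = D (M - K) (res \<F> M (M - K) (?e z)) a"
          by (rule sheaf_hom_res_apply[OF hom openin_topspace oK _ order_refl eM aK, symmetric]) blast
        also have "\<dots> = 0" unfolding eK by (rule sheaf_hom_zero[OF hom oK _ aK]) blast
        finally show ?thesis using diff_seminorm_nonneg[OF D' V zV] by simp
      qed
    qed
  qed
  then show "\<exists>K'. compactin T K' \<and> K' \<subseteq> M \<and> ?e ` supp_in V K \<subseteq> supp_in M K' \<and>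
      (\<forall>D\<in>Diff_c T \<O> \<F> M. \<exists>D'\<in>Diff_c T \<O> \<F> V. \<forall>z\<in>supp_in V K. diff_seminorm M D (?e z) \<le> diff_seminorm V D' z)"
    using ext_by_zero(1)[OF V K] K VM by (intro exI[of _ K]) auto
qed

text \<open>Cutting off, restricting and extending back is just multiplication by \<open>f\<close>.
  This computes the composite of the restriction map with its candidate left inverse.\<close>

lemma ext_mult_res:
  assumes V: "openin T V" and f: "vanishes_off f Z" "Z \<subseteq> V" and u: "u \<in> carrier (test M)"
  shows "ext_by_zero T \<F> M V (mult_res V f u) = f \<odot>\<^bsub>sec \<F> M\<^esub> u"
proof -
  obtain K where K: "compactin T K" "u \<in> supp_in M K" using u by (rule test_carrierE)
  note s = mult_res_supp[OF V f K]
  show ?thesis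
    using s(1) f(2)
    by (intro ext_by_zero_eqI[OF V s(3) _ s(2)]) (auto simp: supp_in_iff[OF openin_topspace s(3)] mult_res_def)
qed

section \<open>Bounded sets of test sections\<close>

text \<open>If all seminorms vanished at \<open>u\<close>, then \<open>u\<close> would lie in every
  neighbourhood of zero. A seminorm that is not zero there has a nonzero value at some
  point.\<close>

lemma Hausdorff_separating_operator:
  assumes H: "Hausdorff_space (topo (sections M))" and u: "u \<in> carrier (sec \<F> M)" "u \<noteq> \<zero>\<^bsub>sec \<F> M\<^esub>"
  obtains D a where "D \<in> Diff_c T \<O> \<F> M" "a \<in> M" "D M u a \<noteq> 0"
proof -
  interpret F: Module.module "sec \<O> M" "sec \<F> M" by (rule F_module) simp
  let ?P = "diff_seminorm M ` Diff_c T \<O> \<F> M"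
  have "\<zero>\<^bsub>sec \<F> M\<^esub> \<in> topspace (topo (sections M))" "u \<in> topspace (topo (sections M))"
    using u by (simp_all add: section_space_simps topspace_seminorm_topology)
  then obtain S S' where S: "openin (topo (sections M)) S" "\<zero>\<^bsub>sec \<F> M\<^esub> \<in> S" "u \<in> S'" "disjnt S S'"
    using H u(2) unfolding Hausdorff_space_def by metis
  then obtain Q e where Q: "Q \<subseteq> ?P" "e > 0" "{y \<in> carrier (sec \<F> M). \<forall>p\<in>Q. p (y \<ominus>\<^bsub>sec \<F> M\<^esub> \<zero>\<^bsub>sec \<F> M\<^esub>) < e} \<subseteq> S"
    unfolding section_space_simps openin_seminorm_topology by blast
  have "\<ominus>\<^bsub>sec \<F> M\<^esub> \<zero>\<^bsub>sec \<F> M\<^esub> = \<zero>\<^bsub>sec \<F> M\<^esub>" using F.r_neg[of "\<zero>\<^bsub>sec \<F> M\<^esub>"] by simp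
  then have u0: "u \<ominus>\<^bsub>sec \<F> M\<^esub> \<zero>\<^bsub>sec \<F> M\<^esub> = u" unfolding F.minus_eq using u by (metis F.r_zero)
  have "u \<notin> S" using S by (auto simp: disjnt_iff)
  then have "\<not> (\<forall>p\<in>Q. p (u \<ominus>\<^bsub>sec \<F> M\<^esub> \<zero>\<^bsub>sec \<F> M\<^esub>) < e)" using Q(3) u(1) by blast
  then obtain p where "p \<in> Q" "\<not> p u < e" unfolding u0 by blast
  then obtain D where D: "D \<in> Diff_c T \<O> \<F> M" "\<not> diff_seminorm M D u < e" using Q(1) by blast
  have "\<exists>a\<in>M. D M u a \<noteq> 0"
  proof (rule ccontr)
    assume "\<not> ?thesis"
    then have "diff_seminorm M D u \<le> 0" by (intro diff_seminorm_le) auto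
    then show False using D(2) Q(2) by simp
  qed
  then show thesis using that D(1) by blast
qed

lemma test_smult_smult:
  assumes "u \<in> carrier (test M)"
  shows "scalar_mult \<O> \<F> M c (scalar_mult \<O> \<F> M d u) = scalar_mult \<O> \<F> M (c * d) u" "scalar_mult \<O> \<F> M 1 u = u"
proof -
  interpret X: Module.module "\<complex>\<^sub>R" "test M" by (rule test_module) simp
  show "scalar_mult \<O> \<F> M c (scalar_mult \<O> \<F> M d u) = scalar_mult \<O> \<F> M (c * d) u" "scalar_mult \<O> \<F> M 1 u = u"
    using X.smult_assoc1[of c d u] X.smult_one[of u] assms by (simp_all add: test_space_simps(4))
qed

text \<open>If a bounded set met infinitely many supports, the Hausdorff property would give one operator
  for each of them, and a weighted supremum of these operators would be a continuous seminorm,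
  since only finitely many of them matter on each compact set, that is unbounded on the set.\<close>

lemma bounded_finite_support:
  assumes H: "Hausdorff_space (topo (sections M))"
    and g: "\<And>i. i \<in> I \<Longrightarrow> vanishes_off (g i) (Z i)"
    and fin: "\<And>K. compactin T K \<Longrightarrow> finite {i \<in> I. Z i \<inter> K \<noteq> {}}"
    and B: "bounded_in (test M) B"
  shows "finite {i \<in> I. \<exists>u\<in>B. g i \<odot>\<^bsub>sec \<F> M\<^esub> u \<noteq> \<zero>\<^bsub>sec \<F> M\<^esub>}"
proof (rule ccontr)
  assume "infinite {i \<in> I. \<exists>u\<in>B. g i \<odot>\<^bsub>sec \<F> M\<^esub> u \<noteq> \<zero>\<^bsub>sec \<F> M\<^esub>}"
  then obtain \<iota> :: "nat \<Rightarrow> _" where \<iota>: "inj \<iota>" "range \<iota> \<subseteq> {i \<in> I. \<exists>u\<in>B. g i \<odot>\<^bsub>sec \<F> M\<^esub> u \<noteq> \<zero>\<^bsub>sec \<F> M\<^esub>}"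
    using infinite_countable_subset by blast
  let ?X = "test M"
  interpret X: Module.module "\<complex>\<^sub>R" ?X by (rule test_module) simp
  interpret F: Module.module "sec \<O> M" "sec \<F> M" by (rule F_module) simp
  have \<iota>I: "\<iota> j \<in> I" for j using \<iota>(2) by blast
  have gM: "g (\<iota> j) \<in> carrier (sec \<O> M)" for j using vanishes_offD(1)[OF g[OF \<iota>I]] .
  have "\<exists>u\<in>B. g (\<iota> j) \<odot>\<^bsub>sec \<F> M\<^esub> u \<noteq> \<zero>\<^bsub>sec \<F> M\<^esub>" for j using \<iota>(2) by blast
  then obtain u where u: "\<And>j. u j \<in> B" "\<And>j. g (\<iota> j) \<odot>\<^bsub>sec \<F> M\<^esub> u j \<noteq> \<zero>\<^bsub>sec \<F> M\<^esub>" by metis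
  have BX: "B \<subseteq> carrier ?X" using B by (simp add: bounded_in_def)
  have in_F: "x \<in> carrier ?X \<Longrightarrow> x \<in> carrier (sec \<F> M)" for x using test_subset by blast
  have uF: "u j \<in> carrier (sec \<F> M)" for j using u(1) BX in_F by blast
  have "\<exists>D a. D \<in> Diff_c T \<O> \<F> M \<and> a \<in> M \<and> D M (g (\<iota> j) \<odot>\<^bsub>sec \<F> M\<^esub> u j) a \<noteq> 0" for j
    using Hausdorff_separating_operator[OF H F.smult_closed[OF gM uF] u(2)] by metis
  then obtain D a where D: "\<And>j. D j \<in> Diff_c T \<O> \<F> M" and a: "\<And>j. a j \<in> M"
    and ne: "\<And>j. D j M (g (\<iota> j) \<odot>\<^bsub>sec \<F> M\<^esub> u j) (a j) \<noteq> 0" by metis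
  have hom: "sheaf_hom T \<O> \<F> M (D j)" for j by (rule Diff_c_sheaf_hom[OF D])
  \<comment> \<open>The functional attached to the j-th cutoff: apply the separating operator after
    the cutoff and evaluate at the separating point.\<close>
  define l where "l = (\<lambda>j x. cmod (D j M (g (\<iota> j) \<odot>\<^bsub>sec \<F> M\<^esub> x) (a j)))"
  \<comment> \<open>The weight makes the j-th term of the supremum equal to \<open>j\<close> at
    \<open>u j\<close>, so the supremum is unbounded on \<open>B\<close>.\<close>
  define w where "w = (\<lambda>j. real j / l j (u j))"
  have lu: "l j (u j) > 0" for j using ne by (simp add: l_def)
  have w0: "w j \<ge> 0" for j using lu[of j] by (simp add: w_def)
  have l0: "l j x \<ge> 0" for j x by (simp add: l_def)
  have l_add: "l j (x \<oplus>\<^bsub>sec \<F> M\<^esub> y) \<le> l j x + l j y" if "x \<in> carrier ?X" "y \<in> carrier ?X" for j x y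
    using F.smult_r_distr[OF gM in_F[OF that(1)] in_F[OF that(2)]] norm_triangle_ineq
      sheaf_hom_add[OF hom openin_topspace order_refl F.smult_closed[OF gM in_F[OF that(1)]] F.smult_closed[OF gM in_F[OF that(2)]] a]
    by (simp add: l_def)
  have l_smult: "l j (scalar_mult \<O> \<F> M c x) = cmod c * l j x" if "x \<in> carrier ?X" for j c x
    using smult_scalar_mult[OF openin_topspace gM in_F[OF that]]
      sheaf_hom_smult[OF hom openin_topspace order_refl F.smult_closed[OF gM in_F[OF that]] a]
    by (simp add: l_def norm_mult)
  have l_zero: "l j x = 0" if x: "x \<in> supp_in M K" and K: "compactin T K" "Z (\<iota> j) \<inter> K = {}" for j x K
  proof -
    have xM: "x \<in> carrier (sec \<F> M)" using x supp_in_carrier by blast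
    have "g (\<iota> j) \<odot>\<^bsub>sec \<F> M\<^esub> x \<in> supp_in M (Z (\<iota> j) \<inter> K)"
      by (rule mult_res_supp(1)[OF openin_topspace g[OF \<iota>I] _ K(1) x])
         (use vanishes_offD(2)[OF g[OF \<iota>I]] closedin_subset in blast)
    then have "g (\<iota> j) \<odot>\<^bsub>sec \<F> M\<^esub> x = \<zero>\<^bsub>sec \<F> M\<^esub>"
      using K(2) F_res_id[OF openin_topspace F.smult_closed[OF gM xM]] by (simp add: supp_in_iff)
    then show ?thesis using sheaf_hom_zero[OF hom openin_topspace order_refl a] by (simp add: l_def)
  qed
  \<comment> \<open>The sequence of indices is injective, so local finiteness of the family passes
    to it.\<close>
  have finJ: "finite {j. Z (\<iota> j) \<inter> K \<noteq> {}}" if "compactin T K" for K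
  proof -
    have "\<iota> ` {j. Z (\<iota> j) \<inter> K \<noteq> {}} \<subseteq> {i \<in> I. Z i \<inter> K \<noteq> {}}" using \<iota>I by blast
    then have "finite (\<iota> ` {j. Z (\<iota> j) \<inter> K \<noteq> {}})" using fin[OF that] finite_subset by blast
    then show ?thesis using \<iota>(1) finite_imageD inj_on_subset by blast
  qed
  \<comment> \<open>For a given test section only finitely many terms are nonzero, so the supremum
    is finite although the weights grow without control.\<close>
  define q where "q = (\<lambda>x. Sup (insert 0 (range (\<lambda>j. w j * l j x))))"
  have bdd: "bdd_above (insert 0 (range (\<lambda>j. w j * l j x)))" if x: "x \<in> carrier ?X" for x
  proof -
    obtain K where K: "compactin T K" "x \<in> supp_in M K" using x by (rule test_carrierE)
    have "range (\<lambda>j. w j * l j x) \<subseteq> insert 0 ((\<lambda>j. w j * l j x) ` {j. Z (\<iota> j) \<inter> K \<noteq> {}})"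
      using l_zero[OF K(2,1)] by force
    then have "finite (range (\<lambda>j. w j * l j x))"
      by (rule finite_subset) (use finJ[OF K(1)] in simp)
    then show ?thesis by simp
  qed
  have q_ge: "w j * l j x \<le> q x" if "x \<in> carrier ?X" for j x
    unfolding q_def by (rule cSup_upper[OF _ bdd[OF that]]) simp
  have q_nonneg: "0 \<le> q x" if "x \<in> carrier ?X" for x
    unfolding q_def by (rule cSup_upper[OF _ bdd[OF that]]) simp
  have q_le: "q x \<le> b" if "0 \<le> b" "\<And>j. w j * l j x \<le> b" for x b
    unfolding q_def by (rule cSup_least) (use that in auto)
  have q_add: "q (x \<oplus>\<^bsub>?X\<^esub> y) \<le> q x + q y" if "x \<in> carrier ?X" "y \<in> carrier ?X" for x y
  proof (rule q_le)
    show "0 \<le> q x + q y" using q_nonneg that by simp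
    fix j
    have "w j * l j (x \<oplus>\<^bsub>sec \<F> M\<^esub> y) \<le> w j * (l j x + l j y)"
      using l_add[OF that] w0 by (intro mult_left_mono)
    also have "\<dots> \<le> q x + q y" using q_ge[OF that(1), of j] q_ge[OF that(2), of j] by (simp add: distrib_left)
    finally show "w j * l j (x \<oplus>\<^bsub>?X\<^esub> y) \<le> q x + q y" by (simp add: test_space_simps)
  qed
  have q_smult_le: "q (scalar_mult \<O> \<F> M c x) \<le> cmod c * q x" if "x \<in> carrier ?X" for c x
  proof (rule q_le)
    show "0 \<le> cmod c * q x" using q_nonneg[OF that] by simp
    show "w j * l j (scalar_mult \<O> \<F> M c x) \<le> cmod c * q x" for j
      using mult_left_mono[OF q_ge[OF that, of j], of "cmod c"] by (simp add: l_smult[OF that] mult.left_commute)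
  qed
  have sX: "scalar_mult \<O> \<F> M c x \<in> carrier ?X" if "x \<in> carrier ?X" for c x
    using X.smult_closed[of c x] that by (simp add: test_space_simps(4))
  have q_smult: "q (c \<odot>\<^bsub>?X\<^esub> x) = cmod c * q x" if x: "x \<in> carrier ?X" for c x
  proof (cases "c = 0")
    case True
    then show ?thesis using q_smult_le[OF x, of 0] q_nonneg[OF sX[OF x, of 0]] by (simp add: test_space_simps(4))
  next
    case False
    \<comment> \<open>The reverse inequality comes from applying the proved one to the inverse
      scalar.\<close>
    have "q x = q (scalar_mult \<O> \<F> M (inverse c) (scalar_mult \<O> \<F> M c x))"
      using test_smult_smult[OF x] False by simp
    also have "\<dots> \<le> cmod (inverse c) * q (scalar_mult \<O> \<F> M c x)" by (rule q_smult_le[OF sX[OF x]])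
    finally have "cmod c * q x \<le> q (scalar_mult \<O> \<F> M c x)" using False by (simp add: norm_inverse norm_divide field_simps)
    then show ?thesis using q_smult_le[OF x, of c] by (simp add: test_space_simps(4))
  qed
  \<comment> \<open>Once shown to be coarser than the topology of each supported piece, this
    topology takes part in the supremum defining the test space, and its unit ball is a
    neighbourhood of zero there.\<close>
  define \<sigma> where "\<sigma> = seminorm_topology ?X {q}"
  have lcs\<sigma>: "lcs (?X\<lparr>topo := \<sigma>\<rparr>)"
    unfolding \<sigma>_def by (rule lcs_single_seminorm[OF X.module_axioms q_add q_smult])
  have abX: "abelian_group ?X" by (rule X.abelian_group_axioms)
  have q0: "q \<zero>\<^bsub>?X\<^esub> = 0"
    using q_smult[OF X.zero_closed, of 0] X.smult_r_null[of 0] by simp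
  have cont: "continuous_map (topo Y) \<sigma> (\<lambda>x. x)" if Yin: "Y \<in> {piece M K | K. compactin T K \<and> K \<subseteq> M}" for Y
  proof -
    obtain K where Y: "Y = piece M K" and K: "compactin T K" "K \<subseteq> M" using Yin by blast
    have sub: "supp_in M K \<subseteq> carrier ?X" using test_carrierI[OF K] by blast
    have "continuous_map (topo (piece M K)) (subtopology \<sigma> (carrier ?X)) (\<lambda>x. x)"
      unfolding piece_simps \<sigma>_def
    proof (rule continuous_map_seminorm_topology[OF F_abelian_group[OF openin_topspace] supp_in_carrier
          seminorms_subadditive[OF openin_topspace] abX order_refl])
      show "\<forall>p\<in>{q}. \<forall>y\<in>carrier ?X. \<forall>z\<in>carrier ?X. p (y \<oplus>\<^bsub>?X\<^esub> z) \<le> p y + p z" using q_add by blast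
      show "\<forall>p\<in>{q}. p \<zero>\<^bsub>?X\<^esub> = 0" using q0 by blast
      show "(\<lambda>x. x) \<in> supp_in M K \<rightarrow> carrier ?X" using sub by blast
      fix x y assume xy: "x \<in> supp_in M K" "y \<in> supp_in M K"
      have "\<ominus>\<^bsub>?X\<^esub> x = scalar_mult \<O> \<F> M (-1) x"
        using module_minus_eq_smult[OF X.module_axioms, of x] sub xy by (auto simp: test_space_simps(4))
      then have "y \<ominus>\<^bsub>sec \<F> M\<^esub> x = y \<ominus>\<^bsub>?X\<^esub> x"
        using F_minus_eq[OF openin_topspace, of x y] sub xy in_F by (auto simp: X.minus_eq test_space_simps(3))
      then show "y \<ominus>\<^bsub>sec \<F> M\<^esub> x \<in> supp_in M K \<and> y \<ominus>\<^bsub>sec \<F> M\<^esub> x = y \<ominus>\<^bsub>?X\<^esub> x"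
        using supp_in_minus[OF openin_topspace K(1) xy] by simp
    next
      fix p' and e :: real assume "p' \<in> {q}" and e: "e > 0"
      then have p': "p' = q" by simp
      let ?J = "{j. Z (\<iota> j) \<inter> K \<noteq> {}}"
      have J: "finite ?J" by (rule finJ[OF K(1)])
      let ?p = "\<lambda>j. diff_seminorm M (premult M (g (\<iota> j)) (D j))"
      have PD: "premult M (g (\<iota> j)) (D j) \<in> Diff_c T \<O> \<F> M" for j
        using vanishes_offD(3)[OF g[OF \<iota>I], of "M - M" j] by (intro premult_Diff_c[OF D _ _ gM, of M]) auto
      \<comment> \<open>Chosen so that each weighted term is at most e/2; adding 1 to the weight
        also covers weight 0, and passing through e/2 leaves a strict bound for the
        supremum.\<close>
      define d where "d = Min (insert 1 ((\<lambda>j. e / (2 * (w j + 1))) ` ?J))"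
      have wp: "0 < 2 * (w j + 1)" for j using add_nonneg_pos[OF w0[of j] zero_less_one] by simp
      have d: "d > 0" "\<And>j. j \<in> ?J \<Longrightarrow> d \<le> e / (2 * (w j + 1))"
        using J e wp by (auto simp: d_def)
      have "q z < e" if z: "z \<in> supp_in M K" "\<forall>p\<in>?p ` ?J. p z < d" for z
      proof -
        have zM: "z \<in> carrier (sec \<F> M)" using z supp_in_carrier by blast
        have "q z \<le> e / 2"
        proof (rule q_le)
          fix j
          show "w j * l j z \<le> e / 2"
          proof (cases "j \<in> ?J")
            case True
            have "l j z \<le> ?p j z"
              using diff_seminorm_ge[OF D openin_topspace F.smult_closed[OF gM zM] a, of j j]
              by (simp add: l_def diff_seminorm_premult[OF openin_topspace gM])
            then have "l j z \<le> e / (2 * (w j + 1))" using z(2) True d(2)[OF True] by force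
            then have "w j * l j z \<le> w j * (e / (2 * (w j + 1)))" using w0 by (intro mult_left_mono)
            also have "\<dots> \<le> e / 2" using w0[of j] e by (simp add: field_simps)
            finally show ?thesis .
          next
            case False
            then show ?thesis using l_zero[OF z(1) K(1)] e by simp
          qed
        qed (use e in simp)
        then show ?thesis using e by simp
      qed
      then show "\<exists>Q d. finite Q \<and> Q \<subseteq> diff_seminorm M ` Diff_c T \<O> \<F> M \<and> d > 0 \<and>
          (\<forall>z\<in>supp_in M K. (\<forall>p\<in>Q. p z < d) \<longrightarrow> p' z < e)"
        unfolding p' using J d(1) PD by (intro exI[of _ "?p ` ?J"] exI[of _ d]) auto
    qed
    moreover have "subtopology \<sigma> (carrier ?X) = \<sigma>"
      unfolding \<sigma>_def by (metis subtopology_topspace topspace_seminorm_topology)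
    ultimately show ?thesis using Y by simp
  qed
  let ?N = "{x \<in> carrier ?X. \<forall>p\<in>{q}. p (x \<ominus>\<^bsub>?X\<^esub> \<zero>\<^bsub>?X\<^esub>) < 1}"
  have x0: "x \<ominus>\<^bsub>?X\<^esub> \<zero>\<^bsub>?X\<^esub> = x" if "x \<in> carrier ?X" for x
  proof -
    have "\<ominus>\<^bsub>?X\<^esub> \<zero>\<^bsub>?X\<^esub> = \<zero>\<^bsub>?X\<^esub>" using X.r_neg[of "\<zero>\<^bsub>?X\<^esub>"] by simp
    then show ?thesis unfolding X.minus_eq using that by (metis X.r_zero)
  qed
  have "openin \<sigma> ?N"
    unfolding \<sigma>_def by (rule seminorm_ball_open[OF abX]) (use q_add in auto)
  then have "openin (topo ?X) ?N"
    using lcs\<sigma> cont unfolding test_space_def by (intro openin_lc_union)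
  moreover have "\<zero>\<^bsub>?X\<^esub> \<in> ?N" using x0[of "\<zero>\<^bsub>?X\<^esub>"] q0 by simp
  ultimately obtain r where r: "r > 0" "\<And>c. cmod c \<ge> r \<Longrightarrow> B \<subseteq> (\<lambda>x. c \<odot>\<^bsub>?X\<^esub> x) ` ?N"
    using B unfolding bounded_in_def by meson
  obtain j :: nat where j: "r \<le> real j" using real_arch_simple by blast
  \<comment> \<open>Boundedness places all of \<open>B\<close> in r times the unit ball, so
    \<open>q\<close> is below \<open>r\<close> on \<open>B\<close>, against its value of at least
    \<open>j\<close> at \<open>u j\<close>.\<close>
  have "u j \<in> (\<lambda>x. complex_of_real r \<odot>\<^bsub>?X\<^esub> x) ` ?N"
    using r(2)[of "complex_of_real r"] r(1) u(1)[of j] by (auto dest: subsetD)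
  then obtain z where z: "z \<in> carrier ?X" "q (z \<ominus>\<^bsub>?X\<^esub> \<zero>\<^bsub>?X\<^esub>) < 1" "u j = complex_of_real r \<odot>\<^bsub>?X\<^esub> z" by auto
  have "q (u j) = r * q z" using q_smult[OF z(1), of "complex_of_real r"] z(3) r(1) by simp
  also have "\<dots> < r" using z(2) x0[OF z(1)] r(1) by simp
  finally have "q (u j) < real j" using j by simp
  moreover have "w j * l j (u j) = real j" using lu[of j] by (simp add: w_def)
  ultimately show False using q_ge[of "u j" j] u(1) BX by fastforce
qed

end

section \<open>Restriction of distributions\<close>

lemma (in Module.module) finsum_smult_right:
  assumes "finite A" "\<And>i. i \<in> A \<Longrightarrow> r i \<in> carrier R" "x \<in> carrier M"
  shows "finsum M (\<lambda>i. r i \<odot>\<^bsub>M\<^esub> x) A = finsum R r A \<odot>\<^bsub>M\<^esub> x"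
  using assms(1,2)
proof (induction A)
  case empty
  then show ?case using smult_l_null[OF assms(3)] by simp
next
  case (insert i A)
  have r: "r \<in> A \<rightarrow> carrier R" "r i \<in> carrier R" using insert.prems by auto
  then have "finsum M (\<lambda>i. r i \<odot>\<^bsub>M\<^esub> x) (insert i A) = r i \<odot>\<^bsub>M\<^esub> x \<oplus>\<^bsub>M\<^esub> finsum M (\<lambda>i. r i \<odot>\<^bsub>M\<^esub> x) A"
    using assms(3) insert.hyps by (intro finsum_insert) auto
  also have "\<dots> = finsum R r (insert i A) \<odot>\<^bsub>M\<^esub> x"
    using insert r assms(3) R.finsum_closed[OF r(1)] by (simp add: smult_l_distr R.finsum_insert)
  finally show ?case .
qed

lemma (in abelian_group) finsum_minus:
  assumes "finite A" "\<And>i. i \<in> A \<Longrightarrow> f i \<in> carrier G" "\<And>i. i \<in> A \<Longrightarrow> g i \<in> carrier G"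
  shows "finsum G (\<lambda>i. f i \<ominus> g i) A = finsum G f A \<ominus> finsum G g A"
proof -
  have fg: "f \<in> A \<rightarrow> carrier G" "g \<in> A \<rightarrow> carrier G" "(\<lambda>i. f i \<ominus> g i) \<in> A \<rightarrow> carrier G"
    using assms(2,3) by auto
  note c = finsum_closed[OF fg(1)] finsum_closed[OF fg(2)] finsum_closed[OF fg(3)]
  have "finsum G (\<lambda>i. f i \<ominus> g i) A \<oplus> finsum G g A = finsum G (\<lambda>i. (f i \<ominus> g i) \<oplus> g i) A"
    by (rule finsum_addf[OF fg(3,2), symmetric])
  also have "\<dots> = finsum G f A"
    by (rule finsum_cong'[OF refl fg(1)]) (use assms(2,3) in \<open>simp add: minus_eq a_assoc l_neg\<close>)
  finally have "finsum G f A \<ominus> finsum G g A = (finsum G (\<lambda>i. f i \<ominus> g i) A \<oplus> finsum G g A) \<ominus> finsum G g A" by simp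
  also have "\<dots> = finsum G (\<lambda>i. f i \<ominus> g i) A"
    using c by (simp add: minus_eq a_assoc r_neg)
  finally show ?thesis by simp
qed

context module_sheaf_space
begin

text \<open>The sum is formed in the complex vector space of test sections, the restricted one in a
  module over the structure sheaf. The two records share only their addition and zero, so the sums
  are matched term by term.\<close>

lemma res_finsum_test:
  assumes Q: "openin T Q" and A: "finite A" and h: "\<And>i. i \<in> A \<Longrightarrow> h i \<in> carrier (test M)"
  shows "res \<F> M Q (finsum (test M) h A) = finsum (sec \<F> Q) (\<lambda>i. res \<F> M Q (h i)) A"
  using A h
proof (induction A)
  case empty
  interpret X: Module.module "\<complex>\<^sub>R" "test M" by (rule test_module) simp
  interpret F: Module.module "sec \<O> Q" "sec \<F> Q" by (rule F_module[OF Q])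
  show ?case
    using F_res_zero[OF openin_topspace Q openin_subset[OF Q]] by (simp add: test_space_simps(2))
next
  case (insert i A)
  interpret X: Module.module "\<complex>\<^sub>R" "test M" by (rule test_module) simp
  interpret F: Module.module "sec \<O> Q" "sec \<F> Q" by (rule F_module[OF Q])
  have h: "h \<in> A \<rightarrow> carrier (test M)" "h i \<in> carrier (test M)" using insert.prems by auto
  have hF: "x \<in> carrier (test M) \<Longrightarrow> x \<in> carrier (sec \<F> M)" for x using test_subset by blast
  have r: "res \<F> M Q x \<in> carrier (sec \<F> Q)" if "x \<in> carrier (test M)" for x
    by (rule F_res_closed[OF openin_topspace Q openin_subset[OF Q] hF[OF that]])
  have "res \<F> M Q (finsum (test M) h (insert i A)) = res \<F> M Q (h i \<oplus>\<^bsub>sec \<F> M\<^esub> finsum (test M) h A)"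
    using X.finsum_insert[OF insert.hyps h] by (simp add: test_space_simps)
  also have "\<dots> = res \<F> M Q (h i) \<oplus>\<^bsub>sec \<F> Q\<^esub> res \<F> M Q (finsum (test M) h A)"
    by (rule F_res_add[OF openin_topspace Q openin_subset[OF Q] hF[OF h(2)] hF[OF X.finsum_closed[OF h(1)]]])
  also have "\<dots> = finsum (sec \<F> Q) (\<lambda>i. res \<F> M Q (h i)) (insert i A)"
    using insert h r F.finsum_insert[OF insert.hyps, of "\<lambda>i. res \<F> M Q (h i)"] by (simp add: Pi_iff)
  finally show ?case .
qed

theorem restriction_closed_embedding:
  fixes E :: "'v cspace" and \<Gamma> :: "'g set" and U :: "'g \<Rightarrow> 'p set"
  assumes E: "lcs E" "Hausdorff_space (topo E)"
    and U: "\<And>\<gamma>. \<gamma> \<in> \<Gamma> \<Longrightarrow> openin T (U \<gamma>)" "(\<Union>\<gamma>\<in>\<Gamma>. U \<gamma>) = topspace T"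
    and H: "Hausdorff_space (topo (sections M))"
  shows "closed_linear_embedding
    (distribution_space T \<O> \<F> E M)
    (product_space \<Gamma> (\<lambda>\<gamma>. distribution_space T \<O> \<F> E (U \<gamma>)))
    (\<lambda>\<eta>. \<lambda>\<gamma>\<in>\<Gamma>. restrict_distribution T \<O> \<F> M (U \<gamma>) \<eta>)"
proof -
  let ?X = "test M" and ?Y = "\<lambda>\<gamma>. test (U \<gamma>)"
  define S where "S = (\<lambda>\<eta> :: 'b \<Rightarrow> 'v. \<lambda>\<gamma>\<in>\<Gamma>. restrict_distribution T \<O> \<F> M (U \<gamma>) \<eta>)"
  define P where "P = product_topology (\<lambda>\<gamma>. strong_topology (?Y \<gamma>) E) \<Gamma>"
  have lX: "lcs ?X" by (rule lcs_test) simp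
  have lY: "lcs (?Y \<gamma>)" if "\<gamma> \<in> \<Gamma>" for \<gamma> by (rule lcs_test[OF U(1)[OF that]])
  interpret X: Module.module "\<complex>\<^sub>R" ?X by (rule lcs_module[OF lX])
  interpret E: Module.module "\<complex>\<^sub>R" E by (rule lcs_module[OF E(1)])
  interpret F: Module.module "sec \<O> M" "sec \<F> M" by (rule F_module) simp
  have S_eq: "S \<eta> \<gamma> = restrict (\<eta> \<circ> ext_by_zero T \<F> M (U \<gamma>)) (carrier (?Y \<gamma>))" if "\<gamma> \<in> \<Gamma>" for \<eta> \<gamma>
    using that by (simp add: S_def restrict_distribution_def)
  note ext = ext_by_zero_linear[OF U(1)] ext_by_zero_continuous[OF U(1)]
  have tsX: "topspace (strong_topology ?X E) = continuous_linear_maps ?X E"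
    by (rule topspace_strong_topology[OF E(1)])
  have tsP: "topspace P = (\<Pi>\<^sub>E \<gamma>\<in>\<Gamma>. continuous_linear_maps (?Y \<gamma>) E)"
    by (simp add: P_def topspace_strong_topology[OF E(1)])
  have S_closed: "S \<eta> \<gamma> \<in> continuous_linear_maps (?Y \<gamma>) E" if "\<eta> \<in> continuous_linear_maps ?X E" "\<gamma> \<in> \<Gamma>" for \<eta> \<gamma>
    unfolding S_eq[OF that(2)] by (rule precompose_continuous_linear[OF lY[OF that(2)] ext[OF that(2)] that(1)])
  have S_linear: "linear_in (strong_hom_space ?X E) (product_space \<Gamma> (\<lambda>\<gamma>. strong_hom_space (?Y \<gamma>) E)) S"
    unfolding linear_in_def
  proof (intro conjI ballI allI)
    show "S \<in> carrier (strong_hom_space ?X E) \<rightarrow> carrier (product_space \<Gamma> (\<lambda>\<gamma>. strong_hom_space (?Y \<gamma>) E))"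
      using S_closed by (auto simp: strong_hom_space_def product_space_def S_def)
    have e: "ext_by_zero T \<F> M (U \<gamma>) v \<in> carrier ?X" if "v \<in> carrier (?Y \<gamma>)" "\<gamma> \<in> \<Gamma>" for v \<gamma>
      by (rule ext_by_zero_test[OF U(1)[OF that(2)] that(1)])
    show "S (\<eta> \<oplus>\<^bsub>strong_hom_space ?X E\<^esub> \<eta>') =
        S \<eta> \<oplus>\<^bsub>product_space \<Gamma> (\<lambda>\<gamma>. strong_hom_space (?Y \<gamma>) E)\<^esub> S \<eta>'" for \<eta> \<eta>'
      using e by (auto simp: strong_hom_space_def product_space_def S_def restrict_distribution_def fun_eq_iff restrict_def)
    show "S (k \<odot>\<^bsub>strong_hom_space ?X E\<^esub> \<eta>) =
        k \<odot>\<^bsub>product_space \<Gamma> (\<lambda>\<gamma>. strong_hom_space (?Y \<gamma>) E)\<^esub> S \<eta>" for k \<eta>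
      using e by (auto simp: strong_hom_space_def product_space_def S_def restrict_distribution_def fun_eq_iff restrict_def)
  qed
  have S_cont: "continuous_map (strong_topology ?X E) P S"
    unfolding P_def continuous_map_componentwise
  proof (intro conjI ballI)
    show "S ` topspace (strong_topology ?X E) \<subseteq> extensional \<Gamma>" by (auto simp: S_def)
    fix \<gamma> assume \<gamma>: "\<gamma> \<in> \<Gamma>"
    show "continuous_map (strong_topology ?X E) (strong_topology (?Y \<gamma>) E) (\<lambda>\<eta>. S \<eta> \<gamma>)"
      unfolding S_eq[OF \<gamma>] by (rule continuous_map_precompose[OF lY[OF \<gamma>] lX E(1) ext[OF \<gamma>]])
  qed
  obtain I g Z and c :: "'p set \<Rightarrow> 'g" where I: "\<And>i. i \<in> I \<Longrightarrow> c i \<in> \<Gamma>" "\<And>i. i \<in> I \<Longrightarrow> Z i \<subseteq> U (c i)"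
    "\<And>i. i \<in> I \<Longrightarrow> vanishes_off (g i) (Z i)" "\<And>K. compactin T K \<Longrightarrow> finite {i \<in> I. Z i \<inter> K \<noteq> {}}"
    and unity: "\<And>a. a \<in> M \<Longrightarrow> \<exists>Q J. openin T Q \<and> a \<in> Q \<and> finite J \<and> J \<subseteq> I \<and> (\<forall>i\<in>I - J. Z i \<inter> Q = {}) \<and>
      finsum (sec \<O> Q) (\<lambda>i. res \<O> M Q (g i)) J = \<one>\<^bsub>sec \<O> Q\<^esub>"
    using U by (rule partition_of_unity[where \<Gamma> = \<Gamma> and U = U]) (assumption | rule that)+
  have gM: "g i \<in> carrier (sec \<O> M)" if "i \<in> I" for i using vanishes_offD(1)[OF I(3)[OF that]] .
  have XF: "u \<in> carrier ?X \<Longrightarrow> u \<in> carrier (sec \<F> M)" for u using test_subset by blast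
  have oU: "openin T (U (c i))" if "i \<in> I" for i using U(1) I(1) that by blast
  define m where "m = (\<lambda>i. mult_res (U (c i)) (g i))"
  have m: "linear_in ?X (?Y (c i)) (m i)" "continuous_map (topo ?X) (topo (?Y (c i))) (m i)" if "i \<in> I" for i
    unfolding m_def
    by (rule mult_res_linear[OF oU[OF that] I(3,2)[OF that]] mult_res_continuous[OF oU[OF that] I(3,2)[OF that]])+
  have gu: "g i \<odot>\<^bsub>sec \<F> M\<^esub> u \<in> carrier ?X" if i: "i \<in> I" and u: "u \<in> carrier ?X" for i u
  proof -
    obtain K where K: "compactin T K" "u \<in> supp_in M K" using u by (rule test_carrierE)
    show ?thesis
      by (rule test_carrierI[OF mult_res_supp(3)[OF oU[OF i] I(3,2)[OF i] K] _ mult_res_supp(1)[OF oU[OF i] I(3,2)[OF i] K]])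
         (use compactin_subset_topspace[OF K(1)] in blast)
  qed
  have gu_zero: "g i \<odot>\<^bsub>sec \<F> M\<^esub> u = \<zero>\<^bsub>sec \<F> M\<^esub>"
    if i: "i \<in> I" and K: "compactin T K" "u \<in> supp_in M K" and ZK: "Z i \<inter> K = {}" for i u K
  proof -
    have "g i \<odot>\<^bsub>sec \<F> M\<^esub> u \<in> supp_in M {}"
      using mult_res_supp(1)[OF oU[OF i] I(3,2)[OF i] K] ZK by simp
    then show ?thesis
      using F_res_id[OF openin_topspace, of "g i \<odot>\<^bsub>sec \<F> M\<^esub> u"] by (simp add: supp_in_iff)
  qed
  \<comment> \<open>The indices that matter for a single test section. Since the support of
    \<open>u\<close> is compact and the sets \<open>Z i\<close> are locally finite, there are
    finitely many.\<close>
  define act where "act = (\<lambda>u. {i \<in> I. g i \<odot>\<^bsub>sec \<F> M\<^esub> u \<noteq> \<zero>\<^bsub>sec \<F> M\<^esub>})"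
  have act_K: "act u \<subseteq> {i \<in> I. Z i \<inter> K \<noteq> {}}" if "compactin T K" "u \<in> supp_in M K" for u K
    using gu_zero[OF _ that] by (auto simp: act_def)
  have act_fin: "finite (act u)" if "u \<in> carrier ?X" for u
    using that by (rule test_carrierE) (meson act_K I(4) finite_subset)
  define t where "t = (\<lambda>x i u. (x (c i) :: 'b \<Rightarrow> 'v) (m i u))"
  have xc: "x (c i) \<in> continuous_linear_maps (?Y (c i)) E" if "x \<in> topspace P" "i \<in> I" for x i
    using that I(1) unfolding tsP by blast
  have t_lin: "linear_in ?X E (t x i)" if "x \<in> topspace P" "i \<in> I" for x i
    unfolding t_def by (rule linear_in_compose[OF m(1)[OF that(2)] continuous_linear_maps_linear[OF xc[OF that]]])
  have t_cont: "continuous_map (topo ?X) (topo E) (t x i)" if "x \<in> topspace P" "i \<in> I" for x i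
    using continuous_map_compose[OF m(2)[OF that(2)] continuous_linear_maps_continuous[OF xc[OF that]]]
    by (simp add: t_def o_def)
  have tE: "t x i u \<in> carrier E" if "x \<in> topspace P" "i \<in> I" "u \<in> carrier ?X" for x i u
    by (rule linear_in_closed[OF t_lin[OF that(1,2)] that(3)])
  have t_zero: "t x i u = \<zero>\<^bsub>E\<^esub>" if x: "x \<in> topspace P" and i: "i \<in> I" "i \<notin> act u" for x i u
  proof -
    have "m i u = \<zero>\<^bsub>?Y (c i)\<^esub>"
      using i F_res_zero[OF openin_topspace oU[OF i(1)] openin_subset[OF oU[OF i(1)]]]
      by (simp add: m_def mult_res_def act_def test_space_simps)
    then show ?thesis
      unfolding t_def
      using linear_in_zero[OF test_module[OF oU[OF i(1)]] lcs_module[OF E(1)] continuous_linear_maps_linear[OF xc[OF x i(1)]]] by simp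
  qed
  \<comment> \<open>Defined on arbitrary families, without requiring agreement on overlaps. So it
    lives on the whole product, which is what makes the image of the restriction map a retract and
    hence closed.\<close>
  define L where "L = (\<lambda>x. \<lambda>u\<in>carrier ?X. finsum E (\<lambda>i. t x i u) (act u))"
  \<comment> \<open>The index set in \<open>L\<close> varies with \<open>u\<close>. Enlarging it to
    a common finite set is what makes sums, multiples and limits of such expressions
    comparable.\<close>
  have L_eq: "L x u = finsum E (\<lambda>i. t x i u) A"
    if "x \<in> topspace P" "u \<in> carrier ?X" "finite A" "act u \<subseteq> A" "A \<subseteq> I" for x u A
  proof -
    have "finsum E (\<lambda>i. t x i u) (act u) = finsum E (\<lambda>i. t x i u) A"
      using that tE t_zero by (intro E.finsum_neutral_superset) (auto simp: act_def)
    then show ?thesis using that(2) by (simp add: L_def)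
  qed
  have actI: "act u \<subseteq> I" for u by (auto simp: act_def)
  have L_lin: "linear_in ?X E (L x)" if x: "x \<in> topspace P" for x
    unfolding linear_in_def
  proof (intro conjI ballI allI)
    have tA: "(\<lambda>i. t x i u) \<in> A \<rightarrow> carrier E" if "A \<subseteq> I" "u \<in> carrier ?X" for A u
      using tE[OF x _ that(2)] that(1) by blast
    show "L x \<in> carrier ?X \<rightarrow> carrier E"
      using tA[OF actI] by (auto simp: L_def intro: E.finsum_closed)
    fix u assume u: "u \<in> carrier ?X"
    show "L x (k \<odot>\<^bsub>?X\<^esub> u) = k \<odot>\<^bsub>E\<^esub> L x u" for k
    proof -
      have ku: "k \<odot>\<^bsub>?X\<^esub> u \<in> carrier ?X" using u by simp
      let ?A = "act u \<union> act (k \<odot>\<^bsub>?X\<^esub> u)"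
      have A: "finite ?A" "?A \<subseteq> I" using act_fin u ku actI by auto
      have "L x (k \<odot>\<^bsub>?X\<^esub> u) = finsum E (\<lambda>i. t x i (k \<odot>\<^bsub>?X\<^esub> u)) ?A"
        by (rule L_eq[OF x ku A(1) _ A(2)]) blast
      also have "\<dots> = finsum E (\<lambda>i. k \<odot>\<^bsub>E\<^esub> t x i u) ?A"
        by (rule E.finsum_cong'[OF refl])
           (use A(2) tE[OF x _ u] linear_in_smult[OF t_lin[OF x] u] in auto)
      also have "\<dots> = k \<odot>\<^bsub>E\<^esub> finsum E (\<lambda>i. t x i u) ?A"
        using E.finsum_smult_ldistr[OF A(1) _ tA[OF A(2) u], of k] by simp
      also have "finsum E (\<lambda>i. t x i u) ?A = L x u"
        by (rule L_eq[OF x u A(1) _ A(2), symmetric]) blast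
      finally show ?thesis .
    qed
    fix v assume v: "v \<in> carrier ?X"
    have uv: "u \<oplus>\<^bsub>?X\<^esub> v \<in> carrier ?X" using u v by simp
    let ?A = "act u \<union> act v \<union> act (u \<oplus>\<^bsub>?X\<^esub> v)"
    have A: "finite ?A" "?A \<subseteq> I" using act_fin u v uv actI by auto
    have "L x (u \<oplus>\<^bsub>?X\<^esub> v) = finsum E (\<lambda>i. t x i (u \<oplus>\<^bsub>?X\<^esub> v)) ?A"
      by (rule L_eq[OF x uv A(1) _ A(2)]) blast
    also have "\<dots> = finsum E (\<lambda>i. t x i u \<oplus>\<^bsub>E\<^esub> t x i v) ?A"
      by (rule E.finsum_cong'[OF refl])
         (use A(2) tE[OF x _ u] tE[OF x _ v] linear_in_add[OF t_lin[OF x] u v] in auto)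
    also have "\<dots> = finsum E (\<lambda>i. t x i u) ?A \<oplus>\<^bsub>E\<^esub> finsum E (\<lambda>i. t x i v) ?A"
      by (rule E.finsum_addf[OF tA[OF A(2) u] tA[OF A(2) v]])
    also have "finsum E (\<lambda>i. t x i u) ?A = L x u"
      by (rule L_eq[OF x u A(1) _ A(2), symmetric]) blast
    also have "finsum E (\<lambda>i. t x i v) ?A = L x v"
      by (rule L_eq[OF x v A(1) _ A(2), symmetric]) blast
    finally show "L x (u \<oplus>\<^bsub>?X\<^esub> v) = L x u \<oplus>\<^bsub>E\<^esub> L x v" .
  qed
  have L_closed: "L x \<in> continuous_linear_maps ?X E" if x: "x \<in> topspace P" for x
  proof -
    have "continuous_map (topo ?X) (topo E) (L x)"
    proof (rule continuous_map_from_test[OF openin_topspace E(1) L_lin[OF x]])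
      fix K assume K: "compactin T K" "K \<subseteq> M"
      \<comment> \<open>On sections supported in \<open>K\<close> one finite index set serves all of
        them, so \<open>L x\<close> is there a finite sum of continuous maps.\<close>
      let ?A = "{i \<in> I. Z i \<inter> K \<noteq> {}}"
      have "continuous_map (topo (piece M K)) (topo E) (t x i)" if "i \<in> I" for i
        using continuous_map_compose[OF continuous_map_piece_test[OF openin_topspace K] t_cont[OF x that]] by (simp add: o_def)
      then have "continuous_map (topo (piece M K)) (topo E) (\<lambda>u. finsum E (\<lambda>i. t x i u) ?A)"
        by (intro continuous_map_finsum[OF E(1) I(4)[OF K(1)]]) auto
      moreover have "finsum E (\<lambda>i. t x i u) ?A = L x u" if "u \<in> topspace (topo (piece M K))" for u
      proof -
        have u: "u \<in> supp_in M K" using that unfolding piece_topspace by (simp add: piece_simps)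
        then show ?thesis
          using test_carrierI[OF K u] act_K[OF K(1) u] I(4)[OF K(1)] by (intro L_eq[OF x, symmetric]) auto
      qed
      ultimately show "continuous_map (topo (piece M K)) (topo E) (L x)" by (rule continuous_map_eq)
    qed
    then show ?thesis using L_lin[OF x] by (simp add: continuous_linear_maps_def L_def)
  qed
  have L_cont: "continuous_map P (strong_topology ?X E) L"
  proof (rule continuous_map_into_strong_topology[OF E(1)])
    show "L \<in> topspace P \<rightarrow> continuous_linear_maps ?X E" using L_closed by blast
    fix x B N assume x: "x \<in> topspace P" and B: "bounded_in ?X B" and N: "openin (topo E) N" "\<zero>\<^bsub>E\<^esub> \<in> N"
    have BX: "B \<subseteq> carrier ?X" using B by (simp add: bounded_in_def)
    \<comment> \<open>The same finite index set serves all of \<open>B\<close> and all families at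
      once, so uniform closeness on \<open>B\<close> reduces to finitely many components of the
      product.\<close>
    let ?A = "{i \<in> I. \<exists>u\<in>B. g i \<odot>\<^bsub>sec \<F> M\<^esub> u \<noteq> \<zero>\<^bsub>sec \<F> M\<^esub>}"
    have A: "finite ?A" by (rule bounded_finite_support[OF H I(3,4) B])
    obtain N' where N': "openin (topo E) N'" "\<zero>\<^bsub>E\<^esub> \<in> N'" "\<And>f. (\<And>i. i \<in> ?A \<Longrightarrow> f i \<in> N') \<Longrightarrow> finsum E f ?A \<in> N"
      using lcs_finsum_neighbourhood[OF E(1) N A] by blast
    have "\<exists>V. openin (strong_topology (?Y (c i)) E) V \<and> x (c i) \<in> V \<and>
        (\<forall>y\<in>V. \<forall>v\<in>m i ` B. y v \<ominus>\<^bsub>E\<^esub> x (c i) v \<in> N')" if i: "i \<in> ?A" for i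
    proof -
      have i: "i \<in> I" using i by blast
      show ?thesis
        by (rule strong_neighbourhood[OF E(1) xc[OF x i] bounded_in_image[OF lX lY[OF I(1)[OF i]] m[OF i] B] N'(1,2)])
    qed
    then have "\<forall>i\<in>?A. \<exists>V. openin (strong_topology (?Y (c i)) E) V \<and> x (c i) \<in> V \<and>
        (\<forall>y\<in>V. \<forall>v\<in>m i ` B. y v \<ominus>\<^bsub>E\<^esub> x (c i) v \<in> N')" by (rule ballI)
    from bchoice[OF this] obtain V where V: "\<forall>i\<in>?A. openin (strong_topology (?Y (c i)) E) (V i) \<and> x (c i) \<in> V i \<and>
        (\<forall>y\<in>V i. \<forall>v\<in>m i ` B. y v \<ominus>\<^bsub>E\<^esub> x (c i) v \<in> N')" ..
    \<comment> \<open>The inserted whole space keeps the intersection inside \<open>P\<close> and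
      open when no index is involved.\<close>
    define W where "W = \<Inter>(insert (topspace P) ((\<lambda>i. {y \<in> topspace P. y (c i) \<in> V i}) ` ?A))"
    have "openin P W"
      unfolding W_def
    proof (rule openin_Inter)
      fix G assume "G \<in> insert (topspace P) ((\<lambda>i. {y \<in> topspace P. y (c i) \<in> V i}) ` ?A)"
      then consider "G = topspace P" | i where "i \<in> ?A" "G = {y \<in> topspace P. y (c i) \<in> V i}" by blast
      then show "openin P G"
      proof cases
        case (2 i)
        have "continuous_map P (strong_topology (?Y (c i)) E) (\<lambda>y. y (c i))"
          unfolding P_def by (rule continuous_map_product_projection) (use 2 I(1) in blast)
        then show ?thesis unfolding 2(2) using bspec[OF V 2(1)] openin_continuous_map_preimage by blast
      qed simp
    qed (use A in auto)
    moreover have "x \<in> W" using x V by (auto simp: W_def)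
    moreover have "L y u \<ominus>\<^bsub>E\<^esub> L x u \<in> N" if y: "y \<in> W" and u: "u \<in> B" for y u
    proof -
      have yP: "y \<in> topspace P" and yV: "\<And>i. i \<in> ?A \<Longrightarrow> y (c i) \<in> V i" using y by (auto simp: W_def)
      have uX: "u \<in> carrier ?X" using u BX by blast
      have sub: "act u \<subseteq> ?A" using u by (auto simp: act_def)
      have "L y u \<ominus>\<^bsub>E\<^esub> L x u = finsum E (\<lambda>i. t y i u) ?A \<ominus>\<^bsub>E\<^esub> finsum E (\<lambda>i. t x i u) ?A"
        using L_eq[OF yP uX A sub] L_eq[OF x uX A sub] by auto
      also have "\<dots> = finsum E (\<lambda>i. t y i u \<ominus>\<^bsub>E\<^esub> t x i u) ?A"
        by (rule E.finsum_minus[OF A, symmetric]) (use tE[OF yP _ uX] tE[OF x _ uX] in auto)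
      also have "\<dots> \<in> N"
        by (rule N'(3)) (use V yV u in \<open>auto simp: t_def\<close>)
      finally show ?thesis .
    qed
    ultimately show "\<exists>W. openin P W \<and> x \<in> W \<and> (\<forall>y\<in>W. \<forall>u\<in>B. L y u \<ominus>\<^bsub>E\<^esub> L x u \<in> N)" by blast
  qed
  \<comment> \<open>The sum over \<open>act u\<close> is global while the partition of unity sums to
    1 only over a local index set \<open>J\<close>. Near a point both are enlarged to their union:
    outside \<open>act u\<close> the products vanish, and outside \<open>J\<close> the cutoffs
    vanish on \<open>Q\<close>.\<close>
  have sum_gu: "finsum ?X (\<lambda>i. g i \<odot>\<^bsub>sec \<F> M\<^esub> u) (act u) = u" if u: "u \<in> carrier ?X" for u
  proof (rule F_eqI[OF openin_topspace])
    let ?h = "\<lambda>i. g i \<odot>\<^bsub>sec \<F> M\<^esub> u"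
    have h: "?h \<in> act u \<rightarrow> carrier ?X" using gu u actI by blast
    show "finsum ?X ?h (act u) \<in> carrier (sec \<F> M)" by (rule XF[OF X.finsum_closed[OF h]])
    show uM: "u \<in> carrier (sec \<F> M)" by (rule XF[OF u])
    fix a assume a: "a \<in> M"
    obtain Q J where Q: "openin T Q" "a \<in> Q" and J: "finite J" "J \<subseteq> I" "\<forall>i\<in>I - J. Z i \<inter> Q = {}"
      and one: "finsum (sec \<O> Q) (\<lambda>i. res \<O> M Q (g i)) J = \<one>\<^bsub>sec \<O> Q\<^esub>"
      using unity[OF a] by (elim exE conjE) (rule that)
    interpret Q: Module.module "sec \<O> Q" "sec \<F> Q" by (rule F_module[OF Q(1)])
    have QM: "Q \<subseteq> M" by (rule openin_subset[OF Q(1)])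
    let ?A = "act u \<union> J"
    have A: "finite ?A" "?A \<subseteq> I" using act_fin[OF u] J actI by auto
    have rg: "res \<O> M Q (g i) \<in> carrier (sec \<O> Q)" if "i \<in> I" for i
      by (rule O_res_closed[OF openin_topspace Q(1) QM gM[OF that]])
    have ru: "res \<F> M Q u \<in> carrier (sec \<F> Q)" by (rule F_res_closed[OF openin_topspace Q(1) QM uM])
    have "finsum ?X ?h (act u) = finsum ?X ?h ?A"
      by (rule X.finsum_neutral_superset[OF A(1)]) (use h J(2) in \<open>auto simp: act_def test_space_simps(2)\<close>)
    then have "res \<F> M Q (finsum ?X ?h (act u)) = finsum (sec \<F> Q) (\<lambda>i. res \<F> M Q (?h i)) ?A"
      using res_finsum_test[OF Q(1) A(1), of ?h] gu[OF _ u] A(2) by auto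
    also have "\<dots> = finsum (sec \<F> Q) (\<lambda>i. res \<O> M Q (g i) \<odot>\<^bsub>sec \<F> Q\<^esub> res \<F> M Q u) ?A"
    proof (rule Q.finsum_cong'[OF refl])
      show "(\<lambda>i. res \<O> M Q (g i) \<odot>\<^bsub>sec \<F> Q\<^esub> res \<F> M Q u) \<in> ?A \<rightarrow> carrier (sec \<F> Q)"
        using A(2) rg ru by (blast intro: Q.smult_closed)
      show "res \<F> M Q (?h i) = res \<O> M Q (g i) \<odot>\<^bsub>sec \<F> Q\<^esub> res \<F> M Q u" if "i \<in> ?A" for i
        using that A(2) gM by (intro F_res_smult[OF openin_topspace Q(1) QM _ uM]) blast
    qed
    also have "\<dots> = finsum (sec \<O> Q) (\<lambda>i. res \<O> M Q (g i)) ?A \<odot>\<^bsub>sec \<F> Q\<^esub> res \<F> M Q u"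
      by (rule Q.finsum_smult_right[OF A(1) _ ru]) (use rg A(2) in blast)
    also have "finsum (sec \<O> Q) (\<lambda>i. res \<O> M Q (g i)) ?A = finsum (sec \<O> Q) (\<lambda>i. res \<O> M Q (g i)) J"
    proof (rule Q.R.finsum_neutral_superset[OF A(1), symmetric])
      fix i assume "i \<in> ?A - J"
      then have i: "i \<in> I - J" using A(2) by blast
      then show "res \<O> M Q (g i) = \<zero>\<^bsub>sec \<O> Q\<^esub>"
        using vanishes_offD(3)[OF I(3) Q(1)] bspec[OF J(3) i] by (simp add: Int_commute)
    qed (use rg J(2) in auto)
    also have "\<dots> \<odot>\<^bsub>sec \<F> Q\<^esub> res \<F> M Q u = res \<F> M Q u"
      unfolding one by (rule Q.smult_one[OF ru])
    finally show "\<exists>Q. openin T Q \<and> a \<in> Q \<and> Q \<subseteq> M \<and> res \<F> M Q (finsum ?X ?h (act u)) = res \<F> M Q u"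
      using Q QM by blast
  qed
  \<comment> \<open>Each summand becomes the value of the given distribution at \<open>g i\<close>
    times \<open>u\<close>, and the distribution commutes with the finite sum, which is
    \<open>u\<close>.\<close>
  have LS: "L (S \<eta>) = \<eta>" if \<eta>: "\<eta> \<in> continuous_linear_maps ?X E" for \<eta>
  proof (rule extensionalityI[of _ "carrier ?X"])
    show "L (S \<eta>) \<in> extensional (carrier ?X)" by (simp add: L_def)
    show "\<eta> \<in> extensional (carrier ?X)" by (rule continuous_linear_maps_extensional[OF \<eta>])
    fix u assume u: "u \<in> carrier ?X"
    have h: "g i \<odot>\<^bsub>sec \<F> M\<^esub> u \<in> carrier ?X" if "i \<in> act u" for i using that gu u actI by blast
    have "t (S \<eta>) i u = \<eta> (g i \<odot>\<^bsub>sec \<F> M\<^esub> u)" if "i \<in> act u" for i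
    proof -
      have i: "i \<in> I" using that actI by blast
      show ?thesis
        using linear_in_closed[OF m(1)[OF i] u] ext_mult_res[OF oU[OF i] I(3,2)[OF i] u]
        by (simp add: t_def S_eq[OF I(1)[OF i]] m_def)
    qed
    then have "L (S \<eta>) u = finsum E (\<lambda>i. \<eta> (g i \<odot>\<^bsub>sec \<F> M\<^esub> u)) (act u)"
      using u h linear_in_closed[OF continuous_linear_maps_linear[OF \<eta>]]
      by (auto simp: L_def intro!: E.finsum_cong'[OF refl])
    also have "\<dots> = \<eta> (finsum ?X (\<lambda>i. g i \<odot>\<^bsub>sec \<F> M\<^esub> u) (act u))"
      by (rule linear_in_finsum[OF X.module_axioms E.module_axioms continuous_linear_maps_linear[OF \<eta>] act_fin[OF u] h, symmetric])
    finally show "L (S \<eta>) u = \<eta> u" by (simp add: sum_gu[OF u])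
  qed
  \<comment> \<open>A continuous left inverse makes \<open>S\<close> a section of \<open>L\<close>:
    it is an embedding, and its image is a retract of \<open>P\<close>, closed since
    \<open>P\<close> is Hausdorff.\<close>
  have retr: "retraction_maps P (strong_topology ?X E) L S"
    unfolding retraction_maps_def using L_cont S_cont LS tsX by simp
  have "Hausdorff_space P"
    unfolding P_def Hausdorff_space_product_topology
    using Hausdorff_strong_topology[OF lY E] by blast
  then have "closedin P (S ` topspace (strong_topology ?X E))"
    using retract_of_space_imp_closedin retraction_maps_section_image1[OF retr] by blast
  moreover have "embedding_map (strong_topology ?X E) P S"
    by (rule section_imp_embedding_map) (use retr section_map_def in blast)
  ultimately show ?thesis
    using S_linear unfolding closed_linear_embedding_def distribution_space_def S_def[symmetric]
    by (simp add: strong_hom_space_def product_space_def P_def)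
qed

end

theorem proposition4p13:
  fixes T :: "'p topology"
    and \<O> :: "('p, complex, 'a) presheaf"
    and \<F> :: "('p, 'a, 'b) presheaf"
    and E :: "'v cspace"
    and \<Gamma> :: "'g set"
    and U :: "'g \<Rightarrow> 'p set"
  assumes "formal_manifold T \<O>"
    and "module_sheaf T \<O> \<F>"
    and "quasi_complete_lcs E"
    and "\<forall>\<gamma>\<in>\<Gamma>. openin T (U \<gamma>)"
    and "(\<Union>\<gamma>\<in>\<Gamma>. U \<gamma>) = topspace T"
    and "Hausdorff_space (topo (section_space T \<O> \<F> (topspace T)))"
  shows "closed_linear_embedding
    (distribution_space T \<O> \<F> E (topspace T))
    (product_space \<Gamma> (\<lambda>\<gamma>. distribution_space T \<O> \<F> E (U \<gamma>)))
    (\<lambda>\<eta>. \<lambda>\<gamma>\<in>\<Gamma>. restrict_distribution T \<O> \<F> (topspace T) (U \<gamma>) \<eta>)"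
proof -
  interpret module_sheaf_space T \<O> \<F>
    using assms(1,2) by unfold_locales
  show ?thesis
    using assms(3-6) by (intro restriction_closed_embedding) (auto simp: quasi_complete_lcs_def)
qed

end
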